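(* Let $n\ge 2$ be an integer and let $\mathbb D=\{z\in\mathbb C:|z|<1\}$. There exist functions $u:\mathbb D\times\mathbb C^{n-1}\to\mathbb R$ that are both pluripotential solutions and viscosity solutions to $$\det(\partial\bar\partial u)=1\quad\text{on } \mathbb D\times\mathbb C^{n-1},$$ and that satisfy all of the following: (i) $u\in W^{1,2}_{loc}(\mathbb D\times\mathbb C^{n-1})\cap W^{2,1}_{loc}(\mathbb D\times\mathbb C^{n-1})$; (ii) $u\notin W^{1,p}_{loc}(\mathbb D\times\mathbb C^{n-1})$ for every $p>2$; (iii) $u\notin W^{2,q}_{loc}(\mathbb D\times\mathbb C^{n-1})$ for every $q>1$; (iv) $u$ is not Dini continuous in the interior: there is a compact set $K\subset\mathbb D\times\mathbb C^{n-1}$ such that the modulus of continuity $\omega_K(r)=\sup\{|u(x)-u(y)|: x,y\in K,\ |x-y|\le r\}$ satisfies $\int_0^1\frac{\omega_K(r)}{r}\,dr=\infty$.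
   Context: $\partial\bar\partial u=\left(\frac{\partial^2u}{\partial z_i\partial\bar z_j}\right)_{i,j=1}^n$ denotes the complex Hessian of $u$. Sobolev spaces are taken with respect to the real coordinates of $\mathbb C^n\cong\mathbb R^{2n}$ and Lebesgue measure. Pluripotential solution. Write $d=\partial+\bar\partial$, $d^c=\sqrt{-1}(\bar\partial-\partial)$, so $dd^c=2\sqrt{-1}\,\partial\bar\partial$. For a domain $\Omega\subset\mathbb C^n$ and a locally bounded plurisubharmonic function $u$ on $\Omega$, the Bedford–Taylor Monge–Ampère measure $(dd^cu)^n$ is defined inductively by $(dd^cu)^n:=dd^c(u\,dd^c(u\cdots dd^cu))$ in the sense of currents. For $u\in C^2$ one has $(dd^cu)^n=4^n n!\det(\partial\bar\partial u)\,dV_{\mathbb C^n}$, where $dV_{\mathbb C^n}$ is the standard volume form. A pluripotential solution to $\det(\partial\bar\partial u)=1$ on $\Omega$ is a locally bounded plurisubharmonic function $u$ on $\Omega$ with $(dd^cu)^n=4^n n!\,dV_{\mathbb C^n}$ as measures on $\Omega$. Viscosity solution. For an $n\times n$ Hermitian matrix $A$ put $F(A)=1-\det A$ if $A\ge0$ (positive semidefinite) and $F(A)=+\infty$ otherwise. An upper semicontinuous function $u:\Omega\to\mathbb R$ is a viscosity subsolution to $\det(\partial\bar\partial u)=1$ if for every $p\in\Omega$ and every real-valued $C^2$ function $\varphi$ defined near $p$ such that $u-\varphi$ has a local maximum at $p$, one has $F(\partial\bar\partial\varphi(p))\le0$. A lower semicontinuous function $u:\Omega\to\mathbb R$ is a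 viscosity supersolution if for every $p\in\Omega$ and every real-valued $C^2$ function $\varphi$ defined near $p$ such that $u-\varphi$ has a local minimum at $p$, one has $F(\partial\bar\partial\varphi(p))\ge0$. A viscosity solution is a function that is both a viscosity subsolution and a viscosity supersolution. *)

theory Defs
  imports "HOL-Analysis.Analysis"
begin

text \<open>
  $\mathbb{C}^n$ is the type \<open>complex ^ 'n\<close> with $n = $ \<open>CARD('n)\<close>. Its Euclidean structure and
  Lebesgue measure are those of $\mathbb{R}^{2n}$, with \<open>Basis\<close> consisting of the vectors
  \<open>axis j 1\<close> and \<open>axis j \<i>\<close>. Functions on an open set \<open>\<Omega>\<close> are total
  functions whose values outside \<open>\<Omega>\<close> are never used.
\<close>

section \<open>Classical derivatives and test functions\<close>

definition partial_deriv ::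
    "'a::euclidean_space \<Rightarrow> ('a \<Rightarrow> 'b::real_normed_vector) \<Rightarrow> 'a \<Rightarrow> 'b" where
  "partial_deriv v f x = frechet_derivative f (at x) v"

text \<open>\<open>C_k_on k S f\<close>: \<open>f\<close> is of class $C^k$ on the open set \<open>S\<close>.\<close>

primrec C_k_on :: "nat \<Rightarrow> 'a::euclidean_space set \<Rightarrow> ('a \<Rightarrow> 'b::real_normed_vector) \<Rightarrow> bool" where
  "C_k_on 0 S f \<longleftrightarrow> continuous_on S f"
| "C_k_on (Suc k) S f \<longleftrightarrow>
     (\<forall>x\<in>S. f differentiable (at x)) \<and> (\<forall>b\<in>Basis. C_k_on k S (partial_deriv b f))"

definition smooth_everywhere :: "('a::euclidean_space \<Rightarrow> 'b::real_normed_vector) \<Rightarrow> bool" where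
  "smooth_everywhere f \<longleftrightarrow> (\<forall>k. C_k_on k UNIV f)"

definition test_function :: "'a::euclidean_space set \<Rightarrow> ('a \<Rightarrow> real) \<Rightarrow> bool" where
  "test_function \<Omega> \<phi> \<longleftrightarrow>
     smooth_everywhere \<phi> \<and> (\<exists>K. compact K \<and> K \<subseteq> \<Omega> \<and> (\<forall>x. x \<notin> K \<longrightarrow> \<phi> x = 0))"

section \<open>Local Sobolev spaces\<close>

definition Lp_loc :: "real \<Rightarrow> 'a::euclidean_space set \<Rightarrow> ('a \<Rightarrow> real) \<Rightarrow> bool" where
  "Lp_loc p \<Omega> f \<longleftrightarrow> set_borel_measurable lebesgue \<Omega> f \<and>
     (\<forall>K. compact K \<and> K \<subseteq> \<Omega> \<longrightarrow> set_integrable lebesgue K (\<lambda>x. \<bar>f x\<bar> powr p))"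

text \<open>
  A multi-index is given as a list \<open>bs\<close> of basis vectors, one for each differentiation.
\<close>

definition weak_deriv ::
    "'a::euclidean_space set \<Rightarrow> 'a list \<Rightarrow> ('a \<Rightarrow> real) \<Rightarrow> ('a \<Rightarrow> real) \<Rightarrow> bool" where
  "weak_deriv \<Omega> bs f g \<longleftrightarrow>
     (\<forall>\<phi>. test_function \<Omega> \<phi> \<longrightarrow>
        (LINT x:\<Omega>|lebesgue. f x * foldr partial_deriv bs \<phi> x)
          = (-1) ^ length bs * (LINT x:\<Omega>|lebesgue. g x * \<phi> x))"

text \<open>\<open>sobolev_loc k p \<Omega>\<close> is $W^{k,p}_{loc}(\Omega)$, for $1 \le p < \infty$.\<close>

definition sobolev_loc :: "nat \<Rightarrow> real \<Rightarrow> 'a::euclidean_space set \<Rightarrow> ('a \<Rightarrow> real) set" where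
  "sobolev_loc k p \<Omega> =
     {f. Lp_loc p \<Omega> f \<and>
         (\<forall>bs. set bs \<subseteq> Basis \<and> length bs \<le> k \<longrightarrow> (\<exists>g. Lp_loc p \<Omega> g \<and> weak_deriv \<Omega> bs f g))}"

section \<open>Complex derivatives\<close>

text \<open>
  The $\mathbb{C}$-linear and $\mathbb{C}$-antilinear parts of the real differential:
  \<open>del f x v\<close> is $\sum_j v_j\,\partial f/\partial z_j(x)$ and \<open>delbar f x v\<close> is
  $\sum_j \bar v_j\,\partial f/\partial \bar z_j(x)$.
\<close>

definition del :: "(complex^'n \<Rightarrow> complex) \<Rightarrow> complex^'n \<Rightarrow> complex^'n \<Rightarrow> complex" where
  "del f x v = (partial_deriv v f x - \<i> * partial_deriv (\<i> *s v) f x) / 2"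

definition delbar :: "(complex^'n \<Rightarrow> complex) \<Rightarrow> complex^'n \<Rightarrow> complex^'n \<Rightarrow> complex" where
  "delbar f x v = (partial_deriv v f x + \<i> * partial_deriv (\<i> *s v) f x) / 2"

definition complex_hessian :: "(complex^'n \<Rightarrow> real) \<Rightarrow> complex^'n \<Rightarrow> complex^'n^'n" where
  "complex_hessian \<phi> x =
     (\<chi> i j. del (\<lambda>y. delbar (\<lambda>z. complex_of_real (\<phi> z)) y (axis j 1)) x (axis i 1))"

section \<open>Differential forms and currents\<close>

text \<open>
  A complex-valued $m$-form assigns to each point an alternating $\mathbb{R}$-multilinear function
  of $m$ vectors, here a function on lists of length \<open>m\<close>. The normalisation is
  $(\alpha\wedge\beta)(v,w) = \alpha(v)\beta(w) - \alpha(w)\beta(v)$ for 1-forms, so that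
  $(dx\wedge dy)(\partial_x, \partial_y) = 1$.
\<close>

type_synonym 'a form = "'a \<Rightarrow> 'a list \<Rightarrow> complex"

definition alternating_multilinear :: "nat \<Rightarrow> ('a::real_vector list \<Rightarrow> complex) \<Rightarrow> bool" where
  "alternating_multilinear m \<omega> \<longleftrightarrow>
     (\<forall>vs i. length vs = m \<and> i < m \<longrightarrow> linear (\<lambda>v. \<omega> (vs[i := v]))) \<and>
     (\<forall>vs i j. length vs = m \<and> i < j \<and> j < m \<and> vs ! i = vs ! j \<longrightarrow> \<omega> vs = 0)"

definition test_form :: "'a::euclidean_space set \<Rightarrow> nat \<Rightarrow> 'a form \<Rightarrow> bool" where
  "test_form \<Omega> m \<psi> \<longleftrightarrow>
     (\<forall>x. alternating_multilinear m (\<psi> x)) \<and>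
     (\<forall>vs. length vs = m \<longrightarrow> smooth_everywhere (\<lambda>x. \<psi> x vs)) \<and>
     (\<exists>K. compact K \<and> K \<subseteq> \<Omega> \<and> (\<forall>x vs. x \<notin> K \<and> length vs = m \<longrightarrow> \<psi> x vs = 0))"

text \<open>
  $\partial\psi = \sum_j dz_j\wedge\partial\psi/\partial z_j$ evaluated on \<open>vs\<close> is
  $\sum_i (-1)^i \sum_j dz_j(v_i)\,\partial\psi/\partial z_j(\dots,\hat v_i,\dots)$;
  similarly for $\bar\partial$.
\<close>

definition form_del :: "(complex^'n) form \<Rightarrow> (complex^'n) form" where
  "form_del \<psi> x vs =
     (\<Sum>i<length vs. (-1) ^ i * del (\<lambda>y. \<psi> y (take i vs @ drop (Suc i) vs)) x (vs ! i))"

definition form_delbar :: "(complex^'n) form \<Rightarrow> (complex^'n) form" where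
  "form_delbar \<psi> x vs =
     (\<Sum>i<length vs. (-1) ^ i * delbar (\<lambda>y. \<psi> y (take i vs @ drop (Suc i) vs)) x (vs ! i))"

definition form_d :: "(complex^'n) form \<Rightarrow> (complex^'n) form" where
  "form_d \<psi> x vs = form_del \<psi> x vs + form_delbar \<psi> x vs"

definition form_dc :: "(complex^'n) form \<Rightarrow> (complex^'n) form" where
  "form_dc \<psi> x vs = \<i> * (form_delbar \<psi> x vs - form_del \<psi> x vs)"

text \<open>
  The positively oriented frame $\partial_{x_1},\partial_{y_1},\dots,\partial_{x_n},\partial_{y_n}$.
  Permuting the coordinates is an even permutation of the frame, so the enumeration of \<open>'n\<close> chosen
  does not affect the value of a top-degree form on it.
\<close>

definition std_frame :: "(complex^'n) list" where
  "std_frame =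
     concat (map (\<lambda>j. [axis j 1, axis j \<i>]) (SOME js. distinct js \<and> set js = (UNIV :: 'n set)))"

definition integral_form :: "(complex^'n) set \<Rightarrow> (complex^'n) form \<Rightarrow> complex" where
  "integral_form \<Omega> \<psi> = (LINT x:\<Omega>|lborel. \<psi> x std_frame)"

definition basis_tuples :: "nat \<Rightarrow> 'a::euclidean_space list set" where
  "basis_tuples m = {bs. set bs \<subseteq> Basis \<and> length bs = m}"

text \<open>
  A current of order zero acting on \<open>m\<close>-forms, i.e. one whose coefficients are (complex) Radon
  measures on \<open>\<Omega>\<close>. The coefficients are written as densities \<open>\<theta> _ bs\<close> with respect to one
  positive Radon measure \<open>\<sigma>\<close>. Only the alternating part of \<open>\<theta> x\<close> affects the action on
  forms, so no symmetry in \<open>bs\<close> is imposed.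
\<close>

definition measure_coeffs ::
    "'a::euclidean_space set \<Rightarrow> nat \<Rightarrow> 'a measure \<Rightarrow> 'a form \<Rightarrow> bool" where
  "measure_coeffs \<Omega> m \<sigma> \<theta> \<longleftrightarrow>
     sets \<sigma> = sets borel \<and>
     (\<forall>K. compact K \<and> K \<subseteq> \<Omega> \<longrightarrow>
        emeasure \<sigma> K < \<infinity> \<and> (\<forall>bs\<in>basis_tuples m. set_integrable \<sigma> K (\<lambda>x. \<theta> x bs)))"

definition current_apply ::
    "'a::euclidean_space set \<Rightarrow> nat \<Rightarrow> 'a measure \<Rightarrow> 'a form \<Rightarrow> 'a form \<Rightarrow> complex" where
  "current_apply \<Omega> m \<sigma> \<theta> \<psi> = (\<Sum>bs\<in>basis_tuples m. LINT x:\<Omega>|\<sigma>. \<theta> x bs * \<psi> x bs)"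

section \<open>The Bedford--Taylor Monge--Ampere measure\<close>

text \<open>
  \<open>bedford_taylor \<Omega> u k \<sigma> \<theta>\<close>: the current $(dd^c u)^k$, defined by $(dd^c u)^0 = 1$ and
  $(dd^c u)^{k+1} = dd^c(u\,(dd^c u)^k)$, has measure coefficients given by \<open>\<sigma>\<close> and \<open>\<theta>\<close>.
  It has degree $2k$ and so acts on forms of degree $2n - 2k$; the current $1$ acts by integration,
  and $\langle dd^c T, \psi\rangle = \langle T, dd^c\psi\rangle$ for $T$ of even degree.
  Having measure coefficients is what makes the product with the locally bounded Borel function
  \<open>u\<close> meaningful.
\<close>

primrec bedford_taylor ::
    "(complex^'n) set \<Rightarrow> (complex^'n \<Rightarrow> real) \<Rightarrow> nat
      \<Rightarrow> (complex^'n) measure \<Rightarrow> (complex^'n) form \<Rightarrow> bool" where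
  "bedford_taylor \<Omega> u 0 \<sigma> \<theta> \<longleftrightarrow>
     measure_coeffs \<Omega> (2 * CARD('n)) \<sigma> \<theta> \<and>
     (\<forall>\<psi>. test_form \<Omega> (2 * CARD('n)) \<psi> \<longrightarrow>
        current_apply \<Omega> (2 * CARD('n)) \<sigma> \<theta> \<psi> = integral_form \<Omega> \<psi>)"
| "bedford_taylor \<Omega> u (Suc k) \<sigma> \<theta> \<longleftrightarrow>
     measure_coeffs \<Omega> (2 * CARD('n) - 2 * Suc k) \<sigma> \<theta> \<and>
     (\<exists>\<sigma>' \<theta>'. bedford_taylor \<Omega> u k \<sigma>' \<theta>' \<and>
        (\<forall>\<psi>. test_form \<Omega> (2 * CARD('n) - 2 * Suc k) \<psi> \<longrightarrow>
           current_apply \<Omega> (2 * CARD('n) - 2 * Suc k) \<sigma> \<theta> \<psi> =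
           current_apply \<Omega> (2 * CARD('n) - 2 * k) \<sigma>'
             (\<lambda>x bs. complex_of_real (u x) * \<theta>' x bs) (form_d (form_dc \<psi>))))"

text \<open>
  \<open>(dd\<^sup>c u)\<^sup>n\<close> acts on functions; it is the positive measure \<open>\<mu>\<close> if it is
  represented by \<open>\<mu>\<close> with density 1.
\<close>

definition monge_ampere_measure ::
    "(complex^'n) set \<Rightarrow> (complex^'n \<Rightarrow> real) \<Rightarrow> (complex^'n) measure \<Rightarrow> bool" where
  "monge_ampere_measure \<Omega> u \<mu> \<longleftrightarrow> bedford_taylor \<Omega> u CARD('n) \<mu> (\<lambda>_ _. 1)"

section \<open>Pluripotential solutions\<close>

definition usc_on :: "'a::topological_space set \<Rightarrow> ('a \<Rightarrow> real) \<Rightarrow> bool" where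
  "usc_on S f \<longleftrightarrow> (\<forall>a. openin (top_of_set S) {x\<in>S. f x < a})"

definition lsc_on :: "'a::topological_space set \<Rightarrow> ('a \<Rightarrow> real) \<Rightarrow> bool" where
  "lsc_on S f \<longleftrightarrow> (\<forall>a. openin (top_of_set S) {x\<in>S. f x > a})"

text \<open>
  Plurisubharmonicity is the sub-mean value inequality on closed discs in complex lines. Local
  boundedness is part of the definition; with it the circle means are convergent integrals.
\<close>

definition locally_bounded_psh :: "(complex^'n) set \<Rightarrow> (complex^'n \<Rightarrow> real) \<Rightarrow> bool" where
  "locally_bounded_psh \<Omega> u \<longleftrightarrow>
     (\<forall>K. compact K \<and> K \<subseteq> \<Omega> \<longrightarrow> bounded (u ` K)) \<and>
     usc_on \<Omega> u \<and>
     (\<forall>p w. (\<forall>\<zeta>. cmod \<zeta> \<le> 1 \<longrightarrow> p + \<zeta> *s w \<in> \<Omega>) \<longrightarrow>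
        u p \<le> (LINT t:{0..2 * pi}|lborel. u (p + cis t *s w)) / (2 * pi))"

definition pluripotential_solution :: "(complex^'n) set \<Rightarrow> (complex^'n \<Rightarrow> real) \<Rightarrow> bool" where
  "pluripotential_solution \<Omega> u \<longleftrightarrow>
     locally_bounded_psh \<Omega> u \<and>
     monge_ampere_measure \<Omega> u (scale_measure (ennreal (4 ^ CARD('n) * fact CARD('n))) lborel)"

section \<open>Viscosity solutions\<close>

definition hermitian_psd :: "complex^'n^'n \<Rightarrow> bool" where
  "hermitian_psd A \<longleftrightarrow>
     (\<forall>i j. A $ i $ j = cnj (A $ j $ i)) \<and>
     (\<forall>v :: complex^'n. 0 \<le> Re (\<Sum>i\<in>UNIV. \<Sum>j\<in>UNIV. cnj (v $ i) * A $ i $ j * v $ j))"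

text \<open>The determinant of a Hermitian matrix is real, so taking \<open>Re\<close> only changes its type.\<close>

definition MA_operator :: "complex^'n^'n \<Rightarrow> ereal" where
  "MA_operator A = (if hermitian_psd A then ereal (1 - Re (det A)) else \<infinity>)"

definition viscosity_subsolution :: "(complex^'n) set \<Rightarrow> (complex^'n \<Rightarrow> real) \<Rightarrow> bool" where
  "viscosity_subsolution \<Omega> u \<longleftrightarrow>
     usc_on \<Omega> u \<and>
     (\<forall>p\<in>\<Omega>. \<forall>\<phi> U. open U \<and> p \<in> U \<and> C_k_on 2 U \<phi> \<and>
        (\<forall>\<^sub>F x in nhds p. u x - \<phi> x \<le> u p - \<phi> p) \<longrightarrow>
        MA_operator (complex_hessian \<phi> p) \<le> 0)"

definition viscosity_supersolution :: "(complex^'n) set \<Rightarrow> (complex^'n \<Rightarrow> real) \<Rightarrow> bool" where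
  "viscosity_supersolution \<Omega> u \<longleftrightarrow>
     lsc_on \<Omega> u \<and>
     (\<forall>p\<in>\<Omega>. \<forall>\<phi> U. open U \<and> p \<in> U \<and> C_k_on 2 U \<phi> \<and>
        (\<forall>\<^sub>F x in nhds p. u x - \<phi> x \<ge> u p - \<phi> p) \<longrightarrow>
        MA_operator (complex_hessian \<phi> p) \<ge> 0)"

definition viscosity_solution :: "(complex^'n) set \<Rightarrow> (complex^'n \<Rightarrow> real) \<Rightarrow> bool" where
  "viscosity_solution \<Omega> u \<longleftrightarrow> viscosity_subsolution \<Omega> u \<and> viscosity_supersolution \<Omega> u"

section \<open>Dini continuity\<close>

text \<open>
  The supremum is taken in \<open>ennreal\<close>, where the supremum of the empty set is 0.
\<close>

definition modulus_of_continuity ::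
    "'a::metric_space set \<Rightarrow> ('a \<Rightarrow> real) \<Rightarrow> real \<Rightarrow> ennreal" where
  "modulus_of_continuity K u r =
     (SUP (x, y)\<in>{(x, y). x \<in> K \<and> y \<in> K \<and> dist x y \<le> r}. ennreal \<bar>u x - u y\<bar>)"

definition dini_integral :: "'a::metric_space set \<Rightarrow> ('a \<Rightarrow> real) \<Rightarrow> ennreal" where
  "dini_integral K u = (\<integral>\<^sup>+ r\<in>{0<..1}. modulus_of_continuity K u r / ennreal r \<partial>lborel)"

section \<open>The domain\<close>

text \<open>
  $\mathbb{D}\times\mathbb{C}^{n-1}$. The index type \<open>'n\<close> has no preferred first element, so the
  coordinate \<open>k\<close> that ranges over the disc is a parameter.
\<close>

definition disc_times_space :: "'n::finite \<Rightarrow> (complex^'n) set" where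
  "disc_times_space k = {z. cmod (z $ k) < 1}"

end

theory Submission
  imports Defs "HOL-Complex_Analysis.Complex_Analysis"
begin

text \<open>
  Let \<open>z\<close> be the coordinate in the disc, \<open>w\<close> one further coordinate, and \<open>L = -ln \<bar>z\<bar>\<^sup>2\<close>. The solution is
  \<open>u = 2 (Re w)\<^sup>2 / L + \<bar>z\<bar>\<^sup>2 (2 + L) + q\<close>, where \<open>q\<close> is the sum of the squared moduli of the remaining
  coordinates. Off \<open>z = 0\<close> its complex Hessian has determinant 1, because \<open>a = 1/L\<close> satisfies
  \<open>a a\<^sub>z\<^sub>z\<^sub>' = 2 \<bar>a\<^sub>z\<bar>\<^sup>2\<close>, which makes the determinant independent of \<open>Re w\<close>. The function \<open>1/L\<close> is
  continuous but not Dini continuous at \<open>z = 0\<close>; its first and second derivatives, of size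
  \<open>1/(\<bar>z\<bar> L\<^sup>2)\<close> and \<open>1/(\<bar>z\<bar>\<^sup>2 L\<^sup>2)\<close>, are locally in the Lebesgue spaces of exponent 2 and 1 and of
  no larger exponent.

  The set \<open>z = 0\<close> has real codimension two, so that integration by parts over it along any direction
  leaves no boundary term as long as the integrands are locally integrable. The products
  \<open>u (dd\<^sup>c u)\<^sup>j\<close> are such integrands, which gives the Monge--Ampere measure. A \<open>C\<^sup>2\<close> function cannot
  touch \<open>u\<close> from above on \<open>z = 0\<close>, and one touching from below there has a degenerate complex Hessian,
  since \<open>u\<close> does not depend on \<open>w\<close> on this set.
\<close>

section \<open>Partial derivatives and smooth functions\<close>

text \<open>With \<open>s = Re w\<close> the determinant is
  \<open>2 s\<^sup>2 (a a_zz' - 2 |a_z|\<^sup>2) + a b_zz'\<close>. The bracket vanishes exactly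
  when \<open>1 / a\<close> is harmonic, and then \<open>b_zz' = 1 / a\<close> makes the determinant
  1. \<open>L\<close> is a harmonic function that is positive on the disc and infinite at its
  centre; hence the disc in the domain, and a decay of \<open>a\<close> that is just too slow for
  Dini continuity. All estimates rest on the weight \<open>1 / (r\<^sup>2 L\<^sup>2)\<close>, which
  is integrable across \<open>z = 0\<close>, but in no exponent above 1. Second derivatives of
  \<open>u\<close> are of this size, so there is no room for third derivatives. Whenever dd^c u
  would have to be differentiated, the derivatives are moved onto the test function instead, and at
  most two of them are moved back, onto products that stay within the weight. The powers of dd^c u
  are written down explicitly: the part in \<open>z\<close> and \<open>w\<close> occurs at most
  twice and each remaining coordinate at most once, so that the induction over the power reduces to
  counting sets of coordinates. The viscosity inequalities compare the complex Hessian of a test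
  function with the Hermitian square of an explicit matrix of determinant 1.\<close>

lemma partial_deriv_eq: "(f has_derivative f') (at x) \<Longrightarrow> partial_deriv v f x = f' v"
  unfolding partial_deriv_def by (metis frechet_derivative_at)

lemma has_derivative_partial_deriv:
  "f differentiable (at x) \<Longrightarrow> (f has_derivative (\<lambda>v. partial_deriv v f x)) (at x)"
  unfolding partial_deriv_def by (simp add: frechet_derivative_works)

lemma partial_deriv_basis_expansion:
  assumes "f differentiable (at x)"
  shows "partial_deriv v f x = (\<Sum>b\<in>Basis. (v \<bullet> b) *\<^sub>R partial_deriv b f x)"
proof -
  interpret linear "\<lambda>v. partial_deriv v f x"
    using has_derivative_linear[OF has_derivative_partial_deriv[OF assms]] .
  have "partial_deriv v f x = partial_deriv (\<Sum>b\<in>Basis. (v \<bullet> b) *\<^sub>R b) f x"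
    by (simp add: euclidean_representation)
  also have "\<dots> = (\<Sum>b\<in>Basis. (v \<bullet> b) *\<^sub>R partial_deriv b f x)"
    by (simp add: sum scaleR)
  finally show ?thesis .
qed

lemma has_vector_derivative_line:
  assumes "f differentiable (at (x + t *\<^sub>R v))"
  shows "((\<lambda>s. f (x + s *\<^sub>R v)) has_vector_derivative partial_deriv v f (x + t *\<^sub>R v)) (at t)"
proof -
  have "((\<lambda>s. x + s *\<^sub>R v) has_derivative (\<lambda>s. s *\<^sub>R v)) (at t)"
    by (auto intro!: derivative_eq_intros)
  from has_derivative_compose[OF this has_derivative_partial_deriv[OF assms]]
  have "((\<lambda>s. f (x + s *\<^sub>R v)) has_derivative (\<lambda>s. partial_deriv (s *\<^sub>R v) f (x + t *\<^sub>R v))) (at t)" .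
  moreover have "(\<lambda>s. partial_deriv (s *\<^sub>R v) f (x + t *\<^sub>R v)) = (\<lambda>s. s *\<^sub>R partial_deriv v f (x + t *\<^sub>R v))"
    using linear_cmul[OF has_derivative_linear[OF has_derivative_partial_deriv[OF assms]]]
    by auto
  ultimately show ?thesis
    by (simp add: has_vector_derivative_def)
qed

lemma C_k_on_Suc_imp: "C_k_on (Suc k) S f \<Longrightarrow> C_k_on k S f"
proof (induction k arbitrary: f)
  case 0
  then show ?case
    by (auto simp: continuous_on_eq_continuous_within
        intro!: continuous_at_imp_continuous_within[OF differentiable_imp_continuous_within])
next
  case (Suc k)
  then show ?case by auto
qed

lemma C_k_on_const: "C_k_on k UNIV (\<lambda>_. c)"
proof (induction k arbitrary: c)
  case (Suc k)
  have "partial_deriv b (\<lambda>_. c) = (\<lambda>_. 0)" for b :: 'a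
    by (rule ext, rule partial_deriv_eq) (rule has_derivative_const)
  with Suc show ?case by auto
qed simp

lemma C_k_on_add:
  "C_k_on k UNIV f \<Longrightarrow> C_k_on k UNIV g \<Longrightarrow> C_k_on k UNIV (\<lambda>x. f x + g x)"
proof (induction k arbitrary: f g)
  case 0
  then show ?case by (auto intro: continuous_intros)
next
  case (Suc k)
  have "partial_deriv b (\<lambda>x. f x + g x) = (\<lambda>x. partial_deriv b f x + partial_deriv b g x)" for b
    using Suc.prems
    by (intro ext partial_deriv_eq has_derivative_add has_derivative_partial_deriv) auto
  with Suc show ?case by (auto intro: differentiable_add)
qed

lemma C_k_on_scaleR:
  fixes f :: "'a::euclidean_space \<Rightarrow> real"
  shows "C_k_on k UNIV f \<Longrightarrow> C_k_on k UNIV g \<Longrightarrow> C_k_on k UNIV (\<lambda>x. f x *\<^sub>R g x)"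
proof (induction k arbitrary: f g)
  case 0
  then show ?case by (auto intro: continuous_intros)
next
  case (Suc k)
  have "partial_deriv b (\<lambda>x. f x *\<^sub>R g x) = (\<lambda>x. f x *\<^sub>R partial_deriv b g x + partial_deriv b f x *\<^sub>R g x)" for b
    using Suc.prems
    by (intro ext partial_deriv_eq has_derivative_scaleR has_derivative_partial_deriv) auto
  moreover have "C_k_on k UNIV f" "C_k_on k UNIV g"
    using Suc.prems C_k_on_Suc_imp by blast+
  ultimately show ?case using Suc 
    by (auto intro!: differentiable_scaleR C_k_on_add)
qed

lemma C_k_on_compose_inner:
  fixes g :: "real \<Rightarrow> real"
  shows "C_k_on k UNIV g \<Longrightarrow> C_k_on k UNIV (\<lambda>x. g (x \<bullet> b + d))"
proof (induction k arbitrary: g)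
  case 0
  then have "continuous_on UNIV g" by simp
  then have "continuous_on UNIV (\<lambda>x. g (x \<bullet> b + d))"
    by (rule continuous_on_compose2) (auto intro!: continuous_intros)
  then show ?case by simp
next
  case (Suc k)
  have *: "((\<lambda>x. g (x \<bullet> b + d)) has_derivative (\<lambda>v. (v \<bullet> b) *\<^sub>R partial_deriv 1 g (x \<bullet> b + d))) (at x)" for x
  proof -
    have g: "g differentiable at (x \<bullet> b + d)" using Suc.prems by auto
    have "((\<lambda>x. x \<bullet> b + d) has_derivative (\<lambda>v. v \<bullet> b)) (at x)"
      by (auto intro!: derivative_eq_intros)
    note deriv = has_derivative_compose[OF this has_derivative_partial_deriv[OF g]]
    have "(\<lambda>v. partial_deriv (v \<bullet> b) g (x \<bullet> b + d)) = (\<lambda>v. (v \<bullet> b) *\<^sub>R partial_deriv 1 g (x \<bullet> b + d))"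
    proof
      fix v show "partial_deriv (v \<bullet> b) g (x \<bullet> b + d) = (v \<bullet> b) *\<^sub>R partial_deriv 1 g (x \<bullet> b + d)"
      using linear_cmul[OF has_derivative_linear[OF has_derivative_partial_deriv[OF g]], of "v \<bullet> b" 1]
      by simp
    qed
    then show ?thesis using deriv by argo
  qed
  have "partial_deriv c (\<lambda>x. g (x \<bullet> b + d)) = (\<lambda>x. (c \<bullet> b) *\<^sub>R partial_deriv 1 g (x \<bullet> b + d))" for c
    by (rule ext, rule partial_deriv_eq[OF *])
  moreover have "C_k_on k UNIV (\<lambda>x. partial_deriv 1 g (x \<bullet> b + d))"
    using Suc by auto
  ultimately show ?case using *
    by (auto intro!: C_k_on_scaleR[where 'b=real, simplified] C_k_on_const simp: differentiable_def)
qed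

lemma smooth_everywhere_differentiable: "smooth_everywhere f \<Longrightarrow> f differentiable (at x)"
  unfolding smooth_everywhere_def by (metis C_k_on.simps(2) UNIV_I)

lemma smooth_everywhere_continuous: "smooth_everywhere f \<Longrightarrow> continuous_on UNIV f"
  unfolding smooth_everywhere_def by (metis C_k_on.simps(1))

lemma smooth_everywhere_const: "smooth_everywhere (\<lambda>_. c)"
  by (simp add: smooth_everywhere_def C_k_on_const)

lemma smooth_everywhere_add:
  "smooth_everywhere f \<Longrightarrow> smooth_everywhere g \<Longrightarrow> smooth_everywhere (\<lambda>x. f x + g x)"
  by (simp add: smooth_everywhere_def C_k_on_add)

lemma smooth_everywhere_scaleR:
  fixes f :: "'a::euclidean_space \<Rightarrow> real"
  shows "smooth_everywhere f \<Longrightarrow> smooth_everywhere g \<Longrightarrow> smooth_everywhere (\<lambda>x. f x *\<^sub>R g x)"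
  by (simp add: smooth_everywhere_def C_k_on_scaleR)

lemma smooth_everywhere_compose_inner:
  fixes g :: "real \<Rightarrow> real"
  shows "smooth_everywhere g \<Longrightarrow> smooth_everywhere (\<lambda>x. g (x \<bullet> b + d))"
  by (simp add: smooth_everywhere_def C_k_on_compose_inner)

lemma smooth_everywhere_sum:
  "(\<And>i. i \<in> I \<Longrightarrow> smooth_everywhere (f i)) \<Longrightarrow> smooth_everywhere (\<lambda>x. \<Sum>i\<in>I. f i x)"
  by (induction I rule: infinite_finite_induct)
    (auto intro: smooth_everywhere_const smooth_everywhere_add)

lemma smooth_everywhere_prod:
  fixes f :: "'i \<Rightarrow> 'a::euclidean_space \<Rightarrow> real"
  shows "(\<And>i. i \<in> I \<Longrightarrow> smooth_everywhere (f i)) \<Longrightarrow> smooth_everywhere (\<lambda>x. \<Prod>i\<in>I. f i x)"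
  by (induction I rule: infinite_finite_induct)
    (auto intro: smooth_everywhere_const smooth_everywhere_scaleR[where 'b=real, simplified])

lemma smooth_everywhere_partial_deriv:
  assumes "smooth_everywhere f"
  shows "smooth_everywhere (partial_deriv v f)"
proof -
  have b: "smooth_everywhere (partial_deriv b f)" if "b \<in> Basis" for b
    using assms that unfolding smooth_everywhere_def by (metis C_k_on.simps(2))
  have "partial_deriv v f = (\<lambda>x. \<Sum>b\<in>Basis. (v \<bullet> b) *\<^sub>R partial_deriv b f x)"
    using assms by (intro ext partial_deriv_basis_expansion smooth_everywhere_differentiable)
  then show ?thesis
    using b by (auto intro!: smooth_everywhere_sum smooth_everywhere_scaleR smooth_everywhere_const)
qed

section \<open>Symmetry of second derivatives\<close>

text \<open>The mean value theorem twice: along \<open>b\<close> for the difference in direction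
  \<open>c\<close>, then along \<open>c\<close> for the derivative. The second difference is
  symmetric in \<open>b\<close> and \<open>c\<close>, which is the source of the equality of mixed
  derivatives.\<close>

lemma second_difference_mvt:
  fixes f :: "'a::euclidean_space \<Rightarrow> real"
  assumes h: "0 < h"
    and S: "\<And>s t. 0 \<le> s \<Longrightarrow> s \<le> h \<Longrightarrow> 0 \<le> t \<Longrightarrow> t \<le> h \<Longrightarrow> p + s *\<^sub>R b + t *\<^sub>R c \<in> S"
    and f: "\<And>x. x \<in> S \<Longrightarrow> f differentiable (at x)"
    and fb: "\<And>x. x \<in> S \<Longrightarrow> partial_deriv b f differentiable (at x)"
  shows "\<exists>s t. 0 < s \<and> s < h \<and> 0 < t \<and> t < h \<and>
    f (p + h *\<^sub>R b + h *\<^sub>R c) - f (p + h *\<^sub>R b) - f (p + h *\<^sub>R c) + f p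
      = h * h * partial_deriv c (partial_deriv b f) (p + s *\<^sub>R b + t *\<^sub>R c)"
proof -
  let ?F = "\<lambda>s. f (p + h *\<^sub>R c + s *\<^sub>R b) - f (p + s *\<^sub>R b)"
  let ?F' = "\<lambda>s. partial_deriv b f (p + h *\<^sub>R c + s *\<^sub>R b) - partial_deriv b f (p + s *\<^sub>R b)"
  have F: "DERIV ?F s :> ?F' s" if "0 \<le> s" "s \<le> h" for s
  proof -
    have "DERIV (\<lambda>s. f (q + s *\<^sub>R b)) s :> partial_deriv b f (q + s *\<^sub>R b)"
      if "q + s *\<^sub>R b \<in> S" for q
      using has_vector_derivative_line[OF f[OF that]]
      by (simp add: has_real_derivative_iff_has_vector_derivative)
    moreover have "p + h *\<^sub>R c + s *\<^sub>R b \<in> S" "p + s *\<^sub>R b \<in> S"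
      using S[of s h] S[of s 0] that h by (simp_all add: add_ac)
    ultimately show ?thesis by (intro DERIV_diff)
  qed
  obtain s where s: "0 < s" "s < h" "?F h - ?F 0 = (h - 0) * ?F' s"
    using MVT2[of 0 h ?F ?F'] F h by auto
  let ?G = "\<lambda>t. partial_deriv b f (p + s *\<^sub>R b + t *\<^sub>R c)"
  let ?G' = "\<lambda>t. partial_deriv c (partial_deriv b f) (p + s *\<^sub>R b + t *\<^sub>R c)"
  have G: "DERIV ?G t :> ?G' t" if "0 \<le> t" "t \<le> h" for t
    using S[of s t] that s
    by (simp add: has_real_derivative_iff_has_vector_derivative)
      (auto intro!: has_vector_derivative_line fb)
  obtain t where t: "0 < t" "t < h" "?G h - ?G 0 = (h - 0) * ?G' t"
    using MVT2[of 0 h ?G ?G'] G h by auto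
  have "?F h - ?F 0 = h * h * ?G' t"
    using s t by (simp add: algebra_simps)
  then have "f (p + h *\<^sub>R b + h *\<^sub>R c) - f (p + h *\<^sub>R b) - f (p + h *\<^sub>R c) + f p = h * h * ?G' t"
    by (simp add: algebra_simps)
  then show ?thesis using s(1,2) t(1,2) by blast
qed

text \<open>Schwarz's theorem: over a small square the second difference quotient is a value of
  either mixed derivative, so by continuity their values at \<open>p\<close> cannot differ.\<close>

lemma second_partial_deriv_commute_basis:
  fixes f :: "'a::euclidean_space \<Rightarrow> real"
  assumes S: "open S" "p \<in> S" and f: "C_k_on 2 S f" and bc: "b \<in> Basis" "c \<in> Basis"
  shows "partial_deriv b (partial_deriv c f) p = partial_deriv c (partial_deriv b f) p"
proof (rule ccontr)
  define A B where "A = partial_deriv b (partial_deriv c f)" and "B = partial_deriv c (partial_deriv b f)"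
  assume "\<not> ?thesis"
  then have ne: "A p \<noteq> B p" by (simp add: A_def B_def)
  define e where "e = \<bar>A p - B p\<bar> / 2"
  have e: "e > 0" using ne by (simp add: e_def)
  have d: "f differentiable (at x)" "partial_deriv b f differentiable (at x)"
    "partial_deriv c f differentiable (at x)" if "x \<in> S" for x
    using f that bc by (auto simp: numeral_2_eq_2)
  have "continuous_on S A" "continuous_on S B"
    using f bc by (auto simp: numeral_2_eq_2 A_def B_def)
  then have "isCont A p" "isCont B p"
    using S by (auto simp: continuous_on_eq_continuous_at)
  then have "\<exists>d>0. \<forall>x. dist x p < d \<longrightarrow> dist (A x) (A p) < e"
    "\<exists>d>0. \<forall>x. dist x p < d \<longrightarrow> dist (B x) (B p) < e"
    using e by (simp_all add: continuous_at_eps_delta)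
  then obtain d1 d2 where d12: "d1 > 0" "d2 > 0" "\<And>x. dist x p < d1 \<Longrightarrow> dist (A x) (A p) < e"
     "\<And>x. dist x p < d2 \<Longrightarrow> dist (B x) (B p) < e"
    by blast
  obtain d3 where d3: "d3 > 0" "ball p d3 \<subseteq> S"
    using S open_contains_ball by blast
  \<comment> \<open>Points of the square are within \<open>2 * h\<close> of \<open>p\<close>, hence
    strictly within all three radii.\<close>
  define h where "h = min (min d1 d2) d3 / 3"
  have h: "h > 0" using d12 d3 by (simp add: h_def)
  have near: "dist (p + s *\<^sub>R b' + t *\<^sub>R c') p < min (min d1 d2) d3"
    if "0 \<le> s" "s \<le> h" "0 \<le> t" "t \<le> h" "b' \<in> Basis" "c' \<in> Basis" for s t and b' c' :: 'a
  proof -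
    have "dist (p + s *\<^sub>R b' + t *\<^sub>R c') p = norm (s *\<^sub>R b' + t *\<^sub>R c')"
      by (simp add: dist_norm)
    also have "\<dots> \<le> s + t"
      by (rule order_trans[OF norm_triangle_ineq]) (use that in simp)
    also have "\<dots> \<le> 2 * h" using that by simp
    also have "\<dots> < 3 * h" using h by simp
    finally show ?thesis by (simp add: h_def)
  qed
  have inS: "p + s *\<^sub>R b' + t *\<^sub>R c' \<in> S"
    if "0 \<le> s" "s \<le> h" "0 \<le> t" "t \<le> h" "b' \<in> Basis" "c' \<in> Basis" for s t and b' c' :: 'a
    using near[OF that] d3 by (auto simp: dist_commute)
  obtain s t where st: "0 < s" "s < h" "0 < t" "t < h"
    "f (p + h *\<^sub>R b + h *\<^sub>R c) - f (p + h *\<^sub>R b) - f (p + h *\<^sub>R c) + f p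
      = h * h * B (p + s *\<^sub>R b + t *\<^sub>R c)"
    unfolding B_def using second_difference_mvt[OF h inS d(1,2)] bc by blast
  obtain s' t' where st': "0 < s'" "s' < h" "0 < t'" "t' < h"
    "f (p + h *\<^sub>R c + h *\<^sub>R b) - f (p + h *\<^sub>R c) - f (p + h *\<^sub>R b) + f p
      = h * h * A (p + s' *\<^sub>R c + t' *\<^sub>R b)"
    unfolding A_def using second_difference_mvt[OF h inS d(1,3)] bc by blast
  have "p + h *\<^sub>R b + h *\<^sub>R c = p + h *\<^sub>R c + h *\<^sub>R b" by (simp add: add_ac)
  from st(5)[unfolded this] st'(5)
  have "h * h * A (p + s' *\<^sub>R c + t' *\<^sub>R b) = h * h * B (p + s *\<^sub>R b + t *\<^sub>R c)"
    by linarith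
  then have "A (p + s' *\<^sub>R c + t' *\<^sub>R b) = B (p + s *\<^sub>R b + t *\<^sub>R c)"
    using h by simp
  moreover have "dist (A (p + s' *\<^sub>R c + t' *\<^sub>R b)) (A p) < e"
    using near[of s' t' c b] st' bc d12 by simp
  moreover have "dist (B (p + s *\<^sub>R b + t *\<^sub>R c)) (B p) < e"
    using near[of s t b c] st bc d12 by simp
  ultimately show False unfolding e_def dist_real_def by (simp add: abs_if split: if_splits)
qed

text \<open>\<open>C_k_on\<close> speaks of basis directions only. The expansion of a general
  directional derivative in the basis holds on all of \<open>S\<close>, so it may be differentiated
  once more.\<close>

lemma second_partial_deriv_bilinear:
  fixes f :: "'a::euclidean_space \<Rightarrow> 'b::real_normed_vector"
  assumes S: "open S" "p \<in> S" and f: "C_k_on 2 S f"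
  shows "partial_deriv v f differentiable (at p)"
    and "partial_deriv v (partial_deriv w f) p
      = (\<Sum>b\<in>Basis. \<Sum>c\<in>Basis. ((v \<bullet> b) * (w \<bullet> c)) *\<^sub>R partial_deriv b (partial_deriv c f) p)"
proof -
  have d: "f differentiable (at x)" if "x \<in> S" for x
    using f that by (auto simp: numeral_2_eq_2)
  have d2: "partial_deriv c f differentiable (at x)" if "c \<in> Basis" "x \<in> S" for x c
    using f that by (auto simp: numeral_2_eq_2)
  have *: "(partial_deriv w f has_derivative
      (\<lambda>v. \<Sum>c\<in>Basis. (w \<bullet> c) *\<^sub>R partial_deriv v (partial_deriv c f) p)) (at p)" for w
  proof (rule has_derivative_transform_within_open[OF _ S])
    show "((\<lambda>x. \<Sum>c\<in>Basis. (w \<bullet> c) *\<^sub>R partial_deriv c f x) has_derivative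
      (\<lambda>v. \<Sum>c\<in>Basis. (w \<bullet> c) *\<^sub>R partial_deriv v (partial_deriv c f) p)) (at p)"
      by (intro has_derivative_sum has_derivative_scaleR_right has_derivative_partial_deriv d2 S)
  qed (simp add: partial_deriv_basis_expansion[OF d])
  show "partial_deriv v f differentiable (at p)"
    using * differentiable_def by blast
  have "partial_deriv v (partial_deriv w f) p = (\<Sum>c\<in>Basis. (w \<bullet> c) *\<^sub>R partial_deriv v (partial_deriv c f) p)"
    by (rule partial_deriv_eq[OF *])
  also have "\<dots> = (\<Sum>c\<in>Basis. \<Sum>b\<in>Basis. ((v \<bullet> b) * (w \<bullet> c)) *\<^sub>R partial_deriv b (partial_deriv c f) p)"
    by (intro sum.cong refl)
      (simp add: partial_deriv_basis_expansion[OF d2[OF _ S(2)], of _ v] scaleR_sum_right ac_simps)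
  finally show "partial_deriv v (partial_deriv w f) p
      = (\<Sum>b\<in>Basis. \<Sum>c\<in>Basis. ((v \<bullet> b) * (w \<bullet> c)) *\<^sub>R partial_deriv b (partial_deriv c f) p)"
    by (subst sum.swap) simp
qed

lemma second_partial_deriv_commute:
  fixes f :: "'a::euclidean_space \<Rightarrow> real"
  assumes "open S" "p \<in> S" "C_k_on 2 S f"
  shows "partial_deriv v (partial_deriv w f) p = partial_deriv w (partial_deriv v f) p"
proof -
  define D where "D b c = partial_deriv b (partial_deriv c f) p" for b c
  have "(\<Sum>b\<in>Basis. \<Sum>c\<in>Basis. ((v \<bullet> b) * (w \<bullet> c)) *\<^sub>R D b c)
      = (\<Sum>b\<in>Basis. \<Sum>c\<in>Basis. ((w \<bullet> c) * (v \<bullet> b)) *\<^sub>R D c b)"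
    using second_partial_deriv_commute_basis[OF assms] unfolding D_def[symmetric]
    by (auto intro!: sum.cong simp: mult.commute)
  also have "\<dots> = (\<Sum>c\<in>Basis. \<Sum>b\<in>Basis. ((w \<bullet> c) * (v \<bullet> b)) *\<^sub>R D c b)"
    by (rule sum.swap)
  finally show ?thesis
    unfolding D_def second_partial_deriv_bilinear(2)[OF assms, of v w]
      second_partial_deriv_bilinear(2)[OF assms, of w v] .
qed

lemma partial_deriv_bounded_linear:
  assumes "bounded_linear h" "f differentiable (at x)"
  shows "partial_deriv v (\<lambda>y. h (f y)) x = h (partial_deriv v f x)"
  by (rule partial_deriv_eq)
    (rule bounded_linear.has_derivative[OF assms(1) has_derivative_partial_deriv[OF assms(2)]])

lemma smooth_everywhere_bounded_linear:
  assumes h: "bounded_linear h" and f: "smooth_everywhere f"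
  shows "smooth_everywhere (\<lambda>x. h (f x))"
proof -
  have "C_k_on k UNIV (\<lambda>x. h (f x))" if "smooth_everywhere f" for k f
    using that
  proof (induction k arbitrary: f)
    case 0
    then show ?case
      using bounded_linear.continuous_on[OF h smooth_everywhere_continuous] by auto
  next
    case (Suc k)
    have "partial_deriv b (\<lambda>x. h (f x)) = (\<lambda>x. h (partial_deriv b f x))" for b
      by (intro ext partial_deriv_bounded_linear h smooth_everywhere_differentiable Suc.prems)
    moreover have "(\<lambda>x. h (f x)) differentiable at x" for x
      using bounded_linear.has_derivative[OF h has_derivative_partial_deriv[OF smooth_everywhere_differentiable[OF Suc.prems]]]
        differentiable_def by blast
    ultimately show ?case
      using Suc.IH[OF smooth_everywhere_partial_deriv[OF Suc.prems]] by auto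
  qed
  from this[OF f] show ?thesis by (simp add: smooth_everywhere_def)
qed

text \<open>Reduction to the real case by taking the components of \<open>f\<close>.\<close>

lemma smooth_partial_deriv_commute:
  fixes f :: "'a::euclidean_space \<Rightarrow> 'b::euclidean_space"
  assumes "smooth_everywhere f"
  shows "partial_deriv v (partial_deriv w f) = partial_deriv w (partial_deriv v f)"
proof
  fix x
  have *: "partial_deriv v (partial_deriv w f) x \<bullet> e = partial_deriv v (partial_deriv w (\<lambda>x. f x \<bullet> e)) x" for e v w
  proof -
    have "partial_deriv w (\<lambda>x. f x \<bullet> e) = (\<lambda>x. partial_deriv w f x \<bullet> e)"
      by (intro ext partial_deriv_bounded_linear bounded_linear_inner_left
          smooth_everywhere_differentiable assms)
    then show ?thesis
      by (simp add: partial_deriv_bounded_linear[OF bounded_linear_inner_left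
          smooth_everywhere_differentiable[OF smooth_everywhere_partial_deriv[OF assms]]])
  qed
  have comm: "partial_deriv v (partial_deriv w (\<lambda>x. f x \<bullet> e)) x = partial_deriv w (partial_deriv v (\<lambda>x. f x \<bullet> e)) x" for e
    using smooth_everywhere_bounded_linear[OF bounded_linear_inner_left[of e] assms]
    by (intro second_partial_deriv_commute[of UNIV]) (auto simp: smooth_everywhere_def)
  show "partial_deriv v (partial_deriv w f) x = partial_deriv w (partial_deriv v f) x"
  proof (rule euclidean_eqI)
    fix e :: 'b
    show "partial_deriv v (partial_deriv w f) x \<bullet> e = partial_deriv w (partial_deriv v f) x \<bullet> e"
      unfolding *[of v w e] *[of w v e] by (rule comm)
  qed
qed

section \<open>Test functions\<close>

text \<open>The coefficients of test forms are complex, so test functions are needed with values in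
  a normed space.\<close>

definition vtest :: "'a::euclidean_space set \<Rightarrow> ('a \<Rightarrow> 'b::real_normed_vector) \<Rightarrow> bool" where
  "vtest \<Omega> \<phi> \<longleftrightarrow>
     smooth_everywhere \<phi> \<and> (\<exists>K. compact K \<and> K \<subseteq> \<Omega> \<and> (\<forall>x. x \<notin> K \<longrightarrow> \<phi> x = 0))"

lemma test_function_iff_vtest: "test_function \<Omega> \<phi> \<longleftrightarrow> vtest \<Omega> \<phi>"
  by (simp add: test_function_def vtest_def)

lemma partial_deriv_eq_0:
  assumes "open S" "x \<in> S" "\<And>y. y \<in> S \<Longrightarrow> f y = 0"
  shows "partial_deriv v f x = 0"
proof -
  have "(f has_derivative (\<lambda>_. 0)) (at x)"
    by (rule has_derivative_transform_within_open[OF has_derivative_const[of 0] assms(1,2)])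
      (simp add: assms(3))
  then show ?thesis by (rule partial_deriv_eq)
qed

lemma vtest_partial_deriv:
  assumes "vtest \<Omega> \<phi>" shows "vtest \<Omega> (partial_deriv v \<phi>)"
proof -
  obtain K where K: "compact K" "K \<subseteq> \<Omega>" "\<And>x. x \<notin> K \<Longrightarrow> \<phi> x = 0"
    using assms by (auto simp: vtest_def)
  have "partial_deriv v \<phi> x = 0" if "x \<notin> K" for x
    by (rule partial_deriv_eq_0[of "- K"]) (use K that in \<open>auto simp: compact_imp_closed\<close>)
  then show ?thesis
    using K assms by (auto simp: vtest_def smooth_everywhere_partial_deriv)
qed

lemma vtest_smooth: "vtest \<Omega> \<phi> \<Longrightarrow> smooth_everywhere \<phi>"
  by (simp add: vtest_def)

lemma vtest_differentiable: "vtest \<Omega> \<phi> \<Longrightarrow> \<phi> differentiable (at x)"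
  by (simp add: vtest_def smooth_everywhere_differentiable)

subsection \<open>Bump functions\<close>

text \<open>The quotients by powers of \<open>t\<close> are included to obtain a family closed under differentiation.\<close>

definition flat_exp :: "nat \<Rightarrow> real \<Rightarrow> real" where
  "flat_exp m t = (if t > 0 then exp (- 1 / t) / t ^ m else 0)"

lemma flat_exp_over_tendsto_0: "((\<lambda>t. flat_exp m t) \<longlongrightarrow> 0) (at 0)"
proof -
  have "((\<lambda>y::real. y ^ m / exp y) \<longlongrightarrow> 0) at_top"
    by (rule tendsto_power_div_exp_0)
  then have "((\<lambda>t::real. inverse t ^ m / exp (inverse t)) \<longlongrightarrow> 0) (at_right 0)"
    by (rule filterlim_compose[OF _ filterlim_inverse_at_top_right])
  moreover have "\<forall>\<^sub>F t in at_right 0. inverse t ^ m / exp (inverse t) = flat_exp m t"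
    unfolding eventually_at_right_field
    by (auto intro!: exI[of _ 1] simp: flat_exp_def exp_minus field_simps)
  ultimately have "(flat_exp m \<longlongrightarrow> 0) (at_right 0)"
    by (rule Lim_transform_eventually)
  moreover have "(flat_exp m \<longlongrightarrow> 0) (at_left 0)"
    by (rule Lim_transform_eventually[OF tendsto_const[of 0]])
      (auto simp: eventually_at_left_field flat_exp_def intro!: exI[of _ "-1"])
  ultimately show ?thesis by (simp add: filterlim_at_split)
qed

lemma flat_exp_derivative:
  "(flat_exp m has_real_derivative flat_exp (m + 2) t - m * flat_exp (m + 1) t) (at t)"
proof (cases t "0::real" rule: linorder_cases)
  case less
  have "(flat_exp m has_real_derivative 0) (at t)"
    by (rule has_field_derivative_transform_within_open[OF DERIV_const[of 0], of "{..<0}"])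
      (use less in \<open>auto simp: flat_exp_def\<close>)
  then show ?thesis using less by (simp add: flat_exp_def)
next
  case greater
  have "((\<lambda>t. exp (- 1 / t) / t ^ m) has_real_derivative flat_exp (m + 2) t - m * flat_exp (m + 1) t) (at t)"
    using greater
    by (auto intro!: derivative_eq_intros simp: flat_exp_def) 
      (cases m; simp add: divide_simps; simp add: algebra_simps power2_eq_square)
  then show ?thesis
    by (rule has_field_derivative_transform_within_open[of _ _ _ "{0<..}"])
      (use greater in \<open>auto simp: flat_exp_def\<close>)
next
  case equal
  \<comment> \<open>At 0 the difference quotient is itself a member of the family, with
    \<open>m\<close> raised by one.\<close>
  have "((\<lambda>h. (flat_exp m (0 + h) - flat_exp m 0) / h) \<longlongrightarrow> 0) (at 0)"
    by (rule Lim_transform_eventually[OF flat_exp_over_tendsto_0[of "Suc m"]])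
      (auto simp: eventually_at_filter flat_exp_def)
  then show ?thesis using equal by (simp add: DERIV_def flat_exp_def)
qed

lemma partial_deriv_flat_exp: "partial_deriv 1 (flat_exp m) = (\<lambda>t. flat_exp (m + 2) t + (- real m) *\<^sub>R flat_exp (m + 1) t)"
  by (rule ext, subst partial_deriv_eq[OF flat_exp_derivative[unfolded has_field_derivative_def]]) simp

lemma smooth_flat_exp: "smooth_everywhere (flat_exp m)"
proof -
  have "C_k_on k UNIV (flat_exp m)" for k
  proof (induction k arbitrary: m)
    case 0
    then show ?case
      using DERIV_isCont[OF flat_exp_derivative] by (simp add: continuous_on_eq_continuous_at)
  next
    case (Suc k)
    have "flat_exp m differentiable (at t)" for t
      using flat_exp_derivative real_differentiable_def by blast
    moreover have "C_k_on k UNIV (partial_deriv 1 (flat_exp m))"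
      unfolding partial_deriv_flat_exp by (intro C_k_on_add C_k_on_scaleR C_k_on_const Suc.IH)
    ultimately show ?case by simp
  qed
  then show ?thesis by (simp add: smooth_everywhere_def)
qed

definition bump1 :: "real \<Rightarrow> real" where
  "bump1 t = flat_exp 0 (1 + t) * flat_exp 0 (1 - t)"

lemma smooth_bump1: "smooth_everywhere bump1"
  using smooth_everywhere_scaleR[OF smooth_everywhere_compose_inner[OF smooth_flat_exp[of 0], of "1::real" 1]
      smooth_everywhere_compose_inner[OF smooth_flat_exp[of 0], of "-1" 1]]
  by (simp add: bump1_def[abs_def] inner_real_def add.commute)

lemma bump1_nonneg: "0 \<le> bump1 t" by (simp add: bump1_def flat_exp_def)

lemma bump1_le_1: "bump1 t \<le> 1" 
  by (auto simp: bump1_def flat_exp_def intro!: mult_le_one)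

lemma bump1_eq_0: "1 \<le> \<bar>t\<bar> \<Longrightarrow> bump1 t = 0"
  by (auto simp: bump1_def flat_exp_def abs_if split: if_splits)

lemma bump1_ge: "\<bar>t\<bar> \<le> 1/2 \<Longrightarrow> exp (- 4) \<le> bump1 t"
proof -
  assume t: "\<bar>t\<bar> \<le> 1/2"
  have "exp (-2) \<le> flat_exp 0 s" if "s \<ge> 1/2" for s
    using that by (auto simp: flat_exp_def field_simps)
  from mult_mono[OF this[of "1 + t"] this[of "1 - t"]] t
  show ?thesis by (auto simp: bump1_def flat_exp_def exp_add[symmetric] abs_if split: if_splits)
qed

text \<open>\<open>r\<close> is the vector of half sides, which allows boxes that shrink in the
  singular coordinate alone.\<close>

definition bump :: "'a::euclidean_space \<Rightarrow> 'a \<Rightarrow> 'a \<Rightarrow> real" where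
  "bump c r x = (\<Prod>b\<in>Basis. bump1 ((x \<bullet> b - c \<bullet> b) / (r \<bullet> b)))"

lemma smooth_bump: "smooth_everywhere (bump c r)"
proof -
  have "smooth_everywhere (\<lambda>x. bump1 ((x \<bullet> b - c \<bullet> b) / (r \<bullet> b)))" for b
    using smooth_everywhere_compose_inner[OF smooth_bump1, of "b /\<^sub>R (r \<bullet> b)" "- (c \<bullet> b) / (r \<bullet> b)"]
    by (simp add: field_simps diff_divide_distrib)
  then show ?thesis unfolding bump_def[abs_def] by (intro smooth_everywhere_prod)
qed

lemma bump_nonneg: "0 \<le> bump c r x"
  by (simp add: bump_def prod_nonneg bump1_nonneg)

lemma bump_le_1: "bump c r x \<le> 1"
  unfolding bump_def by (intro prod_le_1) (simp add: bump1_nonneg bump1_le_1)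

lemma bump_eq_0:
  assumes r: "\<And>b. b \<in> Basis \<Longrightarrow> 0 < r \<bullet> b" and x: "x \<notin> cbox (c - r) (c + r)"
  shows "bump c r x = 0"
proof -
  obtain b where b: "b \<in> Basis" "\<not> (c \<bullet> b - r \<bullet> b \<le> x \<bullet> b \<and> x \<bullet> b \<le> c \<bullet> b + r \<bullet> b)"
    using x by (auto simp: mem_box inner_diff_left inner_add_left)
  then have "bump1 ((x \<bullet> b - c \<bullet> b) / (r \<bullet> b)) = 0"
    using r[OF b(1)] by (intro bump1_eq_0) (auto simp: abs_if field_simps)
  then show ?thesis using b(1) by (auto simp: bump_def)
qed

lemma bump_ge:
  fixes c :: "'a::euclidean_space"
  assumes r: "\<And>b. b \<in> Basis \<Longrightarrow> 0 < r \<bullet> b" and x: "x \<in> cbox (c - r /\<^sub>R 2) (c + r /\<^sub>R 2)"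
  shows "exp (- 4) ^ DIM('a) \<le> bump c r x"
proof -
  have "exp (- 4) \<le> bump1 ((x \<bullet> b - c \<bullet> b) / (r \<bullet> b))" if "b \<in> Basis" for b
    using x r[OF that] that 
    by (intro bump1_ge) (auto simp: mem_box inner_diff_left inner_add_left abs_if field_simps)
  then have "(\<Prod>b\<in>(Basis::'a set). exp (- 4) :: real) \<le> bump c r x"
    unfolding bump_def by (intro prod_mono) auto
  then show ?thesis by simp
qed

lemma test_function_bump:
  assumes r: "\<And>b. b \<in> Basis \<Longrightarrow> 0 < r \<bullet> b" and "cbox (c - r) (c + r) \<subseteq> \<Omega>"
  shows "test_function \<Omega> (bump c r)"
  unfolding test_function_def using smooth_bump bump_eq_0[OF r] assms(2) compact_cbox by metis

no_notation fps_nth (infixl \<open>$\<close> 75)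

section \<open>Integration along lines\<close>

lemma AE_lborel_off_hyperplane:
  fixes a :: "'a::euclidean_space"
  assumes "a \<noteq> 0"
  shows "AE x in lborel. a \<bullet> x \<noteq> b"
proof -
  have "closed {x. a \<bullet> x = b}" by (rule closed_hyperplane)
  then have "{x. a \<bullet> x = b} \<in> null_sets lborel"
    using negligible_hyperplane[of a b] assms
    by (simp add: negligible_iff_null_sets null_sets_completion_iff)
  then show ?thesis by (intro AE_I'[of "{x. a \<bullet> x = b}"]) auto
qed

lemma
  fixes g :: "'a::euclidean_space \<Rightarrow> 'b::euclidean_space"
  assumes "integrable lborel g"
  shows integrable_lborel_translate: "integrable lborel (\<lambda>x. g (x + c))"
    and integral_lborel_translate: "(LINT x|lborel. g (x + c)) = (LINT x|lborel. g x)"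
proof -
  have m: "(+) c \<in> measurable lborel borel" by simp
  have g: "g \<in> borel_measurable borel" using assms by auto
  have "integrable (distr lborel borel ((+) c)) g"
    by (simp add: lborel_distr_plus assms)
  then show "integrable lborel (\<lambda>x. g (x + c))"
    by (subst (asm) integrable_distr_eq[OF m g]) (simp add: add.commute)
  have "(LINT x|lborel. g x) = (LINT x|distr lborel borel ((+) c). g x)"
    by (simp add: lborel_distr_plus)
  also have "\<dots> = (LINT x|lborel. g (c + x))"
    by (rule integral_distr[OF m g])
  finally show "(LINT x|lborel. g (x + c)) = (LINT x|lborel. g x)"
    by (simp add: add.commute)
qed

text \<open>The difference \<open>h (x + v) - h x\<close> has integral zero and equals the integral of the
  derivative \<open>H\<close> over the segment, for all \<open>x\<close> off a hyperplane parallel to \<open>v\<close>.\<close>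

lemma integral_line_derivative_eq_0:
  fixes h H :: "'a::euclidean_space \<Rightarrow> 'b::euclidean_space"
  assumes a: "a \<noteq> 0" "a \<bullet> v = 0"
    and h: "integrable lborel h" and H: "integrable lborel H"
    and deriv: "\<And>x. a \<bullet> x \<noteq> 0 \<Longrightarrow> ((\<lambda>s. h (x + s *\<^sub>R v)) has_vector_derivative H x) (at 0)"
  shows "(LINT x|lborel. H x) = 0"
proof -
  have [measurable]: "H \<in> borel_measurable borel" using H by auto
  define F where "F s x = indicator {0..1} s *\<^sub>R H (x + s *\<^sub>R v)" for s :: real and x
  have line: "((\<lambda>s. H (x + s *\<^sub>R v)) has_integral h (x + v) - h x) {0..1}" if "a \<bullet> x \<noteq> 0" for x
  proof -
    have "((\<lambda>s. h (x + s *\<^sub>R v)) has_vector_derivative H (x + t *\<^sub>R v)) (at t within {0..1})" for t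
    proof -
      have "((\<lambda>s. h ((x + t *\<^sub>R v) + s *\<^sub>R v)) has_vector_derivative H (x + t *\<^sub>R v)) (at (0 + 0))"
        using deriv[of "x + t *\<^sub>R v"] that a by (simp add: inner_add_right)
      then have "((\<lambda>s. h ((x + t *\<^sub>R v) + (s - t) *\<^sub>R v)) has_vector_derivative 1 *\<^sub>R H (x + t *\<^sub>R v)) (at t)"
        by (intro vector_diff_chain_at[of "\<lambda>s. s - t" 1 t "\<lambda>s. h ((x + t *\<^sub>R v) + s *\<^sub>R v)", unfolded o_def])
          (auto intro!: derivative_eq_intros)
      then show ?thesis
        by (simp add: algebra_simps has_vector_derivative_at_within)
    qed
    then have "((\<lambda>s. H (x + s *\<^sub>R v)) has_integral (h (x + 1 *\<^sub>R v) - h (x + 0 *\<^sub>R v))) {0..1}"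
      by (intro fundamental_theorem_of_calculus) auto
    then show ?thesis by simp
  qed
  have tr: "integrable lborel (\<lambda>x. H (x + c))" "(LINT x|lborel. H (x + c)) = (LINT x|lborel. H x)"
    "(LINT x|lborel. norm (H (x + c))) = (LINT x|lborel. norm (H x))" for c
    using integrable_lborel_translate[OF H] integral_lborel_translate[OF H]
      integral_lborel_translate[OF integrable_norm[OF H]] by auto
  have [measurable]: "case_prod F \<in> borel_measurable (lborel \<Otimes>\<^sub>M lborel)"
    unfolding F_def case_prod_beta by measurable
  have int: "integrable (lborel \<Otimes>\<^sub>M lborel) (case_prod F)"
  proof (rule lborel_pair.Fubini_integrable)
    \<comment> \<open>By translation invariance the inner integral does not depend on
      \<open>s\<close> in the unit interval, which gives absolute integrability of \<open>F\<close>
      on the product.\<close>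
    have "(\<lambda>s. LINT x|lborel. norm (case_prod F (s, x))) = (\<lambda>s. indicator {0..1} s *\<^sub>R (LINT x|lborel. norm (H x)))"
      by (auto simp: F_def tr fun_eq_iff indicator_def)
    then show "integrable lborel (\<lambda>s. LINT x|lborel. norm (case_prod F (s, x)))"
      by simp
    show "AE s in lborel. integrable lborel (\<lambda>x. case_prod F (s, x))"
      by (auto simp: F_def tr)
  qed measurable
  have "(LINT x|lborel. H x) = (LINT s|lborel. LINT x|lborel. F s x)"
    by (simp add: F_def tr)
  also have "\<dots> = (LINT x|lborel. LINT s|lborel. F s x)"
    by (rule lborel_pair.Fubini_integral[OF int, symmetric])
  also have "\<dots> = (LINT x|lborel. h (x + v) - h x)"
  proof (rule integral_cong_AE)
    show "AE x in lborel. (LINT s|lborel. F s x) = h (x + v) - h x"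
      using AE_lborel_off_hyperplane[OF a(1), of 0] lborel_pair.AE_integrable_snd[OF int]
    proof eventually_elim
      case (elim x)
      have "set_integrable lborel {0..1} (\<lambda>s. H (x + s *\<^sub>R v))"
        using elim(2) by (simp add: set_integrable_def F_def)
      then have "(LINT s|lborel. F s x) = integral {0..1} (\<lambda>s. H (x + s *\<^sub>R v))"
        using set_borel_integral_eq_integral(2) by (auto simp: set_lebesgue_integral_def F_def)
      then show ?case using line[OF elim(1)] by (simp add: integral_unique)
    qed
    have [measurable]: "h \<in> borel_measurable borel" using h by auto
    show "(\<lambda>x. h (x + v) - h x) \<in> borel_measurable lborel" by measurable
  qed measurable
  also have "\<dots> = 0"
    using integrable_lborel_translate[OF h] integral_lborel_translate[OF h] h by simp
  finally show ?thesis .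
qed

section \<open>Functions with a mild singularity on a complex hyperplane\<close>

lemma measurable_vec_nth [measurable]:
  fixes k :: "'n::finite"
  shows "(\<lambda>x::complex^'n. x $ k) \<in> borel_measurable borel"
  by (intro borel_measurable_continuous_onI continuous_intros)

definition polybox :: "'n \<Rightarrow> real \<Rightarrow> real \<Rightarrow> complex^'n::finite" where
  "polybox k e M = (\<chi> i. if i = k then Complex e e else Complex M M)"

lemma polybox_inner_pos:
  assumes "0 < e" "0 < M" "b \<in> Basis" shows "0 < polybox k e M \<bullet> b"
  using assms by (auto simp: Basis_vec_def inner_axis polybox_def Basis_complex_def complex_inner_1_right complex_inner_i_right)

lemma mem_cbox_polybox:
  "x \<in> cbox (c - polybox k e M) (c + polybox k e M) \<longleftrightarrow>
    (\<bar>Re (x $ k - c $ k)\<bar> \<le> e \<and> \<bar>Im (x $ k - c $ k)\<bar> \<le> e \<and>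
     (\<forall>i. i \<noteq> k \<longrightarrow> \<bar>Re (x $ i - c $ i)\<bar> \<le> M \<and> \<bar>Im (x $ i - c $ i)\<bar> \<le> M))"
proof -
  have "x \<in> cbox (c - polybox k e M) (c + polybox k e M) \<longleftrightarrow>
    (\<forall>i. \<bar>Re (x $ i - c $ i)\<bar> \<le> Re (polybox k e M $ i) \<and> \<bar>Im (x $ i - c $ i)\<bar> \<le> Im (polybox k e M $ i))"
    by (simp add: mem_box Basis_vec_def inner_axis Basis_complex_def complex_inner_1_right complex_inner_i_right abs_le_iff)
      (smt (verit, best))
  also have "\<dots> \<longleftrightarrow> (\<bar>Re (x $ k - c $ k)\<bar> \<le> e \<and> \<bar>Im (x $ k - c $ k)\<bar> \<le> e \<and>
     (\<forall>i. i \<noteq> k \<longrightarrow> \<bar>Re (x $ i - c $ i)\<bar> \<le> M \<and> \<bar>Im (x $ i - c $ i)\<bar> \<le> M))"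
    by (auto simp: polybox_def)
  finally show ?thesis .
qed

lemma emeasure_polybox:
  fixes c :: "complex^'n::finite"
  assumes "0 < e" "0 < M"
  shows "emeasure lborel (cbox (c - polybox k e M) (c + polybox k e M))
    = ennreal (e\<^sup>2 * (4 * (2 * M) ^ (2 * CARD('n) - 2)))"
proof -
  let ?r = "polybox k e M"
  let ?b1 = "axis k 1 :: complex^'n" and ?b2 = "axis k \<i> :: complex^'n"
  have B: "?b1 \<in> Basis" "?b2 \<in> Basis" "?b1 \<noteq> ?b2"
    by (auto simp: Basis_vec_def Basis_complex_def axis_eq_axis)
  have rest: "?r \<bullet> b = M" if "b \<in> Basis - {?b1} - {?b2}" for b
  proof -
    from that obtain i u where iu: "b = axis i u" "u = 1 \<or> u = \<i>"
      by (auto simp: Basis_vec_def Basis_complex_def)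
    with that have "i \<noteq> k" by auto
    with iu show ?thesis
      by (auto simp: inner_axis polybox_def complex_inner_1_right complex_inner_i_right)
  qed
  have k: "?r \<bullet> ?b1 = e" "?r \<bullet> ?b2 = e"
    by (simp_all add: inner_axis polybox_def complex_inner_1_right complex_inner_i_right)
  have "(\<Prod>b\<in>Basis. (c + ?r - (c - ?r)) \<bullet> b) = (\<Prod>b\<in>Basis. 2 * (?r \<bullet> b))"
    unfolding inner_diff_left inner_add_left by simp
  also have "\<dots> = 2 * (?r \<bullet> ?b1) * (2 * (?r \<bullet> ?b2) * (\<Prod>b\<in>Basis - {?b1} - {?b2}. 2 * (?r \<bullet> b)))"
    using B by (simp add: prod.remove[of "Basis" ?b1] prod.remove[of "Basis - {?b1}" ?b2])
  also have "(\<Prod>b\<in>Basis - {?b1} - {?b2}. 2 * (?r \<bullet> b)) = (2 * M) ^ card (Basis - {?b1} - {?b2})"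
    using rest by simp
  also have "card (Basis - {?b1} - {?b2}) = 2 * CARD('n) - 2"
    using B by simp
  finally have "(\<Prod>b\<in>Basis. (c + ?r - (c - ?r)) \<bullet> b) = e\<^sup>2 * (4 * (2 * M) ^ (2 * CARD('n) - 2))"
    by (simp add: k power2_eq_square)
  moreover have "(c - ?r) \<bullet> b \<le> (c + ?r) \<bullet> b" if "b \<in> Basis" for b
    using polybox_inner_pos[OF assms that, of k] by (simp add: inner_add_left inner_diff_left)
  ultimately show ?thesis by (simp add: emeasure_lborel_cbox_eq)
qed

text \<open>The size of the second derivatives of the solution.\<close>

definition sing_weight :: "real \<Rightarrow> real" where
  "sing_weight r = 1 / (r\<^sup>2 * (ln (r\<^sup>2))\<^sup>2)"

lemma sing_weight_nonneg: "0 \<le> sing_weight r"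
  by (simp add: sing_weight_def)

text \<open>On this shell \<open>1 / r\<^sup>2\<close> is at most \<open>4 * 4 ^ j\<close>, and
  \<open>- ln (r\<^sup>2)\<close> is at least \<open>2 * j * ln 2\<close>, which exceeds
  \<open>j\<close> because \<open>ln 2\<close> is at least 1/2.\<close>

lemma sing_weight_bound:
  assumes r: "r \<le> 2 / 2 ^ Suc j" "1 / 2 ^ Suc j < r" and j: "j \<ge> 1"
  shows "sing_weight r \<le> 4 * 4 ^ j / (real j)\<^sup>2"
proof -
  have r0: "r > 0" using r(2) by (rule less_trans[rotated]) simp
  have "ln r \<le> ln (1 / 2 ^ j)" using r(1) r0 by simp
  also have "\<dots> = - real j * ln 2" by (simp add: ln_div ln_realpow)
  finally have l1: "ln (r\<^sup>2) \<le> - 2 * real j * ln 2"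
    using r0 by (simp add: ln_realpow)
  have "ln (2::real) \<ge> 1 / 2" using ln_le_minus_one[of "1/2::real"] by (simp add: ln_div)
  then have "2 * real j * ln 2 \<ge> real j" using mult_left_mono[of "1/2" "ln 2" "2 * real j"] by simp
  with l1 have "real j \<le> - ln (r\<^sup>2)" by simp
  then have l2: "(real j)\<^sup>2 \<le> (ln (r\<^sup>2))\<^sup>2"
    using power_mono[of "real j" "- ln (r\<^sup>2)" 2] by simp
  have "1 / (4 * 4 ^ j) = (1 / 2 ^ Suc j :: real)\<^sup>2"
    by (simp add: power_divide power2_eq_square flip: power_mult_distrib)
  also have "\<dots> \<le> r\<^sup>2" using r(2) by (intro power_mono) auto
  finally have "1 / (4 * 4 ^ j) * (real j)\<^sup>2 \<le> r\<^sup>2 * (ln (r\<^sup>2))\<^sup>2"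
    using l2 by (intro mult_mono) auto
  moreover have "0 < 1 / (4 * 4 ^ j) * (real j)\<^sup>2" using j by simp
  ultimately have "sing_weight r \<le> 1 / (1 / (4 * 4 ^ j) * (real j)\<^sup>2)"
    unfolding sing_weight_def by (intro frac_le) simp_all
  then show ?thesis by simp
qed

text \<open>The outermost shell reaches towards \<open>r = 1\<close>, where the logarithm vanishes;
  there the bound comes from the distance to the boundary of the disc.\<close>

lemma sing_weight_bound_0:
  assumes r: "r \<le> q" "q < 1" "1 / 2 < r"
  shows "sing_weight r \<le> 4 / (ln (q\<^sup>2))\<^sup>2"
proof -
  have "ln (r\<^sup>2) \<le> ln (q\<^sup>2)" using r by (simp add: power_mono)
  moreover have q0: "ln (q\<^sup>2) < 0" using r by (subst ln_less_zero_iff) (auto simp: power_less_one_iff)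
  ultimately have l2: "(ln (q\<^sup>2))\<^sup>2 \<le> (ln (r\<^sup>2))\<^sup>2"
    using power_mono[of "- ln (q\<^sup>2)" "- ln (r\<^sup>2)" 2] by simp
  have "(1 / 2)\<^sup>2 \<le> r\<^sup>2" using r by (intro power_mono) auto
  then have "1 / 4 * (ln (q\<^sup>2))\<^sup>2 \<le> r\<^sup>2 * (ln (r\<^sup>2))\<^sup>2"
    using l2 by (intro mult_mono) (auto simp: power2_eq_square)
  moreover have "0 < 1 / 4 * (ln (q\<^sup>2))\<^sup>2" using q0 by simp
  ultimately have "sing_weight r \<le> 1 / (1 / 4 * (ln (q\<^sup>2))\<^sup>2)"
    unfolding sing_weight_def by (intro frac_le) simp_all
  then show ?thesis by simp
qed

lemma compact_disc_bound:
  fixes K :: "(complex^'n::finite) set"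
  assumes "compact K" "K \<subseteq> disc_times_space k"
  obtains q M where "0 < q" "q < 1" "0 < M" "\<And>x. x \<in> K \<Longrightarrow> norm (x $ k) \<le> q"
    "\<And>x i. x \<in> K \<Longrightarrow> norm (x $ i) \<le> M"
proof -
  obtain M where M: "0 < M" "\<And>x. x \<in> K \<Longrightarrow> norm x \<le> M"
    using compact_imp_bounded[OF assms(1)] by (auto simp: bounded_pos)
  have M': "norm (x $ i) \<le> M" if "x \<in> K" for x :: "complex^'n" and i
    using M(2)[OF that] Finite_Cartesian_Product.norm_nth_le[of x i] by linarith
  show ?thesis
  proof (cases "K = {}")
    case True
    then show ?thesis using that[of "1/2" M] M by auto
  next
    case False
    have "continuous_on K (\<lambda>x. norm (x $ k))" by (intro continuous_intros)
    from continuous_attains_sup[OF assms(1) False this]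
    obtain y where y: "y \<in> K" "\<And>x. x \<in> K \<Longrightarrow> norm (x $ k) \<le> norm (y $ k)" by auto
    have "norm (y $ k) < 1" using y assms(2) by (auto simp: disc_times_space_def)
    then show ?thesis
      using that[of "max (1/2) (norm (y $ k))" M] y M M' by (fastforce simp: le_max_iff_disj)
  qed
qed

lemma AE_vec_nth_nonzero: "AE x in lborel. (x :: complex^'n::finite) $ k \<noteq> 0"
proof -
  have "axis k 1 \<noteq> (0 :: complex^'n)" by simp
  from AE_lborel_off_hyperplane[OF this, of 0] show ?thesis
    by eventually_elim (auto simp: inner_axis inner_commute)
qed

lemma power_two_cover:
  fixes r :: real assumes "0 < r" "r \<le> 1"
  shows "\<exists>j. r \<le> 2 / 2 ^ Suc j \<and> 1 / 2 ^ Suc j < r"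
proof -
  obtain j where "(1 / 2) ^ j < r" using real_arch_pow_inv[of r "1/2"] assms by auto
  then have ex: "\<exists>j. 1 / 2 ^ Suc j < r"
    by (intro exI[of _ j]) (rule le_less_trans[of _ "(1/2)^j"], auto simp: power_divide field_simps)
  define j where "j = (LEAST j. 1 / 2 ^ Suc j < r)"
  have j: "1 / 2 ^ Suc j < r" unfolding j_def by (rule LeastI_ex[OF ex])
  have "r \<le> 2 / 2 ^ Suc j"
  proof (cases j)
    case 0 then show ?thesis using assms by simp
  next
    case (Suc i)
    then have "\<not> 1 / 2 ^ Suc i < r" using not_less_Least[of i "\<lambda>j. 1 / 2 ^ Suc j < r"] by (simp add: j_def)
    then show ?thesis using Suc by simp
  qed
  with j show ?thesis by blast
qed

text \<open>Dyadic shells in the singular variable: the shell of radius \<open>2\<^sup>-\<^sup>j\<close> contributes \<open>O(1/j\<^sup>2)\<close>.\<close>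

lemma integrable_sing_weight_bound:
  fixes f :: "complex^'n::finite \<Rightarrow> real"
  assumes f [measurable]: "f \<in> borel_measurable borel"
    and K: "compact K" "K \<subseteq> disc_times_space k"
    and C: "\<And>x. x \<in> K \<Longrightarrow> x $ k \<noteq> 0 \<Longrightarrow> \<bar>f x\<bar> \<le> C * sing_weight (norm (x $ k))"
  shows "set_integrable lborel K f"
proof -
  obtain q M where qM: "0 < q" "q < 1" "0 < M" "\<And>x. x \<in> K \<Longrightarrow> norm (x $ k) \<le> q"
    "\<And>x i. x \<in> K \<Longrightarrow> norm (x $ i) \<le> M"
    using compact_disc_bound[OF K] by metis
  have [measurable]: "K \<in> sets borel" using K by (simp add: compact_imp_closed)
  define c where "c j = \<bar>C\<bar> * (if j = 0 then 4 / (ln (q\<^sup>2))\<^sup>2 else 4 * 4 ^ j / (real j)\<^sup>2)" for j :: nat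
  define B where "B j = cbox (0 - polybox k (2 / 2 ^ Suc j) M) (0 + polybox k (2 / 2 ^ Suc j) M :: complex^'n)" for j :: nat
  define V where "V = 4 * (2 * M) ^ (2 * CARD('n) - 2)"
  have c0: "c j \<ge> 0" for j by (simp add: c_def)
  have V0: "V \<ge> 0" using qM by (simp add: V_def)
  have [measurable]: "B j \<in> sets borel" for j by (simp add: B_def)
  have emB: "emeasure lborel (B j) = ennreal ((1 / 2 ^ j)\<^sup>2 * V)" for j
    using emeasure_polybox[of "2 / 2 ^ Suc j" M 0 k] qM by (simp add: B_def V_def)
  have pt: "\<bar>f x\<bar> \<le> c j \<and> x \<in> B j" if x: "x \<in> K" "x $ k \<noteq> 0" and j: "norm (x $ k) \<le> 2 / 2 ^ Suc j"
    "1 / 2 ^ Suc j < norm (x $ k)" for x j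
  proof
    have "\<bar>f x\<bar> \<le> \<bar>C\<bar> * sing_weight (norm (x $ k))"
      using C[OF x] by (rule order_trans) (intro mult_right_mono sing_weight_nonneg; simp)
    also have "\<dots> \<le> c j"
      unfolding c_def
      using sing_weight_bound[OF j] sing_weight_bound_0[OF qM(4)[OF x(1)] qM(2)] j
      by (intro mult_left_mono) auto
    finally show "\<bar>f x\<bar> \<le> c j" .
    show "x \<in> B j"
      unfolding B_def mem_cbox_polybox
      using order_trans[OF abs_Re_le_cmod j(1)] order_trans[OF abs_Im_le_cmod j(1)]
        order_trans[OF abs_Re_le_cmod qM(5)[OF x(1)]] order_trans[OF abs_Im_le_cmod qM(5)[OF x(1)]] by simp
  qed
  have summ: "summable (\<lambda>j. c j * ((1 / 2 ^ j)\<^sup>2 * V))"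
  proof (rule summable_comparison_test_ev)
    show "\<forall>\<^sub>F j in sequentially. norm (c j * ((1 / 2 ^ j)\<^sup>2 * V)) \<le> 4 * \<bar>C\<bar> * V * (inverse (real j ^ 2))"
      using eventually_gt_at_top[of 0]
    proof eventually_elim
      case (elim j)
      \<comment> \<open>The area of the shell cancels the factor \<open>4 ^ j\<close> of the weight;
        only \<open>1 / j\<^sup>2\<close> remains.\<close>
      have "(1 / 2 ^ j :: real)\<^sup>2 = 1 / 4 ^ j"
        by (simp add: power_divide power2_eq_square flip: power_mult_distrib)
      then show ?case using elim V0 by (simp add: c_def abs_mult field_simps)
    qed
    show "summable (\<lambda>j. 4 * \<bar>C\<bar> * V * inverse (real j ^ 2))"
      by (intro summable_mult inverse_power_summable) simp
  qed
  have "(\<integral>\<^sup>+ x. ennreal (norm (indicator K x *\<^sub>R f x)) \<partial>lborel)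
     \<le> (\<integral>\<^sup>+ x. (\<Sum>j. ennreal (c j) * indicator (B j) x) \<partial>lborel)"
  proof (rule nn_integral_mono_AE)
    show "AE x in lborel. ennreal (norm (indicator K x *\<^sub>R f x)) \<le> (\<Sum>j. ennreal (c j) * indicator (B j) x)"
      using AE_vec_nth_nonzero[of k]
    proof eventually_elim
      case (elim x)
      show ?case
      proof (cases "x \<in> K")
        case True
        have "norm (x $ k) > 0" "norm (x $ k) \<le> 1" using elim qM(2,4) True by force+
        then obtain j where j: "norm (x $ k) \<le> 2 / 2 ^ Suc j" "1 / 2 ^ Suc j < norm (x $ k)"
          using power_two_cover by blast
        have "ennreal (norm (indicator K x *\<^sub>R f x)) \<le> ennreal (c j) * indicator (B j) x"
          using pt[OF True elim j] True by (auto intro!: ennreal_leI)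
        also have "\<dots> \<le> (\<Sum>j. ennreal (c j) * indicator (B j) x)"
          using sum_le_suminf[of "\<lambda>j. ennreal (c j) * indicator (B j) x" "{j}"]
          by (simp only: sum.insert sum.empty finite.intros insert_not_empty empty_iff add_0_right simp_thms) simp
        finally show ?thesis .
      qed simp
    qed
  qed
  also have "\<dots> = (\<Sum>j. \<integral>\<^sup>+ x. ennreal (c j) * indicator (B j) x \<partial>lborel)"
    by (intro nn_integral_suminf) measurable
  also have "\<dots> = (\<Sum>j. ennreal (c j * ((1 / 2 ^ j)\<^sup>2 * V)))"
    using c0 by (simp add: nn_integral_cmult_indicator emB ennreal_mult V0)
  also have "\<dots> < \<infinity>"
  proof -
    have "0 \<le> c j * ((1 / 2 ^ j)\<^sup>2 * V)" for j
      by (intro mult_nonneg_nonneg c0 V0) auto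
    from ennreal_suminf_neq_top[OF summ this] show ?thesis
      unfolding infinity_ennreal_def less_top .
  qed
  finally have "(\<integral>\<^sup>+ x. ennreal (norm (indicator K x *\<^sub>R f x)) \<partial>lborel) < \<infinity>" .
  then show ?thesis
    unfolding set_integrable_def by (intro integrableI_bounded) measurable
qed

text \<open>The integrability class of the development: it contains \<open>u\<close> with its first
  and second derivatives, is stable under locally bounded factors, and can be integrated against
  test functions. Values on \<open>x $ k = 0\<close>, a null set, are left free.\<close>

definition mild :: "'n \<Rightarrow> (complex^'n::finite \<Rightarrow> real) \<Rightarrow> bool" where
  "mild k f \<longleftrightarrow> f \<in> borel_measurable borel \<and>
     (\<forall>K. compact K \<and> K \<subseteq> disc_times_space k \<longrightarrow>
       (\<exists>C. \<forall>x\<in>K. x $ k \<noteq> 0 \<longrightarrow> \<bar>f x\<bar> \<le> C * sing_weight (norm (x $ k))))"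

lemma mild_set_integrable:
  assumes "mild k f" "compact K" "K \<subseteq> disc_times_space k"
  shows "set_integrable lborel K f"
  using assms unfolding mild_def by (metis integrable_sing_weight_bound)

lemma mild_integrable:
  fixes \<phi> :: "complex^'n::finite \<Rightarrow> 'b::euclidean_space"
  assumes f: "mild k f" and \<phi>: "vtest (disc_times_space k) \<phi>"
  shows "integrable lborel (\<lambda>x. f x *\<^sub>R \<phi> x)"
proof -
  obtain K where K: "compact K" "K \<subseteq> disc_times_space k" "\<And>x. x \<notin> K \<Longrightarrow> \<phi> x = 0"
    using \<phi> by (auto simp: vtest_def)
  have cont: "continuous_on UNIV \<phi>" using \<phi> by (simp add: vtest_def smooth_everywhere_continuous)
  then have "bounded (\<phi> ` K)"
    using K(1) by (meson compact_continuous_image compact_imp_bounded continuous_on_subset subset_UNIV)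
  then obtain B where B: "\<And>x. x \<in> K \<Longrightarrow> norm (\<phi> x) \<le> B" "B > 0" by (auto simp: bounded_pos)
  have "integrable lborel (\<lambda>x. B *\<^sub>R (indicator K x *\<^sub>R f x))"
    using mild_set_integrable[OF f K(1,2)] unfolding set_integrable_def by (intro integrable_scaleR_right) simp
  moreover have "(\<lambda>x. f x *\<^sub>R \<phi> x) \<in> borel_measurable lborel"
    using f borel_measurable_continuous_onI[OF cont] by (auto simp: mild_def)
  ultimately show ?thesis
  proof (rule Bochner_Integration.integrable_bound)
    show "AE x in lborel. norm (f x *\<^sub>R \<phi> x) \<le> norm (B *\<^sub>R (indicator K x *\<^sub>R f x))"
    proof (rule AE_I2)
      fix x show "norm (f x *\<^sub>R \<phi> x) \<le> norm (B *\<^sub>R (indicator K x *\<^sub>R f x))"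
        using mult_right_mono[OF B(1)[of x], of "\<bar>f x\<bar>"] B(2) K(3)[of x]
        by (cases "x \<in> K") (simp_all add: abs_mult mult.commute)
    qed
  qed
qed

text \<open>Integration by parts in one direction needs a derivative along lines in that direction
  only, and only off the singular set.\<close>

definition line_deriv :: "'n \<Rightarrow> complex^'n \<Rightarrow> (complex^'n::finite \<Rightarrow> real) \<Rightarrow> (complex^'n \<Rightarrow> real) \<Rightarrow> bool" where
  "line_deriv k v f g \<longleftrightarrow> (\<forall>x\<in>disc_times_space k. x $ k \<noteq> 0 \<longrightarrow>
     ((\<lambda>s. f (x + s *\<^sub>R v)) has_real_derivative g x) (at 0))"

lemma open_disc_times_space: "open (disc_times_space k)"
  unfolding disc_times_space_def by (intro open_Collect_less continuous_intros)

text \<open>The singular set has real codimension two, so that for each direction \<open>v\<close> there is a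
  hyperplane parallel to \<open>v\<close> containing it.\<close>

lemma mild_integration_by_parts:
  fixes \<phi> :: "complex^'n::finite \<Rightarrow> 'b::euclidean_space"
  assumes f: "mild k f" and g: "mild k g" and fg: "line_deriv k v f g"
    and \<phi>: "vtest (disc_times_space k) \<phi>"
  shows "(LINT x|lborel. f x *\<^sub>R partial_deriv v \<phi> x) = - (LINT x|lborel. g x *\<^sub>R \<phi> x)"
proof -
  obtain K where K: "compact K" "K \<subseteq> disc_times_space k" "\<And>x. x \<notin> K \<Longrightarrow> \<phi> x = 0"
    using \<phi> by (auto simp: vtest_def)
  \<comment> \<open>Over the reals \<open>\<i> * v $ k\<close> is orthogonal to
    \<open>v $ k\<close>, so the real hyperplane orthogonal to \<open>a\<close> contains both
    \<open>v\<close> and the whole set \<open>x $ k = 0\<close>.\<close>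
  define w where "w = (if v $ k = 0 then 1 else \<i> * v $ k)"
  define a where "a = (axis k w :: complex^'n)"
  have a: "a \<noteq> 0" by (auto simp: a_def w_def)
  have "a \<bullet> v = w \<bullet> (v $ k)" by (simp add: a_def inner_commute inner_axis)
  also have "\<dots> = 0" by (auto simp: w_def inner_complex_def)
  finally have av: "a \<bullet> v = 0" .
  have ak: "x $ k \<noteq> 0" if "a \<bullet> x \<noteq> 0" for x
    using that by (auto simp: a_def inner_commute inner_axis)
  have i1: "integrable lborel (\<lambda>x. f x *\<^sub>R \<phi> x)" "integrable lborel (\<lambda>x. g x *\<^sub>R \<phi> x)"
    "integrable lborel (\<lambda>x. f x *\<^sub>R partial_deriv v \<phi> x)"
    using mild_integrable f g \<phi> vtest_partial_deriv by blast+
  have "(LINT x|lborel. f x *\<^sub>R partial_deriv v \<phi> x + g x *\<^sub>R \<phi> x) = 0"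
  proof (rule integral_line_derivative_eq_0[OF a av i1(1) Bochner_Integration.integrable_add[OF i1(3,2)]])
    fix x assume ax: "a \<bullet> x \<noteq> 0"
    show "((\<lambda>s. f (x + s *\<^sub>R v) *\<^sub>R \<phi> (x + s *\<^sub>R v)) has_vector_derivative
            f x *\<^sub>R partial_deriv v \<phi> x + g x *\<^sub>R \<phi> x) (at 0)"
    proof (cases "x \<in> disc_times_space k")
      case True
      have "((\<lambda>s. f (x + s *\<^sub>R v)) has_real_derivative g x) (at 0)"
        using fg True ak[OF ax] by (auto simp: line_deriv_def)
      moreover have "((\<lambda>s. \<phi> (x + s *\<^sub>R v)) has_vector_derivative partial_deriv v \<phi> (x + 0 *\<^sub>R v)) (at 0)"
        by (rule has_vector_derivative_line[OF vtest_differentiable[OF \<phi>]])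
      ultimately show ?thesis
        by (auto dest: has_vector_derivative_scaleR)
    next
      case False
      then have x: "x \<in> - K" "open (- K)" using K by (auto simp: compact_imp_closed)
      have p0: "partial_deriv v \<phi> x = 0" "\<phi> x = 0"
        using partial_deriv_eq_0[OF x(2,1), of \<phi>] K(3) x by auto
      have "continuous_on UNIV (\<lambda>s. x + s *\<^sub>R v)" by (intro continuous_intros)
      then have "open ((\<lambda>s. x + s *\<^sub>R v) -` (- K))"
        using x(2) by (simp add: open_vimage)
      then have "((\<lambda>s. f (x + s *\<^sub>R v) *\<^sub>R \<phi> (x + s *\<^sub>R v)) has_vector_derivative 0) (at 0)"
        by (rule has_vector_derivative_transform_within_open[OF has_vector_derivative_const[of 0]])
          (use x K(3) in auto)
      then show ?thesis by (simp add: p0)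
    qed
  qed
  then show ?thesis
    using i1 by (simp add: eq_neg_iff_add_eq_0)
qed

text \<open>The multipliers of the class \<open>mild\<close>; again nothing is asked on the singular
  set.\<close>

definition tame :: "'n \<Rightarrow> (complex^'n::finite \<Rightarrow> real) \<Rightarrow> bool" where
  "tame k f \<longleftrightarrow> f \<in> borel_measurable borel \<and>
     (\<forall>K. compact K \<and> K \<subseteq> disc_times_space k \<longrightarrow> (\<exists>C. \<forall>x\<in>K. x $ k \<noteq> 0 \<longrightarrow> \<bar>f x\<bar> \<le> C))"

section \<open>Closure rules for the classes \<open>tame\<close> and \<open>mild\<close>\<close>

lemma tame_continuous:
  assumes "continuous_on UNIV f" shows "tame k f"
  unfolding tame_def
proof (intro conjI allI impI)
  show "f \<in> borel_measurable borel" using assms by (rule borel_measurable_continuous_onI)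
  fix K assume "compact K \<and> K \<subseteq> disc_times_space k"
  then have "bounded (f ` K)"
    by (meson assms compact_continuous_image compact_imp_bounded continuous_on_subset subset_UNIV)
  then show "\<exists>C. \<forall>x\<in>K. x $ k \<noteq> 0 \<longrightarrow> \<bar>f x\<bar> \<le> C" by (auto simp: bounded_iff)
qed

lemma tame_const: "tame k (\<lambda>_. c)"
  by (intro tame_continuous continuous_intros)

lemma tame_add:
  assumes "tame k f" "tame k g" shows "tame k (\<lambda>x. f x + g x)"
  unfolding tame_def
proof (intro conjI allI impI)
  show "(\<lambda>x. f x + g x) \<in> borel_measurable borel" using assms by (auto simp: tame_def)
  fix K assume "compact K \<and> K \<subseteq> disc_times_space k"
  then obtain C D where "\<And>x. x \<in> K \<Longrightarrow> x $ k \<noteq> 0 \<Longrightarrow> \<bar>f x\<bar> \<le> C" "\<And>x. x \<in> K \<Longrightarrow> x $ k \<noteq> 0 \<Longrightarrow> \<bar>g x\<bar> \<le> D"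
    using assms by (fastforce simp: tame_def)
  then show "\<exists>C. \<forall>x\<in>K. x $ k \<noteq> 0 \<longrightarrow> \<bar>f x + g x\<bar> \<le> C"
    by (intro exI[of _ "C + D"] ballI impI order_trans[OF abs_triangle_ineq] add_mono)
qed

lemma tame_mult:
  assumes "tame k f" "tame k g" shows "tame k (\<lambda>x. f x * g x)"
  unfolding tame_def
proof (intro conjI allI impI)
  show "(\<lambda>x. f x * g x) \<in> borel_measurable borel" using assms by (auto simp: tame_def)
  fix K assume "compact K \<and> K \<subseteq> disc_times_space k"
  then obtain C D where "\<And>x. x \<in> K \<Longrightarrow> x $ k \<noteq> 0 \<Longrightarrow> \<bar>f x\<bar> \<le> C" "\<And>x. x \<in> K \<Longrightarrow> x $ k \<noteq> 0 \<Longrightarrow> \<bar>g x\<bar> \<le> D"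
    using assms by (fastforce simp: tame_def)
  then show "\<exists>C. \<forall>x\<in>K. x $ k \<noteq> 0 \<longrightarrow> \<bar>f x * g x\<bar> \<le> C"
    by (intro exI[of _ "\<bar>C\<bar> * \<bar>D\<bar>"] ballI impI) (unfold abs_mult, intro mult_mono; fastforce)
qed

lemma tame_diff:
  assumes "tame k f" "tame k g" shows "tame k (\<lambda>x. f x - g x)"
  using tame_add[OF assms(1) tame_mult[OF tame_const[of _ "-1"] assms(2)]] by simp

lemma tame_uminus: "tame k f \<Longrightarrow> tame k (\<lambda>x. - f x)"
  using tame_mult[OF tame_const[of _ "-1"]] by fastforce

lemma tame_power: "tame k f \<Longrightarrow> tame k (\<lambda>x. f x ^ j)"
  by (induction j) (auto intro: tame_const tame_mult)

lemma tame_sum: "(\<And>i. i \<in> I \<Longrightarrow> tame k (f i)) \<Longrightarrow> tame k (\<lambda>x. \<Sum>i\<in>I. f i x)"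
  by (induction I rule: infinite_finite_induct) (auto intro: tame_const tame_add)

lemma tame_borel: "tame k f \<Longrightarrow> f \<in> borel_measurable borel"
  by (simp add: tame_def)

lemma mild_borel: "mild k f \<Longrightarrow> f \<in> borel_measurable borel"
  by (simp add: mild_def)

lemmas tame_intros = tame_const tame_add tame_diff tame_mult tame_uminus tame_power tame_sum

lemma mild_add:
  assumes "mild k f" "mild k g" shows "mild k (\<lambda>x. f x + g x)"
  unfolding mild_def
proof (intro conjI allI impI)
  show "(\<lambda>x. f x + g x) \<in> borel_measurable borel" using assms by (auto simp: mild_def)
  fix K assume "compact K \<and> K \<subseteq> disc_times_space k"
  then obtain C D where "\<And>x. x \<in> K \<Longrightarrow> x $ k \<noteq> 0 \<Longrightarrow> \<bar>f x\<bar> \<le> C * sing_weight (norm (x $ k))"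
      "\<And>x. x \<in> K \<Longrightarrow> x $ k \<noteq> 0 \<Longrightarrow> \<bar>g x\<bar> \<le> D * sing_weight (norm (x $ k))"
    using assms unfolding mild_def by metis
  then show "\<exists>C. \<forall>x\<in>K. x $ k \<noteq> 0 \<longrightarrow> \<bar>f x + g x\<bar> \<le> C * sing_weight (norm (x $ k))"
    by (intro exI[of _ "C + D"] ballI impI order_trans[OF abs_triangle_ineq]) (simp add: distrib_right add_mono)
qed

lemma mild_mult_tame:
  assumes "tame k f" "mild k g" shows "mild k (\<lambda>x. f x * g x)"
  unfolding mild_def
proof (intro conjI allI impI)
  show "(\<lambda>x. f x * g x) \<in> borel_measurable borel" using assms by (auto simp: mild_def tame_def)
  fix K assume "compact K \<and> K \<subseteq> disc_times_space k"
  then obtain C D where CD: "\<And>x. x \<in> K \<Longrightarrow> x $ k \<noteq> 0 \<Longrightarrow> \<bar>f x\<bar> \<le> C"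
      "\<And>x. x \<in> K \<Longrightarrow> x $ k \<noteq> 0 \<Longrightarrow> \<bar>g x\<bar> \<le> D * sing_weight (norm (x $ k))"
    using assms unfolding mild_def tame_def by metis
  have "\<bar>f x * g x\<bar> \<le> (\<bar>C\<bar> * \<bar>D\<bar>) * sing_weight (norm (x $ k))" if x: "x \<in> K" "x $ k \<noteq> 0" for x
  proof -
    have "\<bar>f x * g x\<bar> \<le> \<bar>C\<bar> * (\<bar>D\<bar> * sing_weight (norm (x $ k)))"
      unfolding abs_mult
    proof (intro mult_mono)
      have "D * sing_weight (norm (x $ k)) \<le> \<bar>D\<bar> * sing_weight (norm (x $ k))"
        by (intro mult_right_mono sing_weight_nonneg) simp
      with CD(2)[OF x] show "\<bar>g x\<bar> \<le> \<bar>D\<bar> * sing_weight (norm (x $ k))" by simp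
    qed (use CD(1)[OF x] in auto)
    then show ?thesis by (simp add: mult.assoc)
  qed
  then show "\<exists>C. \<forall>x\<in>K. x $ k \<noteq> 0 \<longrightarrow> \<bar>f x * g x\<bar> \<le> C * sing_weight (norm (x $ k))" by blast
qed

lemma mild_cmult: "mild k f \<Longrightarrow> mild k (\<lambda>x. c * f x)"
  by (intro mild_mult_tame tame_const)

lemma mild_uminus: "mild k f \<Longrightarrow> mild k (\<lambda>x. - f x)"
  using mild_cmult[of k f "-1"] by simp

lemma mild_diff: "mild k f \<Longrightarrow> mild k g \<Longrightarrow> mild k (\<lambda>x. f x - g x)"
  using mild_add[OF _ mild_uminus, of k f g] by simp

lemma mild_sum: "(\<And>i. i \<in> I \<Longrightarrow> mild k (f i)) \<Longrightarrow> mild k (\<lambda>x. \<Sum>i\<in>I. f i x)"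
proof (induction I rule: infinite_finite_induct)
  case (insert i I)
  then show ?case by (auto intro!: mild_add)
qed (auto simp: mild_def intro!: exI[of _ 0])

lemma mild_abs: "mild k f \<Longrightarrow> mild k (\<lambda>x. \<bar>f x\<bar>)"
  by (auto simp: mild_def)

lemma line_deriv_mult: "line_deriv k v f f' \<Longrightarrow> line_deriv k v g g' \<Longrightarrow>
    line_deriv k v (\<lambda>x. f x * g x) (\<lambda>x. f' x * g x + g' x * f x)"
  by (auto simp: line_deriv_def intro!: derivative_eq_intros)

lemma line_deriv_const: "line_deriv k v (\<lambda>_. c) (\<lambda>_. 0)"
  by (simp add: line_deriv_def)

lemma set_integral_vtest:
  fixes f :: "complex^'n::finite \<Rightarrow> real"
  assumes f: "f \<in> borel_measurable borel" and \<phi>: "vtest \<Omega> \<phi>"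
  shows "(LINT x:\<Omega>|lebesgue. f x * \<phi> x) = (LINT x|lborel. f x *\<^sub>R \<phi> x)"
proof -
  have "indicator \<Omega> x *\<^sub>R (f x * \<phi> x) = f x *\<^sub>R \<phi> x" for x
    using \<phi> by (cases "x \<in> \<Omega>") (auto simp: vtest_def)
  then have "(LINT x:\<Omega>|lebesgue. f x * \<phi> x) = (LINT x|lebesgue. f x *\<^sub>R \<phi> x)"
    by (simp only: set_lebesgue_integral_def)
  also have "\<dots> = (LINT x|lborel. f x *\<^sub>R \<phi> x)"
    using f borel_measurable_continuous_onI[OF smooth_everywhere_continuous[OF vtest_smooth[OF \<phi>]]]
    by (intro integral_completion) simp
  finally show ?thesis .
qed

lemma Lp_loc_of_mild:
  assumes f: "f \<in> borel_measurable borel" and m: "mild k (\<lambda>x. \<bar>f x\<bar> powr p)"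
  shows "Lp_loc p (disc_times_space k) f"
  unfolding Lp_loc_def
proof (intro conjI allI impI)
  have "disc_times_space k \<in> sets lborel"
    using open_disc_times_space[of k] by simp
  then show "set_borel_measurable lebesgue (disc_times_space k) f"
    unfolding set_borel_measurable_def using f
    by (intro borel_measurable_scaleR borel_measurable_indicator measurable_completion) auto
  fix K assume K: "compact K \<and> K \<subseteq> disc_times_space k"
  then have "integrable lborel (\<lambda>x. indicator K x *\<^sub>R (\<bar>f x\<bar> powr p))"
    using mild_set_integrable[OF m, of K] by (simp add: set_integrable_def)
  then show "set_integrable lebesgue K (\<lambda>x. \<bar>f x\<bar> powr p)"
    unfolding set_integrable_def
    by (subst integrable_completion) auto
qed

section \<open>The solution and its derivatives\<close>

text \<open>\<open>k\<close> is the coordinate called \<open>z\<close> in the overview and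
  \<open>m\<close> the one called \<open>w\<close>. That the dimension is at least 2 enters through
  the existence of \<open>m\<close>.\<close>

locale two_coordinates =
  fixes k m :: "'n::finite"
  assumes km: "k \<noteq> m"
begin

abbreviation \<Omega> :: "(complex^'n) set" where "\<Omega> \<equiv> disc_times_space k"

definition R :: "complex^'n \<Rightarrow> real" where "R x = (norm (x $ k))\<^sup>2"
definition L :: "complex^'n \<Rightarrow> real" where "L x = - ln (R x)"
text \<open>Half the derivative of \<open>R\<close> in direction \<open>v\<close>.\<close>

definition p :: "complex^'n \<Rightarrow> complex^'n \<Rightarrow> real" where "p v x = x $ k \<bullet> v $ k"
definition s :: "complex^'n \<Rightarrow> real" where "s x = Re (x $ m)"

text \<open>For \<open>a\<close>, \<open>b\<close>, \<open>q\<close> and \<open>u\<close> the suffix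
  1 marks the derivative in one direction, the suffix 2 the second derivative in two directions.
  Since \<open>q\<close> is quadratic, its second derivative is the constant
  \<open>q1 w v\<close>.\<close>

definition a :: "complex^'n \<Rightarrow> real" where "a x = 1 / L x"
definition a1 :: "complex^'n \<Rightarrow> complex^'n \<Rightarrow> real" where "a1 v x = 2 * p v x / (R x * (L x)\<^sup>2)"
definition a2 :: "complex^'n \<Rightarrow> complex^'n \<Rightarrow> complex^'n \<Rightarrow> real" where
  "a2 v w x = 2 * (v $ k \<bullet> w $ k) / (R x * (L x)\<^sup>2) - 4 * p v x * p w x / ((R x)\<^sup>2 * (L x)\<^sup>2)
     + 8 * p v x * p w x / ((R x)\<^sup>2 * (L x) ^ 3)"

definition b :: "complex^'n \<Rightarrow> real" where "b x = R x * (2 + L x)"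
definition b1 :: "complex^'n \<Rightarrow> complex^'n \<Rightarrow> real" where "b1 v x = 2 * p v x * (1 + L x)"
definition b2 :: "complex^'n \<Rightarrow> complex^'n \<Rightarrow> complex^'n \<Rightarrow> real" where
  "b2 v w x = 2 * (v $ k \<bullet> w $ k) * (1 + L x) - 4 * p v x * p w x / R x"

definition q :: "complex^'n \<Rightarrow> real" where "q x = (\<Sum>i\<in>- {k, m}. (norm (x $ i))\<^sup>2)"
definition q1 :: "complex^'n \<Rightarrow> complex^'n \<Rightarrow> real" where "q1 v x = 2 * (\<Sum>i\<in>- {k, m}. x $ i \<bullet> v $ i)"

text \<open>In terms of \<open>L = -ln \<bar>z\<bar>\<^sup>2\<close> the functions \<open>a = 1/L\<close> and \<open>b\<close> satisfy
  \<open>a a\<^sub>z\<^sub>z\<^sub>' = 2 \<bar>a\<^sub>z\<bar>\<^sup>2\<close> and \<open>b\<^sub>z\<^sub>z\<^sub>' = L\<close>, where \<open>z'\<close> is the conjugate variable. On \<open>z = 0\<close> the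
  conventions \<open>ln 0 = 0\<close> and \<open>1/0 = 0\<close> give \<open>a = b = 0\<close>, which are the limits of \<open>a\<close> and \<open>b\<close>.\<close>

definition u :: "complex^'n \<Rightarrow> real" where "u x = 2 * (s x)\<^sup>2 * a x + b x + q x"
definition u1 :: "complex^'n \<Rightarrow> complex^'n \<Rightarrow> real" where
  "u1 v x = 4 * s x * s v * a x + 2 * (s x)\<^sup>2 * a1 v x + b1 v x + q1 v x"
definition u2 :: "complex^'n \<Rightarrow> complex^'n \<Rightarrow> complex^'n \<Rightarrow> real" where
  "u2 v w x = 4 * s v * s w * a x + 4 * s x * (s v * a1 w x + s w * a1 v x) + 2 * (s x)\<^sup>2 * a2 v w x
     + b2 v w x + q1 w v"

lemma
  assumes "x \<in> \<Omega>" "x $ k \<noteq> 0"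
  shows R_pos: "0 < R x" and L_pos: "0 < L x"
proof -
  show "0 < R x" using assms by (simp add: R_def)
  have "R x < 1" using assms by (simp add: R_def disc_times_space_def power_less_one_iff)
  then show "0 < L x" using \<open>0 < R x\<close> by (simp add: L_def)
qed

lemma R_line: "R (x + t *\<^sub>R v) = R x + 2 * t * p v x + t\<^sup>2 * R v"
  unfolding R_def p_def power2_norm_eq_inner
  by (simp add: inner_add_left inner_add_right inner_commute power2_eq_square algebra_simps)

lemma p_line: "p w (x + t *\<^sub>R v) = p w x + t * (v $ k \<bullet> w $ k)"
  by (simp add: p_def inner_add_left)

lemma s_line: "s (x + t *\<^sub>R v) = s x + t * s v"
  by (simp add: s_def)

lemma DERIV_R: "((\<lambda>t. R (x + t *\<^sub>R v)) has_real_derivative 2 * p v x) (at 0)"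
  unfolding R_line by (auto intro!: derivative_eq_intros)

lemma DERIV_p: "((\<lambda>t. p w (x + t *\<^sub>R v)) has_real_derivative v $ k \<bullet> w $ k) (at 0)"
  unfolding p_line by (auto intro!: derivative_eq_intros)

lemma DERIV_s: "((\<lambda>t. s (x + t *\<^sub>R v)) has_real_derivative s v) (at 0)"
  unfolding s_line by (auto intro!: derivative_eq_intros)

lemma DERIV_L: "0 < R x \<Longrightarrow> ((\<lambda>t. L (x + t *\<^sub>R v)) has_real_derivative - (2 * p v x / R x)) (at 0)"
  unfolding L_def by (auto intro!: derivative_eq_intros DERIV_R)

lemma DERIV_q: "((\<lambda>t. q (x + t *\<^sub>R v)) has_real_derivative q1 v x) (at 0)"
proof -
  have "(norm ((x + t *\<^sub>R v) $ i))\<^sup>2 = (norm (x $ i))\<^sup>2 + 2 * t * (x $ i \<bullet> v $ i) + t\<^sup>2 * (norm (v $ i))\<^sup>2" for t i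
    unfolding power2_norm_eq_inner
    by (simp add: inner_add_left inner_add_right inner_commute power2_eq_square algebra_simps)
  then show ?thesis
    unfolding q_def q1_def by (auto intro!: derivative_eq_intros simp: sum_distrib_left)
qed

lemma DERIV_q1: "((\<lambda>t. q1 w (x + t *\<^sub>R v)) has_real_derivative q1 w v) (at 0)"
  unfolding q1_def by (auto intro!: derivative_eq_intros simp: inner_add_left)

lemma line_deriv_a: "line_deriv k v a (a1 v)"
  unfolding line_deriv_def
proof (intro ballI impI)
  fix x assume x: "x \<in> \<Omega>" "x $ k \<noteq> 0"
  note pos = R_pos[OF x] L_pos[OF x]
  show "((\<lambda>t. a (x + t *\<^sub>R v)) has_real_derivative a1 v x) (at 0)"
    unfolding a_def a1_def using pos
    by (auto intro!: derivative_eq_intros DERIV_L simp: power2_eq_square field_simps)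
qed

lemma line_deriv_a1: "line_deriv k w (a1 v) (a2 v w)"
  unfolding line_deriv_def
proof (intro ballI impI)
  fix x assume x: "x \<in> \<Omega>" "x $ k \<noteq> 0"
  note pos = R_pos[OF x] L_pos[OF x]
  show "((\<lambda>t. a1 v (x + t *\<^sub>R w)) has_real_derivative a2 v w x) (at 0)"
    unfolding a1_def a2_def using pos
    by (auto intro!: derivative_eq_intros DERIV_L DERIV_p DERIV_R simp: inner_commute)
      (simp add: divide_simps power2_eq_square power3_eq_cube, simp add: algebra_simps)
qed

lemma line_deriv_b: "line_deriv k v b (b1 v)"
  unfolding line_deriv_def
proof (intro ballI impI)
  fix x assume x: "x \<in> \<Omega>" "x $ k \<noteq> 0"
  note pos = R_pos[OF x] L_pos[OF x]
  show "((\<lambda>t. b (x + t *\<^sub>R v)) has_real_derivative b1 v x) (at 0)"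
    unfolding b_def b1_def using pos
    by (auto intro!: derivative_eq_intros DERIV_L DERIV_R simp: field_simps)
qed

lemma line_deriv_b1: "line_deriv k w (b1 v) (b2 v w)"
  unfolding line_deriv_def
proof (intro ballI impI)
  fix x assume x: "x \<in> \<Omega>" "x $ k \<noteq> 0"
  note pos = R_pos[OF x] L_pos[OF x]
  show "((\<lambda>t. b1 v (x + t *\<^sub>R w)) has_real_derivative b2 v w x) (at 0)"
    unfolding b1_def b2_def using pos
    by (auto intro!: derivative_eq_intros DERIV_L DERIV_p simp: inner_commute field_simps)
qed

lemma DERIV_u:
  assumes x: "x \<in> \<Omega>" "x $ k \<noteq> 0"
  shows "((\<lambda>t. u (x + t *\<^sub>R v)) has_real_derivative u1 v x) (at 0)"
    and "((\<lambda>t. u1 v (x + t *\<^sub>R w)) has_real_derivative u2 v w x) (at 0)"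
proof -
  note d = line_deriv_a[of v, unfolded line_deriv_def, rule_format, OF x]
    line_deriv_b[of v, unfolded line_deriv_def, rule_format, OF x]
    line_deriv_a[of w, unfolded line_deriv_def, rule_format, OF x]
    line_deriv_a1[of w v, unfolded line_deriv_def, rule_format, OF x]
    line_deriv_b1[of w v, unfolded line_deriv_def, rule_format, OF x]
  show "((\<lambda>t. u (x + t *\<^sub>R v)) has_real_derivative u1 v x) (at 0)"
    unfolding u_def u1_def by (auto intro!: derivative_eq_intros d DERIV_s DERIV_q simp: algebra_simps)
  show "((\<lambda>t. u1 v (x + t *\<^sub>R w)) has_real_derivative u2 v w x) (at 0)"
    unfolding u1_def u2_def
    by (auto intro!: derivative_eq_intros d DERIV_s DERIV_q1 simp: algebra_simps)
      (simp add: q1_def inner_commute)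
qed

lemma line_deriv_u: "line_deriv k v u (u1 v)" and line_deriv_u1: "line_deriv k w (u1 v) (u2 v w)"
  using DERIV_u by (auto simp: line_deriv_def)

subsection \<open>Local bounds\<close>

lemma borel_components [measurable]:
  "R \<in> borel_measurable borel" "L \<in> borel_measurable borel" "p v \<in> borel_measurable borel"
  "s \<in> borel_measurable borel" "a \<in> borel_measurable borel" "a1 v \<in> borel_measurable borel"
  "a2 v w \<in> borel_measurable borel" "b \<in> borel_measurable borel" "b1 v \<in> borel_measurable borel"
  "b2 v w \<in> borel_measurable borel" "q \<in> borel_measurable borel" "q1 v \<in> borel_measurable borel"
proof -
  show [measurable]: "R \<in> borel_measurable borel" unfolding R_def by measurable
  show [measurable]: "L \<in> borel_measurable borel" unfolding L_def by measurable
  show [measurable]: "p v \<in> borel_measurable borel" for v unfolding p_def by measurable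
  show "s \<in> borel_measurable borel" unfolding s_def by measurable
  show "a \<in> borel_measurable borel" unfolding a_def by measurable
  show "a1 v \<in> borel_measurable borel" unfolding a1_def by measurable
  show "a2 v w \<in> borel_measurable borel" unfolding a2_def by measurable
  show "b \<in> borel_measurable borel" unfolding b_def by measurable
  show "b1 v \<in> borel_measurable borel" unfolding b1_def by measurable
  show "b2 v w \<in> borel_measurable borel" unfolding b2_def by measurable
  show "q \<in> borel_measurable borel" unfolding q_def by measurable
  show "q1 v \<in> borel_measurable borel" unfolding q1_def by measurable
qed

lemma borel_u [measurable]:
  "u \<in> borel_measurable borel" "u1 v \<in> borel_measurable borel" "u2 v w \<in> borel_measurable borel"
  unfolding u_def u1_def u2_def by measurable

text \<open>\<open>R x * (L x)\<^sup>2\<close> is the reciprocal of the weight, so the bound by the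
  weight becomes local boundedness of a product.\<close>

lemma mildI:
  assumes f: "f \<in> borel_measurable borel" and g: "tame k g"
    and fg: "\<And>x. x \<in> \<Omega> \<Longrightarrow> x $ k \<noteq> 0 \<Longrightarrow> R x * (L x)\<^sup>2 * f x = g x"
  shows "mild k f"
  unfolding mild_def
proof (intro conjI allI impI)
  fix K assume K: "compact K \<and> K \<subseteq> \<Omega>"
  then obtain C where C: "\<And>x. x \<in> K \<Longrightarrow> x $ k \<noteq> 0 \<Longrightarrow> \<bar>g x\<bar> \<le> C"
    using g unfolding tame_def by meson
  have "\<bar>f x\<bar> \<le> C * sing_weight (norm (x $ k))" if x: "x \<in> K" "x $ k \<noteq> 0" for x
  proof -
    have x': "x \<in> \<Omega>" using x K by auto
    have "sing_weight (norm (x $ k)) = 1 / (R x * (L x)\<^sup>2)"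
      by (simp add: sing_weight_def R_def L_def)
    moreover have "0 < R x * (L x)\<^sup>2" using R_pos[OF x' x(2)] L_pos[OF x' x(2)] by simp
    moreover have "R x * (L x)\<^sup>2 * \<bar>f x\<bar> \<le> C"
      using C[OF x] fg[OF x' x(2)] \<open>0 < R x * (L x)\<^sup>2\<close> by (metis abs_mult abs_of_pos)
    ultimately show ?thesis by (simp add: pos_le_divide_eq mult.commute)
  qed
  then show "\<exists>C. \<forall>x\<in>K. x $ k \<noteq> 0 \<longrightarrow> \<bar>f x\<bar> \<le> C * sing_weight (norm (x $ k))" by blast
qed (rule f)

definition r :: "complex^'n \<Rightarrow> real" where "r x = norm (x $ k)"
text \<open>The radial component of \<open>v $ k\<close>. It is bounded, so the growth of an
  expression in \<open>e\<close>, \<open>r\<close> and \<open>L\<close> is read off from the powers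
  of \<open>r\<close> and \<open>L\<close>.\<close>

definition e :: "complex^'n \<Rightarrow> complex^'n \<Rightarrow> real" where "e v x = p v x / r x"

lemma r_pos: "x $ k \<noteq> 0 \<Longrightarrow> 0 < r x" by (simp add: r_def)
lemma R_eq: "R x = r x * r x" by (simp add: R_def r_def power2_eq_square)
lemma p_eq: "p v x = r x * e v x" by (cases "x $ k = 0") (simp_all add: e_def r_def p_def)

lemma tame_s: "tame k s" unfolding s_def[abs_def] by (intro tame_continuous continuous_intros)
lemma tame_p: "tame k (p v)" unfolding p_def[abs_def] by (intro tame_continuous continuous_intros)
lemma tame_r: "tame k r" unfolding r_def[abs_def] by (intro tame_continuous continuous_intros)
lemma tame_q: "tame k q" unfolding q_def[abs_def] by (intro tame_continuous continuous_intros)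
lemma tame_q1: "tame k (q1 v)" unfolding q1_def[abs_def] by (intro tame_continuous continuous_intros)

lemma tame_e: "tame k (e v)"
  unfolding tame_def
proof (intro conjI allI impI exI[of _ "norm (v $ k)"] ballI)
  have [measurable]: "r \<in> borel_measurable borel" using tame_r by (simp add: tame_def)
  show "e v \<in> borel_measurable borel" unfolding e_def by measurable
  fix x :: "complex^'n" assume x: "x $ k \<noteq> 0"
  have "\<bar>p v x\<bar> \<le> r x * norm (v $ k)" unfolding p_def r_def by (rule Cauchy_Schwarz_ineq2)
  with x show "\<bar>e v x\<bar> \<le> norm (v $ k)" by (simp add: e_def r_def field_simps)
qed

lemma tame_a: "tame k a"
  unfolding tame_def
proof (intro conjI allI impI)
  fix K assume K: "compact K \<and> K \<subseteq> \<Omega>"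
  then obtain c M where c: "0 < c" "c < 1" "\<And>x. x \<in> K \<Longrightarrow> norm (x $ k) \<le> c"
    using compact_disc_bound[of K k] by metis
  have "\<bar>a x\<bar> \<le> 1 / (- ln (c\<^sup>2))" if x: "x \<in> K" "x $ k \<noteq> 0" for x
  proof -
    have "ln (R x) \<le> ln (c\<^sup>2)" using c(3)[OF x(1)] c(1) x(2) by (simp add: R_def power_mono)
    moreover have "ln (c\<^sup>2) < 0" using c(1,2) by (subst ln_less_zero_iff) (auto simp: power_less_one_iff)
    ultimately show ?thesis
      using frac_le[of 1 1 "- ln (c\<^sup>2)" "L x"] by (simp add: a_def L_def)
  qed
  then show "\<exists>C. \<forall>x\<in>K. x $ k \<noteq> 0 \<longrightarrow> \<bar>a x\<bar> \<le> C" by blast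
qed measurable

text \<open>One factor \<open>r\<close> beats any power of the logarithm, by
  \<open>(1 + y / j) ^ j \<le> exp y\<close> with \<open>y = - ln (r x)\<close>.\<close>

lemma tame_r_L: "0 < j \<Longrightarrow> tame k (\<lambda>x. r x * (L x) ^ j)"
  unfolding tame_def
proof (intro conjI allI impI exI[of _ "(2 * real j) ^ j"] ballI)
  have [measurable]: "r \<in> borel_measurable borel" using tame_r by (simp add: tame_def)
  show "(\<lambda>x. r x * (L x) ^ j) \<in> borel_measurable borel" by measurable
  fix K x assume j: "0 < j" and "compact K \<and> K \<subseteq> \<Omega>" "x \<in> K" "x $ k \<noteq> 0"
  then have x: "x \<in> \<Omega>" "x $ k \<noteq> 0" by auto
  define y where "y = - ln (r x)"
  have r0: "r x > 0" using x by (simp add: r_def)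
  have L: "L x = 2 * y" using r0 by (simp add: y_def L_def R_def r_def ln_realpow)
  have y0: "y > 0" using L_pos[OF x] L by simp
  have "(y / j) ^ j \<le> (1 + y / j) ^ j" using y0 by (intro power_mono) auto
  also have "\<dots> \<le> exp y" using y0 j by (intro exp_ge_one_plus_x_over_n_power_n) auto
  finally have "y ^ j \<le> real j ^ j * exp y" using j by (simp add: power_divide field_simps)
  then have "r x * y ^ j \<le> r x * (real j ^ j * exp y)" using r0 by simp
  also have "\<dots> = real j ^ j" using r0 by (simp add: y_def exp_minus)
  finally have "r x * y ^ j \<le> real j ^ j" .
  then have "2 ^ j * (r x * y ^ j) \<le> 2 ^ j * real j ^ j" by simp
  then show "\<bar>r x * (L x) ^ j\<bar> \<le> (2 * real j) ^ j"
    using r0 y0 by (simp add: L power_mult_distrib abs_mult algebra_simps)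
qed

lemma tame_rL: "tame k (\<lambda>x. r x * L x)" "tame k (\<lambda>x. r x * (L x)\<^sup>2)"
  using tame_r_L[of 1] tame_r_L[of 2] by simp_all

lemma mild_of_tame: 
  assumes "tame k f" shows "mild k f"
proof (rule mildI)
  show "tame k (\<lambda>x. (r x * L x) * (r x * L x) * f x)"
    by (intro tame_intros tame_rL assms)
qed (use assms in \<open>auto simp: tame_def R_eq power2_eq_square\<close>)

lemma mild_L_mult: "tame k f \<Longrightarrow> mild k (\<lambda>x. L x * f x)"
proof (rule mildI[where g = "\<lambda>x. (r x * L x) * (r x * (L x)\<^sup>2) * f x"])
  assume f: "tame k f"
  then show "tame k (\<lambda>x. (r x * L x) * (r x * (L x)\<^sup>2) * f x)"
    by (intro tame_intros tame_rL)
  show "(\<lambda>x. L x * f x) \<in> borel_measurable borel" using tame_borel[OF f] by measurable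
qed (auto simp: R_eq power2_eq_square)

lemma mild_a1: "mild k (a1 v)"
proof (rule mildI[where g = "\<lambda>x. 2 * p v x"])
  show "R x * (L x)\<^sup>2 * a1 v x = 2 * p v x" if "x \<in> \<Omega>" "x $ k \<noteq> 0" for x
    using R_pos[OF that] L_pos[OF that] by (simp add: a1_def)
qed (auto intro!: tame_intros tame_p)

text \<open>The product is of size \<open>1 / (r\<^sup>2 L\<^sup>4)\<close>, which is within the
  weight. This is what puts the gradient of \<open>u\<close> into exponent 2.\<close>

lemma mild_a1_a1: "mild k (\<lambda>x. a1 v x * a1 w x)"
proof (rule mildI[where g = "\<lambda>x. 4 * e v x * e w x * (a x)\<^sup>2"])
  show "R x * (L x)\<^sup>2 * (a1 v x * a1 w x) = 4 * e v x * e w x * (a x)\<^sup>2" if "x \<in> \<Omega>" "x $ k \<noteq> 0" for x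
    using r_pos[OF that(2)] L_pos[OF that]
    by (simp add: a1_def a_def p_eq R_eq field_simps power2_eq_square)
qed (auto intro!: tame_intros tame_e tame_a)

lemma mild_a2: "mild k (a2 v w)"
proof (rule mildI[where g = "\<lambda>x. 2 * (v $ k \<bullet> w $ k) - 4 * e v x * e w x + 8 * e v x * e w x * a x"])
  show "R x * (L x)\<^sup>2 * a2 v w x = 2 * (v $ k \<bullet> w $ k) - 4 * e v x * e w x + 8 * e v x * e w x * a x"
    if "x \<in> \<Omega>" "x $ k \<noteq> 0" for x
    using r_pos[OF that(2)] L_pos[OF that]
    by (simp add: a2_def a_def p_eq R_eq power2_eq_square power3_eq_cube divide_simps)
qed (auto intro!: tame_intros tame_e tame_a)

lemma tame_b: "tame k b"
proof -
  have "b = (\<lambda>x. 2 * r x * r x + r x * (r x * L x))"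
    by (auto simp: b_def R_eq algebra_simps)
  then show ?thesis by (auto intro!: tame_intros tame_r tame_rL)
qed

lemma tame_b1: "tame k (b1 v)"
proof -
  have "b1 v = (\<lambda>x. 2 * e v x * (r x + r x * L x))"
    by (auto simp: b1_def p_eq algebra_simps)
  then show ?thesis by (auto intro!: tame_intros tame_r tame_e tame_rL)
qed

lemma mild_b2: "mild k (b2 v w)"
proof -
  have "mild k (\<lambda>x. 2 * (v $ k \<bullet> w $ k) + L x * (2 * (v $ k \<bullet> w $ k)) - 4 * e v x * e w x)"
    by (intro mild_add mild_diff mild_L_mult mild_of_tame tame_intros tame_e)
  moreover have "2 * (v $ k \<bullet> w $ k) + L x * (2 * (v $ k \<bullet> w $ k)) - 4 * e v x * e w x = b2 v w x" for x
    by (cases "x $ k = 0") (simp_all add: b2_def e_def r_def R_def p_def algebra_simps power2_eq_square)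
  ultimately show ?thesis by simp
qed

lemma tame_u: "tame k u"
  unfolding u_def[abs_def] by (intro tame_intros tame_s tame_a tame_b tame_q)

lemma mild_u1: "mild k (u1 v)"
  unfolding u1_def[abs_def]
  by (intro mild_add mild_mult_tame[of _ _ "a1 v"] mild_of_tame tame_intros tame_s tame_a tame_b1 tame_q1 mild_a1)

text \<open>The only singular term of \<open>u1\<close> is
  \<open>2 * (s x)\<^sup>2 * a1 v x\<close>; the rest is collected in the locally bounded function
  \<open>g\<close> before squaring.\<close>

lemma mild_u1_sq: "mild k (\<lambda>x. (u1 v x)\<^sup>2)"
proof -
  define g where "g x = 4 * s x * s v * a x + b1 v x + q1 v x" for x
  have g: "tame k g" unfolding g_def[abs_def] by (intro tame_intros tame_s tame_a tame_b1 tame_q1)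
  have "mild k (\<lambda>x. 4 * (s x) ^ 4 * (a1 v x * a1 v x) + 4 * (s x)\<^sup>2 * g x * a1 v x + (g x)\<^sup>2)"
    by (intro mild_add mild_mult_tame mild_a1 mild_a1_a1 mild_of_tame[of "\<lambda>x. (g x)\<^sup>2"] tame_intros tame_s g)
  moreover have "4 * (s x) ^ 4 * (a1 v x * a1 v x) + 4 * (s x)\<^sup>2 * g x * a1 v x + (g x)\<^sup>2 = (u1 v x)\<^sup>2" for x
    unfolding u1_def g_def by algebra
  ultimately show ?thesis by simp
qed

lemma mild_u2: "mild k (u2 v w)"
  unfolding u2_def[abs_def]
  by (intro mild_add mild_mult_tame[of _ _ "\<lambda>x. s v * a1 w x + s w * a1 v x"] mild_mult_tame[of _ _ "a2 v w"]
      mild_cmult mild_of_tame[of a]  mild_of_tame[of "\<lambda>_. q1 _ _"] tame_intros tame_s tame_a mild_a1 mild_a2 mild_b2)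

subsection \<open>Sobolev regularity\<close>

text \<open>The classical derivatives off \<open>z = 0\<close> are the weak ones on all of the
  domain, since integration by parts over the singular set leaves no boundary term.\<close>

lemma weak_deriv_u:
  "weak_deriv \<Omega> [] u u" "weak_deriv \<Omega> [v] u (u1 v)" "weak_deriv \<Omega> [v, w] u (u2 v w)"
proof -
  show "weak_deriv \<Omega> [] u u" by (simp add: weak_deriv_def)
  show "weak_deriv \<Omega> [v] u (u1 v)"
    unfolding weak_deriv_def test_function_iff_vtest
  proof (intro allI impI)
    fix \<phi> :: "complex^'n \<Rightarrow> real" assume \<phi>: "vtest \<Omega> \<phi>"
    show "(LINT x:\<Omega>|lebesgue. u x * foldr partial_deriv [v] \<phi> x)
       = (-1) ^ length [v] * (LINT x:\<Omega>|lebesgue. u1 v x * \<phi> x)"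
      using mild_integration_by_parts[OF mild_of_tame[OF tame_u] mild_u1 line_deriv_u \<phi>, of v]
      by (simp add: set_integral_vtest[OF borel_u(1) vtest_partial_deriv[OF \<phi>]]
        set_integral_vtest[OF borel_u(2) \<phi>])
  qed
  show "weak_deriv \<Omega> [v, w] u (u2 v w)"
    unfolding weak_deriv_def test_function_iff_vtest
  proof (intro allI impI)
    fix \<phi> :: "complex^'n \<Rightarrow> real" assume \<phi>: "vtest \<Omega> \<phi>"
    show "(LINT x:\<Omega>|lebesgue. u x * foldr partial_deriv [v, w] \<phi> x)
       = (-1) ^ length [v, w] * (LINT x:\<Omega>|lebesgue. u2 v w x * \<phi> x)"
      using mild_integration_by_parts[OF mild_of_tame[OF tame_u] mild_u1 line_deriv_u, OF vtest_partial_deriv[OF \<phi>]]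
        mild_integration_by_parts[OF mild_u1 mild_u2 line_deriv_u1 \<phi>]
      by (simp add: set_integral_vtest[OF borel_u(1) vtest_partial_deriv[OF vtest_partial_deriv[OF \<phi>]]]
        set_integral_vtest[OF borel_u(3) \<phi>])
  qed
qed

lemma abs_powr_2: "\<bar>x\<bar> powr 2 = (x::real)\<^sup>2"
  by (cases "x = 0") (simp_all add: powr_numeral)

lemma u_sobolev_1_2: "u \<in> sobolev_loc 1 2 \<Omega>"
proof -
  have l: "Lp_loc 2 \<Omega> u" "Lp_loc 2 \<Omega> (u1 v)" for v
    by (rule Lp_loc_of_mild; simp add: abs_powr_2 mild_u1_sq mild_of_tame tame_power[OF tame_u])+
  have "\<exists>g. Lp_loc 2 \<Omega> g \<and> weak_deriv \<Omega> bs u g" if "length bs \<le> 1" for bs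
  proof -
    have "bs = [] \<or> (\<exists>v. bs = [v])"
      using that by (cases bs) auto
    then show ?thesis using l weak_deriv_u by blast
  qed
  then show ?thesis using l by (auto simp: sobolev_loc_def)
qed

lemma u_sobolev_2_1: "u \<in> sobolev_loc 2 1 \<Omega>"
proof -
  have l: "Lp_loc 1 \<Omega> u" "Lp_loc 1 \<Omega> (u1 v)" "Lp_loc 1 \<Omega> (u2 v w)" for v w
    by (rule Lp_loc_of_mild; simp add: mild_u1 mild_u2 mild_abs mild_of_tame tame_u)+
  have "\<exists>g. Lp_loc 1 \<Omega> g \<and> weak_deriv \<Omega> bs u g" if "length bs \<le> 2" for bs
  proof -
    have "bs = [] \<or> (\<exists>v. bs = [v]) \<or> (\<exists>v w. bs = [v, w])"
      using that by (cases bs; cases "tl bs") auto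
    then show ?thesis using l weak_deriv_u by blast
  qed
  then show ?thesis using l by (auto simp: sobolev_loc_def)
qed

end

section \<open>Failure of higher integrability\<close>

context two_coordinates
begin

definition cen :: "real \<Rightarrow> complex^'n" where
  "cen \<epsilon> = (\<chi> i. if i = k then of_real \<epsilon> else if i = m then 3 / 2 else 0)"

text \<open>A box whose size in the singular coordinate is comparable with its distance from
  \<open>z = 0\<close>. It lies where \<open>Re (x $ k)\<close> dominates \<open>Im (x $ k)\<close>
  and where \<open>s\<close> stays away from 0, so that the singular derivatives in direction
  \<open>axis k 1\<close> have a definite sign and full size.\<close>

definition near_box :: "real \<Rightarrow> (complex^'n) set" where
  "near_box \<epsilon> = cbox (cen \<epsilon> - polybox k (\<epsilon> / 8) (1 / 4)) (cen \<epsilon> + polybox k (\<epsilon> / 8) (1 / 4))"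

definition big_box :: "(complex^'n) set" where
  "big_box = cbox (cen 0 - polybox k (1 / 2) 1) (cen 0 + polybox k (1 / 2) 1)"

lemma near_boxD:
  assumes "x \<in> near_box \<epsilon>" "0 < \<epsilon>"
  shows "7 / 8 * \<epsilon> \<le> Re (x $ k)" "Re (x $ k) \<le> 9 / 8 * \<epsilon>" "\<bar>Im (x $ k)\<bar> \<le> \<epsilon> / 8"
    "5 / 4 \<le> s x" "x $ k \<noteq> 0"
proof -
  have k: "\<bar>Re (x $ k) - \<epsilon>\<bar> \<le> \<epsilon> / 8" "\<bar>Im (x $ k)\<bar> \<le> \<epsilon> / 8"
    and m: "\<bar>Re (x $ m) - 3 / 2\<bar> \<le> 1 / 4"
    using assms(1) km unfolding near_box_def mem_cbox_polybox by (auto simp: cen_def)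
  show "7 / 8 * \<epsilon> \<le> Re (x $ k)" "Re (x $ k) \<le> 9 / 8 * \<epsilon>" "\<bar>Im (x $ k)\<bar> \<le> \<epsilon> / 8"
    using k unfolding abs_le_iff by linarith+
  show "5 / 4 \<le> s x" using m unfolding s_def abs_le_iff by linarith
  show "x $ k \<noteq> 0" using k assms(2) by (auto simp: abs_if split: if_splits)
qed

lemma near_box_subset:
  assumes "0 < \<epsilon>" "\<epsilon> \<le> 1 / 4" shows "near_box \<epsilon> \<subseteq> big_box"
proof
  fix x assume x: "x \<in> near_box \<epsilon>"
  have "\<bar>Re (x $ k)\<bar> \<le> 1 / 2 \<and> \<bar>Im (x $ k)\<bar> \<le> 1 / 2"
    using near_boxD[OF x assms(1)] assms by (auto simp: abs_le_iff)
  then show "x \<in> big_box"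
    using x unfolding near_box_def big_box_def mem_cbox_polybox by (fastforce simp: cen_def)
qed

lemma big_box_subset: "big_box \<subseteq> \<Omega>"
proof
  fix x assume "x \<in> big_box"
  then have "\<bar>Re (x $ k)\<bar> \<le> 1 / 2 \<and> \<bar>Im (x $ k)\<bar> \<le> 1 / 2"
    unfolding big_box_def mem_cbox_polybox by (auto simp: cen_def)
  then have "(Re (x $ k))\<^sup>2 \<le> (1 / 2)\<^sup>2" "(Im (x $ k))\<^sup>2 \<le> (1 / 2)\<^sup>2"
    by (auto simp only: abs_le_square_iff[symmetric] abs_of_nonneg)
  then have "(cmod (x $ k))\<^sup>2 < 1" unfolding cmod_power2 by (simp add: power2_eq_square)
  then show "x \<in> \<Omega>" by (simp add: disc_times_space_def power_less_one_iff)
qed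

text \<open>The constants 49 and 50 come from \<open>Re (x $ k) \<ge> 7 / 8 * \<epsilon>\<close> and
  \<open>\<bar>Im (x $ k)\<bar> \<le> \<epsilon> / 8\<close>: the squares are in the ratio 49 to 1
  at worst.\<close>

lemma near_box_R:
  assumes "x \<in> near_box \<epsilon>" "0 < \<epsilon>"
  shows "\<epsilon>\<^sup>2 / 4 \<le> R x" "R x \<le> 2 * \<epsilon>\<^sup>2" "49 * R x \<le> 50 * (Re (x $ k))\<^sup>2"
proof -
  note D = near_boxD[OF assms]
  have R: "R x = (Re (x $ k))\<^sup>2 + (Im (x $ k))\<^sup>2" by (simp add: R_def cmod_power2)
  have l: "49 / 64 * \<epsilon>\<^sup>2 \<le> (Re (x $ k))\<^sup>2"
    using power_mono[of "7 / 8 * \<epsilon>" "Re (x $ k)" 2] D assms by (simp add: power2_eq_square)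
  have h: "(Re (x $ k))\<^sup>2 \<le> 81 / 64 * \<epsilon>\<^sup>2"
    using power_mono[of "Re (x $ k)" "9 / 8 * \<epsilon>" 2] D assms by (simp add: power2_eq_square)
  have i: "(Im (x $ k))\<^sup>2 \<le> 1 / 64 * \<epsilon>\<^sup>2"
    using power_mono[of "\<bar>Im (x $ k)\<bar>" "\<epsilon> / 8" 2] D by (simp add: power2_eq_square)
  define A B E where "A = (Re (x $ k))\<^sup>2" and "B = (Im (x $ k))\<^sup>2" and "E = \<epsilon>\<^sup>2"
  have "0 \<le> B" "0 \<le> E" by (simp_all add: B_def E_def)
  with l h i show "\<epsilon>\<^sup>2 / 4 \<le> R x" "R x \<le> 2 * \<epsilon>\<^sup>2" "49 * R x \<le> 50 * (Re (x $ k))\<^sup>2"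
    unfolding R A_def[symmetric] B_def[symmetric] E_def[symmetric] distrib_left by linarith+
qed

text \<open>The pairing with a bump of size \<open>\<epsilon>\<close> in the singular variable; the estimate
  \<open>y \<le> M + M\<^sup>1\<^sup>-\<^sup>p y\<^sup>p\<close> with \<open>M = \<epsilon>\<^sup>-\<^sup>2\<^sup>/\<^sup>p\<close> replaces Hoelder's inequality.\<close>

lemma concentration_bound:
  fixes p :: real
  assumes p: "1 < p" and G: "Lp_loc p \<Omega> G" and f: "mild k f"
    and eq: "\<And>\<phi>. test_function \<Omega> \<phi> \<Longrightarrow> (LINT x:\<Omega>|lebesgue. G x * \<phi> x) = (LINT x:\<Omega>|lebesgue. f x * \<phi> x)"
  shows "\<exists>C. \<forall>\<epsilon> h \<sigma>. 0 < \<epsilon> \<longrightarrow> \<epsilon> \<le> 1 / 4 \<longrightarrow> \<bar>\<sigma>\<bar> = 1 \<longrightarrow> (\<forall>x\<in>near_box \<epsilon>. h \<le> \<sigma> * f x) \<longrightarrow> 0 \<le> h \<longrightarrow>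
    h \<le> C * \<epsilon> powr (- 2 / p)"
proof -
  define I where "I = (LINT x:big_box|lebesgue. \<bar>G x\<bar> powr p)"
  have Ki: "set_integrable lebesgue big_box (\<lambda>x. \<bar>G x\<bar> powr p)"
    using G big_box_subset by (auto simp: Lp_loc_def big_box_def)
  \<comment> \<open>\<open>\<epsilon>\<^sup>2 * V1\<close> is the volume of the half box, on which
    the bump is at least \<open>d\<close>, and \<open>\<epsilon>\<^sup>2 * V2\<close> that of
    \<open>near_box\<close>.\<close>
  define V1 V2 :: real where "V1 = 4 * (1 / 4) ^ (2 * CARD('n) - 2) / 256"
    and "V2 = 4 * (1 / 2) ^ (2 * CARD('n) - 2) / 64"
  have V1: "V1 > 0" by (simp add: V1_def)
  define d :: real where "d = exp (- 4) ^ DIM(complex^'n)"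
  have d: "d > 0" by (simp add: d_def)
  have main: "h \<le> (V2 + I) / (d * V1) * \<epsilon> powr (- 2 / p)"
    if \<epsilon>: "0 < \<epsilon>" "\<epsilon> \<le> 1 / 4" and \<sigma>: "\<bar>\<sigma>\<bar> = 1" and h: "\<And>x. x \<in> near_box \<epsilon> \<Longrightarrow> h \<le> \<sigma> * f x" "0 \<le> h" for \<epsilon> h \<sigma>
  proof -
    let ?r = "polybox k (\<epsilon> / 8) (1 / 4) :: complex^'n"
    define Hf where "Hf = cbox (cen \<epsilon> - ?r /\<^sub>R 2) (cen \<epsilon> + ?r /\<^sub>R 2)"
    have half: "?r /\<^sub>R 2 = polybox k (\<epsilon> / 16) (1 / 8)"
      by (simp add: polybox_def vec_eq_iff complex_eq_iff)
    have r: "0 < ?r \<bullet> b" if "b \<in> Basis" for b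
      using polybox_inner_pos[OF _ _ that] \<epsilon> by simp
    define \<phi> where "\<phi> = bump (cen \<epsilon>) ?r"
    have sub: "near_box \<epsilon> \<subseteq> big_box" by (rule near_box_subset[OF \<epsilon>])
    have \<phi>: "test_function \<Omega> \<phi>"
      unfolding \<phi>_def using sub big_box_subset by (intro test_function_bump r) (auto simp: near_box_def)
    have \<phi>0: "\<phi> x = 0" if "x \<notin> near_box \<epsilon>" for x
      unfolding \<phi>_def using that by (intro bump_eq_0 r) (auto simp: near_box_def)
    have half_sub: "Hf \<subseteq> near_box \<epsilon>"
      unfolding Hf_def half near_box_def by (auto simp only: subset_eq mem_cbox_polybox) (use \<epsilon> in auto)
    have m1: "measure lborel Hf = \<epsilon>\<^sup>2 * V1"
      using emeasure_polybox[of "\<epsilon> / 16" "1 / 8" "cen \<epsilon>" k] \<epsilon> unfolding Hf_def half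
      by (simp add: measure_def V1_def power2_eq_square)
    have m2: "measure lborel (near_box \<epsilon>) = \<epsilon>\<^sup>2 * V2"
      using emeasure_polybox[of "\<epsilon> / 8" "1 / 4" "cen \<epsilon>" k] \<epsilon>
      by (simp add: measure_def V2_def power2_eq_square near_box_def)
    have "h * d * (\<epsilon>\<^sup>2 * V1) = (LINT x|lborel. indicator Hf x * (h * d))"
      by (simp add: m1)
    also have "\<dots> \<le> (LINT x|lborel. \<sigma> * (f x *\<^sub>R \<phi> x))"
    proof (rule integral_mono)
      show "integrable lborel (\<lambda>x. indicator Hf x * (h * d))"
        by (intro integrable_mult_left integrable_real_indicator) (auto simp: emeasure_lborel_cbox_eq Hf_def)
      show "integrable lborel (\<lambda>x. \<sigma> * (f x *\<^sub>R \<phi> x))"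
        using mild_integrable[OF f \<phi>[unfolded test_function_iff_vtest]] by simp
      fix x
      show "indicator Hf x * (h * d) \<le> \<sigma> * (f x *\<^sub>R \<phi> x)"
      proof (cases "x \<in> Hf")
        case True
        then have "h * d \<le> (\<sigma> * f x) * \<phi> x"
          unfolding d_def \<phi>_def using h half_sub bump_ge[OF r True[unfolded Hf_def]]
          by (intro mult_mono) (auto intro: order_trans)
        then show ?thesis using True by simp
      next
        case False
        have "0 \<le> (\<sigma> * f x) * \<phi> x"
          using h(1)[of x] h(2) \<phi>0[of x] bump_nonneg[of "cen \<epsilon>" ?r x] 
          by (cases "x \<in> near_box \<epsilon>") (auto simp: \<phi>_def)
        then show ?thesis using False by simp
      qed
    qed
    also have "\<dots> = (LINT x:\<Omega>|lebesgue. (\<sigma> * G x) * \<phi> x)"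
      using eq[OF \<phi>] set_integral_vtest[OF mild_borel[OF f] \<phi>[unfolded test_function_iff_vtest]]
      by (simp add: mult.assoc)
    \<comment> \<open>The threshold is chosen so that both terms contribute the order
      \<open>\<epsilon> powr (2 - 2 / p)\<close>: the first by the volume of the box, the second
      because the integral of the p-th power over \<open>big_box\<close> is a fixed number.\<close>
    also have "\<dots> \<le> (LINT x|lebesgue. \<epsilon> powr (- 2 / p) * indicator (near_box \<epsilon>) x
        + \<epsilon> powr (2 - 2 / p) * (indicator big_box x *\<^sub>R \<bar>G x\<bar> powr p))"
      unfolding set_lebesgue_integral_def
    proof (rule integral_mono')
      have "integrable lebesgue (\<lambda>x. indicator (near_box \<epsilon>) x :: real)"
        by (simp add: near_box_def lmeasurable_iff_integrable[symmetric])
      then show "integrable lebesgue (\<lambda>x. \<epsilon> powr (- 2 / p) * indicator (near_box \<epsilon>) x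
        + \<epsilon> powr (2 - 2 / p) * (indicator big_box x *\<^sub>R \<bar>G x\<bar> powr p))"
        using Ki unfolding set_integrable_def by (intro Bochner_Integration.integrable_add integrable_mult_right)
      fix x
      show "0 \<le> \<epsilon> powr (- 2 / p) * indicator (near_box \<epsilon>) x
        + \<epsilon> powr (2 - 2 / p) * (indicator big_box x *\<^sub>R \<bar>G x\<bar> powr p)" by simp
      show "indicator \<Omega> x *\<^sub>R ((\<sigma> * G x) * \<phi> x) \<le> \<epsilon> powr (- 2 / p) * indicator (near_box \<epsilon>) x
        + \<epsilon> powr (2 - 2 / p) * (indicator big_box x *\<^sub>R \<bar>G x\<bar> powr p)"
      proof (cases "x \<in> near_box \<epsilon>")
        case True
        then have xs: "x \<in> big_box" "x \<in> \<Omega>" using sub big_box_subset by auto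
        have "(\<sigma> * G x) * \<phi> x \<le> \<bar>\<sigma> * G x\<bar> * \<phi> x"
          by (intro mult_right_mono) (auto simp: \<phi>_def bump_nonneg)
        also have "\<dots> \<le> \<bar>\<sigma> * G x\<bar> * 1"
          unfolding \<phi>_def by (intro mult_left_mono bump_le_1) auto
        also have "\<dots> = \<bar>G x\<bar>" using \<sigma> by (simp add: abs_mult)
        also have "\<dots> \<le> \<epsilon> powr (- 2 / p) + \<epsilon> powr (2 - 2 / p) * \<bar>G x\<bar> powr p"
        proof (cases "\<bar>G x\<bar> \<le> \<epsilon> powr (- 2 / p)")
          case True
          then show ?thesis by (simp add: add_increasing2)
        next
          case False
          then have g0: "0 < \<bar>G x\<bar>" using \<epsilon> by (smt (verit) powr_ge_zero)
          have "\<bar>G x\<bar> = \<bar>G x\<bar> powr (1 - p) * \<bar>G x\<bar> powr p"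
            using g0 by (simp flip: powr_add)
          also have "\<dots> \<le> (\<epsilon> powr (- 2 / p)) powr (1 - p) * \<bar>G x\<bar> powr p"
            using False p \<epsilon> g0 by (intro mult_right_mono powr_mono2') auto
          also have "(\<epsilon> powr (- 2 / p)) powr (1 - p) = \<epsilon> powr (2 - 2 / p)"
          proof -
            have "(- 2 / p) * (1 - p) = 2 - 2 / p" using p by (simp add: field_simps)
            then show ?thesis by (simp only: powr_powr)
          qed
          finally show ?thesis by (simp add: add_increasing)
        qed
        finally show ?thesis using True xs by simp
      qed (simp add: \<phi>0)
    qed
    also have "\<dots> = \<epsilon> powr (- 2 / p) * (\<epsilon>\<^sup>2 * V2) + \<epsilon> powr (2 - 2 / p) * I"
    proof -
      have "integrable lebesgue (\<lambda>x. indicator (near_box \<epsilon>) x :: real)"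
        by (simp add: near_box_def lmeasurable_iff_integrable[symmetric])
      moreover have "measure lebesgue (near_box \<epsilon>) = \<epsilon>\<^sup>2 * V2"
        using m2 by (simp add: near_box_def)
      ultimately show ?thesis
        using Ki unfolding set_integrable_def I_def set_lebesgue_integral_def by simp
    qed
    also have "\<epsilon> powr (2 - 2 / p) = \<epsilon> powr (- 2 / p) * \<epsilon>\<^sup>2"
      using \<epsilon> by (simp add: powr_diff powr_minus powr_numeral field_simps)
    finally have "h * (d * V1) * \<epsilon>\<^sup>2 \<le> (\<epsilon> powr (- 2 / p) * (V2 + I)) * \<epsilon>\<^sup>2"
      by (simp add: algebra_simps)
    then have "h * (d * V1) \<le> \<epsilon> powr (- 2 / p) * (V2 + I)"
      using \<epsilon> by simp
    then show ?thesis using d V1 by (simp add: pos_le_divide_eq mult.commute)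
  qed
  show ?thesis by (rule exI[of _ "(V2 + I) / (d * V1)"]) (use main in blast)
qed

text \<open>A squared logarithm cannot make up for a gap between powers. With
  \<open>\<alpha> - \<beta> = 4 * g\<close> the bound \<open>ln y \<le> y powr g / g\<close> costs
  only \<open>\<epsilon> powr (- (2 * g))\<close>, and what remains,
  \<open>\<epsilon> powr (- (2 * g)) \<le> D\<close>, fails for the chosen
  \<open>\<epsilon>\<close>.\<close>

lemma no_polynomial_gain:
  fixes C \<alpha> \<beta> \<epsilon>0 :: real
  assumes "\<beta> < \<alpha>" "0 < \<epsilon>0"
    and le: "\<And>\<epsilon>. 0 < \<epsilon> \<Longrightarrow> \<epsilon> \<le> \<epsilon>0 \<Longrightarrow> \<epsilon> \<le> 1 / 4 \<Longrightarrow> \<epsilon> powr (- \<alpha>) / (ln (\<epsilon>\<^sup>2 / 4))\<^sup>2 \<le> C * \<epsilon> powr (- \<beta>)"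
  shows False
proof -
  define g where "g = (\<alpha> - \<beta>) / 4"
  have g: "g > 0" using assms by (simp add: g_def)
  define D where "D = \<bar>C\<bar> * (2 * 2 powr g / g)\<^sup>2 + 1"
  have D: "D \<ge> 1" by (simp add: D_def)
  define \<epsilon> where "\<epsilon> = min (min \<epsilon>0 (1 / 4)) ((D + 1) powr (- 1 / (2 * g)))"
  have \<epsilon>: "0 < \<epsilon>" "\<epsilon> \<le> \<epsilon>0" "\<epsilon> \<le> 1 / 4" "\<epsilon> \<le> (D + 1) powr (- 1 / (2 * g))"
    using assms D by (auto simp: \<epsilon>_def)
  have lnneg: "ln (\<epsilon>\<^sup>2 / 4) = - 2 * ln (2 / \<epsilon>)"
    using \<epsilon>(1) by (simp add: ln_div ln_realpow) (simp add: ln_realpow[of 2 2, simplified])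
  have l: "0 < ln (2 / \<epsilon>)" "ln (2 / \<epsilon>) \<le> (2 / \<epsilon>) powr g / g"
    using \<epsilon> ln_powr_bound[of "2 / \<epsilon>" g] g by (simp_all only: ln_gt_zero_iff) (simp_all add: field_simps)
  have "(ln (\<epsilon>\<^sup>2 / 4))\<^sup>2 \<le> (2 * ((2 / \<epsilon>) powr g / g))\<^sup>2"
    unfolding lnneg using l power_mono[of "2 * ln (2 / \<epsilon>)" "2 * ((2 / \<epsilon>) powr g / g)" 2]
    by (simp add: power_mult_distrib)
  also have "\<dots> = (2 * 2 powr g / g)\<^sup>2 * \<epsilon> powr (- (2 * g))"
  proof -
    have "((2 / \<epsilon>) powr g)\<^sup>2 = (2 powr g)\<^sup>2 * \<epsilon> powr (- (2 * g))"
      using \<epsilon>(1) by (simp add: powr_divide powr_minus power_divide powr_powr powr_realpow[symmetric] field_simps flip: powr_add)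
    then show ?thesis by (simp add: power_mult_distrib power_divide)
  qed
  finally have sq: "(ln (\<epsilon>\<^sup>2 / 4))\<^sup>2 \<le> (2 * 2 powr g / g)\<^sup>2 * \<epsilon> powr (- (2 * g))" .
  have pos: "0 < (ln (\<epsilon>\<^sup>2 / 4))\<^sup>2" unfolding lnneg using l by simp
  have "\<epsilon> powr (- \<alpha>) \<le> C * \<epsilon> powr (- \<beta>) * (ln (\<epsilon>\<^sup>2 / 4))\<^sup>2"
    using le[OF \<epsilon>(1-3)] pos by (simp add: divide_le_eq)
  also have "\<dots> \<le> \<bar>C\<bar> * \<epsilon> powr (- \<beta>) * (ln (\<epsilon>\<^sup>2 / 4))\<^sup>2"
    by (intro mult_right_mono) auto
  also have "\<dots> \<le> \<bar>C\<bar> * \<epsilon> powr (- \<beta>) * ((2 * 2 powr g / g)\<^sup>2 * \<epsilon> powr (- (2 * g)))"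
    by (intro mult_left_mono sq) auto
  also have "\<dots> \<le> D * (\<epsilon> powr (- \<beta>) * \<epsilon> powr (- (2 * g)))"
    by (simp add: D_def algebra_simps)
  finally have 1: "\<epsilon> powr (- \<alpha>) \<le> D * \<epsilon> powr (- \<beta> - 2 * g)"
    using \<epsilon>(1) by (simp flip: powr_add)
  have "\<epsilon> powr (- \<alpha>) = \<epsilon> powr (- (2 * g)) * \<epsilon> powr (- \<beta> - 2 * g)"
    using \<epsilon>(1) by (simp add: g_def flip: powr_add) (simp add: field_simps)
  with 1 have "\<epsilon> powr (- (2 * g)) \<le> D" using \<epsilon>(1) by simp
  moreover have "((D + 1) powr (- 1 / (2 * g))) powr (- (2 * g)) \<le> \<epsilon> powr (- (2 * g))"
    using \<epsilon> g by (intro powr_mono2') auto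
  moreover have "((D + 1) powr (- 1 / (2 * g))) powr (- (2 * g)) = D + 1"
    using g D by (simp add: powr_powr)
  ultimately show False by simp
qed

section \<open>Size of the derivatives of \<open>u\<close> near the singular set\<close>

lemma near_box_ln:
  assumes "x \<in> near_box \<epsilon>" "0 < \<epsilon>" "\<epsilon> \<le> 1 / 4"
  shows "- ln (2 * \<epsilon>\<^sup>2) \<le> L x" "(L x)\<^sup>2 \<le> (ln (\<epsilon>\<^sup>2 / 4))\<^sup>2" "0 < L x" "0 < R x" "p (axis k 1) x = Re (x $ k)"
proof -
  have x: "x \<in> \<Omega>" "x $ k \<noteq> 0"
    using near_box_subset[OF assms(2,3)] big_box_subset assms(1) near_boxD(5)[OF assms(1,2)] by auto
  show L: "0 < L x" and R: "0 < R x" using L_pos[OF x] R_pos[OF x] by auto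
  show "- ln (2 * \<epsilon>\<^sup>2) \<le> L x"
    using near_box_R(2)[OF assms(1,2)] R assms(2) by (simp add: L_def)
  have "L x \<le> - ln (\<epsilon>\<^sup>2 / 4)"
    using near_box_R(1)[OF assms(1,2)] R assms(2) by (simp add: L_def)
  then show "(L x)\<^sup>2 \<le> (ln (\<epsilon>\<^sup>2 / 4))\<^sup>2" using L power_mono[of "L x" "- ln (\<epsilon>\<^sup>2 / 4)" 2] by simp
  show "p (axis k 1) x = Re (x $ k)" by (simp add: p_def complex_inner_1_right)
qed

lemma norm_axis_complex: "norm (axis i c :: complex^'n) = norm c"
  by (simp add: norm_eq_sqrt_inner inner_axis)

lemma axis_k_simps: "s (axis k 1) = 0" "q1 (axis k 1) x = 0"
  using km by (auto simp: s_def q1_def axis_def intro!: sum.neutral)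

text \<open>In direction \<open>axis k 1\<close> only the terms with \<open>a1\<close> and
  \<open>b1\<close> survive, and both are nonnegative on the box. The factor 1 is the sign
  \<open>\<sigma>\<close> of \<open>concentration_bound\<close>.\<close>

lemma u1_lower:
  assumes "x \<in> near_box \<epsilon>" "0 < \<epsilon>" "\<epsilon> \<le> 1 / 4"
  shows "\<epsilon> powr (- 1) / (ln (\<epsilon>\<^sup>2 / 4))\<^sup>2 \<le> 1 * u1 (axis k 1) x"
proof -
  note N = near_box_ln[OF assms] near_boxD[OF assms(1,2)] near_box_R[OF assms(1,2)]
  have s2: "1 \<le> (s x)\<^sup>2" using power_mono[of 1 "s x" 2] N(9) by simp
  have "\<epsilon> powr (- 1) / (ln (\<epsilon>\<^sup>2 / 4))\<^sup>2 = 1 / (\<epsilon> * (ln (\<epsilon>\<^sup>2 / 4))\<^sup>2)"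
    using assms(2) by (simp add: powr_minus field_simps)
  also have "\<dots> \<le> 1 / (\<epsilon> * (L x)\<^sup>2)"
    using N assms by (intro frac_le mult_left_mono) auto
  also have "\<dots> \<le> 4 * Re (x $ k) / (R x * (L x)\<^sup>2)"
  proof -
    have "\<epsilon> * (7 / 8 * \<epsilon>) \<le> \<epsilon> * Re (x $ k)" using N(6) assms(2) by (intro mult_left_mono) auto
    then have "7 / 8 * (\<epsilon> * \<epsilon>) \<le> \<epsilon> * Re (x $ k)" by simp
    moreover have "R x \<le> 2 * (\<epsilon> * \<epsilon>)" using N(12) by (simp add: power2_eq_square)
    moreover have "0 \<le> \<epsilon> * \<epsilon>" by simp
    ultimately have "R x \<le> 4 * (\<epsilon> * Re (x $ k))" by linarith
    then have "1 / \<epsilon> \<le> 4 * Re (x $ k) / R x"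
      using N(4) assms(2) by (simp add: divide_simps mult_ac)
    then have "1 / \<epsilon> * (1 / (L x)\<^sup>2) \<le> 4 * Re (x $ k) / R x * (1 / (L x)\<^sup>2)"
      by (rule mult_right_mono) simp
    then show ?thesis by simp
  qed
  also have "\<dots> = 2 * 1 * a1 (axis k 1) x" using N by (simp add: a1_def)
  also have "\<dots> \<le> 2 * (s x)\<^sup>2 * a1 (axis k 1) x"
    using s2 N assms by (intro mult_right_mono) (auto simp: a1_def)
  also have "\<dots> \<le> 1 * u1 (axis k 1) x"
    using N assms by (simp add: u1_def axis_k_simps b1_def)
  finally show ?thesis .
qed

lemma exp_ge_pow4: "0 \<le> (y::real) \<Longrightarrow> y ^ 4 / 256 \<le> exp y"
  using exp_ge_one_plus_x_over_n_power_n[of 4 y] power_mono[of "y / 4" "1 + y / 4" 4]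
  by (simp add: power_divide)

text \<open>The direction is almost radial on the box, so the leading part
  \<open>2 * R x - 4 * X\<close> of the numerator of \<open>a2\<close> is about
  \<open>- 2 * R x\<close>: \<open>a2\<close> is negative and as large as the weight. The remaining
  terms, one of relative order \<open>1 / L\<close> and \<open>b2\<close> of order \<open>L\<close>,
  are absorbed for large \<open>L\<close>.\<close>

lemma u2_upper:
  assumes "x \<in> near_box \<epsilon>" "0 < \<epsilon>" "\<epsilon> \<le> 1 / 4" "\<epsilon> \<le> exp (- 300)"
  shows "1 / 2 * (\<epsilon> powr (- 2) / (ln (\<epsilon>\<^sup>2 / 4))\<^sup>2) \<le> - 1 * u2 (axis k 1) (axis k 1) x"
proof -
  note N = near_box_ln[OF assms(1-3)] near_boxD[OF assms(1,2)] near_box_R[OF assms(1,2)]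
  define X where "X = (Re (x $ k))\<^sup>2"
  have ln_eps: "ln \<epsilon> \<le> - 300" using assms(2,4) by (metis exp_gt_zero ln_exp ln_le_cancel_iff)
  have "ln (2 * \<epsilon>\<^sup>2) = ln 2 + 2 * ln \<epsilon>" using assms(2) by (simp add: ln_mult ln_realpow)
  also have "\<dots> \<le> - 599" using ln_eps ln_le_minus_one[of "2::real"] by simp
  \<comment> \<open>What is used below is \<open>L x \<ge> 512\<close> in the estimate
    \<open>small\<close> and \<open>L x \<ge> 400\<close> in the bound of \<open>8 * X\<close>; the
    restriction to \<open>\<epsilon> \<le> exp (- 300)\<close> provides both.\<close>
  finally have L: "L x \<ge> 599" using N(1) by simp
  have RL: "R x = exp (- L x)" using N(4) by (simp add: L_def)
  have "(L x)\<^sup>2 * (1 + L x) \<le> (L x)\<^sup>2 * (2 * L x)" using L by (intro mult_left_mono) auto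
  also have "\<dots> \<le> (L x) ^ 3 * (L x / 256)" using L by (simp add: power2_eq_square power3_eq_cube mult.assoc)
  also have "\<dots> = (L x) ^ 4 / 256" by (simp add: power3_eq_cube power4_eq_xxxx)
  also have "\<dots> \<le> exp (L x)" using L by (intro exp_ge_pow4) simp
  finally have small: "R x * ((L x)\<^sup>2 * (1 + L x)) \<le> 1"
    by (simp add: RL exp_minus field_simps)
  have a2: "a2 (axis k 1) (axis k 1) x \<le> - 1 / (R x * (L x)\<^sup>2)"
  proof -
    have "a2 (axis k 1) (axis k 1) x = (2 * R x * L x - 4 * X * L x + 8 * X) / ((R x)\<^sup>2 * (L x) ^ 3)"
      using N(3,4) by (simp add: a2_def X_def N(5) complex_inner_1_right power2_eq_square power3_eq_cube divide_simps)
        (simp add: algebra_simps)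
    also have "\<dots> \<le> (- R x * L x) / ((R x)\<^sup>2 * (L x) ^ 3)"
    proof (rule divide_right_mono)
      have X: "49 * R x \<le> 50 * X" "0 < X" using N(13,4) by (auto simp: X_def)
      have "8 * X \<le> L x / 50 * X" using L X by (intro mult_right_mono) auto
      moreover have "49 * R x * L x \<le> 50 * X * L x" using X L by (intro mult_right_mono) auto
      moreover have "0 \<le> X * L x" "0 \<le> R x * L x" using X L N(4) by auto
      ultimately show "2 * R x * L x - 4 * X * L x + 8 * X \<le> - R x * L x"
        by (simp add: algebra_simps)
    qed (use N in auto)
    also have "\<dots> = - 1 / (R x * (L x)\<^sup>2)"
      using N(3,4) by (simp add: power2_eq_square power3_eq_cube)
    finally show ?thesis .
  qed
  have s3: "3 / 2 \<le> (s x)\<^sup>2" using power_mono[of "5/4" "s x" 2] N(9) by (simp add: power2_eq_square)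
  have b2: "b2 (axis k 1) (axis k 1) x \<le> 2 * (1 + L x)"
    using N(4) by (simp add: b2_def N(5) complex_inner_1_right)
  define Y where "Y = 1 / (R x * (L x)\<^sup>2)"
  have Y0: "0 \<le> Y" using N by (simp add: Y_def)
  have "2 * (s x)\<^sup>2 * a2 (axis k 1) (axis k 1) x \<le> 2 * (s x)\<^sup>2 * (- Y)"
    using a2 by (intro mult_left_mono) (auto simp: Y_def)
  also have "\<dots> \<le> - (3 * Y)"
    using mult_right_mono[OF s3 Y0] by simp
  finally have 1: "2 * (s x)\<^sup>2 * a2 (axis k 1) (axis k 1) x \<le> - (3 * Y)" .
  have 2: "1 + L x \<le> Y"
    using small N by (simp add: Y_def pos_le_divide_eq mult_ac)
  have "u2 (axis k 1) (axis k 1) x = 2 * (s x)\<^sup>2 * a2 (axis k 1) (axis k 1) x + b2 (axis k 1) (axis k 1) x"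
    by (simp add: u2_def axis_k_simps)
  then have "1 / (R x * (L x)\<^sup>2) \<le> - u2 (axis k 1) (axis k 1) x"
    using 1 2 b2 unfolding Y_def[symmetric] distrib_left by linarith
  moreover have "1 / 2 * (\<epsilon> powr (- 2) / (ln (\<epsilon>\<^sup>2 / 4))\<^sup>2) \<le> 1 / (R x * (L x)\<^sup>2)"
  proof -
    have "1 / 2 * (\<epsilon> powr (- 2) / (ln (\<epsilon>\<^sup>2 / 4))\<^sup>2) = 1 / (2 * \<epsilon>\<^sup>2 * (ln (\<epsilon>\<^sup>2 / 4))\<^sup>2)"
      using assms(2) by (simp add: powr_minus powr_numeral field_simps)
    also have "\<dots> \<le> 1 / (R x * (L x)\<^sup>2)"
      using N assms by (intro frac_le mult_mono) auto
    finally show ?thesis .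
  qed
  ultimately show ?thesis by simp
qed

lemma axis_k_Basis: "axis k 1 \<in> (Basis :: (complex^'n) set)"
  by (auto simp: Basis_vec_def Basis_complex_def)

text \<open>The derivative has size \<open>1 / (\<epsilon> L\<^sup>2)\<close> on the box, but a weak
  derivative of exponent \<open>p\<close> allows only \<open>\<epsilon> powr (- 2 / p)\<close>. The
  two powers of \<open>\<epsilon>\<close> agree at \<open>p = 2\<close>.\<close>

lemma u_not_sobolev_1:
  fixes p :: real
  assumes "2 < p" shows "u \<notin> sobolev_loc 1 p \<Omega>"
proof
  assume "u \<in> sobolev_loc 1 p \<Omega>"
  then have ex: "\<forall>bs. set bs \<subseteq> Basis \<and> length bs \<le> 1 \<longrightarrow> (\<exists>g. Lp_loc p \<Omega> g \<and> weak_deriv \<Omega> bs u g)"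
    by (simp add: sobolev_loc_def)
  obtain G where G: "Lp_loc p \<Omega> G" "weak_deriv \<Omega> [axis k 1] u G"
    using ex[rule_format, of "[axis k 1]"] axis_k_Basis by auto
  have "(LINT x:\<Omega>|lebesgue. G x * \<phi> x) = (LINT x:\<Omega>|lebesgue. u1 (axis k 1) x * \<phi> x)" if "test_function \<Omega> \<phi>" for \<phi>
    using G(2) weak_deriv_u(2)[of "axis k 1"] that by (auto simp: weak_deriv_def)
  note eq = this
  have "1 < p" using assms by simp
  from concentration_bound[OF this G(1) mild_u1 eq] obtain C where
    C: "\<forall>\<epsilon> h \<sigma>. 0 < \<epsilon> \<longrightarrow> \<epsilon> \<le> 1 / 4 \<longrightarrow> \<bar>\<sigma>\<bar> = 1 \<longrightarrow> (\<forall>x\<in>near_box \<epsilon>. h \<le> \<sigma> * u1 (axis k 1) x) \<longrightarrow> 0 \<le> h \<longrightarrow>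
      h \<le> C * \<epsilon> powr (- 2 / p)" by (rule exE)
  show False
  proof (rule no_polynomial_gain[of "2 / p" 1 "1 / 4" C])
    show "2 / p < 1" using assms by simp
    fix \<epsilon> :: real assume "0 < \<epsilon>" "\<epsilon> \<le> 1 / 4"
    then show "\<epsilon> powr (- 1) / (ln (\<epsilon>\<^sup>2 / 4))\<^sup>2 \<le> C * \<epsilon> powr (- (2 / p))"
      using C[rule_format, of \<epsilon> 1 "\<epsilon> powr (- 1) / (ln (\<epsilon>\<^sup>2 / 4))\<^sup>2"] u1_lower by simp
  qed simp
qed

text \<open>The same comparison with growth \<open>1 / (\<epsilon>\<^sup>2 L\<^sup>2)\<close>, where
  the powers agree at \<open>p = 1\<close>. The sign \<open>\<sigma>\<close> is now
  negative.\<close>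

lemma u_not_sobolev_2:
  fixes p :: real
  assumes "1 < p" shows "u \<notin> sobolev_loc 2 p \<Omega>"
proof
  assume "u \<in> sobolev_loc 2 p \<Omega>"
  then have ex: "\<forall>bs. set bs \<subseteq> Basis \<and> length bs \<le> 2 \<longrightarrow> (\<exists>g. Lp_loc p \<Omega> g \<and> weak_deriv \<Omega> bs u g)"
    by (simp add: sobolev_loc_def)
  obtain G where G: "Lp_loc p \<Omega> G" "weak_deriv \<Omega> [axis k 1, axis k 1] u G"
    using ex[rule_format, of "[axis k 1, axis k 1]"] axis_k_Basis by auto
  have "(LINT x:\<Omega>|lebesgue. G x * \<phi> x) = (LINT x:\<Omega>|lebesgue. u2 (axis k 1) (axis k 1) x * \<phi> x)" if "test_function \<Omega> \<phi>" for \<phi>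
    using G(2) weak_deriv_u(3)[of "axis k 1" "axis k 1"] that by (auto simp: weak_deriv_def)
  note eq = this
  have "1 < p" using assms by simp
  from concentration_bound[OF this G(1) mild_u2 eq] obtain C where
    C: "\<forall>\<epsilon> h \<sigma>. 0 < \<epsilon> \<longrightarrow> \<epsilon> \<le> 1 / 4 \<longrightarrow> \<bar>\<sigma>\<bar> = 1 \<longrightarrow> (\<forall>x\<in>near_box \<epsilon>. h \<le> \<sigma> * u2 (axis k 1) (axis k 1) x) \<longrightarrow> 0 \<le> h \<longrightarrow>
      h \<le> C * \<epsilon> powr (- 2 / p)" by (rule exE)
  show False
  proof (rule no_polynomial_gain[of "2 / p" 2 "exp (- 300)" "2 * C"])
    show "2 / p < 2" using assms by (simp add: divide_less_eq)
    fix \<epsilon> :: real assume "0 < \<epsilon>" "\<epsilon> \<le> 1 / 4" "\<epsilon> \<le> exp (- 300)"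
    then show "\<epsilon> powr (- 2) / (ln (\<epsilon>\<^sup>2 / 4))\<^sup>2 \<le> 2 * C * \<epsilon> powr (- (2 / p))"
      using C[rule_format, of \<epsilon> "- 1" "1 / 2 * (\<epsilon> powr (- 2) / (ln (\<epsilon>\<^sup>2 / 4))\<^sup>2)"] u2_upper by simp
  qed simp
qed

section \<open>Failure of Dini continuity\<close>

text \<open>The primitive \<open>- ln (- ln r)\<close> is unbounded at 0.\<close>

lemma nn_integral_inverse_r_ln:
  "(\<integral>\<^sup>+ r\<in>{0<..1/2}. ennreal (1 / (r * (- ln r))) \<partial>lborel) = \<infinity>"
proof -
  have "ennreal B \<le> (\<integral>\<^sup>+ r\<in>{0<..1/2}. ennreal (1 / (r * (- ln r))) \<partial>lborel)" if B: "B \<ge> 0" for B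
  proof -
    define c where "c = ln (- ln (1/2::real))"
    \<comment> \<open>Solves \<open>ln (- ln t) = B + c\<close>, so that the integral from
      \<open>t\<close> to 1/2 is exactly \<open>B\<close>.\<close>
    define t where "t = exp (- exp (B + c))"
    have l2: "- ln (1/2::real) > 0" by simp
    have "exp c = - ln (1/2::real)" using l2 by (simp only: c_def exp_ln)
    then have "exp (B + c) \<ge> - ln (1/2)" using B by (simp add: exp_add)
    then have t: "0 < t" "t \<le> 1/2"
      unfolding t_def using exp_le_cancel_iff[of "- exp (B + c)" "ln (1/2)"] by auto
    have "(\<integral>\<^sup>+ r. ennreal (1 / (r * (- ln r))) * indicator {t..1/2} r \<partial>lborel)
      = ennreal (- ln (- ln (1/2)) - (- ln (- ln t)))"
    proof (rule nn_integral_FTC_Icc)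
      fix r :: real assume r: "r \<in> {t..1/2}"
      then have "r > 0" "ln r < 0" using t by auto
      then show "((\<lambda>r. - ln (- ln r)) has_real_derivative 1 / (r * (- ln r))) (at r)"
        by (auto intro!: derivative_eq_intros)
      show "0 \<le> 1 / (r * (- ln r))" using mult_pos_neg[OF \<open>r > 0\<close> \<open>ln r < 0\<close>] by simp
    qed (use t in \<open>auto intro!: borel_measurable_divide borel_measurable_times borel_measurable_uminus borel_measurable_ln\<close>)
    also have "- ln (- ln (1/2)) - (- ln (- ln t)) = B"
      by (simp only: t_def ln_exp c_def minus_minus)
    finally have "ennreal B = (\<integral>\<^sup>+ r. ennreal (1 / (r * (- ln r))) * indicator {t..1/2} r \<partial>lborel)" by simp
    also have "\<dots> \<le> (\<integral>\<^sup>+ r\<in>{0<..1/2}. ennreal (1 / (r * (- ln r))) \<partial>lborel)"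
      using t by (intro nn_integral_mono mult_left_mono) (auto simp: indicator_def)
    finally show ?thesis .
  qed
  then have bound: "ennreal B \<le> (\<integral>\<^sup>+ r\<in>{0<..1/2}. ennreal (1 / (r * (- ln r))) \<partial>lborel)" if "B \<ge> 0" for B
    using that by blast
  show ?thesis
  proof (cases "\<integral>\<^sup>+ r\<in>{0<..1/2}. ennreal (1 / (r * (- ln r))) \<partial>lborel")
    case (real c)
    then have "ennreal (c + 1) \<le> ennreal c" using bound[of "c + 1"] by simp
    then show ?thesis using real(1) by simp
  qed simp
qed

text \<open>Between the points with \<open>z = 0\<close> and \<open>z = r\<close>, both with
  \<open>w = 1\<close>, \<open>u\<close> increases by at least
  \<open>2 / L = 1 / (- ln r)\<close>.\<close>

lemma u_not_dini: "\<exists>K. compact K \<and> K \<subseteq> \<Omega> \<and> dini_integral K u = \<infinity>"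
proof (intro exI[of _ big_box] conjI big_box_subset)
  show "compact big_box" by (simp add: big_box_def)
  have low: "ennreal (1 / (- ln r)) \<le> modulus_of_continuity big_box u r" if r: "0 < r" "r \<le> 1/2" for r
  proof -
    define x y :: "complex^'n" where "x = axis k (of_real r) + axis m 1" and "y = axis m 1"
    have xk: "x $ k = of_real r" "x $ m = 1" "y $ k = 0" "y $ m = 1"
      using km by (auto simp: x_def y_def axis_def)
    have xi: "x $ i = 0" "y $ i = 0" if "i \<noteq> k" "i \<noteq> m" for i
      using that by (auto simp: x_def y_def axis_def)
    have xy: "x \<in> big_box" "y \<in> big_box"
      unfolding big_box_def mem_cbox_polybox using r xk xi km
      by (auto simp: cen_def)
    have d: "dist x y \<le> r" using r by (simp add: x_def y_def dist_norm norm_axis_complex)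
    have qx: "q x = 0" "q y = 0" using xi by (auto simp: q_def)
    have uy: "u y = 0" by (simp add: u_def qx b_def a_def L_def R_def xk)
    have Lx: "L x = - 2 * ln r" using r by (simp add: L_def R_def xk ln_realpow)
    have lr: "- ln r > 0" using r by simp
    have ux: "u x = 1 / (- ln r) + r\<^sup>2 * (2 - 2 * ln r)"
      using r by (simp add: u_def qx b_def a_def Lx s_def xk R_def)
    have "0 \<le> r\<^sup>2 * (2 - 2 * ln r)" using lr by simp
    then have "1 / (- ln r) \<le> \<bar>u x - u y\<bar>" unfolding ux uy by linarith
    then have "ennreal (1 / (- ln r)) \<le> ennreal \<bar>u x - u y\<bar>" by (rule ennreal_leI)
    also have "\<dots> \<le> modulus_of_continuity big_box u r"
      unfolding modulus_of_continuity_def using xy d by (intro SUP_upper2[of "(x, y)"]) auto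
    finally show ?thesis .
  qed
  have "(\<integral>\<^sup>+ r\<in>{0<..1/2}. ennreal (1 / (r * (- ln r))) \<partial>lborel) \<le> dini_integral big_box u"
    unfolding dini_integral_def
  proof (intro nn_integral_mono)
    fix r :: real
    show "ennreal (1 / (r * (- ln r))) * indicator {0<..1/2} r
      \<le> modulus_of_continuity big_box u r / ennreal r * indicator {0<..1} r"
    proof (cases "0 < r \<and> r \<le> 1/2")
      case True
      then have "- ln r > 0" by simp
      then have "ennreal (1 / (r * (- ln r))) = ennreal (1 / (- ln r)) / ennreal r"
        using True by (subst divide_ennreal) (auto simp: field_simps)
      also have "\<dots> \<le> modulus_of_continuity big_box u r / ennreal r"
        using low True by (intro divide_right_mono_ennreal) auto
      finally show ?thesis using True by simp
    qed (auto simp: indicator_def)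
  qed
  then show "dini_integral big_box u = \<infinity>"
    by (simp only: nn_integral_inverse_r_ln infinity_ennreal_def top_le)
qed

end

section \<open>Means over circles\<close>

lemma has_integral_circle_linear:
  fixes c :: complex
  shows "((\<lambda>t. Re (c * cis t)) has_integral 0) {0..2 * pi}"
proof -
  have "((\<lambda>t. Re (c * cis t)) has_integral (Re c * sin (2 * pi) + Im c * cos (2 * pi) - (Re c * sin 0 + Im c * cos 0))) {0..2 * pi}"
    by (rule fundamental_theorem_of_calculus)
      (auto intro!: derivative_eq_intros simp: has_real_derivative_iff_has_vector_derivative[symmetric])
  then show ?thesis by simp
qed

lemma norm_add_squared:
  fixes x y :: complex
  shows "(norm (x + y))\<^sup>2 = (norm x)\<^sup>2 + (norm y)\<^sup>2 + 2 * Re (cnj x * y)"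
  unfolding cmod_power2 by (simp add: power2_eq_square algebra_simps)

lemma has_integral_circle_norm_sq:
  fixes z w :: complex
  shows "((\<lambda>t. (norm (z + cis t * w))\<^sup>2) has_integral 2 * pi * ((norm z)\<^sup>2 + (norm w)\<^sup>2)) {0..2 * pi}"
proof -
  have eq: "(norm (z + cis t * w))\<^sup>2 = (norm z)\<^sup>2 + (norm w)\<^sup>2 + 2 * Re ((cnj z * w) * cis t)" for t
  proof -
    have "(norm (z + cis t * w))\<^sup>2 = (norm z)\<^sup>2 + (norm (cis t * w))\<^sup>2 + 2 * Re (cnj z * (cis t * w))"
      by (rule norm_add_squared)
    then show ?thesis by (simp add: norm_mult mult_ac)
  qed
  have "((\<lambda>t. (norm z)\<^sup>2 + (norm w)\<^sup>2) has_integral (2 * pi - 0) * ((norm z)\<^sup>2 + (norm w)\<^sup>2)) {0..2 * pi}"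
    using has_integral_const_real[of "(norm z)\<^sup>2 + (norm w)\<^sup>2" 0 "2 * pi"] by simp
  from has_integral_add[OF this has_integral_mult_right[OF has_integral_circle_linear[of "cnj z * w"], of 2]]
  show ?thesis unfolding eq by (simp only: mult_zero_right add_0_right diff_zero)
qed

text \<open>Mean value property: the integrand is the real part of the holomorphic function
  \<open>Ln (1 + c * z)\<close>, which vanishes at the centre.\<close>

lemma has_integral_circle_ln:
  fixes c :: complex
  assumes "norm c < 1"
  shows "((\<lambda>t. ln (norm (1 + c * cis t))) has_integral 0) {0..2 * pi}"
proof -
  have re: "Re (c * z) > - 1" if "z \<in> cball 0 1" for z
  proof -
    have "norm (c * z) \<le> norm c * 1" unfolding norm_mult using that by (intro mult_left_mono) auto
    then show ?thesis using abs_Re_le_cmod[of "c * z"] assms by linarith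
  qed
  have nz: "1 + c * z \<notin> \<real>\<^sub>\<le>\<^sub>0" if "z \<in> cball 0 1" for z
    using re[OF that] by (auto simp: complex_nonpos_Reals_iff)
  have "(\<lambda>z. Ln (1 + c * z)) holomorphic_on cball 0 1"
    using nz by (auto intro!: holomorphic_intros)
  from Cauchy_integral_circlepath_simple[OF this, of 0]
  have "((\<lambda>z. Ln (1 + c * z) / z) has_contour_integral 0) (part_circlepath 0 1 0 (2 * pi))"
    by (simp add: circlepath_def)
  then have "((\<lambda>t. Ln (1 + c * cis t) * \<i>) has_integral 0) {0..2 * pi}"
    by (subst (asm) has_contour_integral_part_circlepath_iff) (simp_all add: mult_ac)
  from has_integral_mult_right[OF this, of "- \<i>"]
  have "((\<lambda>t. Ln (1 + c * cis t)) has_integral 0) {0..2 * pi}"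
    by (simp add: mult_ac)
  from has_integral_linear[OF this bounded_linear_Re]
  have "((\<lambda>t. Re (Ln (1 + c * cis t))) has_integral 0) {0..2 * pi}" by (simp add: o_def)
  moreover have "Re (Ln (1 + c * cis t)) = ln (norm (1 + c * cis t))" for t
    using nz[of "cis t"] by (intro Re_Ln) auto
  ultimately show ?thesis by simp
qed

text \<open>\<open>\<bar>z + e\<^sup>i\<^sup>t w\<bar>\<^sup>2 + \<epsilon> = \<bar>P + e\<^sup>i\<^sup>t Q\<bar>\<^sup>2\<close> with \<open>P = \<surd>X z\<close> and \<open>Q = w / \<surd>X\<close> for some
  \<open>X \<ge> 1\<close> such that \<open>\<bar>Q\<bar> < \<bar>P\<bar>\<close>.\<close>

lemma ln_circle_mean_ge:
  fixes z w :: complex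
  assumes z: "z \<noteq> 0" and \<epsilon>: "0 < \<epsilon>"
  shows "2 * pi * ln ((norm z)\<^sup>2) \<le> integral {0..2 * pi} (\<lambda>t. ln ((norm (z + cis t * w))\<^sup>2 + \<epsilon>))"
proof -
  define A B where "A = (norm z)\<^sup>2" and "B = (norm w)\<^sup>2"
  have AB: "A > 0" "B \<ge> 0" using z by (auto simp: A_def B_def)
  \<comment> \<open>The cross terms of the two squared moduli agree for every \<open>X\<close>; the
    constant terms agree when \<open>f X = \<epsilon>\<close>.\<close>
  define f where "f X = X * A + B / X - A - B" for X
  \<comment> \<open>Beyond \<open>X0\<close> both \<open>X \<ge> 1\<close> and
    \<open>\<bar>Q\<bar> < \<bar>P\<bar>\<close> hold. As \<open>f X0 \<le> 0\<close> and
    \<open>f X1 \<ge> \<epsilon>\<close>, the intermediate value theorem gives a solution, and it is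
    not \<open>X0\<close> because \<open>\<epsilon>\<close> is positive.\<close>
  define X0 X1 where "X0 = max 1 (norm w / norm z)" and "X1 = (A + B + \<epsilon>) / A"
  have "norm w / norm z \<le> (A + B) / A"
  proof -
    have "0 \<le> (norm z - norm w)\<^sup>2" by simp
    then have "2 * (norm z * norm w) \<le> A + B"
      by (simp add: A_def B_def power2_eq_square algebra_simps)
    moreover have "0 \<le> norm z * norm w" by simp
    ultimately have "norm z * norm w \<le> A + B" by linarith
    then have "norm w * A \<le> (A + B) * norm z"
      using mult_right_mono[of "norm z * norm w" "A + B" "norm z"] by (simp add: A_def power2_eq_square mult_ac)
    then show ?thesis using z AB by (simp add: divide_simps)
  qed
  moreover have "(A + B) / A \<le> X1" "1 \<le> X1" using AB \<epsilon> by (simp_all add: X1_def field_simps)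
  ultimately have X01: "1 \<le> X0" "X0 \<le> X1" by (auto simp: X0_def)
  have fX0: "f X0 \<le> 0"
  proof (cases "norm w / norm z \<le> 1")
    case True
    then show ?thesis by (simp add: X0_def f_def)
  next
    case False
    then have X0: "X0 = norm w / norm z" and w: "norm w > 0" by (auto simp: X0_def)
    have "X0 * A = norm w * norm z" "B / X0 = norm w * norm z"
      using z w by (simp_all add: X0 A_def B_def power2_eq_square)
    moreover have "0 \<le> (norm z - norm w)\<^sup>2" by simp
    then have "2 * (norm w * norm z) \<le> A + B"
      by (simp add: A_def B_def power2_eq_square algebra_simps)
    ultimately show ?thesis unfolding f_def by linarith
  qed
  have "f X1 \<ge> \<epsilon>"
  proof -
    have "X1 * A = A + B + \<epsilon>" using AB by (simp add: X1_def)
    moreover have "B / X1 \<ge> 0" using AB X01 by simp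
    ultimately show ?thesis by (simp add: f_def)
  qed
  moreover have "continuous_on {X0..X1} f"
    unfolding f_def using X01 by (intro continuous_intros) auto
  ultimately obtain X where X: "X0 \<le> X" "f X = \<epsilon>"
    using IVT'[of f X0 \<epsilon> X1] X01 fX0 \<epsilon> by auto
  then have "X \<noteq> X0" using fX0 \<epsilon> by auto
  then have X1: "X \<ge> 1" "norm w / norm z < X" using X(1) X01 by (auto simp: X0_def)
  define c where "c = w / (of_real X * z)"
  have c: "norm c < 1" using X1 z by (simp add: c_def norm_divide norm_mult divide_simps mult_ac)
  have c1: "1 + c * cis t \<noteq> 0" for t
  proof
    assume "1 + c * cis t = 0"
    then have "c * cis t = - 1" by (simp add: eq_neg_iff_add_eq_0 add.commute)
    then have "norm (c * cis t) = 1" by simp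
    then show False using c by (simp add: norm_mult)
  qed
  have key: "ln ((norm (z + cis t * w))\<^sup>2 + \<epsilon>) = ln (X * A) + 2 * ln (norm (1 + c * cis t))" for t
  proof -
    define y where "y = Re ((cnj z * w) * cis t)"
    have "(norm (z + cis t * w))\<^sup>2 = A + B + 2 * y"
    proof -
      have "(norm (z + cis t * w))\<^sup>2 = (norm z)\<^sup>2 + (norm (cis t * w))\<^sup>2 + 2 * Re (cnj z * (cis t * w))"
        by (rule norm_add_squared)
      then show ?thesis by (simp add: norm_mult mult_ac A_def B_def y_def)
    qed
    moreover have "X * A * (norm (1 + c * cis t))\<^sup>2 = X * A + B / X + 2 * y"
    proof -
      have zc: "z * c = w / of_real X" using z X1 by (simp add: c_def)
      have "A * (norm (1 + c * cis t))\<^sup>2 = (norm (z + z * c * cis t))\<^sup>2"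
        by (simp add: A_def power_mult_distrib[symmetric] norm_mult[symmetric] algebra_simps)
      also have "\<dots> = (norm (z + cis t * w / of_real X))\<^sup>2" by (subst zc) (simp add: mult_ac)
      also have "\<dots> = (norm z)\<^sup>2 + (norm (cis t * w / of_real X))\<^sup>2 + 2 * Re (cnj z * (cis t * w / of_real X))"
        by (rule norm_add_squared)
      also have "Re (cnj z * (cis t * w / of_real X)) = y / X"
        by (simp add: y_def mult_ac flip: Re_divide_of_real)
      also have "(norm (cis t * w / of_real X))\<^sup>2 = B / X\<^sup>2"
        by (simp add: norm_divide norm_mult power_divide B_def)
      finally have "A * (norm (1 + c * cis t))\<^sup>2 = A + B / X\<^sup>2 + 2 * (y / X)" by (simp add: A_def)
      then have "X * (A * (norm (1 + c * cis t))\<^sup>2) = X * (A + B / X\<^sup>2 + 2 * (y / X))" by simp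
      moreover have "X * (A + B / X\<^sup>2 + 2 * (y / X)) = X * A + B / X + 2 * y"
        using X1 by (simp add: distrib_left power2_eq_square)
      ultimately show ?thesis by (simp only: mult.assoc)
    qed
    ultimately have "(norm (z + cis t * w))\<^sup>2 + \<epsilon> = X * A * (norm (1 + c * cis t))\<^sup>2"
      using X(2) by (simp add: f_def)
    then show ?thesis using X1 AB c1[of t] by (simp add: ln_mult ln_realpow)
  qed
  have "((\<lambda>t. ln (X * A)) has_integral (2 * pi - 0) * ln (X * A)) {0..2 * pi}"
    using has_integral_const_real[of "ln (X * A)" 0 "2 * pi"] by simp
  from has_integral_add[OF this has_integral_mult_right[OF has_integral_circle_ln[OF c], of 2]]
  have "((\<lambda>t. ln ((norm (z + cis t * w))\<^sup>2 + \<epsilon>)) has_integral 2 * pi * ln (X * A)) {0..2 * pi}"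
    unfolding key by simp
  moreover have "ln A \<le> ln (X * A)" using X1 AB by simp
  then have "2 * pi * ln A \<le> 2 * pi * ln (X * A)" by (intro mult_left_mono) auto
  ultimately show ?thesis by (simp add: integral_unique A_def)
qed

section \<open>Continuity and plurisubharmonicity\<close>

definition profile_a :: "real \<Rightarrow> real" where "profile_a y = 1 / (- ln y)"
definition profile_b :: "real \<Rightarrow> real" where "profile_b y = y * (2 - ln y)"

lemma continuous_on_profile_a: "continuous_on {0..<1} profile_a"
  unfolding continuous_on_eq_continuous_within
proof
  fix x :: real assume x: "x \<in> {0..<1}"
  show "continuous (at x within {0..<1}) profile_a"
  proof (cases "x = 0")
    case False
    then have "isCont profile_a x"
      unfolding profile_a_def using x by (auto intro!: continuous_intros)
    then show ?thesis by (rule continuous_at_imp_continuous_at_within)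
  next
    case True
    have "\<exists>d>0. \<forall>y\<in>{0..<1}. dist y 0 < d \<longrightarrow> dist (profile_a y) (profile_a 0) < e" if e: "e > 0" for e
    proof (intro exI[of _ "exp (- 1 / e)"] conjI ballI impI)
      fix y :: real assume y: "y \<in> {0..<1}" "dist y 0 < exp (- 1 / e)"
      show "dist (profile_a y) (profile_a 0) < e"
      proof (cases "y = 0")
        case False
        then have "0 < y" using y by auto
        then have "ln y < - 1 / e" using y by (metis abs_of_pos dist_real_def diff_zero exp_gt_zero ln_exp ln_less_cancel_iff)
        then have "1 / e < - ln y" by simp
        moreover have "0 < 1 / e" using e by simp
        ultimately have l: "0 < - ln y" "1 / e < - ln y" by linarith+
        then have "1 / (- ln y) < e" using e by (simp add: field_simps)
        then show ?thesis using l(1) by (simp add: profile_a_def dist_real_def)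
      qed (use e in simp)
    qed simp
    then show ?thesis using True by (simp add: continuous_within_eps_delta dist_commute)
  qed
qed

lemma continuous_on_profile_b: "continuous_on {0..<1} profile_b"
proof -
  have "continuous_on {0..<1::real} (\<lambda>y. y * ln y)"
    unfolding continuous_on_eq_continuous_within
  proof
    fix x :: real assume x: "x \<in> {0..<1}"
    show "continuous (at x within {0..<1}) (\<lambda>y. y * ln y)"
    proof (cases "x = 0")
      case False
      then have "isCont (\<lambda>y. y * ln y) x" using x by (auto intro!: continuous_intros)
      then show ?thesis by (rule continuous_at_imp_continuous_at_within)
    next
      case True
      have bound: "\<bar>y * ln y\<bar> \<le> 2 * sqrt y" if y: "0 \<le> y" "y < 1" for y :: real
      proof (cases "y = 0")
        case False
        then have y0: "y > 0" "sqrt y > 0" using y by auto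
        have "- ln y = 2 * ln (1 / sqrt y)" using y0 by (simp add: ln_div ln_sqrt)
        also have "\<dots> \<le> 2 * (1 / sqrt y)" using ln_le_minus_one[of "1 / sqrt y"] y0 by simp
        finally have "y * (- ln y) \<le> y * (2 * (1 / sqrt y))" using y0 by (intro mult_left_mono) auto
        also have "y * (2 * (1 / sqrt y)) = 2 * sqrt y" using y0 by (simp add: field_simps)
        finally show ?thesis using y0 y by (simp add: abs_mult)
      qed simp
      have "((\<lambda>y::real. y * ln y) \<longlongrightarrow> 0) (at 0 within {0..<1})"
      proof (rule Lim_null_comparison)
        have "((\<lambda>y. 2 * sqrt y) \<longlongrightarrow> 2 * sqrt 0) (at 0 within {0..<1})" by (intro tendsto_intros)
        then show "((\<lambda>y. 2 * sqrt y) \<longlongrightarrow> 0) (at 0 within {0..<1})" by simp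
        show "\<forall>\<^sub>F y in at 0 within {0..<1}. norm (y * ln y) \<le> 2 * sqrt y"
          unfolding eventually_at_filter using bound by (intro always_eventually) auto
      qed
      then show ?thesis using True by (simp add: continuous_within)
    qed
  qed
  then have "continuous_on {0..<1::real} (\<lambda>y. 2 * y - y * ln y)"
    by (rule continuous_on_diff[rotated]) (intro continuous_intros)
  then show ?thesis by (simp add: profile_b_def[abs_def] algebra_simps)
qed

context two_coordinates
begin

definition U :: "real \<Rightarrow> real \<Rightarrow> real" where "U x y = 2 * x\<^sup>2 * profile_a y + profile_b y"

lemma u_eq_U: "u x = U (s x) (R x) + q x"
  by (simp add: u_def U_def profile_a_def profile_b_def a_def b_def L_def)

lemma R_range: "x \<in> \<Omega> \<Longrightarrow> R x \<in> {0..<1}"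
  by (simp add: R_def disc_times_space_def power_less_one_iff)

lemma continuous_on_s: "continuous_on S s" and continuous_on_R: "continuous_on S R"
  and continuous_on_q: "continuous_on S q"
  unfolding s_def[abs_def] R_def[abs_def] q_def[abs_def] by (intro continuous_intros)+

lemma continuous_on_u: "continuous_on \<Omega> u"
proof -
  have "continuous_on \<Omega> (\<lambda>x. profile_a (R x))" "continuous_on \<Omega> (\<lambda>x. profile_b (R x))"
    by (rule continuous_on_compose2[OF continuous_on_profile_a continuous_on_R]
        continuous_on_compose2[OF continuous_on_profile_b continuous_on_R]; use R_range in auto)+
  then show ?thesis
    unfolding u_eq_U U_def by (intro continuous_intros continuous_on_s continuous_on_q)
qed

lemma usc_lsc_u: "usc_on \<Omega> u" "lsc_on \<Omega> u"
proof -
  have "{x \<in> \<Omega>. u x < y} = \<Omega> \<inter> u -` {..<y}" "{x \<in> \<Omega>. u x > y} = \<Omega> \<inter> u -` {y<..}" for y by auto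
  then show "usc_on \<Omega> u" "lsc_on \<Omega> u"
    using continuous_openin_preimage[OF continuous_on_u, of UNIV "{..<y}" for y]
      continuous_openin_preimage_gen[OF continuous_on_u]
    by (auto simp: usc_on_def lsc_on_def)
qed

lemma U_nonneg: "y \<in> {0..<1} \<Longrightarrow> 0 \<le> U x y"
proof (cases "y = 0")
  case False
  assume "y \<in> {0..<1}"
  with False have "ln y < 0" "0 < y" by auto
  then have "ln y \<le> 2" by linarith
  with \<open>ln y < 0\<close> \<open>0 < y\<close> have "0 \<le> profile_a y" "0 \<le> profile_b y" 
    by (auto simp: profile_a_def profile_b_def divide_le_0_iff intro!: mult_nonneg_nonneg)
  then show ?thesis by (simp add: U_def)
qed (simp add: U_def profile_a_def profile_b_def)

text \<open>As a function of \<open>x\<close> and \<open>ln y\<close> the function \<open>U\<close> is convex, and nondecreasing in \<open>ln y\<close>.\<close>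

lemma U_tangent:
  assumes y0: "0 < y0" "y0 < 1"
  shows "\<exists>\<alpha> \<kappa>. 0 \<le> \<kappa> \<and> (\<forall>x y. 0 < y \<and> y < 1 \<longrightarrow> U x0 y0 + \<alpha> * (x - x0) + \<kappa> * (ln y - ln y0) \<le> U x y)"
proof -
  define l0 where "l0 = - ln y0"
  have l0: "l0 > 0" using y0 by (simp add: l0_def)
  \<comment> \<open>For positive \<open>l\<close>, \<open>2 * x\<^sup>2 / l\<close> is the maximum
    over \<open>c\<close> of the linear functions \<open>4 * c * x - 2 * c\<^sup>2 * l\<close>,
    attained at \<open>c = x / l\<close>; this is the tangent at \<open>(x0, l0)\<close>.\<close>
  define c where "c = x0 / l0"
  \<comment> \<open>The second summand is the derivative of \<open>exp t * (2 - t)\<close>, which is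
    \<open>profile_b\<close> as a function of \<open>t = ln y\<close>, at
    \<open>t = ln y0\<close>.\<close>
  define \<kappa> where "\<kappa> = 2 * c\<^sup>2 + y0 * (1 + l0)"
  have "U x0 y0 + (4 * c) * (x - x0) + \<kappa> * (ln y - ln y0) \<le> U x y" if y: "0 < y" "y < 1" for x y
  proof -
    define l where "l = - ln y"
    have l: "l > 0" using y by (simp add: l_def)
    have "0 \<le> 2 * (x - c * l)\<^sup>2 / l" using l by simp
    also have "\<dots> = 2 * x\<^sup>2 / l - (4 * c * x - 2 * c\<^sup>2 * l)"
      using l by (simp add: field_simps power2_eq_square)
    finally have 1: "4 * c * x - 2 * c\<^sup>2 * l \<le> 2 * x\<^sup>2 / l" by simp
    have 2: "2 * x0\<^sup>2 / l0 = 4 * c * x0 - 2 * c\<^sup>2 * l0"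
      using l0 by (simp add: c_def field_simps power2_eq_square)
    have cv: "convex_on {..<0::real} (\<lambda>t. exp t * (2 - t))"
    proof (rule f''_ge0_imp_convex)
      show "((\<lambda>t. exp t * (2 - t)) has_real_derivative exp t * (1 - t)) (at t)" for t :: real
        by (auto intro!: derivative_eq_intros simp: algebra_simps)
      show "((\<lambda>t. exp t * (1 - t)) has_real_derivative - t * exp t) (at t)" for t :: real
        by (auto intro!: derivative_eq_intros simp: algebra_simps)
    qed (auto simp: mult_nonpos_nonneg)
    have "(exp (- l0) * (1 + l0)) * (- l - - l0) \<le> exp (- l) * (2 - - l) - exp (- l0) * (2 - - l0)"
      by (rule convex_on_imp_above_tangent[OF cv])
        (use l l0 in \<open>auto simp: interior_open intro!: derivative_eq_intros simp: algebra_simps\<close>)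
    moreover have "exp (- l) = y" "exp (- l0) = y0" using y y0 by (simp_all add: l_def l0_def)
    ultimately have 3: "(y0 * (1 + l0)) * (l0 - l) \<le> y * (2 + l) - y0 * (2 + l0)" by simp
    have Uxy: "U x y = 2 * x\<^sup>2 / l + y * (2 + l)" "U x0 y0 = 2 * x0\<^sup>2 / l0 + y0 * (2 + l0)"
      by (simp_all add: U_def profile_a_def profile_b_def l_def l0_def)
    have ln: "ln y - ln y0 = l0 - l" by (simp add: l_def l0_def)
    show ?thesis
      using 1 3 unfolding Uxy 2 ln \<kappa>_def by (simp add: algebra_simps)
  qed
  moreover have "0 \<le> \<kappa>" using y0 l0 by (simp add: \<kappa>_def)
  ultimately show ?thesis by blast
qed

text \<open>The tangent of \<open>U\<close> is integrated over the circle: its linear term in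
  \<open>x\<close> has mean zero, and the term in \<open>ln y\<close> has a nonnegative mean because
  \<open>ln\<close> of a squared modulus is submean and \<open>\<kappa> \<ge> 0\<close>. The circle
  may pass through 0, where the logarithm is infinite, so \<open>y\<close> is first shifted by
  \<open>\<epsilon>\<close>, and then \<open>\<epsilon>\<close> tends to 0 by continuity. For
  \<open>z = 0\<close> there is no tangent, but \<open>U\<close> vanishes there and is nonnegative
  elsewhere.\<close>

lemma U_submean:
  fixes z w z' w' :: complex
  assumes disc: "\<And>t. norm (z + cis t * w) < 1" "norm z < 1"
  shows "2 * pi * U (Re z') ((norm z)\<^sup>2)
    \<le> integral {0..2 * pi} (\<lambda>t. U (Re (z' + cis t * w')) ((norm (z + cis t * w))\<^sup>2))"
proof -
  let ?S = "\<lambda>t. Re (z' + cis t * w')" and ?N = "\<lambda>t. (norm (z + cis t * w))\<^sup>2"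
  have cis: "continuous_on S cis" for S by (rule continuous_on_cis) (rule continuous_on_id)
  have contN: "continuous_on {0..2 * pi} ?N" and contS: "continuous_on {0..2 * pi} ?S"
    by (intro continuous_intros cis)+
  have N1: "?N t < 1" for t using disc(1)[of t] by (simp add: power_less_one_iff)
  obtain M where M: "M < 1" "\<And>t. t \<in> {0..2 * pi} \<Longrightarrow> ?N t \<le> M" 
  proof -
    obtain t0 where t0: "t0 \<in> {0..2 * pi}" "\<And>t. t \<in> {0..2 * pi} \<Longrightarrow> ?N t \<le> ?N t0"
      using continuous_attains_sup[OF compact_Icc _ contN] by auto
    then show ?thesis using that[of "?N t0"] N1 by blast
  qed
  define \<epsilon>0 where "\<epsilon>0 = (1 - M) / 2"
  have \<epsilon>0: "\<epsilon>0 > 0" "M + \<epsilon>0 < 1" using M(1) by (simp_all add: \<epsilon>0_def field_simps)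
  have contU: "continuous_on ({0..\<epsilon>0} \<times> cbox 0 (2 * pi)) (\<lambda>(\<epsilon>, t). U (?S t) (?N t + \<epsilon>))"
  proof -
    have arg: "continuous_on ({0..\<epsilon>0} \<times> {0..2 * pi}) (\<lambda>x. ?N (snd x) + fst x)"
      by (intro continuous_intros continuous_on_compose2[OF contN]) auto
    have ran: "(\<lambda>x. ?N (snd x) + fst x) ` ({0..\<epsilon>0} \<times> {0..2 * pi}) \<subseteq> {0..<1}"
    proof clarsimp
      fix \<epsilon> t :: real assume "0 \<le> \<epsilon>" "\<epsilon> \<le> \<epsilon>0" "0 \<le> t" "t \<le> 2 * pi"
      then show "(norm (z + cis t * w))\<^sup>2 + \<epsilon> < 1" using M(2)[of t] \<epsilon>0 by simp
    qed
    have "continuous_on ({0..\<epsilon>0} \<times> {0..2 * pi}) (\<lambda>x. U (?S (snd x)) (?N (snd x) + fst x))"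
      unfolding U_def
      by (intro continuous_intros continuous_on_compose2[OF continuous_on_profile_a arg ran]
          continuous_on_compose2[OF continuous_on_profile_b arg ran] continuous_on_compose2[OF contS]) auto
    then show ?thesis by (simp add: case_prod_beta)
  qed
  define F where "F \<epsilon> = integral {0..2 * pi} (\<lambda>t. U (?S t) (?N t + \<epsilon>))" for \<epsilon>
  have contF: "continuous_on {0..\<epsilon>0} F"
    using integral_continuous_on_param[OF contU] by (simp add: F_def[abs_def])
  have intU: "(\<lambda>t. U (?S t) (?N t + \<epsilon>)) integrable_on {0..2 * pi}" if "\<epsilon> \<in> {0..\<epsilon>0}" for \<epsilon>
  proof (rule integrable_continuous_real)
    have "continuous_on {0..2 * pi} (\<lambda>t. (\<lambda>(\<epsilon>, t). U (?S t) (?N t + \<epsilon>)) (\<epsilon>, t))"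
      by (rule continuous_on_compose2[OF contU]) (use that in \<open>auto intro!: continuous_intros\<close>)
    then show "continuous_on {0..2 * pi} (\<lambda>t. U (?S t) (?N t + \<epsilon>))" by simp
  qed
  show ?thesis
  proof (cases "z = 0")
    case True
    have "0 \<le> F 0"
      unfolding F_def using N1 by (intro integral_nonneg intU) (use \<epsilon>0 in \<open>auto intro!: U_nonneg\<close>)
    then show ?thesis using True by (simp add: F_def U_def profile_a_def profile_b_def)
  next
    case False
    let ?y0 = "(norm z)\<^sup>2"
    have y0: "0 < ?y0" "?y0 < 1" using False disc(2) by (simp_all add: power_less_one_iff)
    obtain \<alpha> \<kappa> where tan: "0 \<le> \<kappa>"
      "\<And>x y. 0 < y \<Longrightarrow> y < 1 \<Longrightarrow> U (Re z') ?y0 + \<alpha> * (x - Re z') + \<kappa> * (ln y - ln ?y0) \<le> U x y"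
      using U_tangent[OF y0, of "Re z'"] by blast
    have low: "2 * pi * U (Re z') ?y0 \<le> F \<epsilon>" if \<epsilon>: "\<epsilon> \<in> {0<..\<epsilon>0}" for \<epsilon>
    proof -
      have range: "0 < ?N t + \<epsilon>" "t \<in> {0..2 * pi} \<Longrightarrow> ?N t + \<epsilon> < 1" for t
        using \<epsilon> M(2)[of t] \<epsilon>0 by (auto intro: add_nonneg_pos)
      define I where "I = integral {0..2 * pi} (\<lambda>t. ln (?N t + \<epsilon>))"
      have "continuous_on {0..2 * pi} (\<lambda>t. ln (?N t + \<epsilon>))"
        using range(1) by (intro continuous_intros cis) (auto simp: less_imp_neq[THEN not_sym])
      then have I: "((\<lambda>t. ln (?N t + \<epsilon>)) has_integral I) {0..2 * pi}"
        unfolding I_def by (intro integrable_integral integrable_continuous_real)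
      have c: "((\<lambda>t. C) has_integral 2 * pi * C) {0..2 * pi}" for C :: real
        using has_integral_const_real[of C 0 "2 * pi"] by simp
      have "((\<lambda>t. U (Re z') ?y0 + \<alpha> * Re (w' * cis t) + \<kappa> * (ln (?N t + \<epsilon>) - ln ?y0)) has_integral
          2 * pi * U (Re z') ?y0 + \<alpha> * 0 + \<kappa> * (I - 2 * pi * ln ?y0)) {0..2 * pi}"
        by (intro has_integral_add has_integral_mult_right has_integral_diff c I has_integral_circle_linear)
      moreover have "((\<lambda>t. U (?S t) (?N t + \<epsilon>)) has_integral F \<epsilon>) {0..2 * pi}"
        unfolding F_def using \<epsilon> by (intro integrable_integral intU) auto
      ultimately have "2 * pi * U (Re z') ?y0 + \<alpha> * 0 + \<kappa> * (I - 2 * pi * ln ?y0) \<le> F \<epsilon>"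
      proof (rule has_integral_le)
        fix t assume t: "t \<in> {0..2 * pi}"
        show "U (Re z') ?y0 + \<alpha> * Re (w' * cis t) + \<kappa> * (ln (?N t + \<epsilon>) - ln ?y0) \<le> U (?S t) (?N t + \<epsilon>)"
          using tan(2)[OF range(1) range(2)[OF t], of "?S t"] by (simp add: mult.commute)
      qed
      moreover have "0 \<le> \<kappa> * (I - 2 * pi * ln ?y0)"
        using tan(1) ln_circle_mean_ge[OF False, of \<epsilon> w] \<epsilon> by (simp add: I_def)
      ultimately show ?thesis by simp
    qed
    have "(F \<longlongrightarrow> F 0) (at 0 within {0..\<epsilon>0})"
      using contF \<epsilon>0 by (auto simp: continuous_on)
    then have "2 * pi * U (Re z') ?y0 \<le> F 0"
    proof (rule tendsto_lowerbound)
      show "\<forall>\<^sub>F \<epsilon> in at 0 within {0..\<epsilon>0}. 2 * pi * U (Re z') ?y0 \<le> F \<epsilon>"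
        unfolding eventually_at_filter using low by (intro always_eventually) auto
      show "at 0 within {0..\<epsilon>0} \<noteq> bot"
        using \<epsilon>0 by (simp add: at_within_Icc_at_right trivial_limit_at_right_real)
    qed
    then show ?thesis by (simp add: F_def)
  qed
qed

lemma u_locally_bounded_psh: "locally_bounded_psh \<Omega> u"
  unfolding locally_bounded_psh_def
proof (intro conjI allI impI)
  show "bounded (u ` K)" if "compact K \<and> K \<subseteq> \<Omega>" for K
    using that continuous_on_u by (meson compact_continuous_image compact_imp_bounded continuous_on_subset)
  show "usc_on \<Omega> u" by (rule usc_lsc_u)
  fix x w :: "complex^'n"
  assume disc: "\<forall>\<zeta>. cmod \<zeta> \<le> 1 \<longrightarrow> x + \<zeta> *s w \<in> \<Omega>"
  have in\<Omega>: "x + cis t *s w \<in> \<Omega>" for t using disc by simp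
  have "x \<in> \<Omega>" using disc[rule_format, of 0] by simp
  have cont: "continuous_on {0..2 * pi} (\<lambda>t. x + cis t *s w)"
    unfolding vector_scalar_mult_def by (intro continuous_intros continuous_on_cis)
  then have contu: "continuous_on {0..2 * pi} (\<lambda>t. u (x + cis t *s w))"
    by (rule continuous_on_compose2[OF continuous_on_u]) (use in\<Omega> in auto)
  have "(LINT t:{0..2 * pi}|lborel. u (x + cis t *s w)) = integral {0..2 * pi} (\<lambda>t. u (x + cis t *s w))"
    by (intro set_borel_integral_eq_integral borel_integrable_atLeastAtMost' contu)
  also have "\<dots> \<ge> 2 * pi * u x"
  proof -
    let ?U = "\<lambda>t. U (Re (x $ m + cis t * w $ m)) ((norm (x $ k + cis t * w $ k))\<^sup>2)"
    have eq: "u (x + cis t *s w) = ?U t + q (x + cis t *s w)" for t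
      unfolding u_eq_U by (simp add: s_def R_def)
    have "((\<lambda>t. q (x + cis t *s w)) has_integral (\<Sum>i\<in>- {k, m}. 2 * pi * ((norm (x $ i))\<^sup>2 + (norm (w $ i))\<^sup>2))) {0..2 * pi}"
      unfolding q_def using has_integral_circle_norm_sq by (intro has_integral_sum) auto
    then have q: "((\<lambda>t. q (x + cis t *s w)) has_integral 2 * pi * (q x + q w)) {0..2 * pi}"
      by (simp add: q_def sum_distrib_left sum.distrib distrib_left)
    have "0 \<le> q w" by (simp add: q_def sum_nonneg)
    have iu: "(\<lambda>t. u (x + cis t *s w)) integrable_on {0..2 * pi}"
      by (intro integrable_continuous_real contu)
    have "?U t = u (x + cis t *s w) - q (x + cis t *s w)" for t unfolding eq by simp
    then have iU: "integral {0..2 * pi} ?U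
        = integral {0..2 * pi} (\<lambda>t. u (x + cis t *s w)) - 2 * pi * (q x + q w)"
      using Henstock_Kurzweil_Integration.integral_diff[OF iu has_integral_integrable[OF q]] integral_unique[OF q] by simp
    have "2 * pi * U (Re (x $ m)) ((norm (x $ k))\<^sup>2) \<le> integral {0..2 * pi} ?U"
      by (rule U_submean) (use in\<Omega> \<open>x \<in> \<Omega>\<close> in \<open>auto simp: disc_times_space_def\<close>)
    then have "2 * pi * U (s x) (R x) + 2 * pi * (q x + q w) \<le> integral {0..2 * pi} (\<lambda>t. u (x + cis t *s w))"
      unfolding iU s_def R_def by simp
    moreover have "2 * pi * u x \<le> 2 * pi * U (s x) (R x) + 2 * pi * (q x + q w)"
      using \<open>0 \<le> q w\<close> by (simp add: u_eq_U distrib_left)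
    ultimately show ?thesis by linarith
  qed
  finally show "u x \<le> (LINT t:{0..2 * pi}|lborel. u (x + cis t *s w)) / (2 * pi)"
    by (simp add: pos_le_divide_eq mult.commute)
qed

end

section \<open>Determinants of Hermitian matrices\<close>

text \<open>The real inner product of \<open>complex^'n\<close> is the real part of the Hermitian one, and it suffices here.\<close>

definition adjoint_matrix :: "complex^'n^'n \<Rightarrow> complex^'n^'n" where
  "adjoint_matrix A = (\<chi> i j. cnj (A $ j $ i))"

lemma inner_matrix_vector:
  "v \<bullet> (A *v w) = Re (\<Sum>i\<in>UNIV. \<Sum>j\<in>UNIV. cnj (v $ i) * A $ i $ j * (w :: complex^'n) $ j)"
proof -
  have "v \<bullet> (A *v w) = (\<Sum>i\<in>UNIV. Re (cnj (v $ i) * (\<Sum>j\<in>UNIV. A $ i $ j * w $ j)))"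
    by (simp add: inner_vec_def matrix_vector_mult_def inner_complex_def)
  also have "\<dots> = Re (\<Sum>i\<in>UNIV. \<Sum>j\<in>UNIV. cnj (v $ i) * A $ i $ j * w $ j)"
    by (simp only: sum_distrib_left Re_sum mult.assoc)
  finally show ?thesis .
qed

lemma hermitian_psd_iff:
  "hermitian_psd A \<longleftrightarrow> adjoint_matrix A = A \<and> (\<forall>v. 0 \<le> v \<bullet> (A *v v))"
proof -
  have "(\<forall>i j. A $ i $ j = cnj (A $ j $ i)) \<longleftrightarrow> adjoint_matrix A = A"
    unfolding adjoint_matrix_def vec_eq_iff vec_lambda_beta by metis
  then show ?thesis unfolding hermitian_psd_def inner_matrix_vector by blast
qed

lemma adjoint_matrix_inner: "v \<bullet> (A *v w) = (adjoint_matrix A *v v) \<bullet> w"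
proof -
  have "(adjoint_matrix A *v v) \<bullet> w = w \<bullet> (adjoint_matrix A *v v)" by (rule inner_commute)
  also have "\<dots> = Re (\<Sum>i\<in>UNIV. \<Sum>j\<in>UNIV. cnj (w $ i) * cnj (A $ j $ i) * v $ j)"
    unfolding inner_matrix_vector by (simp add: adjoint_matrix_def)
  also have "\<dots> = Re (\<Sum>j\<in>UNIV. \<Sum>i\<in>UNIV. cnj (w $ i) * cnj (A $ j $ i) * v $ j)"
    by (subst sum.swap) (rule refl)
  also have "\<dots> = Re (cnj (\<Sum>j\<in>UNIV. \<Sum>i\<in>UNIV. cnj (v $ j) * A $ j $ i * w $ i))"
    unfolding cnj_sum complex_cnj_mult complex_cnj_cnj by (simp only: mult_ac)
  also have "\<dots> = v \<bullet> (A *v w)" unfolding inner_matrix_vector by (simp only: cnj.simps)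
  finally show ?thesis by simp
qed

lemma det_adjoint: "det (adjoint_matrix A) = cnj (det A)"
proof -
  have "det (adjoint_matrix A) = det (transpose (adjoint_matrix A))" by (simp add: det_transpose)
  also have "\<dots> = cnj (det A)"
    by (simp add: det_def adjoint_matrix_def transpose_def)
  finally show ?thesis .
qed

lemma norm_det_le:
  fixes A :: "complex^'n^'n"
  assumes "\<And>i j. norm (A $ i $ j) \<le> 1"
  shows "norm (det A) \<le> fact CARD('n)"
proof -
  have "norm (det A) \<le> (\<Sum>p\<in>{p. p permutes (UNIV :: 'n set)}. 1)"
    unfolding det_def
  proof (rule sum_norm_le)
    fix p :: "'n \<Rightarrow> 'n"
    have "norm (\<Prod>i\<in>UNIV. A $ i $ p i) \<le> (\<Prod>i\<in>(UNIV::'n set). 1)"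
      unfolding prod_norm[symmetric] using assms by (intro prod_mono) auto
    moreover have "norm (of_int (sign p) :: complex) = 1"
      by (simp add: sign_def)
    ultimately show "norm (of_int (sign p) * (\<Prod>i\<in>UNIV. A $ i $ p i)) \<le> 1"
      by (simp add: norm_mult)
  qed
  also have "\<dots> = fact CARD('n)"
    by (simp add: card_permutations[OF refl])
  finally show ?thesis .
qed

text \<open>All powers of a contraction have bounded entries, hence bounded determinants.\<close>

lemma norm_det_contraction:
  fixes M :: "complex^'n^'n"
  assumes M: "\<And>v. norm (M *v v) \<le> norm v"
  shows "norm (det M) \<le> 1"
proof (rule ccontr)
  assume "\<not> ?thesis"
  then obtain j where j: "fact CARD('n) < norm (det M) ^ j"
    using real_arch_pow[of "norm (det M)" "fact CARD('n)"] by auto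
  define P where "P j = ((\<lambda>A. M ** A) ^^ j) (mat 1)" for j
  have P: "norm (P j *v v) \<le> norm v" for j v
  proof (induction j)
    case (Suc j)
    have "P (Suc j) *v v = M *v (P j *v v)" by (simp add: P_def matrix_vector_mul_assoc)
    then show ?case using M[of "P j *v v"] Suc by simp
  qed (simp add: P_def)
  have det: "det (P j) = det M ^ j" for j
    by (induction j) (simp_all add: P_def det_mul)
  have "norm (P j $ a $ b) \<le> 1" for a b
  proof -
    have "P j $ a $ b = (P j *v axis b 1) $ a"
      by (simp add: matrix_vector_mult_def axis_def if_distrib[of "\<lambda>x. _ * x"] cong: if_cong)
    then have "norm (P j $ a $ b) \<le> norm (P j *v axis b 1)"
      using Finite_Cartesian_Product.norm_nth_le by metis
    also have "\<dots> \<le> norm (axis b 1 :: complex^'n)" by (rule P)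
    also have "\<dots> = 1" by (simp add: norm_eq_sqrt_inner inner_axis)
    finally show ?thesis .
  qed
  then have "norm (det (P j)) \<le> fact CARD('n)" by (rule norm_det_le)
  with j show False by (simp add: det norm_power)
qed

text \<open>The inverse matrix is a contraction.\<close>

lemma norm_det_expansion:
  fixes A :: "complex^'n^'n"
  assumes A: "\<And>v. norm v \<le> norm (A *v v)"
  shows "1 \<le> norm (det A)"
proof -
  have "v = w" if "A *v v = A *v w" for v w
    using A[of "v - w"] that by (simp add: matrix_vector_mult_diff_distrib)
  then have "inj ((*v) A)" by (auto simp: inj_def)
  then obtain B where B: "B ** A = mat 1" using matrix_left_invertible_injective by blast
  then have B': "A ** B = mat 1" by (simp add: matrix_left_right_inverse)
  have "norm (B *v w) \<le> norm w" for w
    using A[of "B *v w"] by (simp add: matrix_vector_mul_assoc B')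
  then have "norm (det B) \<le> 1" by (rule norm_det_contraction)
  moreover have "norm (det B) * norm (det A) = 1"
    using arg_cong[OF B, of det] by (simp add: det_mul flip: norm_mult)
  ultimately show ?thesis
    by (metis mult_left_le_one_le norm_ge_zero)
qed

lemma psd_Cauchy_Schwarz:
  assumes A: "adjoint_matrix A = A" "\<And>v. 0 \<le> v \<bullet> (A *v v)"
  shows "(x \<bullet> (A *v y))\<^sup>2 \<le> (x \<bullet> (A *v x)) * (y \<bullet> (A *v y))"
proof -
  define X Y Z where "X = x \<bullet> (A *v x)" and "Y = y \<bullet> (A *v y)" and "Z = x \<bullet> (A *v y)"
  have sym: "y \<bullet> (A *v x) = Z" unfolding Z_def using adjoint_matrix_inner[of y A x] A by (simp add: inner_commute)
  have lin: "A *v (t *\<^sub>R v) = t *\<^sub>R (A *v v)" for t v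
    by (simp add: matrix_vector_mult_def vec_eq_iff scaleR_sum_right)
  have *: "0 \<le> X + 2 * t * Z + t\<^sup>2 * Y" for t
  proof -
    have "(x + t *\<^sub>R y) \<bullet> (A *v (x + t *\<^sub>R y)) = X + 2 * t * Z + t\<^sup>2 * Y"
      using sym unfolding X_def Y_def Z_def
      by (simp add: matrix_vector_right_distrib lin inner_add_left inner_add_right power2_eq_square algebra_simps)
    then show ?thesis using A(2)[of "x + t *\<^sub>R y"] by simp
  qed
  have XY: "X \<ge> 0" "Y \<ge> 0" using A(2) by (simp_all add: X_def Y_def)
  show ?thesis unfolding X_def[symmetric] Y_def[symmetric] Z_def[symmetric]
  proof (cases "Y = 0")
    case True
    have "Z = 0"
    proof (rule ccontr)
      assume Z: "Z \<noteq> 0"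
      \<comment> \<open>With \<open>Y = 0\<close> the form is affine in \<open>t\<close>, and this
        is the value of \<open>t\<close> at which it would equal -1.\<close>
      have "X + 2 * (- (X + 1) / (2 * Z)) * Z = - 1" using Z by (simp add: field_simps)
      then show False using *[of "- (X + 1) / (2 * Z)"] True by simp
    qed
    then show "Z\<^sup>2 \<le> X * Y" using True by simp
  next
    case False
    then have Y: "Y > 0" using XY by simp
    have "X + 2 * (- Z / Y) * Z + (- Z / Y)\<^sup>2 * Y = X - Z\<^sup>2 / Y"
      using Y by (simp add: field_simps power2_eq_square)
    then have "0 \<le> X - Z\<^sup>2 / Y" using *[of "- Z / Y"] by simp
    then show "Z\<^sup>2 \<le> X * Y" using Y by (simp add: pos_divide_le_eq)
  qed
qed

text \<open>The expansion property yields only a modulus of at least 1. The sign is found along the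
  segment from the identity to \<open>A\<close>, on which the determinant is real, starts at 1 and
  never enters the interval between -1 and 1.\<close>

lemma det_ge_1_of_ge_identity:
  fixes A :: "complex^'n^'n"
  assumes h: "adjoint_matrix A = A" and A: "\<And>v. (norm v)\<^sup>2 \<le> v \<bullet> (A *v v)"
  shows "1 \<le> Re (det A)"
proof (rule ccontr)
  assume neg: "\<not> ?thesis"
  define B where "B t = (\<chi> i j. of_real (1 - t) * mat 1 $ i $ j + of_real t * A $ i $ j)" for t :: real
  have Bv: "B t *v v = (1 - t) *\<^sub>R v + t *\<^sub>R (A *v v)" for t v
  proof -
    have "(B t *v v) $ i = of_real (1 - t) * (mat 1 *v v) $ i + of_real t * (A *v v) $ i" for i
      by (simp only: B_def matrix_vector_mult_def vec_lambda_beta sum.distrib sum_distrib_left distrib_right mult.assoc)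
    then show ?thesis
      by (simp add: vec_eq_iff scaleR_conv_of_real[where 'a=complex])
  qed
  have abs1: "1 \<le> norm (det (B t))" if t: "0 \<le> t" "t \<le> 1" for t
  proof (rule norm_det_expansion)
    fix v :: "complex^'n"
    have "t * (norm v)\<^sup>2 \<le> t * (v \<bullet> (A *v v))" using A t by (intro mult_left_mono)
    then have "(norm v)\<^sup>2 \<le> v \<bullet> (B t *v v)"
      by (simp add: Bv inner_add_right power2_norm_eq_inner algebra_simps)
    also have "\<dots> \<le> norm v * norm (B t *v v)" by (rule norm_cauchy_schwarz)
    finally have "norm v * norm v \<le> norm v * norm (B t *v v)" by (simp add: power2_eq_square)
    then show "norm v \<le> norm (B t *v v)"
      by (cases "v = 0") auto
  qed
  have real: "Im (det (B t)) = 0" for t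
  proof -
    have "adjoint_matrix (B t) = B t"
    proof -
      have "cnj (A $ j $ i) = A $ i $ j" for i j
      proof -
        have "cnj (A $ j $ i) = adjoint_matrix A $ i $ j" by (simp add: adjoint_matrix_def)
        then show ?thesis by (simp only: h)
      qed
      then show ?thesis by (simp add: adjoint_matrix_def B_def vec_eq_iff mat_def)
    qed
    then have "cnj (det (B t)) = det (B t)" using det_adjoint[of "B t"] by simp
    then have "Im (cnj (det (B t))) = Im (det (B t))" by (rule arg_cong)
    then show ?thesis by simp
  qed
  have cont: "continuous_on {0..1} (\<lambda>t. Re (det (B t)))"
    unfolding det_def B_def by (simp, intro continuous_intros)
  have B1: "B 1 = A" "B 0 = mat 1" by (simp_all add: B_def vec_eq_iff)
  \<comment> \<open>The target value is nonnegative, less than 1, and lies between the determinants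
    at the two ends.\<close>
  have "\<exists>t. 0 \<le> t \<and> t \<le> 1 \<and> Re (det (B t)) = max 0 (Re (det A))"
    using neg by (intro IVT2' cont) (auto simp: B1)
  then obtain t where t: "0 \<le> t" "t \<le> 1" "Re (det (B t)) = max 0 (Re (det A))" by blast
  have "norm (det (B t)) = \<bar>Re (det (B t))\<bar>" using real[of t] by (simp add: cmod_def)
  then show False using abs1[OF t(1,2)] t(3) neg by (simp add: max_def split: if_splits)
qed

text \<open>Cauchy-Schwarz for the form of \<open>A\<close>, applied to the vectors
  \<open>A *v v\<close> and \<open>v\<close>, shows that \<open>A\<close> is a contraction.\<close>

lemma det_le_1_of_le_identity:
  fixes A :: "complex^'n^'n"
  assumes h: "adjoint_matrix A = A" and psd: "\<And>v. 0 \<le> v \<bullet> (A *v v)"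
    and A: "\<And>v. v \<bullet> (A *v v) \<le> (norm v)\<^sup>2"
  shows "Re (det A) \<le> 1"
proof -
  have "norm (A *v v) \<le> norm v" for v
  proof (cases "A *v v = 0")
    case False
    let ?x = "A *v v"
    have "((norm ?x)\<^sup>2)\<^sup>2 = (?x \<bullet> ?x)\<^sup>2" by (simp add: power2_norm_eq_inner)
    also have "\<dots> \<le> (?x \<bullet> (A *v ?x)) * (v \<bullet> (A *v v))"
      by (rule psd_Cauchy_Schwarz[OF h psd])
    also have "\<dots> \<le> (norm ?x)\<^sup>2 * (norm v)\<^sup>2" by (intro mult_mono A psd) auto
    finally have "(norm ?x)\<^sup>2 * (norm ?x)\<^sup>2 \<le> (norm ?x)\<^sup>2 * (norm v)\<^sup>2"
      by (simp only: power2_eq_square[of "(norm ?x)\<^sup>2"])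
    then have "(norm ?x)\<^sup>2 \<le> (norm v)\<^sup>2" by (rule mult_left_le_imp_le) (use False in simp)
    then show ?thesis by (rule power2_le_imp_le) simp
  qed simp
  then have "norm (det A) \<le> 1" by (rule norm_det_contraction)
  then show ?thesis using complex_Re_le_cmod[of "det A"] by simp
qed

text \<open>Conjugating by the inverse \<open>T\<close> of \<open>S\<close> turns a comparison of
  the form of \<open>A\<close> with \<open>(norm (S *v v))\<^sup>2\<close> into one with the
  identity and keeps the determinant.\<close>

lemma congruence_by_unimodular:
  fixes A S :: "complex^'n^'n"
  assumes h: "adjoint_matrix A = A" and S: "det S = 1"
  obtains A' where "adjoint_matrix A' = A'" "det A' = det A"
    "\<And>v. \<exists>w. S *v w = v \<and> v \<bullet> (A' *v v) = w \<bullet> (A *v w)"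
proof -
  obtain T where T: "S ** T = mat 1"
    using invertible_det_nz[of S] S by (auto simp: invertible_def)
  have dT: "det T = 1" using arg_cong[OF T, of det] S by (simp add: det_mul)
  define A' where "A' = adjoint_matrix T ** (A ** T)"
  have adj_mult: "adjoint_matrix (X ** Y) = adjoint_matrix Y ** adjoint_matrix X" for X Y :: "complex^'n^'n"
    by (simp add: adjoint_matrix_def matrix_matrix_mult_def vec_eq_iff mult.commute)
  have adj_adj: "adjoint_matrix (adjoint_matrix X) = X" for X :: "complex^'n^'n"
    by (simp add: adjoint_matrix_def vec_eq_iff)
  show ?thesis
  proof (rule that[of A'])
    show "adjoint_matrix A' = A'"
      by (simp add: A'_def adj_mult adj_adj h matrix_mul_assoc)
    show "det A' = det A" by (simp add: A'_def det_mul det_adjoint dT)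
    fix v :: "complex^'n"
    have "v \<bullet> (A' *v v) = v \<bullet> (adjoint_matrix T *v (A *v (T *v v)))"
      by (simp add: A'_def matrix_vector_mul_assoc matrix_mul_assoc)
    also have "\<dots> = (T *v v) \<bullet> (A *v (T *v v))"
      by (subst adjoint_matrix_inner) (simp add: adj_adj)
    finally show "\<exists>w. S *v w = v \<and> v \<bullet> (A' *v v) = w \<bullet> (A *v w)"
      by (intro exI[of _ "T *v v"]) (simp add: matrix_vector_mul_assoc T)
  qed
qed

lemma det_ge_1:
  fixes A S :: "complex^'n^'n"
  assumes "adjoint_matrix A = A" "det S = 1" "\<And>v. (norm (S *v v))\<^sup>2 \<le> v \<bullet> (A *v v)"
  shows "1 \<le> Re (det A)"
proof -
  obtain A' where A': "adjoint_matrix A' = A'" "det A' = det A"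
    "\<And>v. \<exists>w. S *v w = v \<and> v \<bullet> (A' *v v) = w \<bullet> (A *v w)"
    using congruence_by_unimodular[OF assms(1,2)] by blast
  have "(norm v)\<^sup>2 \<le> v \<bullet> (A' *v v)" for v
    using A'(3)[of v] assms(3) by metis
  from det_ge_1_of_ge_identity[OF A'(1) this] show ?thesis by (simp add: A'(2))
qed

lemma det_le_1:
  fixes A S :: "complex^'n^'n"
  assumes "adjoint_matrix A = A" "\<And>v. 0 \<le> v \<bullet> (A *v v)" "det S = 1" "\<And>v. v \<bullet> (A *v v) \<le> (norm (S *v v))\<^sup>2"
  shows "Re (det A) \<le> 1"
proof -
  obtain A' where A': "adjoint_matrix A' = A'" "det A' = det A"
    "\<And>v. \<exists>w. S *v w = v \<and> v \<bullet> (A' *v v) = w \<bullet> (A *v w)"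
    using congruence_by_unimodular[OF assms(1,3)] by blast
  have "v \<bullet> (A' *v v) \<le> (norm v)\<^sup>2" "0 \<le> v \<bullet> (A' *v v)" for v
    using A'(3)[of v] assms(2,4) by metis+
  from det_le_1_of_le_identity[OF A'(1) this(2,1)] show ?thesis by (simp add: A'(2))
qed

text \<open>For a semidefinite form a null vector lies in the kernel, by Cauchy-Schwarz with
  \<open>A *v v\<close> as the other vector.\<close>

lemma det_eq_0_of_null_vector:
  fixes A :: "complex^'n^'n"
  assumes h: "adjoint_matrix A = A" and psd: "\<And>v. 0 \<le> v \<bullet> (A *v v)"
    and v: "v \<noteq> 0" "v \<bullet> (A *v v) \<le> 0"
  shows "det A = 0"
proof (rule ccontr)
  assume "det A \<noteq> 0"
  then have "inj ((*v) A)"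
    using invertible_det_nz[of A] matrix_left_invertible_injective[of A] by (auto simp: invertible_def)
  have "v \<bullet> (A *v v) = 0" using psd[of v] v(2) by simp
  then have "((A *v v) \<bullet> (A *v v))\<^sup>2 \<le> 0"
    using psd_Cauchy_Schwarz[OF h psd, of "A *v v" v] by simp
  then have "A *v v = A *v 0" by simp
  with \<open>inj ((*v) A)\<close> v(1) show False by (metis injD)
qed

section \<open>The complex Hessian as a quadratic form\<close>

lemma partial_deriv_cong_open:
  assumes "open S" "x \<in> S" "\<And>y. y \<in> S \<Longrightarrow> f y = g y"
  shows "partial_deriv v f x = partial_deriv v g x"
proof -
  have "(f has_derivative f') (at x) \<longleftrightarrow> (g has_derivative f') (at x)" for f'
    using has_derivative_transform_within_open[OF _ assms(1,2), of f f' UNIV g]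
      has_derivative_transform_within_open[OF _ assms(1,2), of g f' UNIV f] assms(3) by auto
  then show ?thesis by (simp add: partial_deriv_def frechet_derivative_def)
qed

text \<open>The entry \<open>(i, j)\<close> of \<open>complex_hessian\<close> is differentiated in
  the i-th variable and the conjugate of the j-th, whereas \<open>v \<bullet> (A *v v)\<close>
  conjugates the components of the first vector. The form at \<open>v\<close> is therefore the Levi
  form in the conjugate direction.\<close>

definition cnj_vec :: "complex^'n \<Rightarrow> complex^'n" where "cnj_vec v = (\<chi> i. cnj (v $ i))"

lemma imaginary_axis: "\<i> *s axis j 1 = (axis j \<i> :: complex^'n)"
  by (simp add: vec_eq_iff axis_def)

lemma second_partial_deriv_linear:
  fixes f :: "'a::euclidean_space \<Rightarrow> real"
  assumes S: "open S" "p \<in> S" "C_k_on 2 S f"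
  shows "linear (\<lambda>v. partial_deriv v (partial_deriv w f) p)" "linear (\<lambda>w. partial_deriv v (partial_deriv w f) p)"
proof -
  show 1: "linear (\<lambda>v. partial_deriv v (partial_deriv w f) p)" for w
    using has_derivative_linear[OF has_derivative_partial_deriv[OF second_partial_deriv_bilinear(1)[OF S]]] .
  show "linear (\<lambda>w. partial_deriv v (partial_deriv w f) p)"
    using 1[of v] second_partial_deriv_commute[OF S] by simp
qed

lemma complex_hessian_entry:
  fixes \<phi> :: "complex^'n \<Rightarrow> real"
  assumes S: "open S" "x \<in> S" and \<phi>: "C_k_on 2 S \<phi>"
  defines "h \<equiv> \<lambda>v w. partial_deriv v (partial_deriv w \<phi>) x"
  shows "complex_hessian \<phi> x $ i $ j =
    Complex (h (axis i 1) (axis j 1) + h (axis i \<i>) (axis j \<i>)) (h (axis i 1) (axis j \<i>) - h (axis i \<i>) (axis j 1)) / 4"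
proof -
  have d: "\<phi> differentiable (at y)" if "y \<in> S" for y
    using \<phi> that by (auto simp: numeral_2_eq_2)
  have d2: "partial_deriv v \<phi> differentiable (at x)" for v
    using second_partial_deriv_bilinear(1)[OF S \<phi>] .
  have pr: "partial_deriv v (\<lambda>z. complex_of_real (\<phi> z)) y = of_real (partial_deriv v \<phi> y)" if "y \<in> S" for v y
    by (rule partial_deriv_bounded_linear[OF bounded_linear_of_real d[OF that]])
  let ?F = "\<lambda>y. (of_real (partial_deriv (axis j 1) \<phi> y) + \<i> * of_real (partial_deriv (axis j \<i>) \<phi> y)) / 2"
  have F: "partial_deriv v (\<lambda>y. delbar (\<lambda>z. complex_of_real (\<phi> z)) y (axis j 1)) x
     = (of_real (h v (axis j 1)) + \<i> * of_real (h v (axis j \<i>))) / 2" for v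
  proof -
    have "partial_deriv v (\<lambda>y. delbar (\<lambda>z. complex_of_real (\<phi> z)) y (axis j 1)) x = partial_deriv v ?F x"
      by (rule partial_deriv_cong_open[OF S]) (simp add: delbar_def pr imaginary_axis)
    also have "\<dots> = (of_real (h v (axis j 1)) + \<i> * of_real (h v (axis j \<i>))) / 2"
      unfolding h_def
      by (rule partial_deriv_eq[of _ "\<lambda>v. (of_real (partial_deriv v (partial_deriv (axis j 1) \<phi>) x) + \<i> * of_real (partial_deriv v (partial_deriv (axis j \<i>) \<phi>) x)) / 2"])
        (intro bounded_linear.has_derivative[OF bounded_linear_divide] has_derivative_add has_derivative_mult_right has_derivative_of_real has_derivative_partial_deriv d2)
    finally show ?thesis .
  qed
  show ?thesis
    by (simp add: complex_hessian_def del_def F imaginary_axis complex_eq_iff field_simps)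
qed

lemma complex_hessian_hermitian:
  fixes \<phi> :: "complex^'n \<Rightarrow> real"
  assumes S: "open S" "x \<in> S" and \<phi>: "C_k_on 2 S \<phi>"
  shows "adjoint_matrix (complex_hessian \<phi> x) = complex_hessian \<phi> x"
proof -
  have "cnj (complex_hessian \<phi> x $ j $ i) = complex_hessian \<phi> x $ i $ j" for i j
    unfolding complex_hessian_entry[OF assms]
    using second_partial_deriv_commute[OF assms, of "axis j 1" "axis i 1"]
      second_partial_deriv_commute[OF assms, of "axis j \<i>" "axis i \<i>"]
      second_partial_deriv_commute[OF assms, of "axis j 1" "axis i \<i>"]
      second_partial_deriv_commute[OF assms, of "axis j \<i>" "axis i 1"]
    by (simp add: complex_eq_iff)
  then show ?thesis by (simp add: adjoint_matrix_def vec_eq_iff)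
qed

text \<open>The Levi form is a quarter of the trace of the real Hessian over the complex line
  spanned by the direction. This reduces the viscosity inequalities to second derivatives along real
  lines.\<close>

lemma complex_hessian_form:
  fixes \<phi> :: "complex^'n \<Rightarrow> real"
  assumes S: "open S" "x \<in> S" and \<phi>: "C_k_on 2 S \<phi>"
  defines "h \<equiv> \<lambda>v w. partial_deriv v (partial_deriv w \<phi>) x"
  shows "v \<bullet> (complex_hessian \<phi> x *v v) = (h (cnj_vec v) (cnj_vec v) + h (\<i> *s cnj_vec v) (\<i> *s cnj_vec v)) / 4"
proof -
  let ?a = "\<lambda>j. Re (v $ j)" and ?b = "\<lambda>j. Im (v $ j)" and ?e = "\<lambda>j. axis j 1 :: complex^'n" and ?f = "\<lambda>j. axis j \<i> :: complex^'n"
  have y: "cnj_vec v = (\<Sum>j\<in>UNIV. ?a j *\<^sub>R ?e j + (- ?b j) *\<^sub>R ?f j)"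
    and Jy: "\<i> *s cnj_vec v = (\<Sum>j\<in>UNIV. ?b j *\<^sub>R ?e j + ?a j *\<^sub>R ?f j)"
    by (auto simp: vec_eq_iff cnj_vec_def axis_def complex_eq_iff if_distrib[of "\<lambda>x. _ *\<^sub>R x"]
        if_distrib[of Re] if_distrib[of Im] sum.distrib sum_negf cong: if_cong)
  have lin: "linear (\<lambda>v. h v w)" "linear (\<lambda>w. h v w)" for v w
    unfolding h_def by (rule second_partial_deriv_linear[OF assms(1-3)])+
  have exp: "h (\<Sum>j\<in>UNIV. c j *\<^sub>R ?e j + d j *\<^sub>R ?f j) (\<Sum>j\<in>UNIV. c j *\<^sub>R ?e j + d j *\<^sub>R ?f j)
    = (\<Sum>i\<in>UNIV. \<Sum>j\<in>UNIV. c i * c j * h (?e i) (?e j) + c i * d j * h (?e i) (?f j)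
        + d i * c j * h (?f i) (?e j) + d i * d j * h (?f i) (?f j))" for c d
  proof -
    let ?X = "\<lambda>j. c j *\<^sub>R ?e j + d j *\<^sub>R ?f j"
    have "h (\<Sum>j\<in>UNIV. ?X j) (\<Sum>j\<in>UNIV. ?X j) = (\<Sum>i\<in>UNIV. h (?X i) (\<Sum>j\<in>UNIV. ?X j))"
      by (rule linear_sum[OF lin(1)])
    also have "\<dots> = (\<Sum>i\<in>UNIV. \<Sum>j\<in>UNIV. h (?X i) (?X j))"
      by (intro sum.cong refl linear_sum[OF lin(2)])
    finally show ?thesis
      by (simp only: linear_add[OF lin(1)] linear_add[OF lin(2)] linear_cmul[OF lin(1)] linear_cmul[OF lin(2)])
        (simp add: algebra_simps)
  qed
  have "4 * Re (cnj (v $ i) * complex_hessian \<phi> x $ i $ j * v $ j)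
     = (?a i * ?a j * h (?e i) (?e j) + ?a i * (- ?b j) * h (?e i) (?f j)
        + (- ?b i) * ?a j * h (?f i) (?e j) + (- ?b i) * (- ?b j) * h (?f i) (?f j))
     + (?b i * ?b j * h (?e i) (?e j) + ?b i * ?a j * h (?e i) (?f j)
        + ?a i * ?b j * h (?f i) (?e j) + ?a i * ?a j * h (?f i) (?f j))" for i j
    unfolding complex_hessian_entry[OF assms(1-3)] h_def
    by (simp add: field_simps)
  then have "4 * (v \<bullet> (complex_hessian \<phi> x *v v)) = h (cnj_vec v) (cnj_vec v) + h (\<i> *s cnj_vec v) (\<i> *s cnj_vec v)"
    unfolding inner_matrix_vector Re_sum sum_distrib_left exp[of ?a "\<lambda>j. - ?b j", folded y] exp[of ?b ?a, folded Jy]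
    by (simp only: sum.distrib)
  then show ?thesis by simp
qed

section \<open>Second-order conditions along lines\<close>

text \<open>If \<open>c\<close> were positive, \<open>g'\<close> would be positive just to the right
  of its zero at 0, and \<open>g\<close> would increase there. The second derivative need exist at 0
  only.\<close>

lemma second_derivative_local_max:
  fixes g :: "real \<Rightarrow> real"
  assumes d: "0 < d" and g: "\<And>t. \<bar>t\<bar> < d \<Longrightarrow> (g has_real_derivative g' t) (at t)"
    and g': "(g' has_real_derivative c) (at 0)" and max: "\<And>t. \<bar>t\<bar> < d \<Longrightarrow> g t \<le> g 0"
  shows "c \<le> 0"
proof (rule ccontr)
  assume "\<not> c \<le> 0"
  then obtain d' where d': "d' > 0" "\<And>h. 0 < h \<Longrightarrow> h < d' \<Longrightarrow> g' 0 < g' (0 + h)"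
    using DERIV_pos_inc_right[OF g'] by auto
  have "g' 0 = 0"
    using DERIV_local_max[OF g[of 0] d] max d by auto
  define t where "t = min d d' / 2"
  have t: "0 < t" "t < d" "t < d'" using d d' by (auto simp: t_def)
  obtain z where z: "0 < z" "z < t" "g t - g 0 = (t - 0) * g' z"
    using MVT2[of 0 t g g'] g t by force
  then have "g' z > 0" using d'(2)[of z] \<open>g' 0 = 0\<close> t by simp
  then have "g t - g 0 > 0" using z t by simp
  then show False using max[of t] t by simp
qed

lemma has_real_derivative_shift_line:
  fixes x v :: "'a::real_vector"
  assumes "((\<lambda>s. f ((x + t *\<^sub>R v) + s *\<^sub>R v)) has_real_derivative D) (at 0)"
  shows "((\<lambda>s. f (x + s *\<^sub>R v)) has_real_derivative D) (at t)"
proof -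
  have eq: "x + t *\<^sub>R v + s *\<^sub>R v = x + (s + t) *\<^sub>R v" for s
    by (simp add: scaleR_add_left add_ac)
  have "((\<lambda>s. f (x + (s + t) *\<^sub>R v)) has_real_derivative D) (at 0)"
    using assms unfolding eq .
  then show ?thesis using DERIV_shift[of "\<lambda>s. f (x + s *\<^sub>R v)" D 0 t] by simp
qed

lemma line_in_open:
  fixes x v :: "'a::real_normed_vector"
  assumes "open S" "x \<in> S"
  obtains d where "0 < d" "\<And>t. \<bar>t\<bar> < d \<Longrightarrow> x + t *\<^sub>R v \<in> S"
proof -
  obtain e where e: "e > 0" "ball x e \<subseteq> S" using assms open_contains_ball by blast
  have "x + t *\<^sub>R v \<in> S" if "\<bar>t\<bar> < e / (norm v + 1)" for t
  proof -
    have "norm (t *\<^sub>R v) \<le> \<bar>t\<bar> * (norm v + 1)" by (simp add: mult_left_mono)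
    also have "\<dots> < e" using that by (simp add: pos_less_divide_eq add_nonneg_pos)
    finally show ?thesis using e by (auto simp: dist_norm)
  qed
  then show ?thesis using that[of "e / (norm v + 1)"] e by (simp add: add_nonneg_pos)
qed

lemma C2_line_derivatives:
  fixes \<phi> :: "'a::euclidean_space \<Rightarrow> real"
  assumes S: "open S" and \<phi>: "C_k_on 2 S \<phi>"
  shows "x + t *\<^sub>R v \<in> S \<Longrightarrow> ((\<lambda>t. \<phi> (x + t *\<^sub>R v)) has_real_derivative partial_deriv v \<phi> (x + t *\<^sub>R v)) (at t)"
    and "x \<in> S \<Longrightarrow> ((\<lambda>t. partial_deriv v \<phi> (x + t *\<^sub>R v)) has_real_derivative partial_deriv v (partial_deriv v \<phi>) x) (at 0)"
proof -
  assume "x + t *\<^sub>R v \<in> S"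
  then have "\<phi> differentiable (at (x + t *\<^sub>R v))" using \<phi> by (auto simp: numeral_2_eq_2)
  from has_vector_derivative_line[OF this]
  show "((\<lambda>t. \<phi> (x + t *\<^sub>R v)) has_real_derivative partial_deriv v \<phi> (x + t *\<^sub>R v)) (at t)"
    by (simp add: has_real_derivative_iff_has_vector_derivative)
next
  assume "x \<in> S"
  then have "partial_deriv v \<phi> differentiable (at (x + 0 *\<^sub>R v))"
    using second_partial_deriv_bilinear(1)[OF S _ \<phi>] by simp
  from has_vector_derivative_line[OF this]
  show "((\<lambda>t. partial_deriv v \<phi> (x + t *\<^sub>R v)) has_real_derivative partial_deriv v (partial_deriv v \<phi>) x) (at 0)"
    by (simp add: has_real_derivative_iff_has_vector_derivative)
qed

context two_coordinates
begin

section \<open>Viscosity solution\<close>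

text \<open>\<open>\<sigma> = 1\<close> serves test functions touching from above,
  \<open>\<sigma> = -1\<close> those touching from below.\<close>

lemma u_second_order_comparison:
  assumes x: "x \<in> \<Omega>" "x $ k \<noteq> 0" and S: "open S" "x \<in> S" "C_k_on 2 S \<phi>"
    and \<sigma>: "\<bar>\<sigma>\<bar> = (1::real)" and max: "\<forall>\<^sub>F y in nhds x. \<sigma> * (u y - \<phi> y) \<le> \<sigma> * (u x - \<phi> x)"
  shows "\<sigma> * (u2 v v x - partial_deriv v (partial_deriv v \<phi>) x) \<le> 0"
proof -
  have "open {y :: complex^'n. y $ k \<noteq> 0}" by (intro open_Collect_neq continuous_intros)
  then have op: "open (\<Omega> \<inter> S \<inter> {y. y $ k \<noteq> 0})" using open_disc_times_space S by auto
  obtain T where T: "open T" "x \<in> T" "\<And>y. y \<in> T \<Longrightarrow> \<sigma> * (u y - \<phi> y) \<le> \<sigma> * (u x - \<phi> x)"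
    using max by (auto simp: eventually_nhds)
  obtain d where d: "0 < d" "\<And>t. \<bar>t\<bar> < d \<Longrightarrow> x + t *\<^sub>R v \<in> (\<Omega> \<inter> S \<inter> {y. y $ k \<noteq> 0}) \<inter> T"
    using line_in_open[of "(\<Omega> \<inter> S \<inter> {y. y $ k \<noteq> 0}) \<inter> T" x v] op T S x by auto
  show ?thesis
  proof (rule second_derivative_local_max[OF d(1)])
    fix t :: real assume t: "\<bar>t\<bar> < d"
    have "((\<lambda>t. u (x + t *\<^sub>R v)) has_real_derivative u1 v (x + t *\<^sub>R v)) (at t)"
      by (rule has_real_derivative_shift_line) (use d(2)[OF t] in \<open>auto intro: DERIV_u\<close>)
    moreover have "((\<lambda>t. \<phi> (x + t *\<^sub>R v)) has_real_derivative partial_deriv v \<phi> (x + t *\<^sub>R v)) (at t)"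
      by (rule C2_line_derivatives[OF S(1,3)]) (use d(2)[OF t] in auto)
    ultimately show "((\<lambda>t. \<sigma> * (u (x + t *\<^sub>R v) - \<phi> (x + t *\<^sub>R v))) has_real_derivative
        \<sigma> * (u1 v (x + t *\<^sub>R v) - partial_deriv v \<phi> (x + t *\<^sub>R v))) (at t)"
      by (intro DERIV_cmult DERIV_diff)
    show "\<sigma> * (u (x + t *\<^sub>R v) - \<phi> (x + t *\<^sub>R v)) \<le> \<sigma> * (u (x + 0 *\<^sub>R v) - \<phi> (x + 0 *\<^sub>R v))"
      using T(3) d(2)[OF t] by auto
  next
    show "((\<lambda>t. \<sigma> * (u1 v (x + t *\<^sub>R v) - partial_deriv v \<phi> (x + t *\<^sub>R v))) has_real_derivative
       \<sigma> * (u2 v v x - partial_deriv v (partial_deriv v \<phi>) x)) (at 0)"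
      by (intro DERIV_cmult DERIV_diff DERIV_u x C2_line_derivatives[OF S(1,3)] S)
  qed
qed

text \<open>A factor of the complex Hessian of \<open>u\<close> off \<open>z = 0\<close>:
  \<open>(norm (root_matrix x *v v))\<^sup>2\<close> is the Levi form of \<open>u\<close>. It is a
  diagonal matrix with entries \<open>sqrt L\<close>, \<open>1 / sqrt L\<close> and ones, changed by
  one row operation, so its determinant is visibly 1.\<close>

definition root_matrix :: "complex^'n \<Rightarrow> complex^'n^'n" where
  "root_matrix x = (let D = (\<chi> i j. if i = j then (if i = k then of_real (sqrt (L x)) else if i = m then of_real (1 / sqrt (L x)) else 1) else 0)
     in \<chi> i. if i = m then row m D + (of_real (2 * s x / (R x * (L x)\<^sup>2)) * x $ k) *s row k D else row i D)"

text \<open>The matrix arises by completing the square in the coordinate \<open>m\<close>. The terms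
  with \<open>(s x)\<^sup>2\<close> are used up by the square because of the equation for
  \<open>a\<close>, and \<open>L\<close> is left as the coefficient of
  \<open>(norm (v $ k))\<^sup>2\<close>.\<close>

lemma
  assumes x: "x \<in> \<Omega>" "x $ k \<noteq> 0"
  shows det_root_matrix: "det (root_matrix x) = 1"
    and norm_root_matrix: "4 * (norm (root_matrix x *v v))\<^sup>2 = u2 (cnj_vec v) (cnj_vec v) x + u2 (\<i> *s cnj_vec v) (\<i> *s cnj_vec v) x"
proof -
  have pos: "0 < R x" "0 < L x" using R_pos[OF x] L_pos[OF x] by auto
  define d :: "'n \<Rightarrow> complex" where "d i = (if i = k then of_real (sqrt (L x)) else if i = m then of_real (1 / sqrt (L x)) else 1)" for i
  define D :: "complex^'n^'n" where "D = (\<chi> i j. if i = j then d i else 0)"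
  define c where "c = of_real (2 * s x / (R x * (L x)\<^sup>2)) * x $ k"
  have S: "root_matrix x = (\<chi> i. if i = m then row m D + c *s row k D else row i D)"
    unfolding root_matrix_def Let_def D_def d_def c_def by (rule refl)
  have "det (root_matrix x) = det D"
    unfolding S using km by (intro det_row_operation) auto
  also have "det D = (\<Prod>i\<in>UNIV. D $ i $ i)" by (rule det_diagonal) (simp add: D_def)
  also have "\<dots> = D $ k $ k * (D $ m $ m * (\<Prod>i\<in>UNIV - {k} - {m}. D $ i $ i))"
    using km by (simp add: prod.remove[of UNIV k] prod.remove[of "UNIV - {k}" m])
  also have "(\<Prod>i\<in>UNIV - {k} - {m}. D $ i $ i) = 1" by (rule prod.neutral) (auto simp: D_def d_def)
  also have "D $ k $ k * (D $ m $ m * 1) = 1"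
    using km pos by (simp add: D_def d_def flip: of_real_mult)
  finally show "det (root_matrix x) = 1" .
  have Dv: "(\<Sum>j\<in>UNIV. row i D $ j * v $ j) = d i * v $ i" for i
    by (simp add: row_def D_def if_distrib[of "\<lambda>x. x * _"] cong: if_cong)
  have "(root_matrix x *v v) $ i = (if i = m then d m * v $ m + c * (d k * v $ k) else d i * v $ i)" for i
    unfolding S matrix_vector_mult_def
    by (simp add: distrib_right sum.distrib mult.assoc Dv flip: sum_distrib_left)
  then have comp: "(root_matrix x *v v) $ i = (if i = m then of_real (1 / sqrt (L x)) * v $ m + c * (of_real (sqrt (L x)) * v $ k)
      else if i = k then of_real (sqrt (L x)) * v $ k else v $ i)" for i
    using km by (auto simp: d_def)
  have q: "(\<Sum>i\<in>- {k, m}. (norm (v $ i))\<^sup>2) = Q \<Longrightarrow> (norm (root_matrix x *v v))\<^sup>2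
      = L x * (norm (v $ k))\<^sup>2 + (norm (of_real (1 / sqrt (L x)) * v $ m + c * (of_real (sqrt (L x)) * v $ k)))\<^sup>2 + Q" for Q
  proof -
    assume Q: "(\<Sum>i\<in>- {k, m}. (norm (v $ i))\<^sup>2) = Q"
    have "(norm (root_matrix x *v v))\<^sup>2 = (\<Sum>i\<in>UNIV. (norm ((root_matrix x *v v) $ i))\<^sup>2)"
      by (simp add: norm_vec_def L2_set_def sum_nonneg)
    also have "\<dots> = (norm ((root_matrix x *v v) $ k))\<^sup>2 + ((norm ((root_matrix x *v v) $ m))\<^sup>2
        + (\<Sum>i\<in>UNIV - {k} - {m}. (norm ((root_matrix x *v v) $ i))\<^sup>2))"
      using km by (simp add: sum.remove[of UNIV k] sum.remove[of "UNIV - {k}" m])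
    also have "(\<Sum>i\<in>UNIV - {k} - {m}. (norm ((root_matrix x *v v) $ i))\<^sup>2) = (\<Sum>i\<in>- {k, m}. (norm (v $ i))\<^sup>2)"
      by (rule sum.cong) (auto simp: comp)
    finally show ?thesis
      unfolding Q comp using km pos by (simp add: norm_mult power_mult_distrib)
  qed
  show "4 * (norm (root_matrix x *v v))\<^sup>2 = u2 (cnj_vec v) (cnj_vec v) x + u2 (\<i> *s cnj_vec v) (\<i> *s cnj_vec v) x"
  proof -
    define z where "z = x $ k"
    define vk vm where "vk = v $ k" and "vm = v $ m"
    define l \<rho> where "l = L x" and "\<rho> = R x"
    have lr: "l > 0" "\<rho> > 0" using pos by (simp_all add: l_def \<rho>_def)
    have \<rho>: "\<rho> = (Re z)\<^sup>2 + (Im z)\<^sup>2" by (simp add: \<rho>_def R_def z_def cmod_power2)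
    have "(norm (of_real (1 / sqrt l) * vm + c * (of_real (sqrt l) * vk)))\<^sup>2
       = (norm (of_real (1 / sqrt l) * (vm + of_real l * c * vk)))\<^sup>2"
      using lr by (simp add: algebra_simps flip: of_real_mult) (simp add: field_simps flip: of_real_mult)
    also have "\<dots> = (norm (vm + of_real l * c * vk))\<^sup>2 / l"
      using lr by (simp add: norm_mult power_mult_distrib norm_divide power_divide)
    also have "of_real l * c = of_real (2 * s x / (\<rho> * l)) * z"
      using lr by (simp add: c_def l_def[symmetric] \<rho>_def[symmetric] z_def power2_eq_square field_simps)
    also have "(norm (vm + of_real (2 * s x / (\<rho> * l)) * z * vk))\<^sup>2 / l
      = ((norm vm)\<^sup>2 + 4 * (s x)\<^sup>2 / (\<rho> * l\<^sup>2) * (norm vk)\<^sup>2 + 4 * s x / (\<rho> * l) * Re (cnj vm * z * vk)) / l"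
    proof -
      have "(norm (of_real (2 * s x / (\<rho> * l)) * z * vk))\<^sup>2 = (2 * s x / (\<rho> * l))\<^sup>2 * \<rho> * (norm vk)\<^sup>2"
        unfolding norm_mult norm_of_real power_mult_distrib power2_abs by (simp add: \<rho>_def R_def z_def)
      also have "\<dots> = 4 * (s x)\<^sup>2 / (\<rho> * l\<^sup>2) * (norm vk)\<^sup>2"
        using lr by (simp add: field_simps power2_eq_square)
      finally have 1: "(norm (of_real (2 * s x / (\<rho> * l)) * z * vk))\<^sup>2 = 4 * (s x)\<^sup>2 / (\<rho> * l\<^sup>2) * (norm vk)\<^sup>2" .
      have "Re (cnj vm * (of_real (2 * s x / (\<rho> * l)) * z * vk)) = Re (of_real (2 * s x / (\<rho> * l)) * (cnj vm * z * vk))"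
        by (simp only: mult_ac)
      also have "\<dots> = 2 * s x / (\<rho> * l) * Re (cnj vm * z * vk)" by (subst scaleR_conv_of_real[symmetric]) simp
      finally have 2: "Re (cnj vm * (of_real (2 * s x / (\<rho> * l)) * z * vk)) = 2 * s x / (\<rho> * l) * Re (cnj vm * z * vk)" .
      define X where "X = Re (cnj vm * z * vk)"
      show ?thesis unfolding norm_add_squared 1 2 X_def[symmetric] by simp
    qed
    finally have main: "4 * (norm (root_matrix x *v v))\<^sup>2 = 4 * l * (norm vk)\<^sup>2
      + 4 * ((norm vm)\<^sup>2 + 4 * (s x)\<^sup>2 / (\<rho> * l\<^sup>2) * (norm vk)\<^sup>2 + 4 * s x / (\<rho> * l) * Re (cnj vm * z * vk)) / l
      + 4 * (\<Sum>i\<in>- {k, m}. (norm (v $ i))\<^sup>2)"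
      unfolding q[OF refl] l_def vk_def vm_def by (simp add: distrib_left)
    define y where "y = cnj_vec v"
    have p1: "p y x = Re z * Re vk - Im z * Im vk" "p (\<i> *s y) x = Re z * Im vk + Im z * Re vk"
      "s y = Re vm" "s (\<i> *s y) = Im vm"
      by (simp_all add: y_def p_def s_def cnj_vec_def z_def vk_def vm_def inner_complex_def)
    have pp: "(p y x)\<^sup>2 + (p (\<i> *s y) x)\<^sup>2 = \<rho> * (norm vk)\<^sup>2"
      unfolding p1 \<rho> cmod_power2 by (simp add: power2_eq_square algebra_simps)
    have sp: "s y * p y x + s (\<i> *s y) * p (\<i> *s y) x = Re (cnj vm * z * vk)"
      unfolding p1 by (simp add: algebra_simps)
    have ss: "(s y)\<^sup>2 + (s (\<i> *s y))\<^sup>2 = (norm vm)\<^sup>2" unfolding p1 cmod_power2 by simp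
    have kk: "y $ k \<bullet> y $ k = (norm vk)\<^sup>2" "(\<i> *s y) $ k \<bullet> (\<i> *s y) $ k = (norm vk)\<^sup>2"
      unfolding cmod_power2 by (simp_all add: y_def cnj_vec_def vk_def inner_complex_def power2_eq_square)
    have qq: "q1 y y = 2 * (\<Sum>i\<in>- {k, m}. (norm (v $ i))\<^sup>2)" "q1 (\<i> *s y) (\<i> *s y) = 2 * (\<Sum>i\<in>- {k, m}. (norm (v $ i))\<^sup>2)"
      unfolding cmod_power2 by (simp_all add: q1_def y_def cnj_vec_def inner_complex_def power2_eq_square add.commute)
    have a2s: "a2 y y x + a2 (\<i> *s y) (\<i> *s y) x = 8 * (norm vk)\<^sup>2 / (\<rho> * l ^ 3)"
    proof -
      have "a2 y y x + a2 (\<i> *s y) (\<i> *s y) x = 4 * (norm vk)\<^sup>2 / (\<rho> * l\<^sup>2)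
         - 4 * ((p y x)\<^sup>2 + (p (\<i> *s y) x)\<^sup>2) / (\<rho>\<^sup>2 * l\<^sup>2) + 8 * ((p y x)\<^sup>2 + (p (\<i> *s y) x)\<^sup>2) / (\<rho>\<^sup>2 * l ^ 3)"
        unfolding a2_def kk l_def[symmetric] \<rho>_def[symmetric]
        by (simp add: power2_eq_square add_divide_distrib algebra_simps)
      then show ?thesis unfolding pp using lr by (simp add: power2_eq_square power3_eq_cube)
    qed
    have b2s: "b2 y y x + b2 (\<i> *s y) (\<i> *s y) x = 4 * l * (norm vk)\<^sup>2"
    proof -
      have "b2 y y x + b2 (\<i> *s y) (\<i> *s y) x = 4 * (norm vk)\<^sup>2 * (1 + l) - 4 * ((p y x)\<^sup>2 + (p (\<i> *s y) x)\<^sup>2) / \<rho>"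
        unfolding b2_def kk l_def[symmetric] \<rho>_def[symmetric]
        by (simp add: power2_eq_square add_divide_distrib algebra_simps)
      then show ?thesis unfolding pp using lr by (simp add: algebra_simps)
    qed
    have a1s: "s y * a1 y x + s (\<i> *s y) * a1 (\<i> *s y) x = 2 * Re (cnj vm * z * vk) / (\<rho> * l\<^sup>2)"
      unfolding a1_def l_def[symmetric] \<rho>_def[symmetric] sp[symmetric]
      by (simp add: add_divide_distrib algebra_simps)
    have "u2 y y x + u2 (\<i> *s y) (\<i> *s y) x = 4 * ((s y)\<^sup>2 + (s (\<i> *s y))\<^sup>2) * a x
      + 8 * s x * (s y * a1 y x + s (\<i> *s y) * a1 (\<i> *s y) x)
      + 2 * (s x)\<^sup>2 * (a2 y y x + a2 (\<i> *s y) (\<i> *s y) x) + (b2 y y x + b2 (\<i> *s y) (\<i> *s y) x) + (q1 y y + q1 (\<i> *s y) (\<i> *s y))"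
      unfolding u2_def by (simp add: power2_eq_square algebra_simps)
    also have "\<dots> = 4 * (norm (root_matrix x *v v))\<^sup>2"
      unfolding main ss a1s a2s b2s qq a_def l_def[symmetric] using lr
      by (simp add: power2_eq_square power3_eq_cube field_simps)
    finally show ?thesis by (simp add: y_def)
  qed
qed

lemma complex_hessian_compare:
  assumes x: "x \<in> \<Omega>" "x $ k \<noteq> 0" and S: "open S" "x \<in> S" "C_k_on 2 S \<phi>"
    and \<sigma>: "\<bar>\<sigma>\<bar> = (1::real)" and max: "\<forall>\<^sub>F y in nhds x. \<sigma> * (u y - \<phi> y) \<le> \<sigma> * (u x - \<phi> x)"
  shows "\<sigma> * (norm (root_matrix x *v v))\<^sup>2 \<le> \<sigma> * (v \<bullet> (complex_hessian \<phi> x *v v))"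
proof -
  let ?h = "\<lambda>w. partial_deriv w (partial_deriv w \<phi>) x" and ?y = "cnj_vec v"
  have "\<sigma> * (u2 ?y ?y x - ?h ?y) + \<sigma> * (u2 (\<i> *s ?y) (\<i> *s ?y) x - ?h (\<i> *s ?y)) \<le> 0"
    using u_second_order_comparison[OF assms, of ?y] u_second_order_comparison[OF assms, of "\<i> *s ?y"] by linarith
  then have "\<sigma> * (4 * (norm (root_matrix x *v v))\<^sup>2) \<le> \<sigma> * (4 * (v \<bullet> (complex_hessian \<phi> x *v v)))"
    unfolding norm_root_matrix[OF x] complex_hessian_form[OF S] by (simp add: algebra_simps)
  then show ?thesis by simp
qed

section \<open>Test functions touching \<open>u\<close> on the singular set\<close>

lemma
  assumes "x $ k = 0"
  shows a_eq_0: "a x = 0" and b_eq_0: "b x = 0"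
  using assms by (simp_all add: a_def b_def L_def R_def)

text \<open>Near the singular set \<open>u\<close> exceeds its value there by \<open>\<bar>z\<bar>\<^sup>2 ln (1/\<bar>z\<bar>\<^sup>2)\<close>, so that no \<open>C\<^sup>2\<close> function
  touches \<open>u\<close> from above.\<close>

lemma no_upper_test_function:
  assumes x: "x \<in> \<Omega>" "x $ k = 0" and S: "open S" "x \<in> S" "C_k_on 2 S \<phi>"
    and max: "\<forall>\<^sub>F y in nhds x. u y - \<phi> y \<le> u x - \<phi> x"
  shows False
proof -
  let ?v = "axis k 1 :: complex^'n"
  obtain T where T: "open T" "x \<in> T" "\<And>y. y \<in> T \<Longrightarrow> u y - \<phi> y \<le> u x - \<phi> x"
    using max by (auto simp: eventually_nhds)
  obtain d where d: "0 < d" "\<And>t. \<bar>t\<bar> < d \<Longrightarrow> x + t *\<^sub>R ?v \<in> S \<inter> T"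
    using line_in_open[of "S \<inter> T" x ?v] T S by auto
  define g where "g t = \<phi> (x + t *\<^sub>R ?v)" for t
  define g' where "g' t = partial_deriv ?v \<phi> (x + t *\<^sub>R ?v)" for t
  have dg: "(g has_real_derivative g' t) (at t)" if "\<bar>t\<bar> < d" for t
    unfolding g_def g'_def by (rule C2_line_derivatives[OF S(1,3)]) (use d(2)[OF that] in auto)
  define c where "c = partial_deriv ?v (partial_deriv ?v \<phi>) x"
  have dg': "(g' has_real_derivative c) (at 0)"
    unfolding g'_def c_def by (rule C2_line_derivatives(2)[OF S(1,3,2)])
  have "(\<lambda>t. (g' (0 + t) - g' 0) / t) \<midarrow>0\<rightarrow> c" using dg' by (simp add: DERIV_def)
  then obtain d2 where d2: "d2 > 0" "\<And>t. t \<noteq> 0 \<Longrightarrow> \<bar>t\<bar> < d2 \<Longrightarrow> \<bar>(g' t - g' 0) / t - c\<bar> < 1"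
    using LIM_D[of "\<lambda>t. (g' (0 + t) - g' 0) / t" c 0 1] by auto
  have lip: "\<bar>g' t - g' 0\<bar> \<le> (\<bar>c\<bar> + 1) * \<bar>t\<bar>" if "\<bar>t\<bar> < d2" for t
  proof (cases "t = 0")
    case False
    have "\<bar>(g' t - g' 0) / t\<bar> \<le> \<bar>c\<bar> + 1" using d2(2)[OF False that] by linarith
    then show ?thesis using False by (simp add: abs_divide pos_divide_le_eq)
  qed simp
  \<comment> \<open>The last bound makes \<open>- ln t\<close> at least
    \<open>\<bar>c\<bar> + 2\<close>, too large for a function whose derivative changes by at most
    \<open>(\<bar>c\<bar> + 1) * t\<close> between 0 and points at distance below
    \<open>t\<close>.\<close>
  define t where "t = min (min d d2 / 2) (min (1 / 2) (exp (- (\<bar>c\<bar> + 2))))"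
  have t: "0 < t" "t < d" "t < d2" "t < 1" "t \<le> exp (- (\<bar>c\<bar> + 2))"
    using d(1) d2(1) by (auto simp: t_def min_less_iff_disj)
  have low: "t\<^sup>2 * (- 2 * ln t) \<le> g \<tau> - g 0" if "\<bar>\<tau>\<bar> = t" for \<tau>
  proof -
    let ?y = "x + \<tau> *\<^sub>R ?v"
    have y: "?y $ k = of_real \<tau>" "?y $ m = x $ m" "\<And>i. i \<noteq> k \<Longrightarrow> ?y $ i = x $ i"
      using km x(2) by (auto simp: axis_def scaleR_conv_of_real[where 'a=complex])
    have qy: "q ?y = q x" unfolding q_def
      by (intro sum.cong refl) (simp add: y(3) del: vector_add_component)
    have "R ?y = \<tau>\<^sup>2" unfolding R_def y(1) by simp
    also have "\<dots> = t\<^sup>2" using that by (metis power2_abs)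
    finally have Ry: "R ?y = t\<^sup>2" .
    then have Ly: "L ?y = - 2 * ln t" using t(1) by (simp add: L_def ln_realpow)
    have L0: "L ?y > 0" using t by (simp add: Ly)
    have "u x = q x" by (simp add: u_def a_eq_0 b_eq_0 x(2))
    moreover have "u ?y = 2 * (s ?y)\<^sup>2 * a ?y + t\<^sup>2 * (2 - 2 * ln t) + q x"
      by (simp add: u_def b_def Ry Ly qy)
    moreover have "0 \<le> 2 * (s ?y)\<^sup>2 * a ?y" using L0 by (simp add: a_def)
    moreover have "t\<^sup>2 * (2 - 2 * ln t) = 2 * t\<^sup>2 + t\<^sup>2 * (- 2 * ln t)" by (simp add: algebra_simps)
    ultimately have "t\<^sup>2 * (- 2 * ln t) \<le> u ?y - u x" using zero_le_power2[of t] by linarith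
    also have "\<dots> \<le> g \<tau> - g 0"
      using T(3)[of ?y] d(2)[of \<tau>] that t by (simp add: g_def)
    finally show ?thesis .
  qed
  obtain z1 where z1: "0 < z1" "z1 < t" "g t - g 0 = (t - 0) * g' z1"
    using MVT2[of 0 t g g'] dg t by force
  obtain z2 where z2: "- t < z2" "z2 < 0" "g 0 - g (- t) = (0 - - t) * g' z2"
    using MVT2[of "- t" 0 g g'] dg t by force
  \<comment> \<open>In the symmetric second difference the first derivative of \<open>g\<close> at 0
    cancels, which leaves order \<open>t\<^sup>2\<close> without a logarithm.\<close>
  have "2 * (t\<^sup>2 * (- 2 * ln t)) \<le> (g t - g 0) - (g 0 - g (- t))"
    using low[of t] low[of "- t"] t by simp
  also have "\<dots> = t * (g' z1 - g' z2)" using z1(3) z2(3) by (simp add: algebra_simps)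
  also have "\<dots> \<le> t * (2 * ((\<bar>c\<bar> + 1) * t))"
  proof (intro mult_left_mono)
    have "\<bar>g' z1 - g' 0\<bar> \<le> (\<bar>c\<bar> + 1) * t" "\<bar>g' z2 - g' 0\<bar> \<le> (\<bar>c\<bar> + 1) * t"
      by (rule order_trans[OF lip mult_left_mono]; use z1 z2 t in simp)+
    then show "g' z1 - g' z2 \<le> 2 * ((\<bar>c\<bar> + 1) * t)" by linarith
  qed (use t in auto)
  finally have "(2 * t\<^sup>2) * (- 2 * ln t) \<le> (2 * t\<^sup>2) * (\<bar>c\<bar> + 1)" by (simp add: power2_eq_square algebra_simps)
  then have "- 2 * ln t \<le> \<bar>c\<bar> + 1" by (rule mult_left_le_imp_le) (use t in simp)
  moreover have "ln t \<le> - (\<bar>c\<bar> + 2)" using t(1,5) by (metis exp_gt_zero ln_exp ln_le_cancel_iff)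
  ultimately show False by linarith
qed

text \<open>On the singular set \<open>u\<close> does not depend on the coordinate \<open>m\<close>; a test function from below
  therefore has a degenerate complex Hessian if that is positive semidefinite at all.\<close>

lemma lower_test_function_singular:
  assumes x: "x \<in> \<Omega>" "x $ k = 0" and S: "open S" "x \<in> S" "C_k_on 2 S \<phi>"
    and min: "\<forall>\<^sub>F y in nhds x. u x - \<phi> x \<le> u y - \<phi> y"
  shows "(axis m 1 :: complex^'n) \<bullet> (complex_hessian \<phi> x *v axis m 1) \<le> 0"
proof -
  have *: "partial_deriv v (partial_deriv v \<phi>) x \<le> 0" if v: "v = axis m 1 \<or> v = axis m \<i>" for v :: "complex^'n"
  proof -
    obtain T where T: "open T" "x \<in> T" "\<And>y. y \<in> T \<Longrightarrow> u x - \<phi> x \<le> u y - \<phi> y"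
      using min by (auto simp: eventually_nhds)
    obtain d where d: "0 < d" "\<And>t. \<bar>t\<bar> < d \<Longrightarrow> x + t *\<^sub>R v \<in> S \<inter> T"
      using line_in_open[of "S \<inter> T" x v] T S by auto
    show ?thesis
    proof (rule second_derivative_local_max[OF d(1)])
      fix t :: real assume t: "\<bar>t\<bar> < d"
      show "((\<lambda>t. \<phi> (x + t *\<^sub>R v)) has_real_derivative partial_deriv v \<phi> (x + t *\<^sub>R v)) (at t)"
        by (rule C2_line_derivatives[OF S(1,3)]) (use d(2)[OF t] in auto)
      let ?y = "x + t *\<^sub>R v"
      have y: "?y $ k = 0" "\<And>i. i \<noteq> m \<Longrightarrow> ?y $ i = x $ i"
        using v km x(2) by (auto simp: axis_def)
      have "q ?y = q x"
        unfolding q_def by (intro sum.cong refl) (simp add: y(2) del: vector_add_component)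
      then have "u ?y = u x" by (simp add: u_def a_eq_0 b_eq_0 y(1) x(2) del: vector_add_component)
      then show "\<phi> (x + t *\<^sub>R v) \<le> \<phi> (x + 0 *\<^sub>R v)" using T(3)[of ?y] d(2)[OF t] by simp
    qed (rule C2_line_derivatives(2)[OF S(1,3,2)])
  qed
  have "cnj_vec (axis m 1) = axis m 1" by (simp add: cnj_vec_def axis_def vec_eq_iff)
  then show ?thesis
    unfolding complex_hessian_form[OF S] using *[of "axis m 1"] *[of "axis m \<i>"] by (simp add: imaginary_axis)
qed

lemma u_viscosity_solution: "viscosity_solution \<Omega> u"
  unfolding viscosity_solution_def viscosity_subsolution_def viscosity_supersolution_def
proof (intro conjI usc_lsc_u ballI allI impI; elim conjE)
  fix x :: "complex^'n" and \<phi> S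
  assume x: "x \<in> \<Omega>" and S: "open S" "x \<in> S" "C_k_on 2 S \<phi>"
    and max: "\<forall>\<^sub>F y in nhds x. u y - \<phi> y \<le> u x - \<phi> x"
  have xk: "x $ k \<noteq> 0" using no_upper_test_function[OF x _ S max] by blast
  have le: "(norm (root_matrix x *v v))\<^sup>2 \<le> v \<bullet> (complex_hessian \<phi> x *v v)" for v
    using complex_hessian_compare[OF x xk S, of 1 v] max by simp
  then have "0 \<le> v \<bullet> (complex_hessian \<phi> x *v v)" for v
    using order_trans[OF zero_le_power2] by blast
  then have "hermitian_psd (complex_hessian \<phi> x)"
    by (simp add: hermitian_psd_iff complex_hessian_hermitian[OF S])
  moreover have "1 \<le> Re (det (complex_hessian \<phi> x))"
    by (rule det_ge_1[OF complex_hessian_hermitian[OF S] det_root_matrix[OF x xk] le])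
  ultimately show "MA_operator (complex_hessian \<phi> x) \<le> 0" by (simp add: MA_operator_def)
next
  fix x :: "complex^'n" and \<phi> S
  assume x: "x \<in> \<Omega>" and S: "open S" "x \<in> S" "C_k_on 2 S \<phi>"
    and min: "\<forall>\<^sub>F y in nhds x. u x - \<phi> x \<le> u y - \<phi> y"
  show "0 \<le> MA_operator (complex_hessian \<phi> x)"
  proof (cases "hermitian_psd (complex_hessian \<phi> x)")
    case True
    then have psd: "0 \<le> v \<bullet> (complex_hessian \<phi> x *v v)" for v by (simp add: hermitian_psd_iff)
    have "Re (det (complex_hessian \<phi> x)) \<le> 1"
    proof (cases "x $ k = 0")
      case True
      have "(axis m 1 :: complex^'n) \<noteq> 0" by simp
      from det_eq_0_of_null_vector[OF complex_hessian_hermitian[OF S] psd this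
          lower_test_function_singular[OF x True S min]]
      show ?thesis by simp
    next
      case False
      have "v \<bullet> (complex_hessian \<phi> x *v v) \<le> (norm (root_matrix x *v v))\<^sup>2" for v
      proof -
        have "\<forall>\<^sub>F y in nhds x. - 1 * (u y - \<phi> y) \<le> - 1 * (u x - \<phi> x)"
          using min by eventually_elim simp
        then show ?thesis using complex_hessian_compare[OF x False S, of "-1" v] by simp
      qed
      then show ?thesis
        by (rule det_le_1[OF complex_hessian_hermitian[OF S] psd det_root_matrix[OF x False]])
    qed
    then show ?thesis by (simp add: MA_operator_def)
  qed (simp add: MA_operator_def)
qed

end

section \<open>Alternating sums over the entries of a list\<close>

text \<open>The sign pattern of the exterior derivative, defined by recursion so that vectors can be
  split off a frame one at a time.\<close>

primrec alt_sum :: "('v \<Rightarrow> 'v list \<Rightarrow> 'c::ab_group_add) \<Rightarrow> 'v list \<Rightarrow> 'c" where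
  "alt_sum F [] = 0"
| "alt_sum F (v # vs) = F v vs - alt_sum (\<lambda>w r. F w (v # r)) vs"

definition alt_sum2 :: "('v \<Rightarrow> 'v \<Rightarrow> 'v list \<Rightarrow> 'c::ab_group_add) \<Rightarrow> 'v list \<Rightarrow> 'c" where
  "alt_sum2 E vs = alt_sum (\<lambda>v r. alt_sum (\<lambda>w r'. E v w r') r) vs"

lemma alt_sum_eq_sum:
  fixes F :: "'v \<Rightarrow> 'v list \<Rightarrow> 'c::comm_ring_1"
  shows "(\<Sum>i<length vs. (-1) ^ i * F (vs ! i) (take i vs @ drop (Suc i) vs)) = alt_sum F vs"
proof (induction vs arbitrary: F)
  case (Cons v vs)
  have "(\<Sum>i<length (v # vs). (-1) ^ i * F ((v # vs) ! i) (take i (v # vs) @ drop (Suc i) (v # vs)))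
    = F v vs - (\<Sum>i<length vs. (-1) ^ i * F (vs ! i) (v # take i vs @ drop (Suc i) vs))"
    by (simp only: list.size sum.lessThan_Suc_shift add_Suc_right add_0_right) (simp add: sum_negf)
  then show ?case using Cons.IH[of "\<lambda>w r. F w (v # r)"] by simp
qed simp

lemma alt_sum_cong:
  assumes "\<And>w r. w \<in> set vs \<Longrightarrow> set r \<subseteq> set vs \<Longrightarrow> Suc (length r) = length vs \<Longrightarrow> F w r = G w r"
  shows "alt_sum F vs = alt_sum G vs"
  using assms
proof (induction vs arbitrary: F G)
  case (Cons v vs)
  have "alt_sum (\<lambda>w r. F w (v # r)) vs = alt_sum (\<lambda>w r. G w (v # r)) vs"
    by (rule Cons.IH) (rule Cons.prems; auto)
  moreover have "F v vs = G v vs" by (rule Cons.prems) auto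
  ultimately show ?case by simp
qed simp

lemma alt_sum_0 [simp]: "alt_sum (\<lambda>w r. 0) vs = 0"
  by (induction vs) auto

lemma alt_sum_add: "alt_sum (\<lambda>w r. F w r + G w r) vs = alt_sum F vs + alt_sum G vs"
  by (induction vs arbitrary: F G) (auto simp: algebra_simps)

lemma alt_sum_diff: "alt_sum (\<lambda>w r. F w r - G w r) vs = alt_sum F vs - alt_sum G vs"
  by (induction vs arbitrary: F G) (auto simp: algebra_simps)

lemma alt_sum_uminus: "alt_sum (\<lambda>w r. - F w r) vs = - alt_sum F vs"
  using alt_sum_diff[of "\<lambda>_ _. 0" F vs] by simp

text \<open>The terms are sorted by whether both, one or none of \<open>x\<close> and
  \<open>y\<close> are among the two vectors removed.\<close>

lemma alt_sum2_Cons_Cons: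
  "alt_sum2 E (x # y # l) = E x y l - E y x l + alt_sum (\<lambda>b r. E b x (y # r) - E x b (y # r)) l
     - alt_sum (\<lambda>b r. E b y (x # r) - E y b (x # r)) l + alt_sum2 (\<lambda>v w r. E v w (x # y # r)) l"
  by (simp add: alt_sum2_def alt_sum_diff)

lemma partial_deriv_alt_sum:
  fixes G :: "'v \<Rightarrow> 'v list \<Rightarrow> 'a::euclidean_space \<Rightarrow> 'b::real_normed_vector"
  assumes "\<And>w r. Suc (length r) = length vs \<Longrightarrow> G w r differentiable (at x)"
  shows "(\<lambda>y. alt_sum (\<lambda>w r. G w r y) vs) differentiable (at x)"
    and "partial_deriv v (\<lambda>y. alt_sum (\<lambda>w r. G w r y) vs) x = alt_sum (\<lambda>w r. partial_deriv v (G w r) x) vs"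
proof -
  have "((\<lambda>y. alt_sum (\<lambda>w r. G w r y) vs) has_derivative (\<lambda>v. alt_sum (\<lambda>w r. partial_deriv v (G w r) x) vs)) (at x)"
    using assms
  proof (induction vs arbitrary: G)
    case (Cons u vs)
    have "((\<lambda>y. alt_sum (\<lambda>w r. G w (u # r) y) vs) has_derivative (\<lambda>v. alt_sum (\<lambda>w r. partial_deriv v (G w (u # r)) x) vs)) (at x)"
      by (rule Cons.IH) (rule Cons.prems, simp)
    moreover have "(G u vs has_derivative (\<lambda>v. partial_deriv v (G u vs) x)) (at x)"
      by (rule has_derivative_partial_deriv) (rule Cons.prems, simp)
    ultimately show ?case by (simp add: has_derivative_diff)
  qed simp
  then show "(\<lambda>y. alt_sum (\<lambda>w r. G w r y) vs) differentiable (at x)"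
    "partial_deriv v (\<lambda>y. alt_sum (\<lambda>w r. G w r y) vs) x = alt_sum (\<lambda>w r. partial_deriv v (G w r) x) vs"
    by (auto simp: differentiable_def partial_deriv_eq)
qed

lemma integral_alt_sum:
  fixes G :: "'v \<Rightarrow> 'v list \<Rightarrow> 'a \<Rightarrow> 'b::{banach, second_countable_topology}"
  assumes "\<And>w r. Suc (length r) = length vs \<Longrightarrow> integrable M (G w r)"
  shows "integrable M (\<lambda>y. alt_sum (\<lambda>w r. G w r y) vs)"
    and "(LINT y|M. alt_sum (\<lambda>w r. G w r y) vs) = alt_sum (\<lambda>w r. LINT y|M. G w r y) vs"
proof -
  have "integrable M (\<lambda>y. alt_sum (\<lambda>w r. G w r y) vs) \<and> (LINT y|M. alt_sum (\<lambda>w r. G w r y) vs) = alt_sum (\<lambda>w r. LINT y|M. G w r y) vs"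
    using assms
  proof (induction vs arbitrary: G)
    case (Cons u vs)
    have "integrable M (\<lambda>y. alt_sum (\<lambda>w r. G w (u # r) y) vs) \<and>
      (LINT y|M. alt_sum (\<lambda>w r. G w (u # r) y) vs) = alt_sum (\<lambda>w r. LINT y|M. G w (u # r) y) vs"
      by (rule Cons.IH) (rule Cons.prems, simp)
    moreover have "integrable M (G u vs)" by (rule Cons.prems) simp
    ultimately show ?case by simp
  qed simp
  then show "integrable M (\<lambda>y. alt_sum (\<lambda>w r. G w r y) vs)"
    "(LINT y|M. alt_sum (\<lambda>w r. G w r y) vs) = alt_sum (\<lambda>w r. LINT y|M. G w r y) vs" by auto
qed

section \<open>The operator dd$^c$ on test forms\<close>

lemma form_d_eq:
  fixes \<psi> :: "(complex^'n) form"
  shows "form_d \<psi> x vs = alt_sum (\<lambda>v r. partial_deriv v (\<lambda>y. \<psi> y r) x) vs"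
proof -
  have "del f x v + delbar f x v = partial_deriv v f x" for f :: "complex^'n \<Rightarrow> complex" and v
    by (simp add: del_def delbar_def field_simps)
  then show ?thesis
    unfolding form_d_def form_del_def form_delbar_def alt_sum_eq_sum[symmetric]
    by (simp only: sum.distrib[symmetric] distrib_left[symmetric])
qed

text \<open>\<open>\<i> * (delbar - del)\<close> is minus the derivative in the direction multiplied
  by \<open>\<i>\<close>, so only real directional derivatives remain in dd^c.\<close>

lemma form_dc_eq:
  fixes \<psi> :: "(complex^'n) form"
  shows "form_dc \<psi> x vs = - alt_sum (\<lambda>v r. partial_deriv (\<i> *s v) (\<lambda>y. \<psi> y r) x) vs"
proof -
  have *: "\<i> * (delbar f x v - del f x v) = - partial_deriv (\<i> *s v) f x" for f :: "complex^'n \<Rightarrow> complex" and v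
    by (simp add: del_def delbar_def field_simps)
  have "form_dc \<psi> x vs = (\<Sum>i<length vs. (-1) ^ i * (\<i> * (delbar (\<lambda>y. \<psi> y (take i vs @ drop (Suc i) vs)) x (vs ! i)
      - del (\<lambda>y. \<psi> y (take i vs @ drop (Suc i) vs)) x (vs ! i))))"
    unfolding form_dc_def form_del_def form_delbar_def sum_subtractf[symmetric] sum_distrib_left
    by (intro sum.cong refl) (simp add: algebra_simps)
  then show ?thesis
    unfolding * alt_sum_eq_sum[symmetric] by (simp add: sum_negf)
qed

lemma ddc_eq:
  fixes \<psi> :: "(complex^'n) form"
  assumes \<psi>: "\<And>r. length r = l \<Longrightarrow> smooth_everywhere (\<lambda>y. \<psi> y r)" and vs: "length vs = l + 2"
  shows "form_d (form_dc \<psi>) x vs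
    = - alt_sum2 (\<lambda>v w r. partial_deriv v (partial_deriv (\<i> *s w) (\<lambda>y. \<psi> y r)) x) vs"
proof -
  have "form_d (form_dc \<psi>) x vs
    = alt_sum (\<lambda>v r. partial_deriv v (\<lambda>y. alt_sum (\<lambda>w r'. - partial_deriv (\<i> *s w) (\<lambda>y. \<psi> y r') y) r) x) vs"
    unfolding form_d_eq form_dc_eq alt_sum_uminus[symmetric] by (rule refl)
  also have "\<dots> = alt_sum (\<lambda>v r. alt_sum (\<lambda>w r'. - partial_deriv v (partial_deriv (\<i> *s w) (\<lambda>y. \<psi> y r')) x) r) vs"
  proof (rule alt_sum_cong)
    fix v and r :: "(complex^'n) list" assume r: "Suc (length r) = length vs"
    have sm: "partial_deriv (\<i> *s w) (\<lambda>y. \<psi> y r') differentiable (at x)" if "Suc (length r') = length r" for w r'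
      by (intro smooth_everywhere_differentiable smooth_everywhere_partial_deriv \<psi>) (use that r vs in simp)
    have "partial_deriv v (\<lambda>y. alt_sum (\<lambda>w r'. - partial_deriv (\<i> *s w) (\<lambda>y. \<psi> y r') y) r) x
      = alt_sum (\<lambda>w r'. partial_deriv v (\<lambda>y. - partial_deriv (\<i> *s w) (\<lambda>y. \<psi> y r') y) x) r"
      by (rule partial_deriv_alt_sum(2)) (rule differentiable_minus[OF sm])
    also have "\<dots> = alt_sum (\<lambda>w r'. - partial_deriv v (partial_deriv (\<i> *s w) (\<lambda>y. \<psi> y r')) x) r"
    proof (rule alt_sum_cong)
      fix w and r' :: "(complex^'n) list" assume "Suc (length r') = length r"
      from has_derivative_partial_deriv[OF sm[OF this]]
      show "partial_deriv v (\<lambda>y. - partial_deriv (\<i> *s w) (\<lambda>y. \<psi> y r') y) x = - partial_deriv v (partial_deriv (\<i> *s w) (\<lambda>y. \<psi> y r')) x"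
        by (intro partial_deriv_eq has_derivative_minus)
    qed
    finally show "partial_deriv v (\<lambda>y. alt_sum (\<lambda>w r'. - partial_deriv (\<i> *s w) (\<lambda>y. \<psi> y r') y) r) x
      = alt_sum (\<lambda>w r'. - partial_deriv v (partial_deriv (\<i> *s w) (\<lambda>y. \<psi> y r')) x) r" .
  qed
  finally show ?thesis by (simp add: alt_sum2_def alt_sum_uminus)
qed

lemma test_form_vtest:
  assumes "test_form \<Omega> l \<psi>" "length r = l" shows "vtest \<Omega> (\<lambda>y. \<psi> y r)"
  using assms by (auto simp: test_form_def vtest_def)

lemma integral_ddc:
  fixes \<psi> :: "(complex^'n) form"
  assumes c: "mild k c" and \<psi>: "test_form (disc_times_space k) l \<psi>" and vs: "length vs = l + 2"
  shows "(LINT x|lborel. c x *\<^sub>R form_d (form_dc \<psi>) x vs)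
    = - alt_sum2 (\<lambda>v w r. LINT x|lborel. c x *\<^sub>R partial_deriv v (partial_deriv (\<i> *s w) (\<lambda>y. \<psi> y r)) x) vs"
proof -
  define P where "P v w r x = partial_deriv v (partial_deriv (\<i> *s w) (\<lambda>y. \<psi> y r)) x" for v w r x
  have sc: "a *\<^sub>R alt_sum F ws = alt_sum (\<lambda>w r. a *\<^sub>R F w r) ws" for a :: real and F :: "complex^'n \<Rightarrow> (complex^'n) list \<Rightarrow> complex" and ws
    by (induction ws arbitrary: F) (auto simp: algebra_simps)
  have int: "integrable lborel (\<lambda>x. c x *\<^sub>R P v w r x)" if "length r = l" for v w r
    unfolding P_def by (intro mild_integrable[OF c] vtest_partial_deriv test_form_vtest[OF \<psi> that])
  have int2: "integrable lborel (\<lambda>x. alt_sum (\<lambda>w r'. c x *\<^sub>R P v w r' x) r)" if "Suc (length r) = length vs" for v r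
    by (rule integral_alt_sum(1)) (rule int, use that vs in simp)
  have "(LINT x|lborel. c x *\<^sub>R form_d (form_dc \<psi>) x vs)
    = (LINT x|lborel. - alt_sum (\<lambda>v r. alt_sum (\<lambda>w r'. c x *\<^sub>R P v w r' x) r) vs)"
  proof (rule Bochner_Integration.integral_cong[OF refl])
    fix x
    have "form_d (form_dc \<psi>) x vs = - alt_sum2 (\<lambda>v w r. P v w r x) vs"
      unfolding P_def by (rule ddc_eq[OF _ vs]) (use \<psi> in \<open>auto simp: test_form_def\<close>)
    then show "c x *\<^sub>R form_d (form_dc \<psi>) x vs = - alt_sum (\<lambda>v r. alt_sum (\<lambda>w r'. c x *\<^sub>R P v w r' x) r) vs"
      by (simp add: alt_sum2_def sc)
  qed
  also have "\<dots> = - alt_sum (\<lambda>v r. LINT x|lborel. alt_sum (\<lambda>w r'. c x *\<^sub>R P v w r' x) r) vs"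
    using integral_alt_sum(2)[of vs lborel "\<lambda>v r x. alt_sum (\<lambda>w r'. c x *\<^sub>R P v w r' x) r", OF int2] by simp
  also have "alt_sum (\<lambda>v r. LINT x|lborel. alt_sum (\<lambda>w r'. c x *\<^sub>R P v w r' x) r) vs
    = alt_sum (\<lambda>v r. alt_sum (\<lambda>w r'. LINT x|lborel. c x *\<^sub>R P v w r' x) r) vs"
    by (rule alt_sum_cong, rule integral_alt_sum(2)) (rule int, use vs in simp)
  finally show ?thesis by (simp add: alt_sum2_def P_def)
qed

section \<open>Frames of coordinate pairs\<close>

definition frame :: "'n list \<Rightarrow> (complex^'n) list" where
  "frame js = concat (map (\<lambda>j. [axis j 1, axis j \<i>]) js)"

lemma frame_simps [simp]: "frame [] = []" "frame (j # js) = axis j 1 # axis j \<i> # frame js"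
  "frame (as @ bs) = frame as @ frame bs"
  by (simp_all add: frame_def)

lemma length_frame [simp]: "length (frame js) = 2 * length js"
  by (induction js) auto

lemma set_frame: "b \<in> set (frame js) \<longleftrightarrow> (\<exists>j\<in>set js. b = axis j 1 \<or> b = axis j \<i>)"
  by (induction js) auto

lemma alternating_swap:
  assumes \<omega>: "alternating_multilinear l \<omega>" and vs: "length vs = l" "i < j" "j < l"
  shows "\<omega> (vs[i := vs ! j, j := vs ! i]) = - \<omega> vs"
proof -
  define f where "f x y = \<omega> (vs[i := x, j := y])" for x y
  have l1: "linear (\<lambda>x. f x y)" for y
  proof -
    have "linear (\<lambda>v. \<omega> ((vs[j := y])[i := v]))"
      using \<omega> vs unfolding alternating_multilinear_def by auto
    moreover have "(vs[j := y])[i := v] = vs[i := v, j := y]" for v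
      using vs by (intro list_update_swap) simp
    ultimately show ?thesis by (simp add: f_def)
  qed
  have l2: "linear (\<lambda>y. f x y)" for x
    using \<omega> vs unfolding alternating_multilinear_def f_def by auto
  have f0: "f x x = 0" for x
  proof -
    have "length (vs[i := x, j := x]) = l" "vs[i := x, j := x] ! i = vs[i := x, j := x] ! j"
      using vs by (simp_all add: nth_list_update)
    then show ?thesis
      using \<omega> vs(2,3) unfolding alternating_multilinear_def f_def by blast
  qed
  have "f (x + y) (x + y) = f x x + f x y + (f y x + f y y)" for x y
    by (simp add: linear_add[OF l1] linear_add[OF l2])
  then have "f x y = - f y x" for x y by (simp add: f0 eq_neg_iff_add_eq_0)
  from this[of "vs ! j" "vs ! i"] show ?thesis by (simp add: f_def)
qed

text \<open>Two transpositions exchange two neighbouring pairs, so coordinates can be reordered in a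
  frame without a sign.\<close>

lemma alternating_swap_pairs:
  assumes \<omega>: "alternating_multilinear l \<omega>" and l: "length (p @ [x, y, z, w] @ r) = l"
  shows "\<omega> (p @ [z, w, x, y] @ r) = \<omega> (p @ [x, y, z, w] @ r)"
proof -
  let ?n = "length p"
  have "\<omega> (p @ [z, y, x, w] @ r) = - \<omega> (p @ [x, y, z, w] @ r)"
    using alternating_swap[OF \<omega> l, of ?n "?n + 2"] l by (simp add: nth_append list_update_append)
  moreover have "length (p @ [z, y, x, w] @ r) = l" using l by simp
  from alternating_swap[OF \<omega> this, of "?n + 1" "?n + 3"] l
  have "\<omega> (p @ [z, w, x, y] @ r) = - \<omega> (p @ [z, y, x, w] @ r)"
    by (simp add: nth_append list_update_append eval_nat_numeral)
  ultimately show ?thesis by simp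
qed

lemma alternating_frame_move:
  assumes \<omega>: "alternating_multilinear l \<omega>" and "length (p @ frame js @ [x, y] @ r) = l"
  shows "\<omega> (p @ frame js @ [x, y] @ r) = \<omega> (p @ [x, y] @ frame js @ r)"
  using assms(2)
proof (induction js arbitrary: p)
  case (Cons j js)
  have "\<omega> ((p @ [axis j 1, axis j \<i>]) @ frame js @ [x, y] @ r) = \<omega> ((p @ [axis j 1, axis j \<i>]) @ [x, y] @ frame js @ r)"
    by (rule Cons.IH) (use Cons.prems in simp)
  also have "\<dots> = \<omega> (p @ [x, y, axis j 1, axis j \<i>] @ frame js @ r)"
    using alternating_swap_pairs[OF \<omega>, of p "axis j 1" "axis j \<i>" x y "frame js @ r"] Cons.prems by simp
  finally show ?case by simp
qed simp

lemma alternating_frame_permute: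
  assumes \<omega>: "alternating_multilinear l \<omega>" and "length (p @ frame js) = l"
    "distinct js" "distinct js'" "set js = set js'"
  shows "\<omega> (p @ frame js) = \<omega> (p @ frame js')"
  using assms(2-5)
proof (induction js arbitrary: js' p)
  case (Cons j js)
  then have "j \<in> set js'" by auto
  then obtain as bs where js': "js' = as @ j # bs" by (meson split_list)
  have s: "set js = set (as @ bs)" "distinct (as @ bs)" using Cons.prems js' by auto
  have len: "length js = length (as @ bs)"
    using s Cons.prems(2) by (metis distinct.simps(2) distinct_card)
  have "\<omega> (p @ frame (j # js)) = \<omega> ((p @ [axis j 1, axis j \<i>]) @ frame js)" by simp
  also have "\<dots> = \<omega> ((p @ [axis j 1, axis j \<i>]) @ frame (as @ bs))"
    by (rule Cons.IH) (use Cons.prems s in auto)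
  also have "\<dots> = \<omega> (p @ [axis j 1, axis j \<i>] @ frame as @ frame bs)" by simp
  also have "\<dots> = \<omega> (p @ frame as @ [axis j 1, axis j \<i>] @ frame bs)"
    by (rule alternating_frame_move[OF \<omega>, symmetric]) (use Cons.prems len in simp)
  finally show ?case by (simp add: js')
qed simp

text \<open>\<open>std_frame\<close> rests on an unspecified enumeration of the coordinates; this
  replaces it by one that begins with \<open>k\<close> and \<open>m\<close> where needed.\<close>

lemma std_frame_eq:
  fixes js :: "'n::finite list"
  assumes \<omega>: "alternating_multilinear (2 * CARD('n)) \<omega>" and js: "distinct js" "set js = (UNIV :: 'n set)"
  shows "\<omega> std_frame = \<omega> (frame js)"
proof -
  let ?P = "\<lambda>js. distinct js \<and> set js = (UNIV :: 'n set)"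
  have P: "?P (SOME js. ?P js)" by (rule someI[of ?P js]) (use js in auto)
  then have "length (SOME js. ?P js) = CARD('n)" by (metis distinct_card)
  then have "\<omega> ([] @ frame (SOME js. ?P js)) = \<omega> ([] @ frame js)"
    using P js by (intro alternating_frame_permute[OF \<omega>]) auto
  then show ?thesis by (simp add: std_frame_def frame_def)
qed

text \<open>With the cross terms between different coordinates gone, the two vectors removed must
  form a coordinate pair, and removing such a pair carries no sign.\<close>

lemma alt_sum2_frame:
  fixes js :: "'n::finite list"
  assumes "distinct js"
    and "\<And>i j v w r. i \<in> set js \<Longrightarrow> j \<in> set js \<Longrightarrow> i \<noteq> j \<Longrightarrow> v \<in> {axis i 1, axis i \<i>} \<Longrightarrow> w \<in> {axis j 1, axis j \<i>} \<Longrightarrow>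
      Suc (Suc (length r)) = length (frame js) \<Longrightarrow> E v w r = 0"
  shows "alt_sum2 E (frame js) = (\<Sum>i\<in>set js. E (axis i 1) (axis i \<i>) (frame (remove1 i js)) - E (axis i \<i>) (axis i 1) (frame (remove1 i js)))"
  using assms
proof (induction js arbitrary: E)
  case (Cons i js)
  let ?x = "axis i 1 :: complex^'n" and ?y = "axis i \<i> :: complex^'n"
  have i: "i \<notin> set js" using Cons.prems by simp
  have cross: "E b v (c # r) - E v b (c # r) = 0" if "b \<in> set (frame js)" "v \<in> {?x, ?y}" "Suc (length r) = length (frame js)" for b v r c
  proof -
    obtain j where j: "j \<in> set js" "b \<in> {axis j 1, axis j \<i>}" using \<open>b \<in> set (frame js)\<close> by (auto simp: set_frame)
    then have ij: "i \<noteq> j" using i by auto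
    have "E b v (c # r) = 0" by (rule Cons.prems(2)[of j i]) (use j ij that in auto)
    moreover have "E v b (c # r) = 0" by (rule Cons.prems(2)[of i j]) (use j ij that in auto)
    ultimately show ?thesis by simp
  qed
  have c1: "alt_sum (\<lambda>b r. E b ?x (?y # r) - E ?x b (?y # r)) (frame js) = alt_sum (\<lambda>b r. 0) (frame js)"
    "alt_sum (\<lambda>b r. E b ?y (?x # r) - E ?y b (?x # r)) (frame js) = alt_sum (\<lambda>b r. 0) (frame js)"
    by (rule alt_sum_cong, rule cross; simp)+
  have "alt_sum2 (\<lambda>v w r. E v w (?x # ?y # r)) (frame js)
    = (\<Sum>j\<in>set js. E (axis j 1) (axis j \<i>) (?x # ?y # frame (remove1 j js)) - E (axis j \<i>) (axis j 1) (?x # ?y # frame (remove1 j js)))"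
  proof (rule Cons.IH)
    show "E v w (?x # ?y # r) = 0" if "i' \<in> set js" "j \<in> set js" "i' \<noteq> j" "v \<in> {axis i' 1, axis i' \<i>}" "w \<in> {axis j 1, axis j \<i>}"
      "Suc (Suc (length r)) = length (frame js)" for i' j v w r
      by (rule Cons.prems(2)[of i' j]) (use that in auto)
  qed (use Cons.prems in simp)
  also have "\<dots> = (\<Sum>j\<in>set js. E (axis j 1) (axis j \<i>) (frame (remove1 j (i # js))) - E (axis j \<i>) (axis j 1) (frame (remove1 j (i # js))))"
    using i by (intro sum.cong) auto
  finally show ?case
    unfolding frame_simps alt_sum2_Cons_Cons c1 using i by simp
qed (simp add: alt_sum2_def)

section \<open>Pairings with test functions\<close>

definition pairing :: "('a::euclidean_space \<Rightarrow> real) \<Rightarrow> ('a \<Rightarrow> complex) \<Rightarrow> complex" where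
  "pairing c \<phi> = (LINT x|lborel. c x *\<^sub>R \<phi> x)"

lemma pairing_add: "mild k c \<Longrightarrow> mild k d \<Longrightarrow> vtest (disc_times_space k) \<phi> \<Longrightarrow>
    pairing (\<lambda>x. c x + d x) \<phi> = pairing c \<phi> + pairing d \<phi>"
  unfolding pairing_def scaleR_add_left by (intro Bochner_Integration.integral_add mild_integrable)

lemma pairing_diff: "mild k c \<Longrightarrow> mild k d \<Longrightarrow> vtest (disc_times_space k) \<phi> \<Longrightarrow>
    pairing (\<lambda>x. c x - d x) \<phi> = pairing c \<phi> - pairing d \<phi>"
  unfolding pairing_def scaleR_diff_left by (intro Bochner_Integration.integral_diff mild_integrable)

lemma pairing_cmult: "pairing (\<lambda>x. r * c x) \<phi> = r *\<^sub>R pairing c \<phi>"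
  unfolding pairing_def scaleR_scaleR[symmetric] by (rule integral_scaleR_right)

lemma pairing_uminus: "pairing (\<lambda>x. - c x) \<phi> = - pairing c \<phi>"
  using pairing_cmult[of "-1"] by simp

text \<open>Identities between derivatives of \<open>u\<close> hold off \<open>x $ k = 0\<close>
  only, a null set.\<close>

lemma pairing_cong:
  assumes "c \<in> borel_measurable borel" "d \<in> borel_measurable borel" "vtest (disc_times_space k) \<phi>"
    and eq: "\<And>x. x \<in> disc_times_space k \<Longrightarrow> x $ k \<noteq> 0 \<Longrightarrow> c x = d x"
  shows "pairing c \<phi> = pairing d \<phi>"
  unfolding pairing_def
proof (rule integral_cong_AE)
  have [measurable]: "\<phi> \<in> borel_measurable borel"
    using assms(3) by (intro borel_measurable_continuous_onI smooth_everywhere_continuous vtest_smooth)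
  show "(\<lambda>x. c x *\<^sub>R \<phi> x) \<in> borel_measurable lborel" "(\<lambda>x. d x *\<^sub>R \<phi> x) \<in> borel_measurable lborel"
    using assms(1,2) by measurable
  have "\<phi> x = 0" if "x \<notin> disc_times_space k" for x
    using assms(3) that by (auto simp: vtest_def)
  then show "AE x in lborel. c x *\<^sub>R \<phi> x = d x *\<^sub>R \<phi> x"
    using AE_vec_nth_nonzero[of k] eq by (auto elim!: eventually_mono)
qed

lemma pairing_by_parts:
  assumes "mild k f" "mild k g" "line_deriv k v f g" "vtest (disc_times_space k) \<phi>"
  shows "pairing f (partial_deriv v \<phi>) = - pairing g \<phi>"
  unfolding pairing_def by (rule mild_integration_by_parts[OF assms])

lemma pairing_by_parts2:
  assumes "mild k f" "mild k g" "mild k h" "line_deriv k v f g" "line_deriv k w g h" "vtest (disc_times_space k) \<phi>"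
  shows "pairing f (partial_deriv v (partial_deriv w \<phi>)) = pairing h \<phi>"
  using pairing_by_parts[OF assms(1,2,4) vtest_partial_deriv[OF assms(6)], of w] pairing_by_parts[OF assms(2,3,5,6)] by simp

lemma mild_zero: "mild k (\<lambda>_. 0)"
  using mild_sum[of "{}"] by simp

lemma pairing_constant_direction:
  assumes "mild k f" "line_deriv k v f (\<lambda>_. 0)" "vtest (disc_times_space k) \<phi>"
  shows "pairing f (partial_deriv v \<phi>) = 0"
  using pairing_by_parts[OF assms(1) mild_zero assms(2,3)] by (simp add: pairing_def)

lemma partial_deriv_uminus_direction:
  "f differentiable (at x) \<Longrightarrow> partial_deriv (- v) f x = - partial_deriv v f x"
  using linear_neg[OF has_derivative_linear[OF has_derivative_partial_deriv]] by blast

lemma pairing_uminus_direction: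
  assumes "vtest \<Omega> \<phi>"
  shows "pairing f (partial_deriv v (partial_deriv (- w) \<phi>)) = - pairing f (partial_deriv v (partial_deriv w \<phi>))"
proof -
  have d: "\<phi> differentiable (at x)" "partial_deriv w \<phi> differentiable (at x)" for x
    using assms vtest_differentiable vtest_partial_deriv by blast+
  have "partial_deriv (- w) \<phi> = (\<lambda>x. - partial_deriv w \<phi> x)"
    by (intro ext partial_deriv_uminus_direction d)
  then have "partial_deriv v (partial_deriv (- w) \<phi>) x = - partial_deriv v (partial_deriv w \<phi>) x" for x
    using partial_deriv_eq[OF has_derivative_minus[OF has_derivative_partial_deriv[OF d(2)]]] by simp
  then show ?thesis by (simp add: pairing_def)
qed

lemma pairing_commute:
  assumes "vtest \<Omega> \<phi>"
  shows "pairing f (partial_deriv v (partial_deriv w \<phi>)) = pairing f (partial_deriv w (partial_deriv v \<phi>))"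
  using smooth_partial_deriv_commute[OF vtest_smooth[OF assms]] by simp

section \<open>The coefficients of dd$^c$ u\<close>

context two_coordinates
begin

abbreviation vX :: "complex^'n" where "vX \<equiv> axis k 1"
abbreviation vY :: "complex^'n" where "vY \<equiv> axis k \<i>"
abbreviation vS :: "complex^'n" where "vS \<equiv> axis m 1"
abbreviation vT :: "complex^'n" where "vT \<equiv> axis m \<i>"

lemma J_axis: "\<i> *s (axis j 1 :: complex^'n) = axis j \<i>" "\<i> *s (axis j \<i> :: complex^'n) = - axis j 1"
  by (auto simp: vec_eq_iff axis_def)

text \<open>The value of dd^c u on the pair \<open>(v, w)\<close>, computed off
  \<open>z = 0\<close>.\<close>

definition tau :: "complex^'n \<Rightarrow> complex^'n \<Rightarrow> complex^'n \<Rightarrow> real" where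
  "tau v w x = u2 w (\<i> *s v) x - u2 v (\<i> *s w) x"

lemma mild_tau: "mild k (tau v w)"
  unfolding tau_def[abs_def] by (intro mild_diff mild_u2)

text \<open>\<open>u\<close> is a function of the coordinates \<open>k\<close> and \<open>m\<close>
  plus a function of the others, so second derivatives in one \<open>planar\<close> and one
  \<open>normal\<close> direction vanish.\<close>

definition planar :: "complex^'n \<Rightarrow> bool" where
  "planar v \<longleftrightarrow> (\<forall>i. i \<noteq> k \<longrightarrow> i \<noteq> m \<longrightarrow> v $ i = 0)"

definition normal :: "complex^'n \<Rightarrow> bool" where
  "normal v \<longleftrightarrow> v $ k = 0 \<and> v $ m = 0"

lemma planar_axes: "planar vX" "planar vY" "planar vS" "planar vT"
  by (auto simp: planar_def axis_def)

lemma planar_J: "planar v \<Longrightarrow> planar (\<i> *s v)" by (simp add: planar_def)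
lemma normal_J: "normal v \<Longrightarrow> normal (\<i> *s v)" by (simp add: normal_def)

lemma normal_axis: "i \<noteq> k \<Longrightarrow> i \<noteq> m \<Longrightarrow> normal (axis i c)"
  by (auto simp: normal_def axis_def)

lemma normal_u1: "normal v \<Longrightarrow> u1 v x = q1 v x"
  by (simp add: normal_def u1_def s_def a1_def b1_def p_def)

lemma normal_planar_u2: "normal v \<Longrightarrow> planar w \<Longrightarrow> u2 v w x = 0" "normal v \<Longrightarrow> planar w \<Longrightarrow> u2 w v x = 0"
  by (auto simp: normal_def planar_def u2_def s_def a1_def a2_def b2_def p_def q1_def intro!: sum.neutral)

lemma u2_uminus: "u2 v (- w) x = - u2 v w x"
  by (simp add: u2_def s_def a1_def a2_def b2_def p_def q1_def sum_negf algebra_simps)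

lemma
  assumes "v $ k = 0"
  shows L_shift: "L (x + t *\<^sub>R v) = L x" and R_shift: "R (x + t *\<^sub>R v) = R x" and p_shift: "p w (x + t *\<^sub>R v) = p w x"
    and a_shift: "a (x + t *\<^sub>R v) = a x" and b_shift: "b (x + t *\<^sub>R v) = b x"
    and a1_shift: "a1 w (x + t *\<^sub>R v) = a1 w x"
    and a2_shift: "a2 w w' (x + t *\<^sub>R v) = a2 w w' x" and b2_shift: "b2 w w' (x + t *\<^sub>R v) = b2 w w' x"
  using assms by (simp_all add: L_def R_def p_def a_def b_def a1_def a2_def b2_def)

lemmas shifts = L_shift R_shift p_shift a_shift b_shift a1_shift a2_shift b2_shift

lemma u2_shift: "v $ k = 0 \<Longrightarrow> s v = 0 \<Longrightarrow> u2 w w' (x + t *\<^sub>R v) = u2 w w' x"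
  by (simp add: u2_def shifts s_line)

lemma line_deriv_tau: "normal v \<Longrightarrow> line_deriv k v (tau w w') (\<lambda>_. 0)"
  by (simp add: line_deriv_def tau_def u2_shift normal_def s_def)

text \<open>Factors such as \<open>q\<close> and \<open>q1 w\<close>, which behave as constants
  under planar derivatives.\<close>

definition transversal :: "(complex^'n \<Rightarrow> real) \<Rightarrow> bool" where
  "transversal \<eta> \<longleftrightarrow> tame k \<eta> \<and> (\<forall>v. planar v \<longrightarrow> line_deriv k v \<eta> (\<lambda>_. 0))"

lemma q1_planar: "planar v \<Longrightarrow> q1 v x = 0" "planar v \<Longrightarrow> q1 x v = 0"
  by (auto simp: planar_def q1_def intro!: sum.neutral)

lemma transversal_q: "transversal q"
  unfolding transversal_def
proof (intro conjI tame_q allI impI)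
  fix v assume "planar v"
  then show "line_deriv k v q (\<lambda>_. 0)"
    using DERIV_q[of _ v] by (simp add: line_deriv_def q1_planar)
qed

lemma transversal_q1: "transversal (q1 w)"
  unfolding transversal_def
proof (intro conjI tame_q1 allI impI)
  fix v assume "planar v"
  then show "line_deriv k v (q1 w) (\<lambda>_. 0)"
    using DERIV_q1[of w _ v] by (simp add: line_deriv_def q1_planar)
qed

lemma transversal_second:
  assumes \<eta>: "transversal \<eta>" and v: "planar v" "planar w" and \<phi>: "vtest \<Omega> \<phi>"
  shows "pairing (\<lambda>x. \<eta> x * u x) (partial_deriv v (partial_deriv w \<phi>)) = pairing (\<lambda>x. \<eta> x * u2 v w x) \<phi>"
proof (rule pairing_by_parts2[OF _ _ _ _ _ \<phi>])
  have \<eta>': "tame k \<eta>" "line_deriv k v \<eta> (\<lambda>_. 0)" "line_deriv k w \<eta> (\<lambda>_. 0)"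
    using \<eta> v by (auto simp: transversal_def)
  show "mild k (\<lambda>x. \<eta> x * u x)" "mild k (\<lambda>x. \<eta> x * u1 v x)" "mild k (\<lambda>x. \<eta> x * u2 v w x)"
    by (intro mild_mult_tame \<eta>' mild_u1 mild_u2 mild_of_tame[OF tame_u])+
  show "line_deriv k v (\<lambda>x. \<eta> x * u x) (\<lambda>x. \<eta> x * u1 v x)"
    using line_deriv_mult[OF \<eta>'(2) line_deriv_u[of v]] by (simp add: mult.commute)
  show "line_deriv k w (\<lambda>x. \<eta> x * u1 v x) (\<lambda>x. \<eta> x * u2 v w x)"
    using line_deriv_mult[OF \<eta>'(3) line_deriv_u1[of w v]] by (simp add: mult.commute)
qed

text \<open>The form with coefficients \<open>tau\<close> is closed, also after multiplication by a function of the
  remaining coordinates. Only \<open>u\<close> itself is differentiated under the integral: the third derivatives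
  of \<open>u\<close> are not locally integrable.\<close>

lemma tau_closed:
  assumes \<eta>: "transversal \<eta>" and v: "planar v1" "planar v2" "planar v3" and \<phi>: "vtest \<Omega> \<phi>"
    and K: "K = (\<lambda>v. v) \<or> K = (\<lambda>v. \<i> *s v)"
  shows "pairing (\<lambda>x. \<eta> x * tau v1 v2 x) (partial_deriv (K v3) \<phi>) - pairing (\<lambda>x. \<eta> x * tau v1 v3 x) (partial_deriv (K v2) \<phi>)
    + pairing (\<lambda>x. \<eta> x * tau v2 v3 x) (partial_deriv (K v1) \<phi>) = 0"
proof -
  \<comment> \<open>With all three derivatives on the smooth \<open>\<phi>\<close>, closedness is
    the pairwise cancellation of commuting derivatives.\<close>
  define P where "P a b c = pairing (\<lambda>x. \<eta> x * u x) (partial_deriv a (partial_deriv b (partial_deriv c \<phi>)))" for a b c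
  have P1: "P a b c = P b a c" for a b c
    unfolding P_def by (rule pairing_commute[OF vtest_partial_deriv[OF \<phi>]])
  have P2: "P a b c = P a c b" for a b c
    unfolding P_def using smooth_partial_deriv_commute[OF vtest_smooth[OF \<phi>]] by simp
  have "mild k (\<lambda>x. \<eta> x * u2 v w x)" for v w
    using \<eta> by (auto simp: transversal_def intro: mild_mult_tame mild_u2)
  then have *: "pairing (\<lambda>x. \<eta> x * tau a b x) (partial_deriv c \<phi>) = P b (\<i> *s a) c - P a (\<i> *s b) c"
    if "planar a" "planar b" for a b c
    using transversal_second[OF \<eta> that(2) planar_J[OF that(1)] vtest_partial_deriv[OF \<phi>]]
      transversal_second[OF \<eta> that(1) planar_J[OF that(2)] vtest_partial_deriv[OF \<phi>]]
      pairing_diff[OF _ _ vtest_partial_deriv[OF \<phi>]]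
    by (simp add: P_def tau_def right_diff_distrib)
  from K show ?thesis
  proof
    assume K: "K = (\<lambda>v. v)"
    have "P v2 (\<i> *s v1) v3 = P v3 (\<i> *s v1) v2" "P v1 (\<i> *s v2) v3 = P v3 (\<i> *s v2) v1"
      "P v1 (\<i> *s v3) v2 = P v2 (\<i> *s v3) v1"
      by (metis P1 P2)+
    then show ?thesis using v by (simp add: * K)
  next
    \<comment> \<open>This case is closedness under d^c.\<close>
    assume K: "K = (\<lambda>v. \<i> *s v)"
    show ?thesis
      using v P2[of v2 "\<i> *s v1" "\<i> *s v3"] P2[of v1 "\<i> *s v2" "\<i> *s v3"] P2[of v3 "\<i> *s v1" "\<i> *s v2"]
      by (simp add: * K)
  qed
qed

section \<open>Derivatives in the remaining coordinates\<close>

text \<open>In normal directions the derivative of \<open>u\<close> is the linear function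
  \<open>q1 v\<close>, so differentiating \<open>u x * c x\<close> costs no integrability as long as
  \<open>c\<close> is constant in these directions.\<close>

lemma normal_second:
  assumes c: "mild k c" "line_deriv k v c (\<lambda>_. 0)" "line_deriv k w c (\<lambda>_. 0)"
    and v: "normal v" and \<phi>: "vtest \<Omega> \<phi>"
  shows "pairing (\<lambda>x. u x * c x) (partial_deriv v \<phi>) = - pairing (\<lambda>x. q1 v x * c x) \<phi>"
    and "pairing (\<lambda>x. u x * c x) (partial_deriv v (partial_deriv w \<phi>)) = q1 v w *\<^sub>R pairing c \<phi>"
proof -
  have m: "mild k (\<lambda>x. u x * c x)" "mild k (\<lambda>x. q1 v x * c x)" "mild k (\<lambda>x. q1 v w * c x)"
    by (intro mild_mult_tame tame_u tame_q1 tame_const c)+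
  have l1: "line_deriv k v (\<lambda>x. u x * c x) (\<lambda>x. q1 v x * c x)"
    using line_deriv_mult[OF line_deriv_u[of v] c(2)] by (simp add: normal_u1[OF v])
  have "line_deriv k w (q1 v) (\<lambda>_. q1 v w)" by (simp add: line_deriv_def DERIV_q1)
  from line_deriv_mult[OF this c(3)]
  have l2: "line_deriv k w (\<lambda>x. q1 v x * c x) (\<lambda>x. q1 v w * c x)" by simp
  show "pairing (\<lambda>x. u x * c x) (partial_deriv v \<phi>) = - pairing (\<lambda>x. q1 v x * c x) \<phi>"
    by (rule pairing_by_parts[OF m(1,2) l1 \<phi>])
  show "pairing (\<lambda>x. u x * c x) (partial_deriv v (partial_deriv w \<phi>)) = q1 v w *\<^sub>R pairing c \<phi>"
    using pairing_by_parts2[OF m l1 l2 \<phi>] by (simp add: pairing_cmult)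
qed

text \<open>dd^c of the squared modulus of one coordinate is 4 times its area form, and different
  coordinates do not interact. The minus sign is that of \<open>ddc_eq\<close>.\<close>

lemma normal_frame:
  fixes \<psi> :: "(complex^'n) form"
  assumes c: "mild k c" "\<And>v. normal v \<Longrightarrow> line_deriv k v c (\<lambda>_. 0)"
    and \<psi>: "test_form \<Omega> l \<psi>" and js: "distinct js" "set js \<subseteq> - {k, m}" and l: "length pre + 2 * length js = l + 2"
  shows "alt_sum2 (\<lambda>v w r. pairing (\<lambda>x. u x * c x) (partial_deriv v (partial_deriv (\<i> *s w) (\<lambda>y. \<psi> y (pre @ r))))) (frame js)
    = - 4 * (\<Sum>i\<in>set js. pairing c (\<lambda>x. \<psi> x (pre @ frame (remove1 i js))))"
proof -
  define E where "E v w r = pairing (\<lambda>x. u x * c x) (partial_deriv v (partial_deriv (\<i> *s w) (\<lambda>y. \<psi> y (pre @ r))))" for v w r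
  have E: "E v w r = q1 v (\<i> *s w) *\<^sub>R pairing c (\<lambda>x. \<psi> x (pre @ r))"
    if "normal v" "normal w" "Suc (Suc (length r)) = 2 * length js" for v w r
    unfolding E_def by (rule normal_second(2)[OF c(1) c(2) c(2) _ test_form_vtest[OF \<psi>]]) (use that l in \<open>auto intro: normal_J\<close>)
  have nj: "normal (axis i z)" if "i \<in> set js" for i z using that js by (intro normal_axis) auto
  have "alt_sum2 E (frame js) = (\<Sum>i\<in>set js. E (axis i 1) (axis i \<i>) (frame (remove1 i js)) - E (axis i \<i>) (axis i 1) (frame (remove1 i js)))"
  proof (rule alt_sum2_frame[OF js(1)])
    fix i j v w and r :: "(complex^'n) list"
    assume ij: "i \<in> set js" "j \<in> set js" "i \<noteq> j" "v \<in> {axis i 1, axis i \<i>}" "w \<in> {axis j 1, axis j \<i>}"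
      and r: "Suc (Suc (length r)) = length (frame js)"
    have "normal v" "normal w" using ij nj by auto
    moreover have "q1 v (\<i> *s w) = 0"
      using ij by (auto simp: q1_def axis_def intro!: sum.neutral split: if_splits)
    ultimately show "E v w r = 0" using r by (simp add: E)
  qed
  also have "\<dots> = (\<Sum>i\<in>set js. - 4 * pairing c (\<lambda>x. \<psi> x (pre @ frame (remove1 i js))))"
  proof (rule sum.cong[OF refl])
    fix i assume i: "i \<in> set js"
    then have im: "i \<noteq> k" "i \<noteq> m" using js by auto
    have len: "Suc (Suc (length (frame (remove1 i js)))) = 2 * length js"
    proof -
      have "length js > 0" using i by (cases js) auto
      moreover have "length (remove1 i js) = length js - 1" using i by (simp add: length_remove1)
      ultimately show ?thesis unfolding length_frame by arith
    qed
    have sm: "(\<Sum>j\<in>- {k, m}. (axis i z :: complex^'n) $ j \<bullet> axis i z' $ j) = z \<bullet> z'" for z z'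
    proof -
      have "(\<Sum>j\<in>- {k, m}. (axis i z :: complex^'n) $ j \<bullet> axis i z' $ j) = (\<Sum>j\<in>- {k, m}. if j = i then z \<bullet> z' else 0)"
        by (intro sum.cong) (auto simp: axis_def)
      then show ?thesis using im by simp
    qed
    have "q1 (axis i 1) (\<i> *s axis i \<i>) = - 2" "q1 (axis i \<i>) (\<i> *s axis i 1) = 2"
      unfolding J_axis q1_def by (simp_all add: sum_negf sm)
    then show "E (axis i 1) (axis i \<i>) (frame (remove1 i js)) - E (axis i \<i>) (axis i 1) (frame (remove1 i js))
      = - 4 * pairing c (\<lambda>x. \<psi> x (pre @ frame (remove1 i js)))"
      by (simp add: E[OF nj[OF i] nj[OF i] len] scaleR_conv_of_real)
  qed
  finally show ?thesis unfolding E_def by (simp only: sum_distrib_left)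
qed

section \<open>The first power of dd$^c$ u\<close>

text \<open>The wedge product of the planar part of dd^c u with a two-form: the terms are the six
  ways to split \<open>vX\<close>, \<open>vY\<close>, \<open>vS\<close>, \<open>vT\<close> into two
  ordered pairs, with the signs of these shuffles.\<close>

definition mixed :: "((complex^'n) list \<Rightarrow> (complex^'n \<Rightarrow> complex)) \<Rightarrow> (complex^'n) list \<Rightarrow> complex" where
  "mixed \<psi> vs = pairing (tau vX vY) (\<psi> (vS # vT # vs)) + pairing (tau vS vT) (\<psi> (vX # vY # vs))
    - pairing (tau vX vS) (\<psi> (vY # vT # vs)) - pairing (tau vY vT) (\<psi> (vX # vS # vs))
    + pairing (tau vX vT) (\<psi> (vY # vS # vs)) + pairing (tau vY vS) (\<psi> (vX # vT # vs))"

text \<open>The two vectors that differentiate are either both planar, which gives the six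
  \<open>tau\<close> terms, or one pair of \<open>frame js\<close>, which gives a factor 4. One
  planar and one normal vector give nothing.\<close>

lemma u_ddc_full:
  fixes \<psi> :: "(complex^'n) form"
  assumes \<psi>: "test_form \<Omega> l \<psi>" and js: "distinct js" "set js \<subseteq> - {k, m}" and l: "4 + 2 * length js = l + 2"
  shows "pairing u (\<lambda>x. form_d (form_dc \<psi>) x ([vX, vY, vS, vT] @ frame js))
    = mixed (\<lambda>r x. \<psi> x r) (frame js) + 4 * (\<Sum>i\<in>set js. pairing (\<lambda>_. 1) (\<lambda>x. \<psi> x ([vX, vY, vS, vT] @ frame (remove1 i js))))"
proof -
  let ?F = "frame js"
  define E where "E v w r = pairing u (partial_deriv v (partial_deriv (\<i> *s w) (\<lambda>y. \<psi> y r)))" for v w r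
  have E: "E v w r = pairing (u2 v (\<i> *s w)) (\<lambda>x. \<psi> x r)" if "length r = l" for v w r
    unfolding E_def
    by (rule pairing_by_parts2[OF mild_of_tame[OF tame_u] mild_u1 mild_u2 line_deriv_u line_deriv_u1 test_form_vtest[OF \<psi> that]])
  have EE: "E w v r - E v w r = pairing (tau v w) (\<lambda>x. \<psi> x r)" if "length r = l" for v w r
    unfolding E[OF that] tau_def[abs_def]
    by (rule pairing_diff[OF mild_u2 mild_u2 test_form_vtest[OF \<psi> that], symmetric])
  have nF: "normal b" if "b \<in> set ?F" for b
    using that js by (auto simp: set_frame intro!: normal_axis)
  have E0: "E b v r = 0" "E v b r = 0" if "b \<in> set ?F" "planar v" "length r = l" for b v r
    using normal_planar_u2[OF nF[OF that(1)] planar_J[OF that(2)]] normal_planar_u2[OF normal_J[OF nF[OF that(1)]] that(2)]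
    by (simp_all add: E[OF that(3)] pairing_def)
  have cross: "alt_sum (\<lambda>b r. E b v (pre @ r) - E v b (pre @ r)) ?F = 0" if "planar v" "length pre = 3" for v pre
  proof -
    have "alt_sum (\<lambda>b r. E b v (pre @ r) - E v b (pre @ r)) ?F = alt_sum (\<lambda>b r. 0) ?F"
      by (rule alt_sum_cong) (use that l in \<open>simp add: E0\<close>)
    then show ?thesis by simp
  qed
  have "pairing u (\<lambda>x. form_d (form_dc \<psi>) x (vX # vY # vS # vT # ?F)) = - alt_sum2 E (vX # vY # vS # vT # ?F)"
    unfolding pairing_def E_def[abs_def]
    by (rule integral_ddc[OF mild_of_tame[OF tame_u] \<psi>]) (use l in simp)
  also have "\<dots> = (E vY vX (vS # vT # ?F) - E vX vY (vS # vT # ?F))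
     - ((E vS vX (vY # vT # ?F) - E vX vS (vY # vT # ?F)) - (E vT vX (vY # vS # ?F) - E vX vT (vY # vS # ?F)))
     + ((E vS vY (vX # vT # ?F) - E vY vS (vX # vT # ?F)) - (E vT vY (vX # vS # ?F) - E vY vT (vX # vS # ?F)))
     + (E vT vS (vX # vY # ?F) - E vS vT (vX # vY # ?F))
     - alt_sum2 (\<lambda>v w r. E v w ([vX, vY, vS, vT] @ r)) ?F"
    unfolding alt_sum2_Cons_Cons
    using cross[OF planar_axes(1), of "[vY, vS, vT]"] cross[OF planar_axes(2), of "[vX, vS, vT]"]
      cross[OF planar_axes(3), of "[vX, vY, vT]"] cross[OF planar_axes(4), of "[vX, vY, vS]"]
    by (simp add: algebra_simps)
  also have "alt_sum2 (\<lambda>v w r. E v w ([vX, vY, vS, vT] @ r)) ?F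
      = - 4 * (\<Sum>i\<in>set js. pairing (\<lambda>_. 1) (\<lambda>x. \<psi> x ([vX, vY, vS, vT] @ frame (remove1 i js))))"
    using normal_frame[of "\<lambda>_. 1" l \<psi> js "[vX, vY, vS, vT]"] \<psi> js l
    by (simp add: E_def mild_of_tame tame_const line_deriv_const)
  finally show ?thesis
    using l by (simp add: mixed_def EE)
qed

section \<open>The second power of dd$^c$ u\<close>

definition uU :: "complex^'n \<Rightarrow> real" where "uU x = 2 * (s x)\<^sup>2 * a x + b x"

lemma u_split: "u x = q x + uU x" by (simp add: u_def uU_def)

lemma tame_uU: "tame k uU"
  unfolding uU_def[abs_def] by (intro tame_intros tame_s tame_a tame_b)

definition lap_a :: "complex^'n \<Rightarrow> real" where "lap_a x = a2 vX vX x + a2 vY vY x"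
definition lap_b :: "complex^'n \<Rightarrow> real" where "lap_b x = b2 vX vX x + b2 vY vY x"

text \<open>The equations for \<open>a\<close> and \<open>b\<close> in real form, the Laplacian in
  \<open>z\<close> being four times the mixed complex derivative.\<close>

lemma lap_facts:
  assumes x: "x \<in> \<Omega>" "x $ k \<noteq> 0"
  shows "a x * lap_a x = 2 * ((a1 vX x)\<^sup>2 + (a1 vY x)\<^sup>2)" "a x * lap_b x = 4"
proof -
  have pos: "0 < R x" "0 < L x" using R_pos[OF x] L_pos[OF x] by auto
  have pp: "(p vX x)\<^sup>2 + (p vY x)\<^sup>2 = R x"
    by (simp add: p_def R_def complex_inner_1_right complex_inner_i_right cmod_power2)
  have "a x * lap_a x = 4 / (R x * (L x) ^ 3) - 4 * ((p vX x)\<^sup>2 + (p vY x)\<^sup>2) / ((R x)\<^sup>2 * (L x) ^ 3)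
      + 8 * ((p vX x)\<^sup>2 + (p vY x)\<^sup>2) / ((R x)\<^sup>2 * (L x) ^ 4)"
    unfolding lap_a_def a_def a2_def
    by (simp add: power2_eq_square power3_eq_cube power4_eq_xxxx add_divide_distrib algebra_simps)
  also have "\<dots> = 8 / (R x * (L x) ^ 4)"
    unfolding pp using pos by (simp add: power2_eq_square)
  finally have 1: "a x * lap_a x = 8 / (R x * (L x) ^ 4)" .
  have "2 * ((a1 vX x)\<^sup>2 + (a1 vY x)\<^sup>2) = 8 * ((p vX x)\<^sup>2 + (p vY x)\<^sup>2) / ((R x)\<^sup>2 * (L x) ^ 4)"
    unfolding a1_def by (simp add: power_divide power_mult_distrib add_divide_distrib algebra_simps flip: power_mult)
  also have "\<dots> = 8 / (R x * (L x) ^ 4)" unfolding pp using pos by (simp add: power2_eq_square)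
  finally show "a x * lap_a x = 2 * ((a1 vX x)\<^sup>2 + (a1 vY x)\<^sup>2)" using 1 by simp
  have "lap_b x = 4 * (1 + L x) - 4 * ((p vX x)\<^sup>2 + (p vY x)\<^sup>2) / R x"
    unfolding lap_b_def b2_def by (simp add: power2_eq_square add_divide_distrib algebra_simps)
  then show "a x * lap_b x = 4" unfolding pp using pos by (simp add: a_def algebra_simps)
qed

lemma mild_laps: "mild k lap_a" "mild k lap_b"
  unfolding lap_a_def[abs_def] lap_b_def[abs_def] by (intro mild_add mild_a2 mild_b2)+

lemma axis_values: "s vX = 0" "s vY = 0" "s vS = 1" "s vT = 0" "vS $ k = 0" "vT $ k = 0"
  "vX $ k = 1" "vY $ k = \<i>" "vX $ m = 0" "vY $ m = 0" "p vS x = 0" "p vT x = 0"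
  using km by (auto simp: s_def p_def axis_def)

lemma q1_axis_values: "q1 vX w = 0" "q1 vY w = 0" "q1 vS w = 0" "q1 vT w = 0"
  by (intro q1_planar planar_axes)+

lemma tau_values:
  "tau vX vY x = 2 * (s x)\<^sup>2 * lap_a x + lap_b x" "tau vS vT x = 4 * a x"
  "tau vX vS x = 4 * s x * a1 vY x" "tau vY vT x = 4 * s x * a1 vY x"
  "tau vX vT x = 4 * s x * a1 vX x" "tau vY vS x = - (4 * s x * a1 vX x)"
  unfolding tau_def J_axis u2_uminus
  by (simp_all add: u2_def axis_values q1_axis_values lap_a_def lap_b_def a2_def b2_def a1_def algebra_simps)

lemma lap_shift: "v $ k = 0 \<Longrightarrow> lap_a (x + t *\<^sub>R v) = lap_a x" "v $ k = 0 \<Longrightarrow> lap_b (x + t *\<^sub>R v) = lap_b x"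
  by (simp_all add: lap_a_def lap_b_def shifts)

text \<open>The coefficient is \<open>4 * a x * uU x\<close>. Two derivatives in \<open>z\<close>
  produce at worst \<open>a1 * a1\<close>, or one of \<open>a2\<close> and \<open>b2\<close> with
  locally bounded factors, so they can be moved back from the test function.\<close>

lemma pairing_XX:
  assumes v: "s v = 0" and \<phi>: "vtest \<Omega> \<phi>"
  shows "pairing (\<lambda>x. uU x * tau vS vT x) (partial_deriv v (partial_deriv v \<phi>))
    = pairing (\<lambda>x. 16 * (s x)\<^sup>2 * (a1 v x * a1 v x) + 16 * (s x)\<^sup>2 * a x * a2 v v x
        + 4 * b x * a2 v v x + 8 * b1 v x * a1 v x + 4 * a x * b2 v v x) \<phi>"
proof (rule pairing_by_parts2[where g = "\<lambda>x. 16 * (s x)\<^sup>2 * a x * a1 v x + 4 * b x * a1 v x + 4 * a x * b1 v x", OF _ _ _ _ _ \<phi>])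
  show "mild k (\<lambda>x. uU x * tau vS vT x)"
    by (intro mild_mult_tame tame_uU mild_tau)
  show "mild k (\<lambda>x. 16 * (s x)\<^sup>2 * a x * a1 v x + 4 * b x * a1 v x + 4 * a x * b1 v x)"
    by (intro mild_add mild_mult_tame[OF _ mild_a1] mild_of_tame[of "\<lambda>x. 4 * a x * b1 v x"] tame_intros tame_s tame_a tame_b tame_b1)
  show "mild k (\<lambda>x. 16 * (s x)\<^sup>2 * (a1 v x * a1 v x) + 16 * (s x)\<^sup>2 * a x * a2 v v x
        + 4 * b x * a2 v v x + 8 * b1 v x * a1 v x + 4 * a x * b2 v v x)"
    by (intro mild_add mild_mult_tame[OF _ mild_a1] mild_mult_tame[OF _ mild_a2] mild_mult_tame[OF _ mild_b2]
        mild_mult_tame[OF _ mild_a1_a1] tame_intros tame_s tame_a tame_b tame_b1)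
  have eq: "uU x * tau vS vT x = 8 * (s x)\<^sup>2 * (a x)\<^sup>2 + 4 * a x * b x" for x
    by (simp add: uU_def tau_values power2_eq_square algebra_simps)
  show "line_deriv k v (\<lambda>x. uU x * tau vS vT x) (\<lambda>x. 16 * (s x)\<^sup>2 * a x * a1 v x + 4 * b x * a1 v x + 4 * a x * b1 v x)"
    unfolding line_deriv_def eq using line_deriv_a[of v] line_deriv_b[of v] v
    by (auto simp: line_deriv_def s_line algebra_simps intro!: derivative_eq_intros)
  show "line_deriv k v (\<lambda>x. 16 * (s x)\<^sup>2 * a x * a1 v x + 4 * b x * a1 v x + 4 * a x * b1 v x)
     (\<lambda>x. 16 * (s x)\<^sup>2 * (a1 v x * a1 v x) + 16 * (s x)\<^sup>2 * a x * a2 v v x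
        + 4 * b x * a2 v v x + 8 * b1 v x * a1 v x + 4 * a x * b2 v v x)"
    unfolding line_deriv_def using line_deriv_a[of v] line_deriv_b[of v] line_deriv_a1[of v v] line_deriv_b1[of v v] v
    by (auto simp: line_deriv_def s_line algebra_simps intro!: derivative_eq_intros)
qed

text \<open>The coefficient already contains \<open>a1\<close>, but only one further derivative
  falls on the singular variable, so the result is again within the weight.\<close>

lemma pairing_SX:
  assumes v: "s v = 0" and \<phi>: "vtest \<Omega> \<phi>"
  shows "pairing (\<lambda>x. uU x * (4 * s x * a1 v x)) (partial_deriv vS (partial_deriv v \<phi>))
    = pairing (\<lambda>x. 24 * (s x)\<^sup>2 * (a1 v x * a1 v x) + 24 * (s x)\<^sup>2 * a x * a2 v v x
        + 4 * b1 v x * a1 v x + 4 * b x * a2 v v x) \<phi>"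
proof (rule pairing_by_parts2[where g = "\<lambda>x. 24 * (s x)\<^sup>2 * a x * a1 v x + 4 * b x * a1 v x", OF _ _ _ _ _ \<phi>])
  show "mild k (\<lambda>x. uU x * (4 * s x * a1 v x))"
    by (intro mild_mult_tame[of _ _ "\<lambda>x. 4 * s x * a1 v x"] mild_mult_tame[OF _ mild_a1] tame_intros tame_s tame_uU)
  show "mild k (\<lambda>x. 24 * (s x)\<^sup>2 * a x * a1 v x + 4 * b x * a1 v x)"
    by (intro mild_add mild_mult_tame[OF _ mild_a1] tame_intros tame_s tame_a tame_b)
  show "mild k (\<lambda>x. 24 * (s x)\<^sup>2 * (a1 v x * a1 v x) + 24 * (s x)\<^sup>2 * a x * a2 v v x
        + 4 * b1 v x * a1 v x + 4 * b x * a2 v v x)"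
    by (intro mild_add mild_mult_tame[OF _ mild_a1] mild_mult_tame[OF _ mild_a2]
        mild_mult_tame[OF _ mild_a1_a1] tame_intros tame_s tame_a tame_b tame_b1)
  show "line_deriv k vS (\<lambda>x. uU x * (4 * s x * a1 v x)) (\<lambda>x. 24 * (s x)\<^sup>2 * a x * a1 v x + 4 * b x * a1 v x)"
    unfolding line_deriv_def uU_def
    by (auto simp: s_line shifts axis_values algebra_simps power2_eq_square intro!: derivative_eq_intros)
  show "line_deriv k v (\<lambda>x. 24 * (s x)\<^sup>2 * a x * a1 v x + 4 * b x * a1 v x)
     (\<lambda>x. 24 * (s x)\<^sup>2 * (a1 v x * a1 v x) + 24 * (s x)\<^sup>2 * a x * a2 v v x
        + 4 * b1 v x * a1 v x + 4 * b x * a2 v v x)"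
    unfolding line_deriv_def using line_deriv_a[of v] line_deriv_b[of v] line_deriv_a1[of v v] v
    by (auto simp: line_deriv_def s_line algebra_simps intro!: derivative_eq_intros)
qed

text \<open>The coefficient contains second derivatives in \<open>z\<close>, but both derivatives
  fall on powers of \<open>s\<close>.\<close>

lemma pairing_SS:
  assumes \<phi>: "vtest \<Omega> \<phi>"
  shows "pairing (\<lambda>x. uU x * tau vX vY x) (partial_deriv vS (partial_deriv vS \<phi>))
    = pairing (\<lambda>x. 48 * (s x)\<^sup>2 * a x * lap_a x + 4 * b x * lap_a x + 4 * a x * lap_b x) \<phi>"
proof (rule pairing_by_parts2[where g = "\<lambda>x. 16 * (s x) ^ 3 * a x * lap_a x + 4 * s x * b x * lap_a x + 4 * s x * a x * lap_b x", OF _ _ _ _ _ \<phi>])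
  show "mild k (\<lambda>x. uU x * tau vX vY x)"
    by (intro mild_mult_tame tame_uU mild_tau)
  show "mild k (\<lambda>x. 16 * (s x) ^ 3 * a x * lap_a x + 4 * s x * b x * lap_a x + 4 * s x * a x * lap_b x)"
    by (intro mild_add mild_mult_tame[OF _ mild_laps(1)] mild_mult_tame[OF _ mild_laps(2)] tame_intros tame_s tame_a tame_b)
  show "mild k (\<lambda>x. 48 * (s x)\<^sup>2 * a x * lap_a x + 4 * b x * lap_a x + 4 * a x * lap_b x)"
    by (intro mild_add mild_mult_tame[OF _ mild_laps(1)] mild_mult_tame[OF _ mild_laps(2)] tame_intros tame_s tame_a tame_b)
  have eq: "uU x * tau vX vY x = 4 * (s x) ^ 4 * a x * lap_a x + 2 * (s x)\<^sup>2 * a x * lap_b x + 2 * (s x)\<^sup>2 * b x * lap_a x + b x * lap_b x" for x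
    by (simp add: uU_def tau_values power2_eq_square power4_eq_xxxx algebra_simps)
  show "line_deriv k vS (\<lambda>x. uU x * tau vX vY x) (\<lambda>x. 16 * (s x) ^ 3 * a x * lap_a x + 4 * s x * b x * lap_a x + 4 * s x * a x * lap_b x)"
    unfolding line_deriv_def eq
    by (auto simp: s_line shifts lap_shift axis_values algebra_simps intro!: derivative_eq_intros)
  show "line_deriv k vS (\<lambda>x. 16 * (s x) ^ 3 * a x * lap_a x + 4 * s x * b x * lap_a x + 4 * s x * a x * lap_b x)
     (\<lambda>x. 48 * (s x)\<^sup>2 * a x * lap_a x + 4 * b x * lap_a x + 4 * a x * lap_b x)"
    unfolding line_deriv_def
    by (auto simp: s_line shifts lap_shift axis_values algebra_simps intro!: derivative_eq_intros)
qed

lemma uU_shift_T: "uU (x + t *\<^sub>R vT) = uU x"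
  by (simp add: uU_def s_line shifts axis_values)

text \<open>\<open>u\<close> depends on the coordinate \<open>m\<close> through its real part
  only.\<close>

lemma pairing_T:
  assumes \<phi>: "vtest \<Omega> \<phi>"
  shows "pairing (\<lambda>x. uU x * tau v w x) (partial_deriv vT \<phi>) = 0"
proof (rule pairing_constant_direction[OF _ _ \<phi>])
  show "mild k (\<lambda>x. uU x * tau v w x)" by (intro mild_mult_tame tame_uU mild_tau)
  show "line_deriv k vT (\<lambda>x. uU x * tau v w x) (\<lambda>_. 0)"
    by (simp add: line_deriv_def uU_shift_T tau_def u2_shift axis_values)
qed

text \<open>\<open>c\<close> paired with the value of dd^c \<phi> on \<open>(v, w)\<close>.\<close>

definition ddc_pairing :: "(complex^'n \<Rightarrow> real) \<Rightarrow> complex^'n \<Rightarrow> complex^'n \<Rightarrow> (complex^'n \<Rightarrow> complex) \<Rightarrow> complex" where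
  "ddc_pairing c v w \<phi> = pairing c (partial_deriv w (partial_deriv (\<i> *s v) \<phi>)) - pairing c (partial_deriv v (partial_deriv (\<i> *s w) \<phi>))"

text \<open>The planar part of dd^c u, multiplied by \<open>c\<close> and wedged with dd^c \<phi>;
  the terms and signs are those of \<open>mixed\<close>.\<close>

definition wedge_pairing :: "(complex^'n \<Rightarrow> real) \<Rightarrow> (complex^'n \<Rightarrow> complex) \<Rightarrow> complex" where
  "wedge_pairing c \<phi> = ddc_pairing (\<lambda>x. c x * tau vX vY x) vS vT \<phi> + ddc_pairing (\<lambda>x. c x * tau vS vT x) vX vY \<phi>
    - ddc_pairing (\<lambda>x. c x * tau vX vS x) vY vT \<phi> - ddc_pairing (\<lambda>x. c x * tau vY vT x) vX vS \<phi>
    + ddc_pairing (\<lambda>x. c x * tau vX vT x) vY vS \<phi> + ddc_pairing (\<lambda>x. c x * tau vY vS x) vX vT \<phi>"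

text \<open>The Monge-Ampere equation in the two special coordinates, with
  \<open>32 = 4\<^sup>2 * 2!\<close>. After integration by parts the coefficient of
  \<open>(s x)\<^sup>2\<close> is \<open>16 * (a * lap_a) - 32 * ((a1 vX)\<^sup>2 + (a1 vY)\<^sup>2)
  = 0\<close>, the terms with \<open>b * lap_a\<close> and \<open>b1 * a1\<close> cancel, and
  \<open>8 * (a * lap_b)\<close> is 32.\<close>

lemma wedge_pairing_uU:
  assumes \<phi>: "vtest \<Omega> \<phi>"
  shows "wedge_pairing uU \<phi> = 32 * pairing (\<lambda>_. 1) \<phi>"
proof -
  note T0 = pairing_T[OF vtest_partial_deriv[OF \<phi>]]
  have T0': "pairing (\<lambda>x. uU x * tau v w x) (partial_deriv w' (partial_deriv vT \<phi>)) = 0" for v w w'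
    using T0 pairing_commute[OF \<phi>] by metis
  have "wedge_pairing uU \<phi> = pairing (\<lambda>x. uU x * tau vX vY x) (partial_deriv vS (partial_deriv vS \<phi>))
     + pairing (\<lambda>x. uU x * tau vS vT x) (partial_deriv vX (partial_deriv vX \<phi>))
     + pairing (\<lambda>x. uU x * tau vS vT x) (partial_deriv vY (partial_deriv vY \<phi>))
     - 2 * pairing (\<lambda>x. uU x * (4 * s x * a1 vY x)) (partial_deriv vS (partial_deriv vY \<phi>))
     - 2 * pairing (\<lambda>x. uU x * (4 * s x * a1 vX x)) (partial_deriv vS (partial_deriv vX \<phi>))"
    unfolding wedge_pairing_def ddc_pairing_def J_axis pairing_uminus_direction[OF \<phi>] T0 T0'
    using pairing_commute[OF \<phi>, of _ vY vS] pairing_commute[OF \<phi>, of _ vX vS]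
    by (simp add: tau_values(3-6) pairing_uminus)
  also have "\<dots> = pairing (\<lambda>x. 32) \<phi>"
  proof -
    define f1 where "f1 x = 48 * (s x)\<^sup>2 * a x * lap_a x + 4 * b x * lap_a x + 4 * a x * lap_b x" for x
    define f2 where "f2 v x = 16 * (s x)\<^sup>2 * (a1 v x * a1 v x) + 16 * (s x)\<^sup>2 * a x * a2 v v x
        + 4 * b x * a2 v v x + 8 * b1 v x * a1 v x + 4 * a x * b2 v v x" for v x
    define f3 where "f3 v x = 24 * (s x)\<^sup>2 * (a1 v x * a1 v x) + 24 * (s x)\<^sup>2 * a x * a2 v v x
        + 4 * b1 v x * a1 v x + 4 * b x * a2 v v x" for v x
    have m1: "mild k f1" unfolding f1_def[abs_def]
      by (intro mild_add mild_mult_tame[OF _ mild_laps(1)] mild_mult_tame[OF _ mild_laps(2)] tame_intros tame_s tame_a tame_b)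
    have m2: "mild k (f2 v)" for v unfolding f2_def[abs_def]
      by (intro mild_add mild_mult_tame[OF _ mild_a1] mild_mult_tame[OF _ mild_a2] mild_mult_tame[OF _ mild_b2]
        mild_mult_tame[OF _ mild_a1_a1] tame_intros tame_s tame_a tame_b tame_b1)
    have m3: "mild k (f3 v)" for v unfolding f3_def[abs_def]
      by (intro mild_add mild_mult_tame[OF _ mild_a1] mild_mult_tame[OF _ mild_a2]
        mild_mult_tame[OF _ mild_a1_a1] tame_intros tame_s tame_a tame_b tame_b1)
    define F where "F x = f1 x + f2 vX x + f2 vY x - 2 * f3 vY x - 2 * f3 vX x" for x
    have "pairing F \<phi> = pairing f1 \<phi> + pairing (f2 vX) \<phi> + pairing (f2 vY) \<phi> - 2 * pairing (f3 vY) \<phi> - 2 * pairing (f3 vX) \<phi>"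
      unfolding F_def[abs_def]
      by (simp add: pairing_add[OF _ _ \<phi>] pairing_diff[OF _ _ \<phi>] pairing_cmult mild_add mild_diff mild_cmult m1 m2 m3 scaleR_conv_of_real)
    moreover have "pairing F \<phi> = pairing (\<lambda>x. 32) \<phi>"
    proof (rule pairing_cong[OF _ _ \<phi>])
      show "F \<in> borel_measurable borel"
        unfolding F_def[abs_def] using mild_borel[OF m1] mild_borel[OF m2] mild_borel[OF m3] by measurable
      fix x assume x: "x \<in> \<Omega>" "x $ k \<noteq> 0"
      have "F x = (s x)\<^sup>2 * (16 * (a x * lap_a x) - 32 * ((a1 vX x)\<^sup>2 + (a1 vY x)\<^sup>2)) + 8 * (a x * lap_b x)"
        unfolding F_def f1_def f2_def f3_def lap_a_def lap_b_def by (simp add: power2_eq_square algebra_simps)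
      then show "F x = 32" unfolding lap_facts[OF x] by simp
    qed simp
    ultimately show ?thesis
      unfolding pairing_SS[OF \<phi>] pairing_XX[OF axis_values(1) \<phi>] pairing_XX[OF axis_values(2) \<phi>]
        pairing_SX[OF axis_values(1) \<phi>] pairing_SX[OF axis_values(2) \<phi>] f1_def f2_def f3_def by simp
  qed
  also have "\<dots> = 32 * pairing (\<lambda>_. 1) \<phi>"
    using pairing_cmult[of 32 "\<lambda>_. 1" \<phi>] by (simp add: scaleR_conv_of_real)
  finally show ?thesis .
qed

text \<open>dd^c \<phi> is the planar differential of d^c \<phi>, paired here with a form that is
  closed in the planar directions.\<close>

lemma wedge_pairing_transversal:
  assumes \<eta>: "transversal \<eta>" and \<phi>: "vtest \<Omega> \<phi>"
  shows "wedge_pairing \<eta> \<phi> = 0"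
  using tau_closed[OF \<eta> planar_axes(2,3,4) vtest_partial_deriv[OF \<phi>, of "\<i> *s vX"], of "\<lambda>v. v", OF disjI1[OF refl]]
    tau_closed[OF \<eta> planar_axes(1,3,4) vtest_partial_deriv[OF \<phi>, of "\<i> *s vY"], of "\<lambda>v. v", OF disjI1[OF refl]]
    tau_closed[OF \<eta> planar_axes(1,2,4) vtest_partial_deriv[OF \<phi>, of "\<i> *s vS"], of "\<lambda>v. v", OF disjI1[OF refl]]
    tau_closed[OF \<eta> planar_axes(1,2,3) vtest_partial_deriv[OF \<phi>, of "\<i> *s vT"], of "\<lambda>v. v", OF disjI1[OF refl]]
  unfolding wedge_pairing_def ddc_pairing_def by algebra

lemma wedge_pairing_u:
  assumes \<phi>: "vtest \<Omega> \<phi>"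
  shows "wedge_pairing u \<phi> = 32 * pairing (\<lambda>_. 1) \<phi>"
proof -
  have m: "mild k (\<lambda>x. q x * tau v w x)" "mild k (\<lambda>x. uU x * tau v w x)" for v w
    by (intro mild_mult_tame tame_q tame_uU mild_tau)+
  have "ddc_pairing (\<lambda>x. u x * tau v w x) v' w' \<phi> = ddc_pairing (\<lambda>x. q x * tau v w x) v' w' \<phi> + ddc_pairing (\<lambda>x. uU x * tau v w x) v' w' \<phi>"
    for v w v' w'
    unfolding ddc_pairing_def u_split distrib_right
    by (simp add: pairing_add[OF m vtest_partial_deriv[OF vtest_partial_deriv[OF \<phi>]]])
  then have "wedge_pairing u \<phi> = wedge_pairing q \<phi> + wedge_pairing uU \<phi>"
    unfolding wedge_pairing_def by (simp add: algebra_simps)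
  then show ?thesis
    using wedge_pairing_transversal[OF transversal_q \<phi>] wedge_pairing_uU[OF \<phi>] by simp
qed

text \<open>Two planar vectors give the square of the planar part, written \<open>2 * 16\<close>
  because 16 is the coefficient kept for the square and its two equal factors can be chosen in two
  orders. A pair from \<open>frame js\<close> again gives a factor 4. The cross terms do not vanish
  one by one, but only in sums.\<close>

lemma u_ddc_mixed:
  fixes \<psi> :: "(complex^'n) form"
  assumes \<psi>: "test_form \<Omega> l \<psi>" and js: "distinct js" "set js \<subseteq> - {k, m}" and l: "2 + 2 * length js = l + 2"
  defines "\<Psi> \<equiv> \<lambda>v w. \<lambda>x. form_d (form_dc \<psi>) x (v # w # frame js)"
  shows "pairing (\<lambda>x. u x * tau vX vY x) (\<Psi> vS vT) + pairing (\<lambda>x. u x * tau vS vT x) (\<Psi> vX vY)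
    - pairing (\<lambda>x. u x * tau vX vS x) (\<Psi> vY vT) - pairing (\<lambda>x. u x * tau vY vT x) (\<Psi> vX vS)
    + pairing (\<lambda>x. u x * tau vX vT x) (\<Psi> vY vS) + pairing (\<lambda>x. u x * tau vY vS x) (\<Psi> vX vT)
    = 2 * pairing (\<lambda>_. 16) (\<lambda>x. \<psi> x (frame js)) + 4 * (\<Sum>i\<in>set js. mixed (\<lambda>r x. \<psi> x r) (frame (remove1 i js)))"
proof -
  let ?F = "frame js"
  define E where "E a b v w r = pairing (\<lambda>x. u x * tau a b x) (partial_deriv v (partial_deriv (\<i> *s w) (\<lambda>y. \<psi> y r)))" for a b v w r
  \<comment> \<open>The terms in which the planar \<open>v\<close> and a vector \<open>c\<close> of
    the frame differentiate, while the planar \<open>w\<close> stays in the form.\<close>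
  define D where "D a b v w = (\<lambda>c r. E a b c v (w # r) - E a b v c (w # r))" for a b v w
  have mt: "mild k (\<lambda>x. u x * tau a b x)" for a b by (intro mild_mult_tame tame_u mild_tau)
  have nF: "normal c" if "c \<in> set ?F" for c
    using that js by (auto simp: set_frame intro!: normal_axis)
  have main: "pairing (\<lambda>x. u x * tau a b x) (\<Psi> v w) = ddc_pairing (\<lambda>x. u x * tau a b x) v w (\<lambda>x. \<psi> x ?F)
      - alt_sum (D a b v w) ?F + alt_sum (D a b w v) ?F
      + 4 * (\<Sum>i\<in>set js. pairing (tau a b) (\<lambda>x. \<psi> x (v # w # frame (remove1 i js))))" for a b v w
  proof -
    have "pairing (\<lambda>x. u x * tau a b x) (\<Psi> v w) = - alt_sum2 (E a b) (v # w # ?F)"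
      unfolding pairing_def E_def[abs_def] \<Psi>_def
      by (rule integral_ddc[OF mt \<psi>]) (use l in simp)
    moreover have "alt_sum2 (\<lambda>v' w' r. E a b v' w' (v # w # r)) ?F
      = - 4 * (\<Sum>i\<in>set js. pairing (tau a b) (\<lambda>x. \<psi> x (v # w # frame (remove1 i js))))"
      using normal_frame[OF mild_tau line_deriv_tau \<psi> js, of "[v, w]"] l by (simp add: E_def)
    ultimately show ?thesis
      unfolding alt_sum2_Cons_Cons by (simp add: D_def ddc_pairing_def E_def)
  qed
  \<comment> \<open>For fixed \<open>w\<close> the sum runs over the choice of the differentiating
    vector among the other three planar ones. The derivative along the frame vector turns
    \<open>u\<close> into a transversal factor \<open>q1\<close>, and then closedness of
    \<open>tau\<close> applies.\<close>
  have closed: "alt_sum (D v1 v2 v3 w) ?F - alt_sum (D v1 v3 v2 w) ?F + alt_sum (D v2 v3 v1 w) ?F = 0"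
    if v: "planar v1" "planar v2" "planar v3" for v1 v2 v3 w
  proof -
    have "alt_sum (\<lambda>c r. D v1 v2 v3 w c r - D v1 v3 v2 w c r + D v2 v3 v1 w c r) ?F = alt_sum (\<lambda>c r. 0) ?F"
    proof (rule alt_sum_cong)
      fix c and r :: "(complex^'n) list" assume c: "c \<in> set ?F" and r: "Suc (length r) = length ?F"
      have \<phi>: "vtest \<Omega> (\<lambda>y. \<psi> y (w # r))" by (rule test_form_vtest[OF \<psi>]) (use l r in simp)
      have D: "D a b v w c r = pairing (\<lambda>x. q1 (\<i> *s c) x * tau a b x) (partial_deriv v (\<lambda>y. \<psi> y (w # r)))
          - pairing (\<lambda>x. q1 c x * tau a b x) (partial_deriv (\<i> *s v) (\<lambda>y. \<psi> y (w # r)))" for a b v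
      proof -
        have "E a b c v (w # r) = - pairing (\<lambda>x. q1 c x * tau a b x) (partial_deriv (\<i> *s v) (\<lambda>y. \<psi> y (w # r)))"
          unfolding E_def
          by (rule normal_second(1)[OF mild_tau line_deriv_tau line_deriv_tau _ vtest_partial_deriv[OF \<phi>]]) (use nF[OF c] in auto)
        moreover have "E a b v c (w # r) = - pairing (\<lambda>x. q1 (\<i> *s c) x * tau a b x) (partial_deriv v (\<lambda>y. \<psi> y (w # r)))"
          unfolding E_def pairing_commute[OF \<phi>, of _ v "\<i> *s c"]
          by (rule normal_second(1)[OF mild_tau line_deriv_tau line_deriv_tau _ vtest_partial_deriv[OF \<phi>]])
            (use normal_J[OF nF[OF c]] in auto)
        ultimately show ?thesis by (simp add: D_def)
      qed
      show "D v1 v2 v3 w c r - D v1 v3 v2 w c r + D v2 v3 v1 w c r = 0"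
        unfolding D
        using tau_closed[OF transversal_q1[of "\<i> *s c"] v \<phi>, of "\<lambda>v. v"] tau_closed[OF transversal_q1[of c] v \<phi>, of "\<lambda>v. \<i> *s v"]
        by (simp add: algebra_simps)
    qed
    then show ?thesis by (simp add: alt_sum_add alt_sum_diff)
  qed
  have wp: "wedge_pairing u (\<lambda>x. \<psi> x ?F) = 32 * pairing (\<lambda>_. 1) (\<lambda>x. \<psi> x ?F)"
    by (rule wedge_pairing_u[OF test_form_vtest[OF \<psi>]]) (use l in simp)
  have "pairing (\<lambda>_. 16) (\<lambda>x. \<psi> x ?F) = 16 * pairing (\<lambda>_. 1) (\<lambda>x. \<psi> x ?F)"
    using pairing_cmult[of 16 "\<lambda>_. 1"] by (simp add: scaleR_conv_of_real)
  then show ?thesis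
    using wp closed[OF planar_axes(1,2,3), of vT] closed[OF planar_axes(1,2,4), of vS]
      closed[OF planar_axes(1,3,4), of vY] closed[OF planar_axes(2,3,4), of vX]
    unfolding main wedge_pairing_def mixed_def sum.distrib sum_subtractf by algebra
qed

lemma u_ddc_normal:
  fixes \<psi> :: "(complex^'n) form"
  assumes \<psi>: "test_form \<Omega> l \<psi>" and js: "distinct js" "set js \<subseteq> - {k, m}" and l: "2 * length js = l + 2"
  shows "pairing (\<lambda>x. u x * 16) (\<lambda>x. form_d (form_dc \<psi>) x (frame js))
    = 4 * (\<Sum>i\<in>set js. pairing (\<lambda>_. 16) (\<lambda>x. \<psi> x (frame (remove1 i js))))"
proof -
  have "pairing (\<lambda>x. u x * 16) (\<lambda>x. form_d (form_dc \<psi>) x (frame js))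
     = - alt_sum2 (\<lambda>v w r. pairing (\<lambda>x. u x * 16) (partial_deriv v (partial_deriv (\<i> *s w) (\<lambda>y. \<psi> y ([] @ r))))) (frame js)"
    unfolding pairing_def append_Nil
    by (rule integral_ddc[OF _ \<psi>]) (use l in \<open>auto intro!: mild_of_tame tame_mult tame_u tame_const\<close>)
  then show ?thesis
    using normal_frame[of "\<lambda>_. 16" l \<psi> js "[]"] \<psi> js l by (simp add: mild_of_tame tame_const line_deriv_const)
qed

end

section \<open>Currents with simple coefficients\<close>

lemma vtest_diff:
  assumes "vtest \<Omega> f" "vtest \<Omega> g" shows "vtest \<Omega> (\<lambda>x. f x - g x)"
proof -
  obtain K where K: "compact K" "K \<subseteq> \<Omega>" "\<And>x. x \<notin> K \<Longrightarrow> f x = 0" using assms(1) by (auto simp: vtest_def)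
  obtain K' where K': "compact K'" "K' \<subseteq> \<Omega>" "\<And>x. x \<notin> K' \<Longrightarrow> g x = 0" using assms(2) by (auto simp: vtest_def)
  have "smooth_everywhere (\<lambda>x. f x + (-1) *\<^sub>R g x)"
    using assms by (intro smooth_everywhere_add smooth_everywhere_scaleR smooth_everywhere_const vtest_smooth)
  moreover have "compact (K \<union> K') \<and> K \<union> K' \<subseteq> \<Omega> \<and> (\<forall>x. x \<notin> K \<union> K' \<longrightarrow> f x - g x = 0)"
    using K K' by auto
  ultimately show ?thesis unfolding vtest_def by auto
qed

lemma vtest_zero: "vtest \<Omega> (\<lambda>_. 0)"
  unfolding vtest_def by (auto intro: smooth_everywhere_const compact_empty)

lemma vtest_alt_sum:
  assumes "\<And>w r. Suc (length r) = length vs \<Longrightarrow> vtest \<Omega> (G w r)"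
  shows "vtest \<Omega> (\<lambda>y. alt_sum (\<lambda>w r. G w r y) vs)"
  using assms
proof (induction vs arbitrary: G)
  case (Cons u vs)
  have "vtest \<Omega> (\<lambda>y. alt_sum (\<lambda>w r. G w (u # r) y) vs)"
    by (rule Cons.IH) (rule Cons.prems, simp)
  moreover have "vtest \<Omega> (G u vs)" by (rule Cons.prems) simp
  ultimately show ?case by (simp add: vtest_diff)
qed (simp add: vtest_zero)

lemma vtest_ddc:
  fixes \<psi> :: "(complex^'n) form"
  assumes \<psi>: "test_form \<Omega> l \<psi>" and vs: "length vs = l + 2"
  shows "vtest \<Omega> (\<lambda>x. form_d (form_dc \<psi>) x vs)"
proof -
  have "vtest \<Omega> (\<lambda>x. 0 - alt_sum (\<lambda>v r. alt_sum (\<lambda>w r'. partial_deriv v (partial_deriv (\<i> *s w) (\<lambda>y. \<psi> y r')) x) r) vs)"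
    by (intro vtest_diff vtest_zero vtest_alt_sum vtest_partial_deriv test_form_vtest[OF \<psi>]) (use vs in simp)
  moreover have "form_d (form_dc \<psi>) x vs
      = 0 - alt_sum (\<lambda>v r. alt_sum (\<lambda>w r'. partial_deriv v (partial_deriv (\<i> *s w) (\<lambda>y. \<psi> y r')) x) r) vs" for x
    using ddc_eq[OF _ vs, of \<psi> x] \<psi> by (simp add: test_form_def alt_sum2_def)
  ultimately show ?thesis by simp
qed

lemma finite_basis_tuples: "finite (basis_tuples l :: 'a::euclidean_space list set)"
  unfolding basis_tuples_def using finite_lists_length_eq[of "Basis :: 'a set" l] by simp

text \<open>Only the alternating part of the coefficients acts on forms, so each wedge monomial is
  recorded at the single tuple \<open>t q\<close>.\<close>

definition simple_coeff :: "'q set \<Rightarrow> ('q \<Rightarrow> 'a list) \<Rightarrow> ('q \<Rightarrow> 'a \<Rightarrow> real) \<Rightarrow> 'a \<Rightarrow> 'a list \<Rightarrow> real" where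
  "simple_coeff Q t c x bs = (\<Sum>q\<in>Q. if bs = t q then c q x else 0)"

lemma mild_simple_coeff:
  assumes "\<And>q. q \<in> Q \<Longrightarrow> mild k (c q)" shows "mild k (\<lambda>x. simple_coeff Q t c x bs)"
  unfolding simple_coeff_def
proof (rule mild_sum)
  fix q assume "q \<in> Q"
  from assms[OF this] show "mild k (\<lambda>x. if bs = t q then c q x else 0)"
    using mild_zero by (cases "bs = t q") auto
qed

lemma measure_coeffs_lborel:
  fixes f :: "complex^'n \<Rightarrow> (complex^'n) list \<Rightarrow> real"
  assumes "\<And>bs. mild k (\<lambda>x. f x bs)"
  shows "measure_coeffs (disc_times_space k) l lborel (\<lambda>x bs. complex_of_real (f x bs))"
  unfolding measure_coeffs_def
proof (intro conjI allI impI ballI)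
  fix K :: "(complex^'n) set" and bs assume K: "compact K \<and> K \<subseteq> disc_times_space k"
  then have "set_integrable lborel K (\<lambda>x. f x bs)" using mild_set_integrable[OF assms] by blast
  then have "integrable lborel (\<lambda>x. complex_of_real (indicator K x *\<^sub>R f x bs))"
    unfolding set_integrable_def by (rule integrable_of_real)
  then show "set_integrable lborel K (\<lambda>x. complex_of_real (f x bs))"
    unfolding set_integrable_def by (simp add: scaleR_conv_of_real)
qed (auto intro: emeasure_compact_finite[unfolded infinity_ennreal_def])

lemma current_apply_simple:
  fixes \<psi> :: "(complex^'n) form"
  assumes Q: "finite Q" "\<And>q. q \<in> Q \<Longrightarrow> t q \<in> basis_tuples l"
    and c: "\<And>q. q \<in> Q \<Longrightarrow> mild k (\<lambda>x. g x * c q x)"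
    and \<psi>: "\<And>bs. length bs = l \<Longrightarrow> vtest (disc_times_space k) (\<lambda>x. \<psi> x bs)"
  shows "current_apply (disc_times_space k) l lborel
      (\<lambda>x bs. complex_of_real (g x) * complex_of_real (simple_coeff Q t c x bs)) \<psi>
    = (\<Sum>q\<in>Q. pairing (\<lambda>x. g x * c q x) (\<lambda>x. \<psi> x (t q)))"
proof -
  let ?f = "\<lambda>bs q x. if bs = t q then (g x * c q x) *\<^sub>R \<psi> x bs else 0"
  have "(LINT x:disc_times_space k|lborel. complex_of_real (g x) * complex_of_real (simple_coeff Q t c x bs) * \<psi> x bs)
      = (\<Sum>q\<in>Q. if bs = t q then pairing (\<lambda>x. g x * c q x) (\<lambda>x. \<psi> x (t q)) else 0)"
    if bs: "bs \<in> basis_tuples l" for bs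
  proof -
    have v: "vtest (disc_times_space k) (\<lambda>x. \<psi> x bs)" by (rule \<psi>) (use bs in \<open>simp add: basis_tuples_def\<close>)
    have "(LINT x:disc_times_space k|lborel. complex_of_real (g x) * complex_of_real (simple_coeff Q t c x bs) * \<psi> x bs)
        = (LINT x|lborel. (\<Sum>q\<in>Q. ?f bs q x))"
      unfolding set_lebesgue_integral_def
    proof (rule Bochner_Integration.integral_cong[OF refl])
      fix x
      have z: "\<psi> x bs = 0" if "x \<notin> disc_times_space k" using v that by (auto simp: vtest_def)
      have "complex_of_real (g x) * complex_of_real (simple_coeff Q t c x bs) * \<psi> x bs = (\<Sum>q\<in>Q. ?f bs q x)"
        unfolding simple_coeff_def of_real_sum sum_distrib_left sum_distrib_right
        by (intro sum.cong refl) (simp add: scaleR_conv_of_real)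
      moreover have "(\<Sum>q\<in>Q. ?f bs q x) = 0" if "x \<notin> disc_times_space k"
        using z[OF that] by (intro sum.neutral) auto
      ultimately show "indicator (disc_times_space k) x *\<^sub>R (complex_of_real (g x) * complex_of_real (simple_coeff Q t c x bs) * \<psi> x bs)
          = (\<Sum>q\<in>Q. ?f bs q x)"
        by (cases "x \<in> disc_times_space k") simp_all
    qed
    also have "\<dots> = (\<Sum>q\<in>Q. LINT x|lborel. ?f bs q x)"
    proof (rule Bochner_Integration.integral_sum)
      fix q assume "q \<in> Q"
      from mild_integrable[OF c[OF this] v] show "integrable lborel (?f bs q)"
        by (cases "bs = t q") auto
    qed
    also have "\<dots> = (\<Sum>q\<in>Q. if bs = t q then pairing (\<lambda>x. g x * c q x) (\<lambda>x. \<psi> x (t q)) else 0)"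
      by (intro sum.cong refl) (auto simp: pairing_def)
    finally show ?thesis .
  qed
  then have "current_apply (disc_times_space k) l lborel
      (\<lambda>x bs. complex_of_real (g x) * complex_of_real (simple_coeff Q t c x bs)) \<psi>
    = (\<Sum>bs\<in>basis_tuples l. \<Sum>q\<in>Q. if bs = t q then pairing (\<lambda>x. g x * c q x) (\<lambda>x. \<psi> x (t q)) else 0)"
    unfolding current_apply_def by (rule sum.cong[OF refl])
  also have "\<dots> = (\<Sum>q\<in>Q. \<Sum>bs\<in>basis_tuples l. if bs = t q then pairing (\<lambda>x. g x * c q x) (\<lambda>x. \<psi> x (t q)) else 0)"
    by (rule sum.swap)
  also have "\<dots> = (\<Sum>q\<in>Q. pairing (\<lambda>x. g x * c q x) (\<lambda>x. \<psi> x (t q)))"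
    using Q(2) by (intro sum.cong refl) (simp add: sum.delta finite_basis_tuples)
  finally show ?thesis .
qed

lemma bedford_taylor_SucI:
  fixes \<sigma> :: "(complex^'n) measure"
  assumes "measure_coeffs \<Omega> (2 * CARD('n) - 2 * Suc j) \<sigma> \<theta>" "bedford_taylor \<Omega> u j \<sigma>' \<theta>'"
    and "\<And>\<psi>. test_form \<Omega> (2 * CARD('n) - 2 * Suc j) \<psi> \<Longrightarrow>
      current_apply \<Omega> (2 * CARD('n) - 2 * Suc j) \<sigma> \<theta> \<psi>
      = current_apply \<Omega> (2 * CARD('n) - 2 * j) \<sigma>' (\<lambda>x bs. complex_of_real (u x) * \<theta>' x bs) (form_d (form_dc \<psi>))"
  shows "bedford_taylor \<Omega> u (Suc j) \<sigma> \<theta>"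
  unfolding bedford_taylor.simps using assms by blast

lemma frame_basis: "set (frame js) \<subseteq> Basis"
  by (auto simp: set_frame axis_in_Basis_iff Basis_complex_def)

text \<open>Double counting: a set with \<open>c\<close> elements is obtained from
  \<open>card A - c\<close> larger sets.\<close>

lemma sum_remove_one:
  fixes F :: "'b set \<Rightarrow> 'c::comm_ring_1"
  assumes "finite A"
  shows "(\<Sum>S | S \<subseteq> A \<and> card S = Suc c. \<Sum>i\<in>S. F (S - {i})) = (\<Sum>S | S \<subseteq> A \<and> card S = c. of_nat (card A - c) * F S)"
proof -
  have fin: "finite S" if "S \<subseteq> A" for S using assms that by (rule finite_subset[rotated])
  have "(\<Sum>S | S \<subseteq> A \<and> card S = Suc c. \<Sum>i\<in>S. F (S - {i}))
    = (\<Sum>(S, i)\<in>Sigma {S. S \<subseteq> A \<and> card S = Suc c} (\<lambda>S. S). F (S - {i}))"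
    by (rule sum.Sigma) (use assms fin in auto)
  also have "\<dots> = (\<Sum>(S, i)\<in>Sigma {S. S \<subseteq> A \<and> card S = c} (\<lambda>S. A - S). F S)"
    by (rule sum.reindex_bij_witness[where i = "\<lambda>(S, i). (insert i S, i)" and j = "\<lambda>(S, i). (S - {i}, i)"])
      (auto simp: insert_absorb card_insert_if fin)
  also have "\<dots> = (\<Sum>S | S \<subseteq> A \<and> card S = c. \<Sum>i\<in>A - S. F S)"
    by (rule sum.Sigma[symmetric]) (use assms in auto)
  also have "\<dots> = (\<Sum>S | S \<subseteq> A \<and> card S = c. of_nat (card A - c) * F S)"
    using fin by (intro sum.cong refl) (auto simp: card_Diff_subset)
  finally show ?thesis .
qed

lemma scale_measure_eq_density: "scale_measure r M = density M (\<lambda>_. r)"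
  by (rule measure_eqI) (auto simp: emeasure_density_const)

section \<open>The Monge--Ampere measure\<close>

context two_coordinates
begin

text \<open>One fixed enumeration serves all subsets, so removing a coordinate from the set removes
  just its pair from the frame.\<close>

definition sorted_frame :: "'n set \<Rightarrow> (complex^'n) list" where
  "sorted_frame S = frame (filter (\<lambda>i. i \<in> S) (SOME js. distinct js \<and> set js = - {k, m}))"

lemma sorted_frame:
  assumes "S \<subseteq> - {k, m}"
  obtains js where "distinct js" "set js = S" "sorted_frame S = frame js"
    "\<And>i. i \<in> S \<Longrightarrow> sorted_frame (S - {i}) = frame (remove1 i js)"
proof
  define ks where "ks = (SOME js. distinct js \<and> set js = - {k, m})"
  have ks: "distinct ks \<and> set ks = - {k, m}"
    unfolding ks_def by (rule someI_ex) (use finite_distinct_list[of "- {k, m}"] in auto)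
  show "distinct (filter (\<lambda>i. i \<in> S) ks)" "set (filter (\<lambda>i. i \<in> S) ks) = S"
    using ks assms by auto
  show "sorted_frame S = frame (filter (\<lambda>i. i \<in> S) ks)" by (simp add: sorted_frame_def ks_def)
  show "sorted_frame (S - {i}) = frame (remove1 i (filter (\<lambda>i. i \<in> S) ks))" if "i \<in> S" for i
  proof -
    have "remove1 i (filter (\<lambda>i. i \<in> S) ks) = filter (\<lambda>j. j \<in> S - {i}) ks"
      unfolding distinct_remove1_removeAll[OF distinct_filter[OF conjunct1[OF ks]]] removeAll_filter_not_eq filter_filter
      by (rule filter_cong) auto
    then show ?thesis by (simp add: sorted_frame_def ks_def)
  qed
qed

text \<open>The \<open>j\<close>-th power of dd$^c$ u is a combination of products of one of eight forms in the two special
  coordinates, numbered by \<open>h\<close> and having the coefficient \<open>piece_coeff h\<close> on \<open>piece_frame h\<close>, with the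
  area forms of the coordinates in a set \<open>S\<close>. The lists \<open>piece_frame h\<close> have length \<open>2 * piece_degree h\<close>.\<close>

definition piece_frame :: "nat \<Rightarrow> (complex^'n) list" where
  "piece_frame h = [[vX, vY, vS, vT], [vS, vT], [vX, vY], [vY, vT], [vX, vS], [vY, vS], [vX, vT], []] ! h"

definition piece_coeff :: "nat \<Rightarrow> complex^'n \<Rightarrow> real" where
  "piece_coeff h = [\<lambda>_. 1, tau vX vY, tau vS vT, \<lambda>x. - tau vX vS x, \<lambda>x. - tau vY vT x, tau vX vT, tau vY vS, \<lambda>_. 16] ! h"

definition piece_degree :: "nat \<Rightarrow> nat" where
  "piece_degree h = [2, 1, 1, 1, 1, 1, 1, 0] ! h"

text \<open>The factor of the pieces of degree \<open>d\<close>: a term of the \<open>j\<close>-th power has \<open>j - (2 - d)\<close> factors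
  dd$^c$ $|z_i|^2$, each of which is 4 times an area form, and arises from \<open>j!\<close> orders of its factors.\<close>

definition weight :: "nat \<Rightarrow> nat \<Rightarrow> real" where
  "weight d j = 4 ^ j * fact j / 4 ^ (2 - d)"

text \<open>A set of remaining coordinates has at most \<open>CARD('n) - 2\<close> elements, so
  there are none of these sets unless \<open>2 \<le> d + j\<close>; the values of
  \<open>weight\<close> for smaller \<open>j\<close> are multiplied by empty sums.\<close>

definition subsets :: "nat \<Rightarrow> nat \<Rightarrow> 'n set set" where
  "subsets d j = {S. S \<subseteq> - {k, m} \<and> card S + d + j = CARD('n)}"

definition power_index :: "nat \<Rightarrow> (nat \<times> 'n set) set" where
  "power_index j = Sigma {..<8} (\<lambda>e. subsets (piece_degree e) j)"

definition power_frame :: "nat \<times> 'n set \<Rightarrow> (complex^'n) list" where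
  "power_frame = (\<lambda>(e, S). piece_frame e @ sorted_frame S)"

definition power_coeff :: "nat \<Rightarrow> nat \<times> 'n set \<Rightarrow> complex^'n \<Rightarrow> real" where
  "power_coeff j = (\<lambda>(e, S) x. weight (piece_degree e) j * piece_coeff e x)"

definition power_density :: "nat \<Rightarrow> complex^'n \<Rightarrow> (complex^'n) list \<Rightarrow> real" where
  "power_density j = simple_coeff (power_index j) power_frame (power_coeff j)"

lemma less_8: "{..<8::nat} = {0, 1, 2, 3, 4, 5, 6, 7}" by auto

lemma mild_power_coeff: "h \<in> power_index j \<Longrightarrow> mild k (power_coeff j h)"
  unfolding power_index_def less_8
  by (auto simp: power_coeff_def piece_coeff_def eval_nat_numeral
      intro!: mild_of_tame[OF tame_const] mild_cmult mild_tau mild_uminus)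

lemma measure_coeffs_power: "measure_coeffs \<Omega> l lborel (\<lambda>x bs. complex_of_real (power_density j x bs))"
  unfolding power_density_def by (intro measure_coeffs_lborel mild_simple_coeff mild_power_coeff)

lemma finite_subsets: "finite (subsets d j)" by (simp add: subsets_def)

lemma finite_power_index: "finite (power_index j)"
  unfolding power_index_def by (intro finite_SigmaI finite_subsets) simp

lemma length_sorted_frame: "S \<subseteq> - {k, m} \<Longrightarrow> length (sorted_frame S) = 2 * card S"
  by (metis sorted_frame length_frame distinct_card)

lemma power_frame_basis:
  assumes "h \<in> power_index j"
  shows "power_frame h \<in> basis_tuples (2 * CARD('n) - 2 * j)"
proof -
  obtain e' S where h: "h = (e', S)" by (cases h)
  have e': "e' \<in> {0, 1, 2, 3, 4, 5, 6, 7}" and S: "S \<subseteq> - {k, m}" "card S + piece_degree e' + j = CARD('n)"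
    using assms unfolding h power_index_def less_8 subsets_def by auto
  have l: "length (piece_frame e') = 2 * piece_degree e'"
    using e' by (auto simp: piece_frame_def piece_degree_def eval_nat_numeral)
  have "set (piece_frame e') \<subseteq> Basis"
    using e' by (auto simp: piece_frame_def eval_nat_numeral axis_in_Basis_iff Basis_complex_def)
  moreover have "set (sorted_frame S) \<subseteq> Basis" unfolding sorted_frame_def by (rule frame_basis)
  moreover have "2 * piece_degree e' + 2 * card S = 2 * CARD('n) - 2 * j" using S(2) by linarith
  ultimately show ?thesis
    using l length_sorted_frame[OF S(1)] by (simp add: h power_frame_def basis_tuples_def)
qed

section \<open>Action of the powers of dd^c u on test forms\<close>

definition multiplied_mixed :: "(complex^'n \<Rightarrow> real) \<Rightarrow> ((complex^'n) list \<Rightarrow> (complex^'n \<Rightarrow> complex)) \<Rightarrow> (complex^'n) list \<Rightarrow> complex" where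
  "multiplied_mixed g \<psi> vs =
      pairing (\<lambda>x. g x * tau vX vY x) (\<psi> (vS # vT # vs)) + pairing (\<lambda>x. g x * tau vS vT x) (\<psi> (vX # vY # vs))
    - pairing (\<lambda>x. g x * tau vX vS x) (\<psi> (vY # vT # vs)) - pairing (\<lambda>x. g x * tau vY vT x) (\<psi> (vX # vS # vs))
    + pairing (\<lambda>x. g x * tau vX vT x) (\<psi> (vY # vS # vs)) + pairing (\<lambda>x. g x * tau vY vS x) (\<psi> (vX # vT # vs))"

definition power_apply :: "nat \<Rightarrow> (complex^'n \<Rightarrow> real) \<Rightarrow> (complex^'n) form \<Rightarrow> complex" where
  "power_apply j g \<psi> =
      of_real (weight 2 j) * (\<Sum>S\<in>subsets 2 j. pairing g (\<lambda>x. \<psi> x ([vX, vY, vS, vT] @ sorted_frame S)))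
    + of_real (weight 1 j) * (\<Sum>S\<in>subsets 1 j. multiplied_mixed g (\<lambda>vs x. \<psi> x vs) (sorted_frame S))
    + of_real (weight 0 j) * (\<Sum>S\<in>subsets 0 j. pairing (\<lambda>x. g x * 16) (\<lambda>x. \<psi> x (sorted_frame S)))"

lemma current_apply_power:
  fixes \<psi> :: "(complex^'n) form"
  assumes g: "tame k g" and \<psi>: "\<And>bs. length bs = 2 * CARD('n) - 2 * j \<Longrightarrow> vtest \<Omega> (\<lambda>x. \<psi> x bs)"
  shows "current_apply \<Omega> (2 * CARD('n) - 2 * j) lborel
      (\<lambda>x bs. complex_of_real (g x) * complex_of_real (power_density j x bs)) \<psi> = power_apply j g \<psi>"
proof -
  have "current_apply \<Omega> (2 * CARD('n) - 2 * j) lborel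
      (\<lambda>x bs. complex_of_real (g x) * complex_of_real (power_density j x bs)) \<psi>
    = (\<Sum>q\<in>power_index j. pairing (\<lambda>x. g x * power_coeff j q x) (\<lambda>x. \<psi> x (power_frame q)))"
    unfolding power_density_def
    by (rule current_apply_simple[OF finite_power_index power_frame_basis mild_mult_tame[OF g mild_power_coeff] \<psi>])
  also have "\<dots> = (\<Sum>(e, S)\<in>power_index j. of_real (weight (piece_degree e) j) *
      pairing (\<lambda>x. g x * piece_coeff e x) (\<lambda>x. \<psi> x (piece_frame e @ sorted_frame S)))"
  proof (intro sum.cong refl, clarify)
    fix e and S :: "'n set"
    have "pairing (\<lambda>x. g x * power_coeff j (e, S) x) \<phi> = of_real (weight (piece_degree e) j) * pairing (\<lambda>x. g x * piece_coeff e x) \<phi>" for \<phi>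
      using pairing_cmult[of "weight (piece_degree e) j" "\<lambda>x. g x * piece_coeff e x" \<phi>]
      by (simp add: power_coeff_def scaleR_conv_of_real mult.left_commute)
    then show "pairing (\<lambda>x. g x * power_coeff j (e, S) x) (\<lambda>x. \<psi> x (power_frame (e, S)))
      = of_real (weight (piece_degree e) j) * pairing (\<lambda>x. g x * piece_coeff e x) (\<lambda>x. \<psi> x (piece_frame e @ sorted_frame S))"
      by (simp add: power_frame_def)
  qed
  also have "\<dots> = (\<Sum>e<8. \<Sum>S\<in>subsets (piece_degree e) j. of_real (weight (piece_degree e) j) *
      pairing (\<lambda>x. g x * piece_coeff e x) (\<lambda>x. \<psi> x (piece_frame e @ sorted_frame S)))"
    unfolding power_index_def by (rule sum.Sigma[symmetric]) (auto simp: finite_subsets)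
  also have "\<dots> = power_apply j g \<psi>"
    unfolding less_8 power_apply_def multiplied_mixed_def sum.distrib sum_subtractf sum_distrib_left[symmetric]
    by (simp add: piece_degree_def piece_coeff_def piece_frame_def eval_nat_numeral pairing_uminus sum_negf algebra_simps)
  finally show ?thesis .
qed

lemma card_rest: "card (- {k, m}) = CARD('n) - 2"
  using km by (simp add: Compl_eq_Diff_UNIV card_Diff_subset)

text \<open>\<open>d + j - 1\<close> is the number of remaining coordinates outside a set in
  \<open>subsets d (Suc j)\<close>. The subtraction takes place in the complex numbers; for
  \<open>d + j = 0\<close> both sums are empty.\<close>

lemma sum_subsets:
  "(\<Sum>S\<in>subsets d j. \<Sum>i\<in>S. F (S - {i})) = (of_nat (d + j) - 1) * (\<Sum>S\<in>subsets d (Suc j). (F S :: complex))"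
proof (cases "d + Suc j \<le> CARD('n)")
  case True
  define c where "c = CARD('n) - d - Suc j"
  have "subsets d j = {S. S \<subseteq> - {k, m} \<and> card S = Suc c}" "subsets d (Suc j) = {S. S \<subseteq> - {k, m} \<and> card S = c}"
    using True by (auto simp: subsets_def c_def)
  then have "(\<Sum>S\<in>subsets d j. \<Sum>i\<in>S. F (S - {i})) = (\<Sum>S\<in>subsets d (Suc j). of_nat (card (- {k, m}) - c) * F S)"
    using sum_remove_one[of "- {k, m}" F c] by simp
  also have "\<dots> = (\<Sum>S\<in>subsets d (Suc j). (of_nat (d + j) - 1) * F S)"
  proof (rule sum.cong[OF refl])
    fix S assume "S \<in> subsets d (Suc j)"
    then have S: "S \<subseteq> - {k, m}" "card S + d + Suc j = CARD('n)" by (auto simp: subsets_def)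
    then have "card S \<le> CARD('n) - 2" using card_mono[of "- {k, m}" S] card_rest by simp
    moreover have "2 \<le> CARD('n)" using card_mono[of UNIV "{k, m}"] km by simp
    ultimately have "card (- {k, m}) - c + 1 = d + j" using S(2) unfolding card_rest c_def by linarith
    then have "(of_nat (card (- {k, m}) - c) :: complex) + 1 = of_nat (d + j)" by (metis of_nat_1 of_nat_add)
    then have "(of_nat (card (- {k, m}) - c) :: complex) = of_nat (d + j) - 1" by (simp only: eq_diff_eq)
    then show "of_nat (card (- {k, m}) - c) * F S = (of_nat (d + j) - 1) * F S" by (simp only:)
  qed
  finally show ?thesis by (simp add: sum_distrib_left)
next
  case False
  then have e: "subsets d (Suc j) = {}" by (auto simp: subsets_def)
  have "(\<Sum>i\<in>S. F (S - {i})) = 0" if "S \<in> subsets d j" for S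
  proof -
    have "card S = 0" using that False unfolding subsets_def mem_Collect_eq by linarith
    then have "S = {}" by simp
    then show ?thesis by simp
  qed
  then have "(\<Sum>S\<in>subsets d j. \<Sum>i\<in>S. F (S - {i})) = 0" by simp
  then show ?thesis using e by simp
qed

text \<open>One more factor dd^c u either acts in the planar coordinates, which lowers the degree
  \<open>d\<close> of the piece by one, or removes a coordinate from \<open>S\<close> with a factor
  4.\<close>

lemma power_apply_ddc:
  fixes \<psi> :: "(complex^'n) form"
  assumes j: "j < CARD('n)" and \<psi>: "test_form \<Omega> (2 * CARD('n) - 2 * Suc j) \<psi>"
  shows "power_apply j u (form_d (form_dc \<psi>)) = power_apply (Suc j) (\<lambda>_. 1) \<psi>"
proof -
  define K2 where "K2 S = pairing (\<lambda>_. 1) (\<lambda>x. \<psi> x ([vX, vY, vS, vT] @ sorted_frame S))" for S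
  define K1 where "K1 S = mixed (\<lambda>vs x. \<psi> x vs) (sorted_frame S)" for S
  define K0 where "K0 S = pairing (\<lambda>_. 16) (\<lambda>x. \<psi> x (sorted_frame S))" for S
  have sh: "subsets 2 j = subsets 1 (Suc j)" "subsets 1 j = subsets 0 (Suc j)"
    by (auto simp: subsets_def)
  have 2: "pairing u (\<lambda>x. form_d (form_dc \<psi>) x ([vX, vY, vS, vT] @ sorted_frame S)) = K1 S + 4 * (\<Sum>i\<in>S. K2 (S - {i}))"
    if "S \<in> subsets 2 j" for S
  proof -
    have S: "S \<subseteq> - {k, m}" "card S + 2 + j = CARD('n)" using that by (auto simp: subsets_def)
    from S(1) obtain js where js: "distinct js" "set js = S" "sorted_frame S = frame js"
      "\<And>i. i \<in> S \<Longrightarrow> sorted_frame (S - {i}) = frame (remove1 i js)" by (rule sorted_frame) blast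
    have l: "4 + 2 * length js = 2 * CARD('n) - 2 * Suc j + 2" using S(2) distinct_card[OF js(1)] js(2) by simp
    show ?thesis using u_ddc_full[OF \<psi> js(1) _ l] S(1) js by (simp add: K1_def K2_def)
  qed
  have 1: "multiplied_mixed u (\<lambda>vs x. form_d (form_dc \<psi>) x vs) (sorted_frame S) = 2 * K0 S + 4 * (\<Sum>i\<in>S. K1 (S - {i}))"
    if "S \<in> subsets 1 j" for S
  proof -
    have S: "S \<subseteq> - {k, m}" "card S + 1 + j = CARD('n)" using that by (auto simp: subsets_def)
    from S(1) obtain js where js: "distinct js" "set js = S" "sorted_frame S = frame js"
      "\<And>i. i \<in> S \<Longrightarrow> sorted_frame (S - {i}) = frame (remove1 i js)" by (rule sorted_frame) blast
    have l: "2 + 2 * length js = 2 * CARD('n) - 2 * Suc j + 2" using S(2) distinct_card[OF js(1)] js(2) by simp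
    show ?thesis using u_ddc_mixed[OF \<psi> js(1) _ l] S(1) js by (simp add: multiplied_mixed_def K1_def K0_def)
  qed
  have 0: "pairing (\<lambda>x. u x * 16) (\<lambda>x. form_d (form_dc \<psi>) x (sorted_frame S)) = 4 * (\<Sum>i\<in>S. K0 (S - {i}))"
    if "S \<in> subsets 0 j" for S
  proof -
    have S: "S \<subseteq> - {k, m}" "card S + j = CARD('n)" using that by (auto simp: subsets_def)
    from S(1) obtain js where js: "distinct js" "set js = S" "sorted_frame S = frame js"
      "\<And>i. i \<in> S \<Longrightarrow> sorted_frame (S - {i}) = frame (remove1 i js)" by (rule sorted_frame) blast
    have l: "2 * length js = 2 * CARD('n) - 2 * Suc j + 2" using S(2) distinct_card[OF js(1)] js(2) j by simp
    show ?thesis using u_ddc_normal[OF \<psi> js(1) _ l] S(1) js by (simp add: K0_def)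
  qed
  have s2: "(\<Sum>S\<in>subsets 2 j. pairing u (\<lambda>x. form_d (form_dc \<psi>) x ([vX, vY, vS, vT] @ sorted_frame S)))
      = (\<Sum>S\<in>subsets 2 j. K1 S + 4 * (\<Sum>i\<in>S. K2 (S - {i})))"
    by (rule sum.cong[OF refl 2])
  have s1: "(\<Sum>S\<in>subsets 1 j. multiplied_mixed u (\<lambda>vs x. form_d (form_dc \<psi>) x vs) (sorted_frame S))
      = (\<Sum>S\<in>subsets 1 j. 2 * K0 S + 4 * (\<Sum>i\<in>S. K1 (S - {i})))"
    by (rule sum.cong[OF refl 1])
  have s0: "(\<Sum>S\<in>subsets 0 j. pairing (\<lambda>x. u x * 16) (\<lambda>x. form_d (form_dc \<psi>) x (sorted_frame S)))
      = (\<Sum>S\<in>subsets 0 j. 4 * (\<Sum>i\<in>S. K0 (S - {i})))"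
    by (rule sum.cong[OF refl 0])
  define X2 where "X2 = (\<Sum>S\<in>subsets 2 (Suc j). K2 S)"
  define X1 where "X1 = (\<Sum>S\<in>subsets 1 (Suc j). K1 S)"
  define X0 where "X0 = (\<Sum>S\<in>subsets 0 (Suc j). K0 S)"
  have "power_apply j u (form_d (form_dc \<psi>))
    = of_real (weight 2 j) * (X1 + 4 * ((of_nat (2 + j) - 1) * X2))
    + of_real (weight 1 j) * (2 * X0 + 4 * ((of_nat (1 + j) - 1) * X1))
    + of_real (weight 0 j) * (4 * ((of_nat (0 + j) - 1) * X0))"
    unfolding power_apply_def s2 s1 s0
    unfolding sum.distrib sum_distrib_left[symmetric] sum_subsets
    unfolding sh X0_def X1_def X2_def ..
  \<comment> \<open>Comparison of coefficients; that of \<open>X0\<close>, for instance, is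
    \<open>4 ^ j * fact j * (1 / 2 + (j - 1) / 4)\<close>, which is
    \<open>4 ^ Suc j * fact (Suc j) / 16\<close>.\<close>
  also have "\<dots> = of_real (weight 2 (Suc j)) * X2 + of_real (weight 1 (Suc j)) * X1 + of_real (weight 0 (Suc j)) * X0"
    by (simp add: weight_def eval_nat_numeral field_simps)
  also have "\<dots> = power_apply (Suc j) (\<lambda>_. 1) \<psi>"
    by (simp add: power_apply_def multiplied_mixed_def mixed_def X0_def X1_def X2_def K0_def K1_def K2_def)
  finally show ?thesis .
qed

lemma power_apply_0:
  fixes \<psi> :: "(complex^'n) form"
  assumes \<psi>: "test_form \<Omega> (2 * CARD('n)) \<psi>"
  shows "power_apply 0 (\<lambda>_. 1) \<psi> = integral_form \<Omega> \<psi>"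
proof -
  have c: "2 \<le> CARD('n)" using card_mono[of UNIV "{k, m}"] km by simp
  have le: "card S + 2 \<le> CARD('n)" if "S \<subseteq> - {k, m}" for S
    using card_mono[OF _ that] card_rest c by simp
  have "S \<notin> subsets d 0" if "d < 2" for d S
    using le[of S] that unfolding subsets_def mem_Collect_eq by linarith
  then have "subsets 1 0 = {}" "subsets 0 0 = {}" by auto
  moreover have "subsets 2 0 = {- {k, m}}"
  proof
    show "{- {k, m}} \<subseteq> subsets 2 0" using card_rest c by (simp add: subsets_def)
    show "subsets 2 0 \<subseteq> {- {k, m}}"
    proof
      fix S assume "S \<in> subsets 2 0"
      then have "S \<subseteq> - {k, m}" "card S = card (- {k, m})" unfolding card_rest by (auto simp: subsets_def)
      then show "S \<in> {- {k, m}}" using card_subset_eq[of "- {k, m}" S] by simp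
    qed
  qed
  note s = calculation this
  obtain js where js: "distinct js" "set js = - {k, m}" "sorted_frame (- {k, m}) = frame js"
    by (rule sorted_frame[OF order_refl]) blast
  have std: "\<psi> x std_frame = \<psi> x (frame (k # m # js))" for x
    by (rule std_frame_eq) (use \<psi> js km in \<open>auto simp: test_form_def\<close>)
  have "\<psi> x std_frame = 0" if "x \<notin> \<Omega>" for x
  proof -
    have "length (frame (k # m # js)) = 2 * CARD('n)"
      using distinct_card[OF js(1)] js(2) card_rest c by simp
    then show ?thesis using \<psi> that unfolding std unfolding test_form_def by blast
  qed
  then have "integral_form \<Omega> \<psi> = (LINT x|lborel. \<psi> x std_frame)"
    unfolding integral_form_def set_lebesgue_integral_def
    by (intro Bochner_Integration.integral_cong refl) (auto simp: indicator_def)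
  then show ?thesis
    by (simp add: power_apply_def s s(1)[unfolded One_nat_def] weight_def pairing_def js(3) std)
qed

lemma bedford_taylor_power:
  "j \<le> CARD('n) \<Longrightarrow> bedford_taylor \<Omega> u j lborel (\<lambda>x bs. complex_of_real (power_density j x bs))"
proof (induction j)
  case 0
  have "current_apply \<Omega> (2 * CARD('n)) lborel (\<lambda>x bs. complex_of_real (power_density 0 x bs)) \<psi> = integral_form \<Omega> \<psi>"
    if "test_form \<Omega> (2 * CARD('n)) \<psi>" for \<psi> :: "(complex^'n) form"
    using current_apply_power[OF tame_const[of k 1], of 0 \<psi>] power_apply_0[OF that] test_form_vtest[OF that] by simp
  then show ?case by (simp add: measure_coeffs_power)
next
  case (Suc j)
  have "current_apply \<Omega> (2 * CARD('n) - 2 * Suc j) lborel (\<lambda>x bs. complex_of_real (power_density (Suc j) x bs)) \<psi>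
    = current_apply \<Omega> (2 * CARD('n) - 2 * j) lborel (\<lambda>x bs. complex_of_real (u x) * complex_of_real (power_density j x bs)) (form_d (form_dc \<psi>))"
    if \<psi>: "test_form \<Omega> (2 * CARD('n) - 2 * Suc j) \<psi>" for \<psi> :: "(complex^'n) form"
  proof -
    have "current_apply \<Omega> (2 * CARD('n) - 2 * Suc j) lborel (\<lambda>x bs. complex_of_real (power_density (Suc j) x bs)) \<psi>
      = power_apply (Suc j) (\<lambda>_. 1) \<psi>"
      using current_apply_power[OF tame_const[of k 1], of "Suc j" \<psi>] test_form_vtest[OF \<psi>] by simp
    moreover have "vtest \<Omega> (\<lambda>x. form_d (form_dc \<psi>) x bs)" if "length bs = 2 * CARD('n) - 2 * j" for bs
      by (rule vtest_ddc[OF \<psi>]) (use that Suc.prems in simp)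
    ultimately show ?thesis
      using current_apply_power[OF tame_u, of j "form_d (form_dc \<psi>)"] power_apply_ddc[OF _ \<psi>] Suc.prems by simp
  qed
  note step = this
  have "bedford_taylor \<Omega> u j lborel (\<lambda>x bs. complex_of_real (power_density j x bs))"
    by (rule Suc.IH) (use Suc.prems in simp)
  then show ?case by (rule bedford_taylor_SucI[OF measure_coeffs_power _ step])
qed

text \<open>The lower powers are represented by densities with respect to \<open>lborel\<close>, but
  the last one has to be represented by the scaled measure with density 1; the last step is
  therefore taken separately.\<close>

lemma u_monge_ampere:
  "monge_ampere_measure \<Omega> u (scale_measure (ennreal (4 ^ CARD('n) * fact CARD('n))) lborel)"
proof -
  let ?c = "4 ^ CARD('n) * fact CARD('n) :: real"
  define \<mu> :: "(complex^'n) measure" where "\<mu> = scale_measure (ennreal ?c) lborel"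
  obtain j where j: "CARD('n) = Suc j" by (metis not0_implies_Suc zero_less_card_finite less_numeral_extra(3))
  have fin: "emeasure \<mu> K < \<infinity>" if "compact K" for K
    unfolding \<mu>_def using emeasure_compact_finite[OF that] by (simp add: ennreal_mult_less_top)
  have mc: "measure_coeffs \<Omega> l \<mu> (\<lambda>_ _. 1)" for l
    unfolding measure_coeffs_def
  proof (intro conjI allI impI ballI)
    fix K :: "(complex^'n) set" assume K: "compact K \<and> K \<subseteq> \<Omega>"
    then show "emeasure \<mu> K < \<infinity>" using fin by blast
    have "K \<in> sets \<mu>" using K by (simp add: \<mu>_def borel_compact)
    then have "integrable \<mu> (indicator K :: _ \<Rightarrow> real)" using fin K by (intro integrable_real_indicator) auto
    then have "integrable \<mu> (\<lambda>x. complex_of_real (indicator K x))" by (rule integrable_of_real)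
    then show "set_integrable \<mu> K (\<lambda>_. 1 :: complex)" by (simp add: set_integrable_def scaleR_conv_of_real)
  qed (simp add: \<mu>_def)
  have "current_apply \<Omega> (2 * CARD('n) - 2 * Suc j) \<mu> (\<lambda>_ _. 1) \<psi>
    = current_apply \<Omega> (2 * CARD('n) - 2 * j) lborel (\<lambda>x bs. complex_of_real (u x) * complex_of_real (power_density j x bs)) (form_d (form_dc \<psi>))"
    if \<psi>: "test_form \<Omega> (2 * CARD('n) - 2 * Suc j) \<psi>" for \<psi> :: "(complex^'n) form"
  proof -
    have v: "vtest \<Omega> (\<lambda>x. \<psi> x [])" by (rule test_form_vtest[OF \<psi>]) (simp add: j)
    have [measurable]: "(\<lambda>x. \<psi> x []) \<in> borel_measurable borel"
      using v by (intro borel_measurable_continuous_onI smooth_everywhere_continuous vtest_smooth)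
    have "vtest \<Omega> (\<lambda>x. form_d (form_dc \<psi>) x bs)" if "length bs = 2 * CARD('n) - 2 * j" for bs
      by (rule vtest_ddc[OF \<psi>]) (use that j in simp)
    then have "current_apply \<Omega> (2 * CARD('n) - 2 * j) lborel
        (\<lambda>x bs. complex_of_real (u x) * complex_of_real (power_density j x bs)) (form_d (form_dc \<psi>))
      = power_apply CARD('n) (\<lambda>_. 1) \<psi>"
      using current_apply_power[OF tame_u, of j "form_d (form_dc \<psi>)"] power_apply_ddc[OF _ \<psi>] j by simp
    \<comment> \<open>In top degree only the piece of degree 0 with \<open>S = {}\<close> is left,
      and \<open>weight 0 CARD('n) * 16\<close> is the required constant.\<close>
    also have "\<dots> = of_real (weight 0 CARD('n)) * pairing (\<lambda>_. 16) (\<lambda>x. \<psi> x [])"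
    proof -
      have "subsets 2 CARD('n) = {}" "subsets 1 CARD('n) = {}" "subsets 0 CARD('n) = {{}}"
        by (auto simp: subsets_def)
      then show ?thesis by (simp add: power_apply_def sorted_frame_def)
    qed
    also have "\<dots> = ?c *\<^sub>R (LINT x|lborel. \<psi> x [])"
      using pairing_cmult[of 16 "\<lambda>_. 1" "\<lambda>x. \<psi> x []"]
      by (simp add: weight_def pairing_def scaleR_conv_of_real)
    also have "\<dots> = (LINT x|\<mu>. \<psi> x [])"
      unfolding \<mu>_def scale_measure_eq_density by (subst integral_density) auto
    also have "\<dots> = (LINT x:\<Omega>|\<mu>. 1 * \<psi> x [])"
      unfolding set_lebesgue_integral_def
      using v by (intro Bochner_Integration.integral_cong refl) (auto simp: indicator_def vtest_def)
    also have "\<dots> = current_apply \<Omega> 0 \<mu> (\<lambda>_ _. 1) \<psi>"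
    proof -
      have "basis_tuples 0 = {[] :: (complex^'n) list}" by (auto simp: basis_tuples_def)
      then show ?thesis by (simp add: current_apply_def)
    qed
    finally show ?thesis by (simp add: j)
  qed
  note step = this
  have "bedford_taylor \<Omega> u j lborel (\<lambda>x bs. complex_of_real (power_density j x bs))"
    by (rule bedford_taylor_power) (use j in simp)
  then have "bedford_taylor \<Omega> u (Suc j) \<mu> (\<lambda>_ _. 1)" by (rule bedford_taylor_SucI[OF mc _ step])
  then show ?thesis by (simp add: monge_ampere_measure_def j \<mu>_def)
qed

end

theorem theorem1p1:
  fixes k :: "'n::finite"
  assumes "CARD('n) \<ge> 2"
  shows "\<exists>u :: complex^'n \<Rightarrow> real.
    pluripotential_solution (disc_times_space k) u \<and>
    viscosity_solution (disc_times_space k) u \<and>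
    u \<in> sobolev_loc 1 2 (disc_times_space k) \<inter> sobolev_loc 2 1 (disc_times_space k) \<and>
    (\<forall>p>2. u \<notin> sobolev_loc 1 p (disc_times_space k)) \<and>
    (\<forall>q>1. u \<notin> sobolev_loc 2 q (disc_times_space k)) \<and>
    (\<exists>K. compact K \<and> K \<subseteq> disc_times_space k \<and> dini_integral K u = \<infinity>)"
proof -
  have "card (UNIV - {k}) \<noteq> 0" using assms by (simp add: card_Diff_subset)
  then obtain m where "m \<noteq> k" by (metis Diff_iff card_eq_0_iff ex_in_conv singletonI)
  then interpret two_coordinates k m by unfold_locales simp
  show ?thesis
    unfolding pluripotential_solution_def
    by (intro exI[of _ u] conjI IntI allI impI u_locally_bounded_psh u_monge_ampere u_viscosity_solution
        u_sobolev_1_2 u_sobolev_2_1 u_not_sobolev_1 u_not_sobolev_2 u_not_dini)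
qed

end
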